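(* (Hecke type identity) Let $\mathcal{R}\subset\mathbb{R}^N\setminus\{0\}$ be a reduced root system, $a>0$, and $k$ a non-negative multiplicity function satisfying $2\langle k\rangle+N>\max(1,2-a)$. Let $p$ be a homogeneous polynomial on $\mathbb{R}^N$ of degree $m$ which is $k$-harmonic, i.e. $\Delta_kp=0$. Then $$\mathcal{F}_{k,a}\big(e^{-\frac{\|\cdot\|^a}{a}}p\big)(\xi)=e^{-i\frac\pi am}\,e^{-\frac1a\|\xi\|^a}p(\xi).$$
   Context: Let $N\ge1$, $\langle\cdot,\cdot\rangle$ the standard inner product on $\mathbb{R}^N$, $\|x\|=\langle x,x\rangle^{1/2}$, $r_\alpha(x)=x-2\frac{\langle\alpha,x\rangle}{\|\alpha\|^2}\alpha$. A (reduced) root system is a finite set $\mathcal{R}\subset\mathbb{R}^N\setminus\{0\}$ with $r_\alpha(\mathcal{R})=\mathcal{R}$ and $\mathcal{R}\cap\mathbb{R}\alpha=\{\pm\alpha\}$ for all $\alpha\in\mathcal{R}$. $\mathfrak{C}$ is the finite Coxeter group generated by $\{r_\alpha\}$, $\mathcal{R}^+$ a positive subsystem. A multiplicity function is a $\mathfrak{C}$-invariant function $k=(k_\alpha)$ on $\mathcal{R}$; non-negative means all $k_\alpha\ge0$; $\langle k\rangle=\sum_{\alpha\in\mathcal{R}^+}k_\alpha$. Dunkl operators: $T_\xi(k)f(x)=\partial_\xi f(x)+\sum_{\alpha\in\mathcal{R}^+}k_\alpha\langle\alpha,\xi\rangle\frac{f(x)-f(r_\alpha x)}{\langle\alpha,x\rangle}$;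 Dunkl Laplacian $\Delta_k=\sum_{j=1}^NT_{\xi_j}(k)^2$ for an orthonormal basis $(\xi_j)$. $\vartheta_{k,a}(x)=\|x\|^{a-2}\prod_{\alpha\in\mathcal{R}}|\langle\alpha,x\rangle|^{k_\alpha}$. Let $\mathcal{H}_k^m(\mathbb{R}^N)$ be the homogeneous polynomials $p$ of degree $m$ with $\Delta_kp=0$, $\lambda_{k,a,m}=\frac{2m+2\langle k\rangle+N-2}{a}$, $L_\ell^{(\lambda)}$ the Laguerre polynomials. The operator $\|x\|^{2-a}\Delta_k-\|x\|^a$ is essentially self-adjoint on $L^2(\mathbb{R}^N,\vartheta_{k,a}(x)dx)$ with domain the span of the functions $p(x)L_\ell^{(\lambda_{k,a,m})}(\frac2a\|x\|^a)e^{-\|x\|^a/a}$ ($\ell,m\in\mathbb{N}$, $p\in\mathcal{H}_k^m(\mathbb{R}^N)$), and the $(k,a)$-generalized Fourier transform is $\mathcal{F}_{k,a}=e^{i\frac\pi2\left(\frac{2\langle k\rangle+N+a-2}{a}\right)}\exp\big(\frac{\pi i}{2a}(\|x\|^{2-a}\Delta_k-\|x\|^a)\big)$ by functional calculus of its closure. *)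

theory Defs
  imports "HOL-Analysis.Analysis"
begin

section \<open>Root systems and multiplicity functions\<close>

definition reflection :: "real ^ 'n \<Rightarrow> real ^ 'n \<Rightarrow> real ^ 'n" where
  "reflection \<alpha> x = x - (2 * (\<alpha> \<bullet> x) / (norm \<alpha>)\<^sup>2) *\<^sub>R \<alpha>"

definition root_system :: "(real ^ 'n) set \<Rightarrow> bool" where
  "root_system R \<longleftrightarrow>
     finite R \<and> 0 \<notin> R \<and>
     (\<forall>\<alpha>\<in>R. reflection \<alpha> ` R = R) \<and>
     (\<forall>\<alpha>\<in>R. R \<inter> range (\<lambda>t::real. t *\<^sub>R \<alpha>) = {\<alpha>, - \<alpha>})"

text \<open>Inverses need no separate rule, since the generating reflections are involutions.\<close>

inductive_set coxeter_group :: "(real ^ 'n) set \<Rightarrow> (real ^ 'n \<Rightarrow> real ^ 'n) set"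
  for R :: "(real ^ 'n) set" where
  id: "id \<in> coxeter_group R"
| comp: "g \<in> coxeter_group R \<Longrightarrow> \<alpha> \<in> R \<Longrightarrow> reflection \<alpha> \<circ> g \<in> coxeter_group R"

definition positive_subsystem :: "(real ^ 'n) set \<Rightarrow> (real ^ 'n) set \<Rightarrow> bool" where
  "positive_subsystem R P \<longleftrightarrow>
     (\<exists>\<beta>. (\<forall>\<alpha>\<in>R. \<alpha> \<bullet> \<beta> \<noteq> 0) \<and> P = {\<alpha>\<in>R. \<alpha> \<bullet> \<beta> > 0})"

definition multiplicity_function :: "(real ^ 'n) set \<Rightarrow> (real ^ 'n \<Rightarrow> real) \<Rightarrow> bool" where
  "multiplicity_function R k \<longleftrightarrow> (\<forall>g\<in>coxeter_group R. \<forall>\<alpha>\<in>R. k (g \<alpha>) = k \<alpha>)"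

definition multiplicity_sum :: "(real ^ 'n) set \<Rightarrow> (real ^ 'n \<Rightarrow> real) \<Rightarrow> real" where
  "multiplicity_sum P k = (\<Sum>\<alpha>\<in>P. k \<alpha>)"


section \<open>Dunkl operators\<close>

definition directional_derivative ::
    "real ^ 'n \<Rightarrow> (real ^ 'n \<Rightarrow> complex) \<Rightarrow> real ^ 'n \<Rightarrow> complex" where
  "directional_derivative \<xi> f x = vector_derivative (\<lambda>t. f (x + t *\<^sub>R \<xi>)) (at 0)"

text \<open>
  On the hyperplane orthogonal to \<open>\<alpha>\<close> the quotient \<open>(f x - f (reflection \<alpha> x)) / (\<alpha> \<bullet> x)\<close> is
  understood by continuous extension. As \<open>x - reflection \<alpha> x = (2 * (\<alpha> \<bullet> x) / (norm \<alpha>)\<^sup>2) *\<^sub>R \<alpha>\<close>,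
  its limit at such a point is \<open>2 / (norm \<alpha>)\<^sup>2\<close> times the derivative of \<open>f\<close> in direction \<open>\<alpha>\<close>.
\<close>

definition reflection_quotient ::
    "real ^ 'n \<Rightarrow> (real ^ 'n \<Rightarrow> complex) \<Rightarrow> real ^ 'n \<Rightarrow> complex" where
  "reflection_quotient \<alpha> f x =
     (if \<alpha> \<bullet> x = 0 then of_real (2 / (norm \<alpha>)\<^sup>2) * directional_derivative \<alpha> f x
      else (f x - f (reflection \<alpha> x)) / of_real (\<alpha> \<bullet> x))"

definition dunkl_operator ::
    "(real ^ 'n) set \<Rightarrow> (real ^ 'n \<Rightarrow> real) \<Rightarrow> real ^ 'n \<Rightarrow>
     (real ^ 'n \<Rightarrow> complex) \<Rightarrow> real ^ 'n \<Rightarrow> complex" where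
  "dunkl_operator P k \<xi> f x =
     directional_derivative \<xi> f x +
     (\<Sum>\<alpha>\<in>P. of_real (k \<alpha> * (\<alpha> \<bullet> \<xi>)) * reflection_quotient \<alpha> f x)"

definition dunkl_laplacian ::
    "(real ^ 'n) set \<Rightarrow> (real ^ 'n \<Rightarrow> real) \<Rightarrow>
     (real ^ 'n \<Rightarrow> complex) \<Rightarrow> real ^ 'n \<Rightarrow> complex" where
  "dunkl_laplacian P k f x =
     (\<Sum>\<xi>\<in>Basis. dunkl_operator P k \<xi> (dunkl_operator P k \<xi> f) x)"

definition homogeneous_polynomial :: "nat \<Rightarrow> (real ^ 'n \<Rightarrow> complex) \<Rightarrow> bool" where
  "homogeneous_polynomial m p \<longleftrightarrow>
     polynomial_function p \<and> (\<forall>(t::real) x. p (t *\<^sub>R x) = of_real (t ^ m) * p x)"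

definition k_harmonics ::
    "(real ^ 'n) set \<Rightarrow> (real ^ 'n \<Rightarrow> real) \<Rightarrow> nat \<Rightarrow> (real ^ 'n \<Rightarrow> complex) set" where
  "k_harmonics P k m =
     {p. homogeneous_polynomial m p \<and> (\<forall>x. dunkl_laplacian P k p x = 0)}"


section \<open>The Hilbert space of square-integrable functions\<close>

text \<open>
  Elements are represented by functions, so equality of elements is equality almost everywhere.
  An operator, possibly unbounded, is given by its graph, which contains all representatives.
\<close>

definition L2 :: "'a measure \<Rightarrow> ('a \<Rightarrow> complex) set" where
  "L2 M = {f \<in> borel_measurable M. integrable M (\<lambda>x. (cmod (f x))\<^sup>2)}"

definition l2_inner :: "'a measure \<Rightarrow> ('a \<Rightarrow> complex) \<Rightarrow> ('a \<Rightarrow> complex) \<Rightarrow> complex" where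
  "l2_inner M u v = (LINT x|M. u x * cnj (v x))"

definition l2_tendsto ::
    "'a measure \<Rightarrow> (nat \<Rightarrow> 'a \<Rightarrow> complex) \<Rightarrow> ('a \<Rightarrow> complex) \<Rightarrow> bool" where
  "l2_tendsto M s u \<longleftrightarrow>
     (\<lambda>n. \<integral>\<^sup>+ x. ennreal ((cmod (s n x - u x))\<^sup>2) \<partial>M) \<longlonglongrightarrow> 0"

type_synonym 'a operator_graph = "(('a \<Rightarrow> complex) \<times> ('a \<Rightarrow> complex)) set"

definition operator_closure :: "'a measure \<Rightarrow> 'a operator_graph \<Rightarrow> 'a operator_graph" where
  "operator_closure M A =
     {(u, v). u \<in> L2 M \<and> v \<in> L2 M \<and>
        (\<exists>s. (\<forall>n. s n \<in> A) \<and>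
             l2_tendsto M (\<lambda>n. fst (s n)) u \<and> l2_tendsto M (\<lambda>n. snd (s n)) v)}"


section \<open>Borel functional calculus of a self-adjoint operator\<close>

definition projection_valued_measure ::
    "'a measure \<Rightarrow> (real set \<Rightarrow> ('a \<Rightarrow> complex) \<Rightarrow> ('a \<Rightarrow> complex)) \<Rightarrow> bool" where
  "projection_valued_measure M E \<longleftrightarrow>
     (\<forall>B\<in>sets borel. \<forall>u\<in>L2 M. E B u \<in> L2 M) \<and>
     (\<forall>B\<in>sets borel. \<forall>u\<in>L2 M. \<forall>v\<in>L2 M. \<forall>c.
        AE x in M. E B (\<lambda>y. c * u y + v y) x = c * E B u x + E B v x) \<and>
     (\<forall>B\<in>sets borel. \<forall>u\<in>L2 M. \<forall>v\<in>L2 M. l2_inner M (E B u) v = l2_inner M u (E B v)) \<and>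
     (\<forall>B\<in>sets borel. \<forall>C\<in>sets borel. \<forall>u\<in>L2 M. AE x in M. E (B \<inter> C) u x = E B (E C u) x) \<and>
     (\<forall>u\<in>L2 M. AE x in M. E UNIV u x = u x) \<and>
     (\<forall>B :: nat \<Rightarrow> real set. range B \<subseteq> sets borel \<longrightarrow> disjoint_family B \<longrightarrow>
        (\<forall>u\<in>L2 M. \<forall>v\<in>L2 M.
           (\<lambda>n. l2_inner M (E (B n) u) v) sums l2_inner M (E (\<Union>n. B n) u) v))"

definition scalar_spectral_measure ::
    "'a measure \<Rightarrow> (real set \<Rightarrow> ('a \<Rightarrow> complex) \<Rightarrow> ('a \<Rightarrow> complex)) \<Rightarrow>
     ('a \<Rightarrow> complex) \<Rightarrow> real measure" where
  "scalar_spectral_measure M E u =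
     measure_of UNIV (sets borel) (\<lambda>B. ennreal (Re (l2_inner M (E B u) u)))"

text \<open>
  The integral of \<open>\<psi>\<close> against the complex measure \<open>B \<mapsto> \<langle>E B u, w\<rangle>\<close>, for bounded \<open>\<psi>\<close>,
  is obtained by polarization from the integrals against the scalar spectral measures.
\<close>

definition spectral_form ::
    "'a measure \<Rightarrow> (real set \<Rightarrow> ('a \<Rightarrow> complex) \<Rightarrow> ('a \<Rightarrow> complex)) \<Rightarrow>
     (real \<Rightarrow> complex) \<Rightarrow> ('a \<Rightarrow> complex) \<Rightarrow> ('a \<Rightarrow> complex) \<Rightarrow> complex" where
  "spectral_form M E \<psi> u w =
     (\<Sum>j<4. \<i> ^ j * (LINT t|scalar_spectral_measure M E (\<lambda>x. u x + \<i> ^ j * w x). \<psi> t)) / 4"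

text \<open>
  Graph of the possibly unbounded operator \<open>\<integral> \<phi> dE\<close>. Its domain is the set of \<open>u\<close> for which
  \<open>\<phi>\<close> is square-integrable with respect to \<open>B \<mapsto> \<langle>E B u, u\<rangle>\<close>; on it, the value is the limit of the
  integrals of the bounded truncations of \<open>\<phi>\<close>.
\<close>

definition spectral_integral ::
    "'a measure \<Rightarrow> (real set \<Rightarrow> ('a \<Rightarrow> complex) \<Rightarrow> ('a \<Rightarrow> complex)) \<Rightarrow>
     (real \<Rightarrow> complex) \<Rightarrow> 'a operator_graph" where
  "spectral_integral M E \<phi> =
     {(u, v). u \<in> L2 M \<and> v \<in> L2 M \<and>
        (\<integral>\<^sup>+ t. ennreal ((cmod (\<phi> t))\<^sup>2) \<partial>scalar_spectral_measure M E u) < \<infinity> \<and>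
        (\<forall>w\<in>L2 M.
           (\<lambda>n. spectral_form M E (\<lambda>t. if cmod (\<phi> t) \<le> real n then \<phi> t else 0) u w)
             \<longlonglongrightarrow> l2_inner M v w)}"

definition is_spectral_resolution ::
    "'a measure \<Rightarrow> 'a operator_graph \<Rightarrow>
     (real set \<Rightarrow> ('a \<Rightarrow> complex) \<Rightarrow> ('a \<Rightarrow> complex)) \<Rightarrow> bool" where
  "is_spectral_resolution M A E \<longleftrightarrow>
     projection_valued_measure M E \<and> A = spectral_integral M E of_real"

text \<open>
  By the spectral theorem, a self-adjoint operator has a spectral resolution, and it is unique up to
  the choice of representatives of the elements of \<open>L2 M\<close>.
\<close>

definition spectral_resolution ::
    "'a measure \<Rightarrow> 'a operator_graph \<Rightarrow>
     real set \<Rightarrow> ('a \<Rightarrow> complex) \<Rightarrow> ('a \<Rightarrow> complex)" where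
  "spectral_resolution M A = (SOME E. is_spectral_resolution M A E)"

definition functional_calculus ::
    "'a measure \<Rightarrow> 'a operator_graph \<Rightarrow> (real \<Rightarrow> complex) \<Rightarrow>
     ('a \<Rightarrow> complex) \<Rightarrow> ('a \<Rightarrow> complex)" where
  "functional_calculus M A \<phi> u =
     (SOME v. (u, v) \<in> spectral_integral M (spectral_resolution M A) \<phi>)"


section \<open>The \<open>(k,a)\<close>-generalized Fourier transform\<close>

text \<open>
  Since \<open>0 powr 0 = 0\<close>, the formula for the weight deviates from the usual one on the reflecting
  hyperplanes (and at the origin), that is, only on a null set.
\<close>

definition dunkl_weight ::
    "(real ^ 'n) set \<Rightarrow> (real ^ 'n \<Rightarrow> real) \<Rightarrow> real \<Rightarrow> real ^ 'n \<Rightarrow> real" where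
  "dunkl_weight R k a x = norm x powr (a - 2) * (\<Prod>\<alpha>\<in>R. \<bar>\<alpha> \<bullet> x\<bar> powr k \<alpha>)"

definition dunkl_measure ::
    "(real ^ 'n) set \<Rightarrow> (real ^ 'n \<Rightarrow> real) \<Rightarrow> real \<Rightarrow> (real ^ 'n) measure" where
  "dunkl_measure R k a = density lborel (\<lambda>x. ennreal (dunkl_weight R k a x))"

definition laguerre :: "nat \<Rightarrow> real \<Rightarrow> real \<Rightarrow> real" where
  "laguerre l \<nu> t = (\<Sum>j\<le>l. (- 1) ^ j * ((real l + \<nu>) gchoose (l - j)) * t ^ j / fact j)"

definition laguerre_parameter ::
    "(real ^ 'n) set \<Rightarrow> (real ^ 'n \<Rightarrow> real) \<Rightarrow> real \<Rightarrow> nat \<Rightarrow> real" where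
  "laguerre_parameter P k a m =
     (2 * real m + 2 * multiplicity_sum P k + real CARD('n) - 2) / a"

definition laguerre_functions ::
    "(real ^ 'n) set \<Rightarrow> (real ^ 'n \<Rightarrow> real) \<Rightarrow> real \<Rightarrow> (real ^ 'n \<Rightarrow> complex) set" where
  "laguerre_functions P k a =
     {(\<lambda>x. p x * of_real (laguerre l (laguerre_parameter P k a m) (2 / a * norm x powr a)
                          * exp (- (norm x powr a) / a))) | p l m. p \<in> k_harmonics P k m}"

definition complex_span :: "('a \<Rightarrow> complex) set \<Rightarrow> ('a \<Rightarrow> complex) set" where
  "complex_span S =
     {(\<lambda>x. \<Sum>i<n. c i * g i x) | (n::nat) c g. \<forall>i<n. g i \<in> S}"

definition dunkl_oscillator ::
    "(real ^ 'n) set \<Rightarrow> (real ^ 'n \<Rightarrow> real) \<Rightarrow> real \<Rightarrow>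
     (real ^ 'n \<Rightarrow> complex) \<Rightarrow> real ^ 'n \<Rightarrow> complex" where
  "dunkl_oscillator P k a f x =
     of_real (norm x powr (2 - a)) * dunkl_laplacian P k f x - of_real (norm x powr a) * f x"

definition dunkl_oscillator_graph ::
    "(real ^ 'n) set \<Rightarrow> (real ^ 'n) set \<Rightarrow> (real ^ 'n \<Rightarrow> real) \<Rightarrow> real \<Rightarrow>
     (real ^ 'n) operator_graph" where
  "dunkl_oscillator_graph R P k a =
     {(f, g). f \<in> complex_span (laguerre_functions P k a) \<and>
              g \<in> L2 (dunkl_measure R k a) \<and>
              (AE x in dunkl_measure R k a. g x = dunkl_oscillator P k a f x)}"

definition generalized_fourier ::
    "(real ^ 'n) set \<Rightarrow> (real ^ 'n) set \<Rightarrow> (real ^ 'n \<Rightarrow> real) \<Rightarrow> real \<Rightarrow>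
     (real ^ 'n \<Rightarrow> complex) \<Rightarrow> real ^ 'n \<Rightarrow> complex" where
  "generalized_fourier R P k a f \<xi> =
     exp (\<i> * of_real (pi / 2 * ((2 * multiplicity_sum P k + real CARD('n) + a - 2) / a))) *
     functional_calculus (dunkl_measure R k a)
       (operator_closure (dunkl_measure R k a) (dunkl_oscillator_graph R P k a))
       (\<lambda>t. exp (\<i> * of_real (pi / (2 * a) * t))) f \<xi>"

end

theory Submission
  imports Defs "HOL-Computational_Algebra.Polynomial"
begin

text \<open>
  The function \<open>u = p exp (- |x|\<^sup>a / a)\<close> is the Laguerre function of order \<open>0\<close>
  attached to the harmonic polynomial \<open>p\<close>, hence an eigenfunction of the oscillator, with eigenvalue
  \<open>\<kappa> = - (2 m + 2 \<gamma> + N + a - 2)\<close>, where \<open>\<gamma>\<close> is the sum of the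
  multiplicities over the positive roots. A functional calculus acts on an eigenvector as multiplication by
  \<open>\<phi> \<kappa>\<close>; for the exponential in question the constants multiply to
  \<open>exp (- i \<pi> m / a)\<close>.

  The functional calculus is formed with an unspecified spectral resolution of the closure of the oscillator. So
  there are two things to prove: every spectral resolution acts on eigenvectors in the expected way
  (\<open>functional_calculus_eigenvector\<close>), and a spectral resolution exists
  (\<open>oscillator_spectral_resolution_exists\<close>). The second statement contains the essential
  self-adjointness of the oscillator. It holds because the Laguerre functions are a total system of eigenfunctions
  that are orthogonal to each other whenever the eigenvalues differ. Gram-Schmidt orthonormalization stays inside
  the eigenspaces and gives an orthonormal basis of eigenvectors; in its coordinates the closure of the oscillator
  is the maximal multiplication operator, whose spectral projections multiply the coordinates by indicator
  functions (\<open>diagonal_spectral_resolution\<close>).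

  The analysis lies in the properties of the Laguerre functions.

  \<^item> They are eigenfunctions (\<open>oscillator_laguerre\<close>): by \<open>Lap_radial\<close> the Dunkl
  Laplacian acts on a radial multiple of a harmonic polynomial through an ordinary differential operator in the
  radius, which in the variable \<open>2 |x|\<^sup>a / a\<close> becomes the Laguerre operator.

  \<^item> They are orthogonal (\<open>laguerre_function_orthogonal\<close>). For harmonics of different degree,
  the Dunkl operators are skew up to a multiplication operator for the Gaussian weights
  \<open>exp (- c |x|\<^sup>2)\<close> (\<open>Gauss_skew\<close>), and Euler's identity makes the degree an
  eigenvalue of a symmetric form (\<open>Gauss_harmonic_orthogonal\<close>); as this holds for every
  \<open>c\<close>, injectivity of the Laplace transform replaces the Gaussian by any radial weight. For equal
  degree, a scaling argument gives the moments of the Gamma distribution (\<open>Gamma_moment_recursion\<close>),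
  for which Laguerre polynomials are orthogonal.

  \<^item> They are total (\<open>laguerre_functions_total\<close>). If \<open>f\<close> is orthogonal to all of
  them, its radial moments against each harmonic vanish, so by the Laplace transform again its integral over every
  ball against any product of a power of \<open>|x|\<^sup>2\<close> and a harmonic vanishes. These products span
  all polynomials (\<open>Fischer_decomposition\<close>), and the Stone-Weierstrass theorem forces
  \<open>f = 0\<close>.
\<close>

section \<open>Square-integrable functions\<close>

lemma L2_measurable[measurable_dest]: "f \<in> L2 M \<Longrightarrow> f \<in> borel_measurable M"
  by (simp add: L2_def)

lemma L2_integrable_norm_square: "f \<in> L2 M \<Longrightarrow> integrable M (\<lambda>x. (cmod (f x))\<^sup>2)"
  by (simp add: L2_def)

lemma L2_mult_integrable:
  assumes u: "u \<in> L2 M" and v: "v \<in> L2 M"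
  shows "integrable M (\<lambda>x. u x * v x)"
proof (rule Bochner_Integration.integrable_bound)
  show "integrable M (\<lambda>x. (cmod (u x))\<^sup>2 + (cmod (v x))\<^sup>2)"
    using u v by (simp add: L2_integrable_norm_square)
  show "(\<lambda>x. u x * v x) \<in> borel_measurable M"
    using u v by measurable
  have "cmod (u x * v x) \<le> (cmod (u x))\<^sup>2 + (cmod (v x))\<^sup>2" for x
    using sum_squares_bound[of "cmod (u x)" "cmod (v x)"]
      mult_nonneg_nonneg[OF norm_ge_zero[of "u x"] norm_ge_zero[of "v x"]]
    unfolding norm_mult by linarith
  then show "AE x in M. norm (u x * v x) \<le> norm ((cmod (u x))\<^sup>2 + (cmod (v x))\<^sup>2)"
    by simp
qed

lemma borel_measurable_cnj [measurable]: "cnj \<in> borel_measurable borel"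
  by (intro borel_measurable_continuous_onI continuous_intros)

lemma L2_cnj: "u \<in> L2 M \<Longrightarrow> (\<lambda>x. cnj (u x)) \<in> L2 M"
  unfolding L2_def by auto

lemma L2_inner_integrable: "u \<in> L2 M \<Longrightarrow> v \<in> L2 M \<Longrightarrow> integrable M (\<lambda>x. u x * cnj (v x))"
  by (intro L2_mult_integrable L2_cnj)

lemma L2_zero: "(\<lambda>x. 0) \<in> L2 M"
  by (simp add: L2_def)

lemma L2_scale: "u \<in> L2 M \<Longrightarrow> (\<lambda>x. c * u x) \<in> L2 M"
  unfolding L2_def by (auto simp: norm_mult power_mult_distrib)

lemma L2_add:
  assumes u: "u \<in> L2 M" and v: "v \<in> L2 M"
  shows "(\<lambda>x. u x + v x) \<in> L2 M"
proof -
  have "integrable M (\<lambda>x. (cmod (u x + v x))\<^sup>2)"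
  proof (rule Bochner_Integration.integrable_bound)
    show "integrable M (\<lambda>x. 2 * (cmod (u x))\<^sup>2 + 2 * (cmod (v x))\<^sup>2)"
      using u v by (simp add: L2_integrable_norm_square)
    show "(\<lambda>x. (cmod (u x + v x))\<^sup>2) \<in> borel_measurable M"
      using u v by measurable
    have "(cmod (u x + v x))\<^sup>2 \<le> 2 * (cmod (u x))\<^sup>2 + 2 * (cmod (v x))\<^sup>2" for x
    proof -
      have "(cmod (u x + v x))\<^sup>2 \<le> (cmod (u x) + cmod (v x))\<^sup>2"
        by (intro power_mono norm_triangle_ineq) simp
      also have "\<dots> \<le> 2 * (cmod (u x))\<^sup>2 + 2 * (cmod (v x))\<^sup>2"
        using sum_squares_bound[of "cmod (u x)" "cmod (v x)"] by (simp add: power2_sum)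
      finally show ?thesis .
    qed
    then show "AE x in M. norm ((cmod (u x + v x))\<^sup>2) \<le> norm (2 * (cmod (u x))\<^sup>2 + 2 * (cmod (v x))\<^sup>2)"
      by simp
  qed
  then show ?thesis using u v by (auto simp: L2_def)
qed

lemma L2_diff: "u \<in> L2 M \<Longrightarrow> v \<in> L2 M \<Longrightarrow> (\<lambda>x. u x - v x) \<in> L2 M"
  using L2_add[of u M "\<lambda>x. - 1 * v x"] L2_scale[of v M "-1"] by simp

lemma L2_sum: "(\<And>i. i \<in> I \<Longrightarrow> f i \<in> L2 M) \<Longrightarrow> (\<lambda>x. \<Sum>i\<in>I. f i x) \<in> L2 M"
  by (induction I rule: infinite_finite_induct) (auto intro: L2_add L2_zero)

lemma l2_inner_add_left:
  "u \<in> L2 M \<Longrightarrow> v \<in> L2 M \<Longrightarrow> w \<in> L2 M \<Longrightarrow>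
    l2_inner M (\<lambda>x. u x + v x) w = l2_inner M u w + l2_inner M v w"
  unfolding l2_inner_def by (simp add: ring_distribs L2_inner_integrable)

lemma l2_inner_diff_left:
  "u \<in> L2 M \<Longrightarrow> v \<in> L2 M \<Longrightarrow> w \<in> L2 M \<Longrightarrow>
    l2_inner M (\<lambda>x. u x - v x) w = l2_inner M u w - l2_inner M v w"
  unfolding l2_inner_def by (simp add: ring_distribs L2_inner_integrable)

lemma l2_inner_scale_left: "l2_inner M (\<lambda>x. c * u x) w = c * l2_inner M u w"
  unfolding l2_inner_def by (simp add: mult.assoc)

lemma l2_inner_commute: "l2_inner M v u = cnj (l2_inner M u v)"
proof -
  have "cnj (l2_inner M u v) = (LINT x|M. cnj (u x * cnj (v x)))"
    unfolding l2_inner_def by (rule Bochner_Integration.integral_cnj[symmetric])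
  then show ?thesis by (simp add: l2_inner_def mult.commute)
qed

lemma l2_inner_add_right:
  "u \<in> L2 M \<Longrightarrow> v \<in> L2 M \<Longrightarrow> w \<in> L2 M \<Longrightarrow>
    l2_inner M w (\<lambda>x. u x + v x) = l2_inner M w u + l2_inner M w v"
  unfolding l2_inner_commute[of M w] by (simp add: l2_inner_add_left)

lemma l2_inner_diff_right:
  "u \<in> L2 M \<Longrightarrow> v \<in> L2 M \<Longrightarrow> w \<in> L2 M \<Longrightarrow>
    l2_inner M w (\<lambda>x. u x - v x) = l2_inner M w u - l2_inner M w v"
  unfolding l2_inner_commute[of M w] by (simp add: l2_inner_diff_left)

lemma l2_inner_scale_right: "l2_inner M w (\<lambda>x. c * u x) = cnj c * l2_inner M w u"
  unfolding l2_inner_commute[of M w] by (simp add: l2_inner_scale_left)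

lemma l2_inner_zero_left: "l2_inner M (\<lambda>x. 0) w = 0"
  by (simp add: l2_inner_def)

lemma l2_inner_sum_left:
  assumes "\<And>i. i \<in> I \<Longrightarrow> f i \<in> L2 M" "w \<in> L2 M"
  shows "l2_inner M (\<lambda>x. \<Sum>i\<in>I. f i x) w = (\<Sum>i\<in>I. l2_inner M (f i) w)"
  using assms
  by (induction I rule: infinite_finite_induct) (auto simp: l2_inner_zero_left l2_inner_add_left L2_sum)

lemma l2_inner_cong_AE:
  assumes "u \<in> borel_measurable M" "u' \<in> borel_measurable M"
    and "v \<in> borel_measurable M" "v' \<in> borel_measurable M"
    and "AE x in M. u x = u' x" "AE x in M. v x = v' x"
  shows "l2_inner M u v = l2_inner M u' v'"
  unfolding l2_inner_def
proof (rule integral_cong_AE)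
  show "(\<lambda>x. u x * cnj (v x)) \<in> borel_measurable M" "(\<lambda>x. u' x * cnj (v' x)) \<in> borel_measurable M"
    using assms(1-4) by measurable
qed (use assms(5,6) in auto)

lemma l2_inner_self: "l2_inner M u u = of_real (LINT x|M. (cmod (u x))\<^sup>2)"
  unfolding l2_inner_def by (simp only: complex_norm_square[symmetric] integral_complex_of_real)

lemma l2_inner_self_Re: "Re (l2_inner M u u) = (LINT x|M. (cmod (u x))\<^sup>2)"
  by (simp add: l2_inner_self)

lemma l2_inner_self_eq_0:
  assumes "u \<in> L2 M" "l2_inner M u u = 0"
  shows "AE x in M. u x = 0"
proof -
  have "(LINT x|M. (cmod (u x))\<^sup>2) = 0" using assms(2) by (simp add: l2_inner_self)
  then have "AE x in M. (cmod (u x))\<^sup>2 = 0"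
    using integral_nonneg_eq_0_iff_AE[OF L2_integrable_norm_square[OF assms(1)]] by simp
  then show ?thesis by simp
qed

lemma l2_inner_Cauchy_Schwarz:
  assumes u: "u \<in> L2 M" and v: "v \<in> L2 M"
  shows "(cmod (l2_inner M u v))\<^sup>2 \<le> Re (l2_inner M u u) * Re (l2_inner M v v)"
proof -
  define z where "z = l2_inner M u v"
  define a where "a = Re (l2_inner M u u)"
  define b where "b = Re (l2_inner M v v)"
  have a: "l2_inner M u u = of_real a" and b: "l2_inner M v v = of_real b"
    by (simp_all add: a_def b_def l2_inner_self)
  have b0: "b \<ge> 0" by (simp add: b_def l2_inner_self)
  have key: "0 \<le> a - 2 * Re (cnj c * z) + (cmod c)\<^sup>2 * b" for c
  proof -
    have cv: "(\<lambda>x. c * v x) \<in> L2 M" by (rule L2_scale[OF v])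
    have "0 \<le> Re (l2_inner M (\<lambda>x. u x - c * v x) (\<lambda>x. u x - c * v x))"
      by (simp add: l2_inner_self_Re)
    also have "l2_inner M (\<lambda>x. u x - c * v x) (\<lambda>x. u x - c * v x) =
        of_real a - cnj c * z - c * cnj z + c * cnj c * of_real b"
      using u v cv
      by (simp add: l2_inner_diff_left l2_inner_diff_right L2_diff l2_inner_scale_left
          l2_inner_scale_right a b z_def l2_inner_commute[of M v u] algebra_simps)
    also have "Re \<dots> = a - 2 * Re (cnj c * z) + (cmod c)\<^sup>2 * b"
      by (simp add: complex_norm_square[symmetric] cmod_power2 algebra_simps power2_eq_square)
    finally show ?thesis .
  qed
  have Re_t: "Re (cnj (of_real t * z) * z) = t * (cmod z)\<^sup>2" for t :: real
    unfolding cmod_power2 by (simp add: power2_eq_square algebra_simps)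
  have norm_t: "(cmod (of_real t * z))\<^sup>2 = t\<^sup>2 * (cmod z)\<^sup>2" for t :: real
    by (simp add: norm_mult power_mult_distrib)
  have quad: "0 \<le> a - 2 * (t * (cmod z)\<^sup>2) + t\<^sup>2 * (cmod z)\<^sup>2 * b" for t :: real
    using key[of "of_real t * z"] unfolding Re_t norm_t .
  show ?thesis
  proof (cases "b = 0")
    case False
    have "(1 / b)\<^sup>2 * (cmod z)\<^sup>2 * b = (cmod z)\<^sup>2 / b"
      using False by (simp add: power2_eq_square)
    then have "(cmod z)\<^sup>2 / b \<le> a" using quad[of "1 / b"] by simp
    then show ?thesis using False b0
      by (simp add: a_def[symmetric] b_def[symmetric] z_def[symmetric] pos_divide_le_eq)
  next
    case True
    have "z = 0"
    proof (rule ccontr)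
      assume "z \<noteq> 0"
      then have "(a + 1) / (2 * (cmod z)\<^sup>2) * (cmod z)\<^sup>2 = (a + 1) / 2" by simp
      moreover have "0 \<le> a" by (simp add: a_def l2_inner_self)
      ultimately show False using quad[of "(a + 1) / (2 * (cmod z)\<^sup>2)"] True by simp
    qed
    then show ?thesis using True by (simp add: z_def b_def)
  qed
qed

lemma l2_tendsto_iff:
  assumes "\<And>n. s n \<in> L2 M" "u \<in> L2 M"
  shows "l2_tendsto M s u \<longleftrightarrow> (\<lambda>n. LINT x|M. (cmod (s n x - u x))\<^sup>2) \<longlonglongrightarrow> 0"
proof -
  have "(\<integral>\<^sup>+ x. ennreal ((cmod (s n x - u x))\<^sup>2) \<partial>M) = ennreal (LINT x|M. (cmod (s n x - u x))\<^sup>2)" for n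
    using L2_diff[OF assms(1)[of n] assms(2)]
    by (intro nn_integral_eq_integral) (auto dest: L2_integrable_norm_square)
  then have "l2_tendsto M s u \<longleftrightarrow> (\<lambda>n. ennreal (LINT x|M. (cmod (s n x - u x))\<^sup>2)) \<longlonglongrightarrow> ennreal 0"
    by (simp add: l2_tendsto_def)
  also have "\<dots> \<longleftrightarrow> (\<lambda>n. LINT x|M. (cmod (s n x - u x))\<^sup>2) \<longlonglongrightarrow> 0"
    by (subst tendsto_ennreal_iff) auto
  finally show ?thesis .
qed

lemma l2_tendsto_inner:
  assumes s: "\<And>n. s n \<in> L2 M" and u: "u \<in> L2 M" and v: "v \<in> L2 M" and lim: "l2_tendsto M s u"
  shows "(\<lambda>n. l2_inner M (s n) v) \<longlonglongrightarrow> l2_inner M u v"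
proof -
  let ?d = "\<lambda>n. LINT x|M. (cmod (s n x - u x))\<^sup>2"
  have "?d \<longlonglongrightarrow> 0" using lim l2_tendsto_iff[OF s u] by simp
  then have "(\<lambda>n. ?d n * Re (l2_inner M v v)) \<longlonglongrightarrow> 0 * Re (l2_inner M v v)"
    by (intro tendsto_intros)
  then have "(\<lambda>n. sqrt (?d n * Re (l2_inner M v v))) \<longlonglongrightarrow> sqrt 0"
    by (intro tendsto_real_sqrt) simp
  then have lim0: "(\<lambda>n. sqrt (?d n * Re (l2_inner M v v))) \<longlonglongrightarrow> 0" by simp
  have "norm (l2_inner M (s n) v - l2_inner M u v) \<le> sqrt (?d n * Re (l2_inner M v v))" for n
  proof -
    have "l2_inner M (s n) v - l2_inner M u v = l2_inner M (\<lambda>x. s n x - u x) v"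
      using s u v by (simp add: l2_inner_diff_left)
    moreover have "(cmod (l2_inner M (\<lambda>x. s n x - u x) v))\<^sup>2 \<le> ?d n * Re (l2_inner M v v)"
      using l2_inner_Cauchy_Schwarz[OF L2_diff[OF s u] v, of n] by (simp add: l2_inner_self_Re)
    ultimately show ?thesis by (simp add: real_le_rsqrt)
  qed
  then have "(\<lambda>n. l2_inner M (s n) v - l2_inner M u v) \<longlonglongrightarrow> 0"
    by (intro Lim_null_comparison[OF _ lim0]) simp
  then show ?thesis by (simp add: LIM_zero_iff)
qed

text \<open>
  The usual subsequence argument: consecutive differences along a fast subsequence are so small that they are
  almost everywhere absolutely summable, and Fatou's lemma identifies the pointwise limit as the limit in the
  mean.
\<close>

lemma L2_complete:
  assumes s: "\<And>n. s n \<in> L2 M"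
    and cauchy: "\<And>\<epsilon>::real. \<epsilon> > 0 \<Longrightarrow>
      \<exists>N. \<forall>m\<ge>N. \<forall>n\<ge>N. (LINT x|M. (cmod (s m x - s n x))\<^sup>2) < \<epsilon>"
  shows "\<exists>u\<in>L2 M. l2_tendsto M s u"
proof -
  (* The rate 1/4 leaves room for the factor 2^k below, which makes the differences summable. *)
  have "\<exists>N. \<forall>k. \<forall>m\<ge>N k. \<forall>n\<ge>N k. (LINT x|M. (cmod (s m x - s n x))\<^sup>2) < (1/4)^k"
    by (intro choice allI cauchy) simp
  then obtain N where N: "\<And>k m n. m \<ge> N k \<Longrightarrow> n \<ge> N k \<Longrightarrow> (LINT x|M. (cmod (s m x - s n x))\<^sup>2) < (1/4)^k"
    by blast
  define r where "r k = (\<Sum>i\<le>k. N i)" for k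
  have rN: "N k \<le> r k" for k
    unfolding r_def by (rule member_le_sum) auto
  have r_mono: "j \<le> k \<Longrightarrow> r j \<le> r k" for j k
    unfolding r_def by (intro sum_mono2) auto
  have r: "(LINT x|M. (cmod (s m x - s n x))\<^sup>2) < (1/4)^k" if "m \<ge> r k" "n \<ge> r k" for k m n
    using N[of k m n] rN[of k] that by linarith
  have sd: "(\<lambda>x. s m x - s n x) \<in> L2 M" for m n
    by (intro L2_diff s)
  have rnn: "(\<integral>\<^sup>+x. ennreal ((cmod (s m x - s n x))\<^sup>2) \<partial>M) \<le> ennreal ((1/4)^k)" if "m \<ge> r k" "n \<ge> r k" for k m n
    using r[OF that] sd[of m n]
    by (subst nn_integral_eq_integral) (auto dest: L2_integrable_norm_square intro!: ennreal_leI)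
  define d where "d k x = s (r (Suc k)) x - s (r k) x" for k x
  have [measurable]: "s n \<in> borel_measurable M" for n using s by (rule L2_measurable)
  have [measurable]: "d k \<in> borel_measurable M" for k unfolding d_def by measurable
  have "(\<integral>\<^sup>+x. (\<Sum>k. ennreal (2^k * (cmod (d k x))\<^sup>2)) \<partial>M) = (\<Sum>k. \<integral>\<^sup>+x. ennreal (2^k * (cmod (d k x))\<^sup>2) \<partial>M)"
    by (rule nn_integral_suminf) measurable
  also have "\<dots> \<le> (\<Sum>k. ennreal ((1/2)^k))"
  proof (intro suminf_le allI)
    fix k
    have "(\<integral>\<^sup>+x. ennreal (2^k * (cmod (d k x))\<^sup>2) \<partial>M) = ennreal (2^k) * (\<integral>\<^sup>+x. ennreal ((cmod (d k x))\<^sup>2) \<partial>M)"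
      by (simp add: ennreal_mult nn_integral_cmult)
    also have "\<dots> \<le> ennreal (2^k) * ennreal ((1/4)^k)"
      unfolding d_def using r_mono[of k "Suc k"] by (intro mult_left_mono rnn) auto
    also have "\<dots> = ennreal ((1/2)^k)"
      by (subst ennreal_mult[symmetric]) (auto simp: power_mult_distrib[symmetric])
    finally show "(\<integral>\<^sup>+x. ennreal (2^k * (cmod (d k x))\<^sup>2) \<partial>M) \<le> ennreal ((1/2)^k)" .
  qed auto
  also have "\<dots> = ennreal (\<Sum>k. (1/2)^k)"
    by (intro suminf_ennreal2) (auto intro: summable_geometric)
  also have "\<dots> < \<infinity>" by simp
  finally have "AE x in M. (\<Sum>k. ennreal (2^k * (cmod (d k x))\<^sup>2)) \<noteq> \<infinity>"
    by (intro nn_integral_noteq_infinite) auto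
  then have conv: "AE x in M. convergent (\<lambda>k. s (r k) x)"
  proof eventually_elim
    fix x assume "(\<Sum>k. ennreal (2^k * (cmod (d k x))\<^sup>2)) \<noteq> \<infinity>"
    then have "summable (\<lambda>k. 2^k * (cmod (d k x))\<^sup>2)"
      by (intro summable_suminf_not_top) auto
    then have "summable (\<lambda>k. (1/2)^k + 2^k * (cmod (d k x))\<^sup>2)"
      by (intro summable_add summable_geometric) auto
    then have "summable (\<lambda>k. d k x)"
    proof (rule summable_comparison_test_ev[rotated], intro always_eventually allI)
      fix k
      let ?t = "2^k * cmod (d k x)"
      have "y \<le> 1 + y * y" if "0 \<le> y" for y :: real
        using sum_squares_bound[of 1 y] that by (simp add: power2_eq_square)
      then have "?t \<le> 1 + ?t * ?t" by simp
      then have "?t / 2^k \<le> (1 + ?t * ?t) / 2^k" by (intro divide_right_mono) auto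
      moreover have "?t / 2^k = norm (d k x)" by simp
      moreover have "(1 + ?t * ?t) / 2^k = (1/2)^k + 2^k * (cmod (d k x))\<^sup>2"
        unfolding add_divide_distrib power_one_over by (simp add: power2_eq_square)
      ultimately show "norm (d k x) \<le> (1/2)^k + 2^k * (cmod (d k x))\<^sup>2" by metis
    qed
    then have "convergent (\<lambda>n. \<Sum>k<n. d k x)" by (simp add: summable_iff_convergent)
    moreover have "(\<Sum>k<n. d k x) = s (r n) x - s (r 0) x" for n
      unfolding d_def by (rule sum_lessThan_telescope)
    ultimately have "convergent (\<lambda>n. (s (r n) x - s (r 0) x) + s (r 0) x)"
      by (intro convergent_add convergent_const) simp
    then show "convergent (\<lambda>k. s (r k) x)" by simp
  qed
  define u where "u x = lim (\<lambda>k. s (r k) x)" for x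
  have [measurable]: "u \<in> borel_measurable M" unfolding u_def by measurable
  have fatou: "(\<integral>\<^sup>+x. ennreal ((cmod (s n x - u x))\<^sup>2) \<partial>M) \<le> ennreal ((1/4)^j)" if n: "n \<ge> r j" for n j
  proof -
    have "(\<integral>\<^sup>+x. ennreal ((cmod (s n x - u x))\<^sup>2) \<partial>M)
        = (\<integral>\<^sup>+x. liminf (\<lambda>k. ennreal ((cmod (s n x - s (r k) x))\<^sup>2)) \<partial>M)"
    proof (rule nn_integral_cong_AE, use conv in eventually_elim)
      fix x assume "convergent (\<lambda>k. s (r k) x)"
      then have "(\<lambda>k. s (r k) x) \<longlonglongrightarrow> u x" by (simp add: u_def convergent_LIMSEQ_iff)
      then have "(\<lambda>k. ennreal ((cmod (s n x - s (r k) x))\<^sup>2)) \<longlonglongrightarrow> ennreal ((cmod (s n x - u x))\<^sup>2)"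
        by (intro tendsto_intros)
      then show "ennreal ((cmod (s n x - u x))\<^sup>2) = liminf (\<lambda>k. ennreal ((cmod (s n x - s (r k) x))\<^sup>2))"
        by (rule lim_imp_Liminf[OF sequentially_bot, symmetric])
    qed
    also have "\<dots> \<le> liminf (\<lambda>k. \<integral>\<^sup>+x. ennreal ((cmod (s n x - s (r k) x))\<^sup>2) \<partial>M)"
      by (rule nn_integral_liminf) measurable
    also have "\<dots> \<le> liminf (\<lambda>k::nat. ennreal ((1/4)^j))"
      by (rule Liminf_mono) (use n r_mono in \<open>auto simp: eventually_sequentially intro!: rnn exI[of _ j]\<close>)
    also have "\<dots> = ennreal ((1/4)^j)" by (simp add: Liminf_const)
    finally show ?thesis .
  qed
  have "(\<lambda>x. s (r 0) x - u x) \<in> L2 M"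
  proof -
    have "(\<integral>\<^sup>+x. ennreal ((cmod (s (r 0) x - u x))\<^sup>2) \<partial>M) < \<infinity>"
      using fatou[of 0 "r 0"] by (simp add: order_le_less_trans)
    then show ?thesis by (auto simp: L2_def integrable_iff_bounded)
  qed
  from L2_diff[OF s[of "r 0"] this] have uL: "u \<in> L2 M" by simp
  have "l2_tendsto M s u"
    unfolding l2_tendsto_def
  proof (rule tendsto_sandwich[of "\<lambda>_. 0"])
    show "(\<lambda>n. 0 :: ennreal) \<longlonglongrightarrow> 0" by simp
  next
    show "(\<lambda>n. \<integral>\<^sup>+x. ennreal ((cmod (s n x - u x))\<^sup>2) \<partial>M) \<longlonglongrightarrow> 0"
    proof (rule order_tendstoI)
      fix y :: ennreal assume "0 < y"
      have "(\<lambda>j::nat. ennreal ((1/4)^j)) \<longlonglongrightarrow> ennreal 0"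
        by (intro tendsto_ennrealI LIMSEQ_power_zero) simp
      then have "\<forall>\<^sub>F j in sequentially. ennreal ((1/4)^j) < y"
        using order_tendstoD(2)[of _ 0 sequentially y] \<open>0 < y\<close> by simp
      then obtain j where j: "ennreal ((1/4)^j) < y" by (auto simp: eventually_sequentially)
      show "\<forall>\<^sub>F n in sequentially. (\<integral>\<^sup>+x. ennreal ((cmod (s n x - u x))\<^sup>2) \<partial>M) < y"
        using fatou[of j] j by (auto simp: eventually_sequentially intro: order_le_less_trans)
    qed simp
  qed auto
  then show ?thesis using uL by blast
qed

section \<open>Orthonormal expansions\<close>

text \<open>
  An orthonormal basis indexed by the natural numbers, in which some of the vectors may be zero. Zero vectors
  cover finite-dimensional spaces, and they are what Gram-Schmidt produces from a linearly dependent sequence.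
  Sequences of coefficients are admissible if they vanish at the zero vectors, which is written as
  \<open>c i * l2_inner M (e i) (e i) = c i\<close>.
\<close>

locale L2_basis =
  fixes M :: "'a measure" and e :: "nat \<Rightarrow> 'a \<Rightarrow> complex"
  assumes e_L2: "\<And>i. e i \<in> L2 M"
    and e_orth: "\<And>i j. i \<noteq> j \<Longrightarrow> l2_inner M (e i) (e j) = 0"
    and e_norm: "\<And>i. l2_inner M (e i) (e i) = 0 \<or> l2_inner M (e i) (e i) = 1"
    and e_total: "\<And>u. u \<in> L2 M \<Longrightarrow> (\<And>i. l2_inner M u (e i) = 0) \<Longrightarrow> AE x in M. u x = 0"
begin

definition coord :: "('a \<Rightarrow> complex) \<Rightarrow> nat \<Rightarrow> complex" where
  "coord u i = l2_inner M u (e i)"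

definition comb :: "(nat \<Rightarrow> complex) \<Rightarrow> nat set \<Rightarrow> 'a \<Rightarrow> complex" where
  "comb c I x = (\<Sum>i\<in>I. c i * e i x)"

lemma comb_L2: "comb c I \<in> L2 M"
  unfolding comb_def[abs_def] by (intro L2_sum L2_scale e_L2)

lemma coord_add: "u \<in> L2 M \<Longrightarrow> v \<in> L2 M \<Longrightarrow> coord (\<lambda>x. u x + v x) i = coord u i + coord v i"
  by (simp add: coord_def l2_inner_add_left e_L2)

lemma coord_diff: "u \<in> L2 M \<Longrightarrow> v \<in> L2 M \<Longrightarrow> coord (\<lambda>x. u x - v x) i = coord u i - coord v i"
  by (simp add: coord_def l2_inner_diff_left e_L2)

lemma coord_scale: "coord (\<lambda>x. c * u x) i = c * coord u i"
  by (simp add: coord_def l2_inner_scale_left)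

lemma coord_degenerate:
  assumes "u \<in> L2 M" "l2_inner M (e i) (e i) = 0"
  shows "coord u i = 0"
  using l2_inner_Cauchy_Schwarz[OF assms(1) e_L2[of i]] assms(2) by (simp add: coord_def)

lemma coord_norm: "u \<in> L2 M \<Longrightarrow> coord u i * l2_inner M (e i) (e i) = coord u i"
  using e_norm[of i] coord_degenerate[of u i] by auto

lemma coord_comb:
  assumes "finite I" "c j * l2_inner M (e j) (e j) = c j"
  shows "coord (comb c I) j = (if j \<in> I then c j else 0)"
proof -
  have "coord (comb c I) j = (\<Sum>i\<in>I. c i * l2_inner M (e i) (e j))"
    unfolding coord_def comb_def[abs_def]
    by (subst l2_inner_sum_left) (auto intro: L2_scale e_L2 simp: l2_inner_scale_left)
  also have "\<dots> = (\<Sum>i\<in>I. if i = j then c j else 0)"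
    using assms(2) by (intro sum.cong) (auto simp: e_orth)
  finally show ?thesis using assms(1) by simp
qed

lemma inner_comb:
  assumes "v \<in> L2 M"
  shows "l2_inner M (comb c I) v = (\<Sum>i\<in>I. c i * cnj (coord v i))"
  unfolding coord_def comb_def[abs_def] using assms
  by (subst l2_inner_sum_left)
     (auto intro: L2_scale e_L2 simp: l2_inner_scale_left l2_inner_commute[of M _ v] simp del: complex_cnj_cnj intro!: sum.cong l2_inner_commute)

lemma comb_norm:
  assumes "finite I" "\<And>i. c i * l2_inner M (e i) (e i) = c i"
  shows "(LINT x|M. (cmod (comb c I x))\<^sup>2) = (\<Sum>i\<in>I. (cmod (c i))\<^sup>2)"
proof -
  have "complex_of_real (LINT x|M. (cmod (comb c I x))\<^sup>2) = (\<Sum>i\<in>I. c i * cnj (coord (comb c I) i))"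
    by (simp add: l2_inner_self[symmetric] inner_comb comb_L2)
  also have "\<dots> = (\<Sum>i\<in>I. c i * cnj (c i))"
    by (intro sum.cong) (auto simp: coord_comb assms)
  also have "\<dots> = of_real (\<Sum>i\<in>I. (cmod (c i))\<^sup>2)"
    by (simp only: complex_norm_square[symmetric] of_real_sum)
  finally show ?thesis by (simp only: of_real_eq_iff)
qed

lemma Bessel:
  assumes u: "u \<in> L2 M" and "finite I"
  shows "(\<Sum>i\<in>I. (cmod (coord u i))\<^sup>2) \<le> Re (l2_inner M u u)"
proof -
  let ?S = "comb (coord u) I"
  have S: "?S \<in> L2 M" by (rule comb_L2)
  have cc: "(\<Sum>i\<in>I. coord u i * cnj (coord u i)) = of_real (\<Sum>i\<in>I. (cmod (coord u i))\<^sup>2)"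
    by (simp only: complex_norm_square[symmetric] of_real_sum)
  have 1: "l2_inner M ?S u = of_real (\<Sum>i\<in>I. (cmod (coord u i))\<^sup>2)"
    unfolding inner_comb[OF u] cc ..
  then have 2: "l2_inner M u ?S = of_real (\<Sum>i\<in>I. (cmod (coord u i))\<^sup>2)"
    unfolding l2_inner_commute[of M u ?S] by simp
  have 3: "l2_inner M ?S ?S = of_real (\<Sum>i\<in>I. (cmod (coord u i))\<^sup>2)"
    by (simp only: l2_inner_self comb_norm[OF assms(2) coord_norm[OF u]])
  have "0 \<le> Re (l2_inner M (\<lambda>x. u x - ?S x) (\<lambda>x. u x - ?S x))"
    by (simp add: l2_inner_self_Re)
  also have "l2_inner M (\<lambda>x. u x - ?S x) (\<lambda>x. u x - ?S x) =
      l2_inner M u u - of_real (\<Sum>i\<in>I. (cmod (coord u i))\<^sup>2)"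
    using u S by (simp add: l2_inner_diff_left l2_inner_diff_right L2_diff 1 2 3)
  finally show ?thesis by simp
qed

lemma coord_summable:
  assumes "u \<in> L2 M"
  shows "summable (\<lambda>i. (cmod (coord u i))\<^sup>2)"
  by (rule summableI_nonneg_bounded[where x = "Re (l2_inner M u u)"]) (auto intro: Bessel assms)

lemma Riesz_Fischer:
  assumes sm: "summable (\<lambda>i. (cmod (c i))\<^sup>2)" and c: "\<And>i. c i * l2_inner M (e i) (e i) = c i"
  shows "\<exists>u\<in>L2 M. l2_tendsto M (\<lambda>n. comb c {..<n}) u \<and> (\<forall>i. coord u i = c i)"
proof -
  have diff: "(LINT x|M. (cmod (comb c {..<m} x - comb c {..<n} x))\<^sup>2) = (\<Sum>i\<in>{n..<m}. (cmod (c i))\<^sup>2)"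
    if "n \<le> m" for m n
  proof -
    have "comb c {..<m} x - comb c {..<n} x = comb c {n..<m} x" for x
    proof -
      have "comb c {..<m} x = comb c {..<n} x + comb c {n..<m} x"
        unfolding comb_def using that
        by (subst sum.union_disjoint[symmetric]) (auto intro!: sum.cong)
      then show ?thesis by simp
    qed
    then show ?thesis by (simp add: comb_norm c)
  qed
  have diff': "(LINT x|M. (cmod (comb c {..<m} x - comb c {..<n} x))\<^sup>2) = (\<Sum>i\<in>{min m n..<max m n}. (cmod (c i))\<^sup>2)" for m n
  proof (cases "n \<le> m")
    case True then show ?thesis by (simp add: diff min_def max_def)
  next
    case False
    then show ?thesis by (subst norm_minus_commute) (simp add: diff min_def max_def)
  qed
  have "\<exists>u\<in>L2 M. l2_tendsto M (\<lambda>n. comb c {..<n}) u"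
  proof (rule L2_complete[OF comb_L2])
    fix \<epsilon> :: real assume "\<epsilon> > 0"
    then obtain N where N: "\<And>m n. m \<ge> N \<Longrightarrow> norm (\<Sum>i\<in>{m..<n}. (cmod (c i))\<^sup>2) < \<epsilon>"
      using sm unfolding summable_Cauchy by blast
    show "\<exists>N. \<forall>m\<ge>N. \<forall>n\<ge>N. (LINT x|M. (cmod (comb c {..<m} x - comb c {..<n} x))\<^sup>2) < \<epsilon>"
    proof (intro exI[of _ N] allI impI)
      fix m n assume "N \<le> m" "N \<le> n"
      then have "norm (\<Sum>i\<in>{min m n..<max m n}. (cmod (c i))\<^sup>2) < \<epsilon>" by (intro N) simp
      then show "(LINT x|M. (cmod (comb c {..<m} x - comb c {..<n} x))\<^sup>2) < \<epsilon>"
        unfolding diff' by simp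
    qed
  qed
  then obtain u where u: "u \<in> L2 M" and lim: "l2_tendsto M (\<lambda>n. comb c {..<n}) u" by blast
  have "coord u i = c i" for i
  proof -
    have "(\<lambda>n. coord (comb c {..<n}) i) \<longlonglongrightarrow> coord u i"
      unfolding coord_def by (rule l2_tendsto_inner[OF comb_L2 u e_L2 lim])
    moreover have "\<forall>\<^sub>F n in sequentially. coord (comb c {..<n}) i = c i"
      using eventually_gt_at_top[of i] by eventually_elim (simp add: coord_comb c)
    ultimately have "(\<lambda>n::nat. c i) \<longlonglongrightarrow> coord u i"
      by (rule Lim_transform_eventually)
    then show ?thesis using LIMSEQ_const_iff by metis
  qed
  then show ?thesis using u lim by blast
qed

lemma coord_eq_imp_AE_eq:
  assumes u: "u \<in> L2 M" and v: "v \<in> L2 M" and "\<And>i. coord u i = coord v i"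
  shows "AE x in M. u x = v x"
  using e_total[OF L2_diff[OF u v]] assms by (simp add: coord_diff[unfolded coord_def] coord_def)

lemma l2_tendsto_cong_AE:
  assumes "AE x in M. u x = v x" "l2_tendsto M s u"
  shows "l2_tendsto M s v"
proof -
  have "(\<integral>\<^sup>+ x. ennreal ((cmod (s n x - u x))\<^sup>2) \<partial>M) = (\<integral>\<^sup>+ x. ennreal ((cmod (s n x - v x))\<^sup>2) \<partial>M)" for n
    using assms(1) by (intro nn_integral_cong_AE) auto
  then show ?thesis using assms(2) by (simp add: l2_tendsto_def)
qed

lemma expansion:
  assumes u: "u \<in> L2 M"
  shows "l2_tendsto M (\<lambda>n. comb (coord u) {..<n}) u"
proof -
  obtain v where v: "v \<in> L2 M" "l2_tendsto M (\<lambda>n. comb (coord u) {..<n}) v" "\<And>i. coord v i = coord u i"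
    using Riesz_Fischer[of "coord u"] coord_summable[OF u] coord_norm[OF u] by blast
  show ?thesis
    using l2_tendsto_cong_AE[OF coord_eq_imp_AE_eq[OF v(1) u v(3)] v(2)] .
qed

lemma Parseval:
  assumes u: "u \<in> L2 M" and v: "v \<in> L2 M"
  shows "(\<lambda>i. coord u i * cnj (coord v i)) sums l2_inner M u v"
  using l2_tendsto_inner[OF comb_L2 u v expansion[OF u]] by (simp add: sums_def inner_comb v)

lemma coord_product_summable:
  assumes u: "u \<in> L2 M" and v: "v \<in> L2 M"
  shows "summable (\<lambda>i. cmod (coord u i) * cmod (coord v i))"
proof (rule summable_comparison_test_ev)
  show "summable (\<lambda>i. (cmod (coord u i))\<^sup>2 + (cmod (coord v i))\<^sup>2)"
    by (intro summable_add coord_summable u v)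
  show "\<forall>\<^sub>F i in sequentially. norm (cmod (coord u i) * cmod (coord v i)) \<le> (cmod (coord u i))\<^sup>2 + (cmod (coord v i))\<^sup>2"
  proof (intro always_eventually allI)
    fix i
    show "norm (cmod (coord u i) * cmod (coord v i)) \<le> (cmod (coord u i))\<^sup>2 + (cmod (coord v i))\<^sup>2"
      using sum_squares_bound[of "cmod (coord u i)" "cmod (coord v i)"]
        mult_nonneg_nonneg[OF norm_ge_zero[of "coord u i"] norm_ge_zero[of "coord v i"]]
      unfolding norm_mult real_norm_def abs_norm_cancel by linarith
  qed
qed

text \<open>
  A bounded sequence multiplies the coordinates of a vector to the coordinates of another one, by the theorem of
  Riesz and Fischer. Indicator functions give the spectral projections.
\<close>

lemma multiplier_exists:
  assumes u: "u \<in> L2 M" and b: "\<And>i. cmod (b i) \<le> 1"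
  shows "\<exists>v\<in>L2 M. \<forall>i. coord v i = b i * coord u i"
proof -
  have "summable (\<lambda>i. (cmod (b i * coord u i))\<^sup>2)"
  proof (rule summable_comparison_test_ev[OF _ coord_summable[OF u]], intro always_eventually allI)
    fix i
    have "cmod (b i * coord u i) \<le> cmod (coord u i)"
      using mult_right_mono[OF b[of i], of "cmod (coord u i)"] by (simp add: norm_mult)
    then show "norm ((cmod (b i * coord u i))\<^sup>2) \<le> (cmod (coord u i))\<^sup>2"
      by (simp add: power_mono)
  qed
  moreover have "b i * coord u i * l2_inner M (e i) (e i) = b i * coord u i" for i
    using coord_norm[OF u, of i] by (simp add: mult.assoc)
  ultimately show ?thesis using Riesz_Fischer[of "\<lambda>i. b i * coord u i"] by blast
qed

end

section \<open>The spectral measure of a diagonal operator\<close>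

context L2_basis
begin

text \<open>
  The projection onto the closed span of the basis vectors whose eigenvalue lies in \<open>B\<close>.
\<close>

definition specproj :: "(nat \<Rightarrow> real) \<Rightarrow> real set \<Rightarrow> ('a \<Rightarrow> complex) \<Rightarrow> 'a \<Rightarrow> complex" where
  "specproj ev B u = (SOME v. v \<in> L2 M \<and> (\<forall>i. coord v i = indicator B (ev i) * coord u i))"

lemma specproj:
  assumes "u \<in> L2 M"
  shows specproj_L2: "specproj ev B u \<in> L2 M"
    and coord_specproj: "coord (specproj ev B u) i = indicator B (ev i) * coord u i"
proof -
  have "\<exists>v. v \<in> L2 M \<and> (\<forall>i. coord v i = indicator B (ev i) * coord u i)"
  proof -
    have "cmod (indicator B (ev i)) \<le> 1" for i by (simp add: indicator_def)
    then show ?thesis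
      using multiplier_exists[OF assms, of "\<lambda>i. indicator B (ev i)"] by blast
  qed
  from someI_ex[OF this] show "specproj ev B u \<in> L2 M"
    "coord (specproj ev B u) i = indicator B (ev i) * coord u i"
    unfolding specproj_def by auto
qed

lemma coord_product_integrable:
  assumes "u \<in> L2 M" "v \<in> L2 M"
  shows "integrable (count_space UNIV) (\<lambda>i. coord u i * cnj (coord v i))"
  using coord_product_summable[OF assms] by (simp add: integrable_count_space_nat_iff norm_mult)

lemma inner_integral:
  assumes u: "u \<in> L2 M" and v: "v \<in> L2 M"
  shows "l2_inner M u v = (LINT i|count_space UNIV. coord u i * cnj (coord v i))"
  using sums_unique2[OF Parseval[OF u v] sums_integral_count_space_nat[OF coord_product_integrable[OF u v]]] .

lemma bounded_coord_product_integrable: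
  assumes "u \<in> L2 M" "v \<in> L2 M" "\<And>i. cmod (b i) \<le> C"
  shows "integrable (count_space UNIV) (\<lambda>i. b i * (coord u i * cnj (coord v i)))"
proof (rule Bochner_Integration.integrable_bound)
  show "integrable (count_space UNIV) (\<lambda>i. C * cmod (coord u i * cnj (coord v i)))"
    using coord_product_integrable[OF assms(1,2)] by simp
  show "AE i in count_space UNIV. norm (b i * (coord u i * cnj (coord v i))) \<le> norm (C * cmod (coord u i * cnj (coord v i)))"
    using mult_right_mono[OF order_trans[OF assms(3) abs_ge_self]] by (auto simp: norm_mult abs_mult)
qed simp

lemma inner_specproj:
  assumes u: "u \<in> L2 M" and v: "v \<in> L2 M"
  shows "l2_inner M (specproj ev B u) v =
    (LINT i|count_space UNIV. indicator B (ev i) * (coord u i * cnj (coord v i)))"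
  by (simp add: inner_integral specproj u v mult.assoc)

lemma specproj_projection_valued_measure:
  "projection_valued_measure M (specproj ev)"
  unfolding projection_valued_measure_def
proof (intro conjI ballI allI impI)
  fix B u v c
  assume "u \<in> L2 M" "v \<in> L2 M"
  then show "AE x in M. specproj ev B (\<lambda>y. c * u y + v y) x = c * specproj ev B u x + specproj ev B v x"
    by (intro coord_eq_imp_AE_eq)
       (auto intro!: L2_add L2_scale specproj_L2 simp: coord_add coord_scale L2_scale L2_add specproj algebra_simps)
next
  fix B u v assume "u \<in> L2 M" "v \<in> L2 M"
  then show "l2_inner M (specproj ev B u) v = l2_inner M u (specproj ev B v)"
    by (simp add: inner_integral specproj) (auto intro!: Bochner_Integration.integral_cong simp: indicator_def)
next
  fix B C u assume "u \<in> L2 M"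
  then show "AE x in M. specproj ev (B \<inter> C) u x = specproj ev B (specproj ev C u) x"
    by (intro coord_eq_imp_AE_eq) (auto simp: specproj indicator_def)
next
  fix u assume "u \<in> L2 M"
  then show "AE x in M. specproj ev UNIV u x = u x"
    by (intro coord_eq_imp_AE_eq) (auto simp: specproj)
next
  fix B :: "nat \<Rightarrow> real set" and u v
  assume disj: "disjoint_family B" and u: "u \<in> L2 M" and v: "v \<in> L2 M"
  let ?a = "\<lambda>i. coord u i * cnj (coord v i)"
  have ind: "(\<Sum>n<N. indicator (B n) t) = (indicator (\<Union>n<N. B n) t :: complex)" for N t
    using disj by (subst indicator_UN_disjoint) (auto simp: disjoint_family_on_def)
  have int: "integrable (count_space UNIV) (\<lambda>i. indicator C (ev i) * ?a i)" for C
    by (rule bounded_coord_product_integrable[OF u v, of _ 1]) (auto simp: indicator_def)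
  have "(\<Sum>n<N. l2_inner M (specproj ev (B n) u) v) =
      (LINT i|count_space UNIV. indicator (\<Union>n<N. B n) (ev i) * ?a i)" for N
  proof -
    have "(\<Sum>n<N. l2_inner M (specproj ev (B n) u) v) =
        (LINT i|count_space UNIV. (\<Sum>n<N. indicator (B n) (ev i) * ?a i))"
      by (subst Bochner_Integration.integral_sum) (auto simp: inner_specproj u v int)
    then show ?thesis by (simp only: sum_distrib_right[symmetric] ind)
  qed
  moreover have "(\<lambda>N. LINT i|count_space UNIV. indicator (\<Union>n<N. B n) (ev i) * ?a i)
      \<longlonglongrightarrow> (LINT i|count_space UNIV. indicator (\<Union>n. B n) (ev i) * ?a i)"
  proof (rule integral_dominated_convergence[where w = "\<lambda>i. cmod (?a i)"])
    show "AE i in count_space UNIV. (\<lambda>N. indicator (\<Union>n<N. B n) (ev i) * ?a i) \<longlonglongrightarrow> indicator (\<Union>n. B n) (ev i) * ?a i"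
      by (intro AE_I2 tendsto_mult tendsto_const LIMSEQ_indicator_UN)
  qed (auto simp: indicator_def coord_product_integrable u v)
  ultimately show "(\<lambda>n. l2_inner M (specproj ev (B n) u) v) sums l2_inner M (specproj ev (\<Union>n. B n) u) v"
    by (simp add: sums_def inner_specproj u v)
qed (simp_all add: specproj_L2)

end

lemma pvm_D:
  assumes "projection_valued_measure M E"
  shows pvm_L2: "\<And>B u. B \<in> sets borel \<Longrightarrow> u \<in> L2 M \<Longrightarrow> E B u \<in> L2 M"
    and pvm_linear: "\<And>B u v c. B \<in> sets borel \<Longrightarrow> u \<in> L2 M \<Longrightarrow> v \<in> L2 M \<Longrightarrow>
       AE x in M. E B (\<lambda>y. c * u y + v y) x = c * E B u x + E B v x"
    and pvm_sym: "\<And>B u v. B \<in> sets borel \<Longrightarrow> u \<in> L2 M \<Longrightarrow> v \<in> L2 M \<Longrightarrow>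
       l2_inner M (E B u) v = l2_inner M u (E B v)"
    and pvm_Int: "\<And>B C u. B \<in> sets borel \<Longrightarrow> C \<in> sets borel \<Longrightarrow> u \<in> L2 M \<Longrightarrow>
       AE x in M. E (B \<inter> C) u x = E B (E C u) x"
    and pvm_UNIV: "\<And>u. u \<in> L2 M \<Longrightarrow> AE x in M. E UNIV u x = u x"
    and pvm_sums: "\<And>B u v. range B \<subseteq> sets borel \<Longrightarrow> disjoint_family B \<Longrightarrow> u \<in> L2 M \<Longrightarrow> v \<in> L2 M \<Longrightarrow>
       (\<lambda>n. l2_inner M (E (B n) u) v) sums l2_inner M (E (\<Union>n. B n) u) v"
proof -
  note * = assms[unfolded projection_valued_measure_def]
  note 1 = conjunct1[OF *] and t1 = conjunct2[OF *]
  note 2 = conjunct1[OF t1] and t2 = conjunct2[OF t1]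
  note 3 = conjunct1[OF t2] and t3 = conjunct2[OF t2]
  note 4 = conjunct1[OF t3] and t4 = conjunct2[OF t3]
  note 5 = conjunct1[OF t4] and 6 = conjunct2[OF t4]
  show "\<And>B u. B \<in> sets borel \<Longrightarrow> u \<in> L2 M \<Longrightarrow> E B u \<in> L2 M"
    using 1 by simp
  show "\<And>B u v c. B \<in> sets borel \<Longrightarrow> u \<in> L2 M \<Longrightarrow> v \<in> L2 M \<Longrightarrow>
       AE x in M. E B (\<lambda>y. c * u y + v y) x = c * E B u x + E B v x"
    using 2 by simp
  show "\<And>B u v. B \<in> sets borel \<Longrightarrow> u \<in> L2 M \<Longrightarrow> v \<in> L2 M \<Longrightarrow>
       l2_inner M (E B u) v = l2_inner M u (E B v)"
    by (rule 3[rule_format])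
  show "\<And>B C u. B \<in> sets borel \<Longrightarrow> C \<in> sets borel \<Longrightarrow> u \<in> L2 M \<Longrightarrow>
       AE x in M. E (B \<inter> C) u x = E B (E C u) x"
    using 4 by simp
  show "\<And>u. u \<in> L2 M \<Longrightarrow> AE x in M. E UNIV u x = u x"
    using 5 by simp
  show "\<And>B u v. range B \<subseteq> sets borel \<Longrightarrow> disjoint_family B \<Longrightarrow> u \<in> L2 M \<Longrightarrow> v \<in> L2 M \<Longrightarrow>
       (\<lambda>n. l2_inner M (E (B n) u) v) sums l2_inner M (E (\<Union>n. B n) u) v"
    by (rule 6[rule_format])
qed

lemma pvm_inner_Int:
  assumes E: "projection_valued_measure M E" and B: "B \<in> sets borel" and C: "C \<in> sets borel"
    and u: "u \<in> L2 M" and v: "v \<in> L2 M"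
  shows "l2_inner M (E B u) (E C v) = l2_inner M (E (B \<inter> C) u) v"
proof -
  have "l2_inner M (E B u) (E C v) = l2_inner M (E C (E B u)) v"
    by (simp add: pvm_sym[OF E] pvm_L2[OF E] B C u v)
  also have "\<dots> = l2_inner M (E (C \<inter> B) u) v"
    using pvm_Int[OF E C B u] B C u v
    by (intro l2_inner_cong_AE) (auto intro!: L2_measurable pvm_L2[OF E])
  finally show ?thesis by (simp add: Int_commute)
qed

lemma pvm_inner_self:
  assumes E: "projection_valued_measure M E" and B: "B \<in> sets borel" and u: "u \<in> L2 M"
  shows "l2_inner M (E B u) u = of_real (LINT x|M. (cmod (E B u x))\<^sup>2)"
  using pvm_inner_Int[OF E B B u u] by (simp add: l2_inner_self)

lemma pvm_inner_real:
  assumes E: "projection_valued_measure M E" and B: "B \<in> sets borel" and u: "u \<in> L2 M"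
  shows "l2_inner M (E B u) u = of_real (Re (l2_inner M (E B u) u))"
    and "0 \<le> Re (l2_inner M (E B u) u)"
  by (simp_all add: pvm_inner_self[OF assms])

lemma pvm_empty:
  assumes E: "projection_valued_measure M E" and u: "u \<in> L2 M" and v: "v \<in> L2 M"
  shows "l2_inner M (E {} u) v = 0"
proof -
  have "(\<lambda>n::nat. l2_inner M (E {} u) v) sums l2_inner M (E {} u) v"
    using pvm_sums[OF E _ _ u v, of "\<lambda>_. {}"] by (simp add: disjoint_family_on_def)
  then have "(\<lambda>n::nat. l2_inner M (E {} u) v) \<longlonglongrightarrow> 0"
    using summable_LIMSEQ_zero sums_summable by blast
  then show ?thesis by (simp add: LIMSEQ_const_iff)
qed

lemma pvm_Un:
  assumes E: "projection_valued_measure M E" and B: "B \<in> sets borel" and C: "C \<in> sets borel"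
    and disj: "B \<inter> C = {}" and u: "u \<in> L2 M" and v: "v \<in> L2 M"
  shows "l2_inner M (E (B \<union> C) u) v = l2_inner M (E B u) v + l2_inner M (E C u) v"
proof -
  have "(\<lambda>n. l2_inner M (E (binaryset B C n) u) v) sums l2_inner M (E (\<Union>n. binaryset B C n) u) v"
    using B C disj by (intro pvm_sums[OF E _ _ u v]) (auto simp: disjoint_family_on_def binaryset_def)
  moreover have "(\<lambda>n. l2_inner M (E (binaryset B C n) u) v) sums
      (\<Sum>n\<in>{0,1}. l2_inner M (E (binaryset B C n) u) v)"
    by (rule sums_finite) (auto simp: binaryset_def pvm_empty[OF E u v])
  ultimately show ?thesis
    by (metis (no_types, lifting) sums_unique2 UN_binaryset_eq sum.insert sum.empty finite.intros
        empty_iff insert_iff zero_neq_one binaryset_def add_0_right fun_upd_def One_nat_def)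
qed

lemma sets_scalar_spectral_measure [simp, measurable_cong]:
  "sets (scalar_spectral_measure M E u) = sets borel"
  by (simp add: scalar_spectral_measure_def sets.sigma_sets_eq[of borel, simplified])

lemma space_scalar_spectral_measure [simp]: "space (scalar_spectral_measure M E u) = UNIV"
  by (simp add: scalar_spectral_measure_def)

lemma emeasure_scalar_spectral_measure:
  assumes E: "projection_valued_measure M E" and u: "u \<in> L2 M" and B: "B \<in> sets borel"
  shows "emeasure (scalar_spectral_measure M E u) B = ennreal (Re (l2_inner M (E B u) u))"
  unfolding scalar_spectral_measure_def
proof (rule emeasure_measure_of_sigma[OF _ _ _ B])
  show "sigma_algebra UNIV (sets (borel :: real measure))"
    using sets.sigma_algebra_axioms[of "borel :: real measure"] by simp
  show "positive (sets borel) (\<lambda>B. ennreal (Re (l2_inner M (E B u) u)))"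
    by (simp add: positive_def pvm_empty[OF E u u])
  show "countably_additive (sets borel) (\<lambda>B. ennreal (Re (l2_inner M (E B u) u)))"
  proof (rule countably_additiveI)
    fix A :: "nat \<Rightarrow> real set"
    assume A: "range A \<subseteq> sets borel" "disjoint_family A"
    show "(\<Sum>i. ennreal (Re (l2_inner M (E (A i) u) u))) = ennreal (Re (l2_inner M (E (\<Union> (range A)) u) u))"
      using A by (intro suminf_ennreal_eq sums_Re pvm_sums[OF E _ _ u u] pvm_inner_real(2)[OF E _ u]) auto
  qed
qed

lemma finite_scalar_spectral_measure:
  assumes E: "projection_valued_measure M E" and u: "u \<in> L2 M"
  shows "finite_measure (scalar_spectral_measure M E u)"
  by (rule finite_measureI) (simp add: emeasure_scalar_spectral_measure[OF assms])

lemma sum_lessThan_4: "(\<Sum>j<(4::nat). f j) = f 0 + f 1 + f 2 + f 3"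
  for f :: "nat \<Rightarrow> 'b::comm_monoid_add"
  by (simp add: numeral_eq_Suc algebra_simps)

text \<open>
  The scalar case of the identity by which \<open>spectral_form\<close> is built from quadratic forms.
\<close>

lemma polarization:
  "(\<Sum>j<4. \<i> ^ j * of_real ((cmod (a + \<i> ^ j * b))\<^sup>2)) / 4 = a * cnj b"
  unfolding sum_lessThan_4 complex_norm_square
  by (simp add: power2_eq_square power3_eq_cube algebra_simps)

lemma integral_bounded_finite_measure:
  assumes "finite_measure N" "f \<in> borel_measurable N" "\<And>t. norm (f t) \<le> C"
  shows "integrable N (f :: 'b \<Rightarrow> complex)"
proof -
  interpret finite_measure N by fact
  show ?thesis by (rule integrable_const_bound[where B = C]) (use assms in auto)
qed

context L2_basis
begin

text \<open>
  The scalar spectral measure is the discrete measure with mass \<open>(cmod (coord u i))\<^sup>2\<close> at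
  \<open>ev i\<close>, so integrals against it are sums over the basis.
\<close>

lemma scalar_spectral_measure_specproj:
  assumes u: "u \<in> L2 M"
  shows "scalar_spectral_measure M (specproj ev) u =
    distr (density (count_space UNIV) (\<lambda>i. ennreal ((cmod (coord u i))\<^sup>2))) borel ev"
proof (rule measure_eqI)
  fix B assume "B \<in> sets (scalar_spectral_measure M (specproj ev) u)"
  then have B: "B \<in> sets borel" by simp
  have "l2_inner M (specproj ev B u) u =
      (LINT i|count_space UNIV. of_real (indicator B (ev i) * (cmod (coord u i))\<^sup>2))"
    unfolding inner_specproj[OF u u] complex_norm_square[symmetric]
    by (intro Bochner_Integration.integral_cong) (auto simp: indicator_def)
  then have "Re (l2_inner M (specproj ev B u) u) =
      (LINT i|count_space UNIV. indicator B (ev i) * (cmod (coord u i))\<^sup>2)"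
    by (simp only: integral_complex_of_real Re_complex_of_real)
  moreover have "integrable (count_space UNIV) (\<lambda>i. indicator B (ev i) * (cmod (coord u i))\<^sup>2)"
    unfolding integrable_count_space_nat_iff
    by (rule summable_comparison_test_ev[OF always_eventually coord_summable[OF u]]) (auto simp: indicator_def)
  ultimately have "ennreal (Re (l2_inner M (specproj ev B u) u)) =
      (\<integral>\<^sup>+i. ennreal (indicator B (ev i) * (cmod (coord u i))\<^sup>2) \<partial>count_space UNIV)"
    by (subst nn_integral_eq_integral) auto
  also have "\<dots> = (\<integral>\<^sup>+i. ennreal ((cmod (coord u i))\<^sup>2) * indicator (ev -` B) i \<partial>count_space UNIV)"
    by (intro nn_integral_cong) (auto simp: indicator_def)
  also have "\<dots> = emeasure (distr (density (count_space UNIV) (\<lambda>i. ennreal ((cmod (coord u i))\<^sup>2))) borel ev) B"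
    using B by (simp add: emeasure_distr emeasure_density)
  finally show "emeasure (scalar_spectral_measure M (specproj ev) u) B =
      emeasure (distr (density (count_space UNIV) (\<lambda>i. ennreal ((cmod (coord u i))\<^sup>2))) borel ev) B"
    using emeasure_scalar_spectral_measure[OF specproj_projection_valued_measure u B] by simp
qed simp

lemma spectral_form_specproj:
  assumes u: "u \<in> L2 M" and w: "w \<in> L2 M"
    and [measurable]: "\<psi> \<in> borel_measurable borel" and bd: "\<And>t. cmod (\<psi> t) \<le> C"
  shows "spectral_form M (specproj ev) \<psi> u w =
    (LINT i|count_space UNIV. \<psi> (ev i) * (coord u i * cnj (coord w i)))"
proof -
  let ?N = "count_space (UNIV :: nat set)"
  have uw: "(\<lambda>x. u x + \<i> ^ j * w x) \<in> L2 M" for j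
    by (rule L2_add[OF u L2_scale[OF w]])
  have int: "integrable ?N (\<lambda>i. \<psi> (ev i) * of_real ((cmod (coord u i + \<i> ^ j * coord w i))\<^sup>2))" for j
  proof -
    have "integrable ?N (\<lambda>i. \<psi> (ev i) * (coord (\<lambda>x. u x + \<i> ^ j * w x) i * cnj (coord (\<lambda>x. u x + \<i> ^ j * w x) i)))"
      by (rule bounded_coord_product_integrable[OF uw uw bd])
    then show ?thesis
      by (simp only: complex_norm_square[symmetric] coord_add[OF u L2_scale[OF w]] coord_scale)
  qed
  have form: "(LINT t|scalar_spectral_measure M (specproj ev) (\<lambda>x. u x + \<i> ^ j * w x). \<psi> t) =
      (LINT i|?N. \<psi> (ev i) * of_real ((cmod (coord u i + \<i> ^ j * coord w i))\<^sup>2))" for j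
  proof -
    have "(LINT t|scalar_spectral_measure M (specproj ev) (\<lambda>x. u x + \<i> ^ j * w x). \<psi> t) =
        (LINT i|?N. (cmod (coord (\<lambda>x. u x + \<i> ^ j * w x) i))\<^sup>2 *\<^sub>R \<psi> (ev i))"
      by (simp add: scalar_spectral_measure_specproj[OF uw] integral_distr integral_density)
    also have "\<dots> = (LINT i|?N. (cmod (coord u i + \<i> ^ j * coord w i))\<^sup>2 *\<^sub>R \<psi> (ev i))"
      by (simp add: coord_add[OF u L2_scale[OF w]] coord_scale)
    finally show ?thesis by (simp add: scaleR_conv_of_real mult.commute[of "\<psi> _"])
  qed
  have "spectral_form M (specproj ev) \<psi> u w =
      (\<Sum>j<4. LINT i|?N. \<i> ^ j * (\<psi> (ev i) * of_real ((cmod (coord u i + \<i> ^ j * coord w i))\<^sup>2))) / 4"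
    unfolding spectral_form_def form by simp
  also have "\<dots> = (LINT i|?N. (\<Sum>j<4. \<i> ^ j * (\<psi> (ev i) * of_real ((cmod (coord u i + \<i> ^ j * coord w i))\<^sup>2))) / 4)"
    using int by (subst Bochner_Integration.integral_sum[symmetric]) auto
  also have "\<dots> = (LINT i|?N. \<psi> (ev i) * (coord u i * cnj (coord w i)))"
    unfolding polarization[symmetric] by (simp add: sum_distrib_left mult.left_commute)
  finally show ?thesis .
qed

text \<open>
  The weak limit in the definition of the spectral integral becomes a statement about coordinates: tested against
  a basis vector, the truncated integrals are eventually constant. In the other direction, the square
  integrability of \<open>v\<close> dominates the sums.
\<close>

lemma spectral_integral_specproj:
  "spectral_integral M (specproj ev) of_real =
    {(u, v). u \<in> L2 M \<and> v \<in> L2 M \<and> (\<forall>i. coord v i = of_real (ev i) * coord u i)}"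
proof -
  let ?N = "count_space (UNIV :: nat set)"
  define trunc where "trunc n t = (if cmod (of_real t) \<le> real n then of_real t else 0 :: complex)" for n t
  have trunc_meas: "trunc n \<in> borel_measurable borel" for n unfolding trunc_def[abs_def] by measurable
  have trunc_bd: "cmod (trunc n t) \<le> real n" for n t by (simp add: trunc_def)
  note form = spectral_form_specproj[OF _ _ trunc_meas trunc_bd]
  have "coord v j = of_real (ev j) * coord u j"
    if u: "u \<in> L2 M" and v: "v \<in> L2 M"
      and lim: "\<And>w. w \<in> L2 M \<Longrightarrow> (\<lambda>n. spectral_form M (specproj ev) (trunc n) u w) \<longlonglongrightarrow> l2_inner M v w"
    for u v j
  proof -
    have "spectral_form M (specproj ev) (trunc n) u (e j) = trunc n (ev j) * coord u j" for n
    proof -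
      have "spectral_form M (specproj ev) (trunc n) u (e j) =
          (LINT i|?N. trunc n (ev i) * (coord u i * cnj (coord (e j) i)))"
        by (rule form[OF u e_L2])
      also have "\<dots> = (\<Sum>i\<in>{j}. trunc n (ev i) * (coord u i * cnj (coord (e j) i)))"
      proof (rule sums_unique2[OF sums_integral_count_space_nat])
        show "integrable ?N (\<lambda>i. trunc n (ev i) * (coord u i * cnj (coord (e j) i)))"
          by (rule bounded_coord_product_integrable[OF u e_L2 trunc_bd])
        show "(\<lambda>i. trunc n (ev i) * (coord u i * cnj (coord (e j) i))) sums
            (\<Sum>i\<in>{j}. trunc n (ev i) * (coord u i * cnj (coord (e j) i)))"
          by (rule sums_finite) (auto simp: coord_def e_orth)
      qed
      also have "\<dots> = trunc n (ev j) * (coord u j * l2_inner M (e j) (e j))"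
        by (simp add: coord_def l2_inner_self)
      finally show ?thesis by (simp add: coord_norm u)
    qed
    then have "(\<lambda>n. trunc n (ev j) * coord u j) \<longlonglongrightarrow> coord v j"
      using lim[OF e_L2[of j]] by (simp add: coord_def)
    moreover have "\<forall>\<^sub>F n in sequentially. trunc n (ev j) * coord u j = of_real (ev j) * coord u j"
      using eventually_ge_at_top[of "nat \<lceil>\<bar>ev j\<bar>\<rceil>"]
    proof eventually_elim
      case (elim n)
      then have "\<bar>ev j\<bar> \<le> real n" by linarith
      then show ?case by (simp add: trunc_def)
    qed
    ultimately have "(\<lambda>n::nat. of_real (ev j) * coord u j) \<longlonglongrightarrow> coord v j"
      by (rule Lim_transform_eventually)
    then show ?thesis using LIMSEQ_const_iff by metis
  qed
  moreover have "(\<integral>\<^sup>+ t. ennreal ((cmod (of_real t))\<^sup>2) \<partial>scalar_spectral_measure M (specproj ev) u) < \<infinity> \<and>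
      (\<forall>w\<in>L2 M. (\<lambda>n. spectral_form M (specproj ev) (trunc n) u w) \<longlonglongrightarrow> l2_inner M v w)"
    if u: "u \<in> L2 M" and v: "v \<in> L2 M" and uv: "\<And>i. coord v i = of_real (ev i) * coord u i" for u v
  proof (intro conjI ballI)
    have "(\<integral>\<^sup>+ t. ennreal ((cmod (of_real t))\<^sup>2) \<partial>scalar_spectral_measure M (specproj ev) u) =
        (\<integral>\<^sup>+ i. ennreal ((cmod (coord v i))\<^sup>2) \<partial>?N)"
      by (simp add: scalar_spectral_measure_specproj u nn_integral_distr nn_integral_density
          ennreal_mult[symmetric] uv norm_mult power_mult_distrib mult.commute)
    also have "\<dots> < \<infinity>"
      using coord_summable[OF v] by (simp add: nn_integral_count_space_nat ennreal_suminf_neq_top less_top[symmetric])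
    finally show "(\<integral>\<^sup>+ t. ennreal ((cmod (of_real t))\<^sup>2) \<partial>scalar_spectral_measure M (specproj ev) u) < \<infinity>" .
    fix w assume w: "w \<in> L2 M"
    have "(\<lambda>n. LINT i|?N. trunc n (ev i) * (coord u i * cnj (coord w i))) \<longlonglongrightarrow> (LINT i|?N. coord v i * cnj (coord w i))"
    proof (rule integral_dominated_convergence[where w = "\<lambda>i. cmod (coord v i * cnj (coord w i))"])
      show "AE i in ?N. (\<lambda>n. trunc n (ev i) * (coord u i * cnj (coord w i))) \<longlonglongrightarrow> coord v i * cnj (coord w i)"
      proof (intro AE_I2)
        fix i
        have "\<forall>\<^sub>F n in sequentially. trunc n (ev i) * (coord u i * cnj (coord w i)) = coord v i * cnj (coord w i)"
          using eventually_ge_at_top[of "nat \<lceil>\<bar>ev i\<bar>\<rceil>"]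
        proof eventually_elim
          case (elim n)
          then have "\<bar>ev i\<bar> \<le> real n" by linarith
          then show ?case by (simp add: trunc_def uv)
        qed
        then show "(\<lambda>n. trunc n (ev i) * (coord u i * cnj (coord w i))) \<longlonglongrightarrow> coord v i * cnj (coord w i)"
          by (rule tendsto_eventually)
      qed
      show "AE i in ?N. norm (trunc n (ev i) * (coord u i * cnj (coord w i))) \<le> cmod (coord v i * cnj (coord w i))" for n
        by (intro AE_I2) (auto simp: trunc_def uv norm_mult)
    qed (auto simp: coord_product_integrable v w)
    then show "(\<lambda>n. spectral_form M (specproj ev) (trunc n) u w) \<longlonglongrightarrow> l2_inner M v w"
      by (simp add: form[OF u w] inner_integral[OF v w])
  qed
  ultimately show ?thesis
    unfolding spectral_integral_def trunc_def[abs_def] by blast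
qed

text \<open>
  Coordinates are continuous, so the closure stays inside the maximal multiplication operator. Conversely the
  partial sums of the expansions of \<open>u\<close> and \<open>v\<close> are pairs in the graph that converge to
  \<open>(u, v)\<close>. This is where a symmetric operator with a complete set of eigenvectors is seen to be
  essentially self-adjoint.
\<close>

lemma closure_diagonal:
  assumes sub: "\<And>f g. (f, g) \<in> A \<Longrightarrow> f \<in> L2 M \<and> g \<in> L2 M \<and> (\<forall>i. coord g i = of_real (ev i) * coord f i)"
    and comb: "\<And>c n. (comb c {..<n}, comb (\<lambda>i. of_real (ev i) * c i) {..<n}) \<in> A"
  shows "operator_closure M A =
    {(u, v). u \<in> L2 M \<and> v \<in> L2 M \<and> (\<forall>i. coord v i = of_real (ev i) * coord u i)}"
proof -
  have "coord v i = of_real (ev i) * coord u i"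
    if u: "u \<in> L2 M" and v: "v \<in> L2 M" and s: "\<And>n. s n \<in> A"
      and lu: "l2_tendsto M (\<lambda>n. fst (s n)) u" and lv: "l2_tendsto M (\<lambda>n. snd (s n)) v" for u v s i
  proof -
    have s': "fst (s n) \<in> L2 M" "snd (s n) \<in> L2 M" "coord (snd (s n)) i = of_real (ev i) * coord (fst (s n)) i" for n
      using sub[of "fst (s n)" "snd (s n)"] s[of n] by auto
    have "(\<lambda>n. coord (snd (s n)) i) \<longlonglongrightarrow> coord v i"
      unfolding coord_def by (rule l2_tendsto_inner[OF s'(2) v e_L2 lv])
    moreover have "(\<lambda>n. of_real (ev i) * coord (fst (s n)) i) \<longlonglongrightarrow> of_real (ev i) * coord u i"
      unfolding coord_def by (intro tendsto_intros l2_tendsto_inner[OF s'(1) u e_L2 lu])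
    ultimately show ?thesis unfolding s'(3) by (rule LIMSEQ_unique)
  qed
  moreover have "\<exists>s. (\<forall>n. s n \<in> A) \<and> l2_tendsto M (\<lambda>n. fst (s n)) u \<and> l2_tendsto M (\<lambda>n. snd (s n)) v"
    if u: "u \<in> L2 M" and v: "v \<in> L2 M" and uv: "\<And>i. coord v i = of_real (ev i) * coord u i" for u v
  proof -
    have "coord v = (\<lambda>i. of_real (ev i) * coord u i)" using uv by auto
    then show ?thesis
      using comb[of "coord u"] expansion[OF u] expansion[OF v]
      by (intro exI[of _ "\<lambda>n. (comb (coord u) {..<n}, comb (\<lambda>i. of_real (ev i) * coord u i) {..<n})"]) auto
  qed
  ultimately show ?thesis unfolding operator_closure_def by blast
qed

theorem diagonal_spectral_resolution:
  assumes "\<And>f g. (f, g) \<in> A \<Longrightarrow> f \<in> L2 M \<and> g \<in> L2 M \<and> (\<forall>i. coord g i = of_real (ev i) * coord f i)"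
    and "\<And>c n. (comb c {..<n}, comb (\<lambda>i. of_real (ev i) * c i) {..<n}) \<in> A"
  shows "is_spectral_resolution M (operator_closure M A) (specproj ev)"
proof -
  have "operator_closure M A = spectral_integral M (specproj ev) of_real"
    unfolding spectral_integral_specproj by (rule closure_diagonal) (fact assms)+
  then show ?thesis
    using specproj_projection_valued_measure by (simp add: is_spectral_resolution_def)
qed

end

section \<open>The functional calculus on eigenvectors\<close>

lemma pvm_inner_add_scale:
  assumes E: "projection_valued_measure M E" and B: "B \<in> sets borel"
    and u: "u \<in> L2 M" and w: "w \<in> L2 M"
  shows "l2_inner M (E B (\<lambda>x. u x + c * w x)) (\<lambda>x. u x + c * w x) =
    l2_inner M (E B u) u + cnj c * l2_inner M (E B u) w + c * l2_inner M (E B w) u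
      + c * cnj c * l2_inner M (E B w) w"
proof -
  have cw: "(\<lambda>x. c * w x) \<in> L2 M" and uw: "(\<lambda>x. u x + c * w x) \<in> L2 M"
    by (intro L2_scale w, intro L2_add[OF u] L2_scale w)
  have uw': "(\<lambda>x. c * w x + u x) = (\<lambda>x. u x + c * w x)" by (simp add: add.commute)
  note EL = pvm_L2[OF E B]
  have "l2_inner M (E B (\<lambda>x. u x + c * w x)) (\<lambda>x. u x + c * w x) =
      l2_inner M (\<lambda>x. c * E B w x + E B u x) (\<lambda>x. u x + c * w x)"
    using pvm_linear[OF E B w u, of c] unfolding uw'
    by (intro l2_inner_cong_AE) (auto intro!: L2_measurable EL uw L2_add L2_scale u w)
  also have "\<dots> = c * l2_inner M (E B w) (\<lambda>x. u x + c * w x) + l2_inner M (E B u) (\<lambda>x. u x + c * w x)"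
    by (subst l2_inner_add_left) (auto intro!: EL uw L2_scale u w simp: l2_inner_scale_left)
  also have "\<dots> = c * (l2_inner M (E B w) u + cnj c * l2_inner M (E B w) w)
      + (l2_inner M (E B u) u + cnj c * l2_inner M (E B u) w)"
    using u w cw EL by (simp add: l2_inner_add_right l2_inner_scale_right)
  finally show ?thesis by (simp add: algebra_simps)
qed

lemma spectral_polarization:
  assumes E: "projection_valued_measure M E" and B: "B \<in> sets borel"
    and u: "u \<in> L2 M" and w: "w \<in> L2 M"
  shows "(\<Sum>j<4. \<i> ^ j * l2_inner M (E B (\<lambda>x. u x + \<i> ^ j * w x)) (\<lambda>x. u x + \<i> ^ j * w x)) / 4
    = l2_inner M (E B u) w"
  unfolding pvm_inner_add_scale[OF assms] sum_lessThan_4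
  by (simp add: power2_eq_square power3_eq_cube algebra_simps)

lemma spectral_sum_split:
  fixes J I :: complex
  shows "(\<Sum>j<4. \<i> ^ j * (J + X j * I)) / 4 = (\<Sum>j<4. \<i> ^ j * X j) / 4 * I"
  unfolding sum_lessThan_4 by (simp add: power2_eq_square power3_eq_cube algebra_simps add_divide_distrib)

text \<open>
  On a Borel set where two scalar spectral measures are proportional, so are the integrals. Splitting the line
  into such pieces evaluates spectral forms that are defined through polarization.
\<close>

lemma integral_scalar_spectral_split:
  assumes E: "projection_valued_measure M E" and B: "B \<in> sets borel"
    and u: "u \<in> L2 M" and v: "v \<in> L2 M"
    and [measurable]: "\<psi> \<in> borel_measurable borel" and bd: "\<And>t. cmod (\<psi> t) \<le> C"
    and r: "0 \<le> r"
    and eq: "\<And>D. D \<in> sets borel \<Longrightarrow> D \<subseteq> B \<Longrightarrow>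
      Re (l2_inner M (E D u) u) = r * Re (l2_inner M (E D v) v)"
  shows "(LINT t|scalar_spectral_measure M E u. indicator B t * \<psi> t) =
    r * (LINT t|scalar_spectral_measure M E v. indicator B t * \<psi> t)"
proof -
  let ?u = "scalar_spectral_measure M E u" and ?v = "scalar_spectral_measure M E v"
  have "density ?u (\<lambda>t. indicator B t) = density ?v (\<lambda>t. ennreal (r * indicator B t))"
  proof (rule measure_eqI)
    fix D assume "D \<in> sets (density ?u (\<lambda>t. indicator B t))"
    then have D: "D \<in> sets borel" by simp
    have "emeasure (density ?u (\<lambda>t. indicator B t)) D = emeasure ?u (B \<inter> D)"
      using B D by (simp add: emeasure_density indicator_inter_arith[symmetric])
    also have "\<dots> = ennreal r * emeasure ?v (B \<inter> D)"
      using B D eq[of "B \<inter> D"] r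
      by (simp add: emeasure_scalar_spectral_measure[OF E] u v ennreal_mult pvm_inner_real(2)[OF E])
    also have "\<dots> = (\<integral>\<^sup>+t. ennreal r * indicator (B \<inter> D) t \<partial>?v)"
      using B D by (simp add: nn_integral_cmult_indicator)
    also have "\<dots> = emeasure (density ?v (\<lambda>t. ennreal (r * indicator B t))) D"
      using B D by (subst emeasure_density) (auto intro!: nn_integral_cong simp: indicator_def)
    finally show "emeasure (density ?u (\<lambda>t. indicator B t)) D
        = emeasure (density ?v (\<lambda>t. ennreal (r * indicator B t))) D" .
  qed simp
  then have "(LINT t|density ?u (\<lambda>t. ennreal (indicator B t)). \<psi> t)
      = (LINT t|density ?v (\<lambda>t. ennreal (r * indicator B t)). \<psi> t)"
    by (simp add: ennreal_indicator)
  then have "(LINT t|?u. indicator B t *\<^sub>R \<psi> t) = (LINT t|?v. (r * indicator B t) *\<^sub>R \<psi> t)"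
    using B r by (subst (asm) (1 2) integral_density) auto
  then show ?thesis
    by (simp add: scaleR_conv_of_real of_real_indicator mult.assoc)
qed

text \<open>
  The vectors \<open>u + c E(B) u\<close> that occur in the polarization have a scalar spectral measure which is
  that of \<open>u\<close> off \<open>B\<close> and \<open>|1 + c|\<^sup>2\<close> times it on \<open>B\<close>.
  The part off \<open>B\<close> cancels in the sum over the fourth roots of unity.
\<close>

lemma spectral_form_spectral_subspace:
  assumes E: "projection_valued_measure M E" and B: "B \<in> sets borel" and u: "u \<in> L2 M"
    and \<psi>[measurable]: "\<psi> \<in> borel_measurable borel" and bd: "\<And>t. cmod (\<psi> t) \<le> C"
  shows "spectral_form M E \<psi> u (E B u) = (LINT t|scalar_spectral_measure M E u. indicator B t * \<psi> t)"
proof -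
  let ?w = "E B u"
  have w: "?w \<in> L2 M" by (rule pvm_L2[OF E B u])
  have uw: "(\<lambda>x. u x + c * ?w x) \<in> L2 M" for c by (rule L2_add[OF u L2_scale[OF w]])
  let ?I = "LINT t|scalar_spectral_measure M E u. indicator B t * \<psi> t"
  let ?J = "LINT t|scalar_spectral_measure M E u. indicator (- B) t * \<psi> t"
  have expand: "l2_inner M (E D (\<lambda>x. u x + c * ?w x)) (\<lambda>x. u x + c * ?w x) =
      l2_inner M (E D u) u + (cnj c + c + c * cnj c) * l2_inner M (E (B \<inter> D) u) u"
    if D: "D \<in> sets borel" for D c
  proof -
    have EE: "AE x in M. E (D \<inter> B) u x = E D ?w x" by (rule pvm_Int[OF E D B u])
    have 1: "l2_inner M (E D u) ?w = l2_inner M (E (B \<inter> D) u) u"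
      using pvm_inner_Int[OF E D B u u] by (simp add: Int_commute)
    have 2: "l2_inner M (E D ?w) u = l2_inner M (E (B \<inter> D) u) u"
      using EE D B u w by (subst Int_commute, intro l2_inner_cong_AE) (auto intro!: L2_measurable pvm_L2[OF E])
    have "l2_inner M (E D ?w) ?w = l2_inner M (E (D \<inter> B) u) ?w"
      using EE D B u w by (intro l2_inner_cong_AE) (auto intro!: L2_measurable pvm_L2[OF E])
    also have "\<dots> = l2_inner M (E (B \<inter> D) u) u"
      using pvm_inner_Int[OF E _ B u u, of "D \<inter> B"] D B by (simp add: Int_commute Int_left_commute)
    finally have 3: "l2_inner M (E D ?w) ?w = l2_inner M (E (B \<inter> D) u) u" .
    show ?thesis
      unfolding pvm_inner_add_scale[OF E D u w] 1 2 3 by (simp add: algebra_simps)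
  qed
  (* ?J does not depend on c, so it drops out of the polarization sum. *)
  have part: "(LINT t|scalar_spectral_measure M E (\<lambda>x. u x + c * ?w x). \<psi> t) =
      ?J + of_real ((cmod (1 + c))\<^sup>2) * ?I" for c
  proof -
    let ?N = "scalar_spectral_measure M E (\<lambda>x. u x + c * ?w x)"
    have int: "integrable ?N (\<lambda>t. indicator D t * \<psi> t)" if "D \<in> sets borel" for D
      by (rule integral_bounded_finite_measure[OF finite_scalar_spectral_measure[OF E uw], where C = C])
         (use that bd order_trans[OF norm_ge_zero bd] in \<open>auto simp: indicator_def\<close>)
    have "(LINT t|?N. \<psi> t) = (LINT t|?N. indicator (- B) t * \<psi> t + indicator B t * \<psi> t)"
      by (intro Bochner_Integration.integral_cong) (auto simp: indicator_def)
    also have "\<dots> = (LINT t|?N. indicator (- B) t * \<psi> t) + (LINT t|?N. indicator B t * \<psi> t)"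
      using int[of B] int[of "- B"] B by (intro Bochner_Integration.integral_add) auto
    also have "(LINT t|?N. indicator (- B) t * \<psi> t) = of_real 1 * ?J"
    proof (rule integral_scalar_spectral_split[OF E _ uw u \<psi> bd])
      fix D assume D: "D \<in> sets borel" "D \<subseteq> - B"
      then have "B \<inter> D = {}" by auto
      then show "Re (l2_inner M (E D (\<lambda>x. u x + c * ?w x)) (\<lambda>x. u x + c * ?w x)) = 1 * Re (l2_inner M (E D u) u)"
        using D by (simp add: expand pvm_empty[OF E u u])
    qed (use B in auto)
    also have "(LINT t|?N. indicator B t * \<psi> t) = of_real ((cmod (1 + c))\<^sup>2) * ?I"
    proof (rule integral_scalar_spectral_split[OF E B uw u \<psi> bd])
      fix D assume D: "D \<in> sets borel" "D \<subseteq> B"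
      then have "B \<inter> D = D" by auto
      then have "l2_inner M (E D (\<lambda>x. u x + c * ?w x)) (\<lambda>x. u x + c * ?w x)
          = ((1 + c) * cnj (1 + c)) * l2_inner M (E D u) u"
        using D by (simp add: expand algebra_simps)
      moreover obtain r where "l2_inner M (E D u) u = of_real r"
        using pvm_inner_real(1)[OF E D(1) u] by blast
      ultimately show "Re (l2_inner M (E D (\<lambda>x. u x + c * ?w x)) (\<lambda>x. u x + c * ?w x))
          = (cmod (1 + c))\<^sup>2 * Re (l2_inner M (E D u) u)"
        by (simp only: complex_norm_square[symmetric] Re_complex_of_real of_real_mult[symmetric])
    qed simp
    finally show ?thesis by simp
  qed
  have "spectral_form M E \<psi> u ?w = (\<Sum>j<4. \<i> ^ j * of_real ((cmod (1 + \<i> ^ j * 1))\<^sup>2)) / 4 * ?I"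
    unfolding spectral_form_def part spectral_sum_split by simp
  then show ?thesis unfolding polarization by simp
qed

text \<open>
  Testing \<open>A u = \<kappa> u\<close> against \<open>E(B) u\<close> gives
  \<open>\<integral>\<^sub>B (t - \<kappa>) d\<mu> = 0\<close> for the scalar spectral measure
  \<open>\<mu>\<close> of \<open>u\<close>. If the integrand has a fixed sign on \<open>B\<close>, the set is
  null. The factor \<open>s\<close> treats both signs at once, and boundedness of \<open>B\<close> makes the
  truncations in the spectral integral eventually harmless.
\<close>

lemma eigenvector_spectral_measure_zero:
  assumes E: "projection_valued_measure M E" and u: "u \<in> L2 M"
    and ev: "(u, \<lambda>x. of_real \<kappa> * u x) \<in> spectral_integral M E of_real"
    and B: "B \<in> sets borel" and bd: "\<And>t. t \<in> B \<Longrightarrow> \<bar>t\<bar> \<le> b"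
    and sgn: "\<And>t. t \<in> B \<Longrightarrow> 0 < s * (t - \<kappa>)"
  shows "emeasure (scalar_spectral_measure M E u) B = 0"
proof -
  let ?N = "scalar_spectral_measure M E u"
  interpret N: finite_measure ?N by (rule finite_scalar_spectral_measure[OF E u])
  define trunc where "trunc n t = (if cmod (of_real t) \<le> real n then of_real t else 0 :: complex)" for n t
  have trunc_meas: "trunc n \<in> borel_measurable borel" for n unfolding trunc_def[abs_def] by measurable
  have trunc_bd: "cmod (trunc n t) \<le> real n" for n t by (simp add: trunc_def)
  have w: "E B u \<in> L2 M" by (rule pvm_L2[OF E B u])
  have "(\<lambda>n. spectral_form M E (trunc n) u (E B u)) \<longlonglongrightarrow> l2_inner M (\<lambda>x. of_real \<kappa> * u x) (E B u)"
    using ev w unfolding spectral_integral_def trunc_def[abs_def] by simp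
  moreover have "\<forall>\<^sub>F n in sequentially. spectral_form M E (trunc n) u (E B u) = of_real (LINT t|?N. indicator B t * t)"
    using eventually_ge_at_top[of "nat \<lceil>b\<rceil>"]
  proof eventually_elim
    case (elim n)
    then have "b \<le> real n" by linarith
    then have "(LINT t|?N. indicator B t * trunc n t) = (LINT t|?N. of_real (indicator B t * t))"
      using bd by (intro Bochner_Integration.integral_cong) (fastforce simp: indicator_def trunc_def)+
    then show ?case
      by (simp only: spectral_form_spectral_subspace[OF E B u trunc_meas trunc_bd] integral_complex_of_real)
  qed
  ultimately have "(\<lambda>n::nat. of_real (LINT t|?N. indicator B t * t)) \<longlonglongrightarrow> l2_inner M (\<lambda>x. of_real \<kappa> * u x) (E B u)"
    by (rule Lim_transform_eventually)
  then have "of_real (LINT t|?N. indicator B t * t) = of_real \<kappa> * l2_inner M u (E B u)"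
    using LIMSEQ_const_iff by (metis l2_inner_scale_left)
  also have "l2_inner M u (E B u) = of_real (Re (l2_inner M (E B u) u))"
    using pvm_sym[OF E B u u] pvm_inner_real(1)[OF E B u] by simp
  also have "Re (l2_inner M (E B u) u) = measure ?N B"
    using pvm_inner_real(2)[OF E B u] by (simp add: measure_def emeasure_scalar_spectral_measure[OF E u B])
  finally have "(LINT t|?N. indicator B t * t) = \<kappa> * measure ?N B"
    by (simp only: of_real_mult[symmetric] of_real_eq_iff)
  moreover have int1: "integrable ?N (\<lambda>t. indicator B t * t)"
    using B bd by (intro N.integrable_const_bound[where B = "\<bar>b\<bar>"]) (fastforce simp: indicator_def)+
  moreover have int2: "integrable ?N (\<lambda>t. indicator B t * \<kappa>)"
    using B by (intro N.integrable_const_bound[where B = "\<bar>\<kappa>\<bar>"]) (auto simp: indicator_def)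
  moreover have "(LINT t|?N. indicator B t * \<kappa>) = \<kappa> * measure ?N B"
    using B by (simp add: mult.commute)
  ultimately have "(LINT t|?N. indicator B t * t - indicator B t * \<kappa>) = 0"
    by (subst Bochner_Integration.integral_diff) simp_all
  then have zero: "(LINT t|?N. s * (indicator B t * t - indicator B t * \<kappa>)) = 0" by simp
  have "AE t in ?N. s * (indicator B t * t - indicator B t * \<kappa>) = 0"
    using zero
  proof (subst (asm) integral_nonneg_eq_0_iff_AE)
    show "integrable ?N (\<lambda>t. s * (indicator B t * t - indicator B t * \<kappa>))" using int1 int2 by simp
    show "AE t in ?N. 0 \<le> s * (indicator B t * t - indicator B t * \<kappa>)"
      using sgn by (intro AE_I2) (auto simp: indicator_def intro: less_imp_le)
  qed
  then have "AE t in ?N. t \<notin> B"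
    by eventually_elim (use sgn in \<open>fastforce simp: indicator_def\<close>)
  then show ?thesis using B by (subst (asm) AE_iff_measurable[of B]) auto
qed

lemma eigenvector_spectral_projection:
  assumes E: "projection_valued_measure M E" and u: "u \<in> L2 M"
    and ev: "(u, \<lambda>x. of_real \<kappa> * u x) \<in> spectral_integral M E of_real"
    and B: "B \<in> sets borel" and nk: "\<kappa> \<notin> B"
  shows "AE x in M. E B u x = 0"
proof -
  let ?N = "scalar_spectral_measure M E u"
  (* Bounded pieces on either side of \<kappa> exhaust B. *)
  let ?P = "\<lambda>n. {t \<in> B. \<kappa> < t \<and> \<bar>t\<bar> \<le> real n}" and ?Q = "\<lambda>n. {t \<in> B. t < \<kappa> \<and> \<bar>t\<bar> \<le> real n}"
  have PQ: "?P n \<in> null_sets ?N" "?Q n \<in> null_sets ?N" for n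
  proof -
    have "?P n = B \<inter> {t. \<kappa> < t \<and> \<bar>t\<bar> \<le> real n}" "?Q n = B \<inter> {t. t < \<kappa> \<and> \<bar>t\<bar> \<le> real n}" by auto
    moreover have "{t. \<kappa> < t \<and> \<bar>t\<bar> \<le> real n} \<in> sets borel" "{t. t < \<kappa> \<and> \<bar>t\<bar> \<le> real n} \<in> sets borel" by measurable
    ultimately have m: "?P n \<in> sets borel" "?Q n \<in> sets borel" using B by auto
    show "?P n \<in> null_sets ?N"
      using m eigenvector_spectral_measure_zero[OF E u ev m(1), of "real n" 1] by auto
    show "?Q n \<in> null_sets ?N"
      using m eigenvector_spectral_measure_zero[OF E u ev m(2), of "real n" "-1"] by auto
  qed
  have "(\<Union>n. ?P n \<union> ?Q n) \<in> null_sets ?N"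
    using PQ by (intro null_sets_UN) auto
  moreover have "B \<subseteq> (\<Union>n. ?P n \<union> ?Q n)"
  proof
    fix t assume "t \<in> B"
    moreover obtain n where "\<bar>t\<bar> \<le> real n" using real_arch_simple by blast
    moreover have "t \<noteq> \<kappa>" using nk \<open>t \<in> B\<close> by auto
    ultimately show "t \<in> (\<Union>n. ?P n \<union> ?Q n)" by auto
  qed
  ultimately have "emeasure ?N B = 0"
    using B by (intro null_setsD1[OF null_sets_subset]) auto
  then have "Re (l2_inner M (E B u) u) = 0"
    using pvm_inner_real(2)[OF E B u] by (simp add: emeasure_scalar_spectral_measure[OF E u B])
  then have "l2_inner M (E B u) (E B u) = 0"
    using pvm_inner_real(1)[OF E B u] pvm_inner_Int[OF E B B u u] by simp
  then show ?thesis using l2_inner_self_eq_0[OF pvm_L2[OF E B u]] by simp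
qed

text \<open>
  Since \<open>E(D) u = 0\<close> for \<open>\<kappa> \<notin> D\<close>, the scalar spectral measure of
  \<open>u + c w\<close> with \<open>|c| = 1\<close> agrees with that of \<open>w\<close> off
  \<open>\<kappa>\<close>. That part cancels in the polarization, and the atom at \<open>\<kappa>\<close>
  contributes
  \<open>\<psi> \<kappa> \<langle>E{\<kappa>} u, w\<rangle> = \<psi> \<kappa> \<langle>u, w\<rangle>\<close>.
\<close>

lemma spectral_form_eigenvector:
  assumes E: "projection_valued_measure M E" and u: "u \<in> L2 M" and w: "w \<in> L2 M"
    and ev: "(u, \<lambda>x. of_real \<kappa> * u x) \<in> spectral_integral M E of_real"
    and \<psi>[measurable]: "\<psi> \<in> borel_measurable borel" and bd: "\<And>t. cmod (\<psi> t) \<le> C"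
  shows "spectral_form M E \<psi> u w = \<psi> \<kappa> * l2_inner M u w"
proof -
  have uw: "(\<lambda>x. u x + c * w x) \<in> L2 M" for c by (rule L2_add[OF u L2_scale[OF w]])
  have zero: "l2_inner M (E D u) v = 0" "l2_inner M v (E D u) = 0"
    if "D \<in> sets borel" "\<kappa> \<notin> D" "v \<in> L2 M" for D v
  proof -
    have "l2_inner M (E D u) v = l2_inner M (\<lambda>x. 0) v"
      using eigenvector_spectral_projection[OF E u ev that(1,2)] that
      by (intro l2_inner_cong_AE) (auto intro!: L2_measurable pvm_L2[OF E] u)
    then show "l2_inner M (E D u) v = 0" by (simp add: l2_inner_zero_left)
    then show "l2_inner M v (E D u) = 0" by (subst l2_inner_commute) simp
  qed
  let ?J = "LINT t|scalar_spectral_measure M E w. indicator (- {\<kappa>}) t * \<psi> t"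
  have part: "(LINT t|scalar_spectral_measure M E (\<lambda>x. u x + c * w x). \<psi> t) =
      ?J + l2_inner M (E {\<kappa>} (\<lambda>x. u x + c * w x)) (\<lambda>x. u x + c * w x) * \<psi> \<kappa>" if c: "cmod c = 1" for c
  proof -
    let ?N = "scalar_spectral_measure M E (\<lambda>x. u x + c * w x)"
    interpret N: finite_measure ?N by (rule finite_scalar_spectral_measure[OF E uw])
    have int: "integrable ?N (\<lambda>t. indicator D t * \<psi> t)" if "D \<in> sets borel" for D
      by (rule integral_bounded_finite_measure[OF finite_scalar_spectral_measure[OF E uw], where C = C])
         (use that bd order_trans[OF norm_ge_zero bd] in \<open>auto simp: indicator_def\<close>)
    have "(LINT t|?N. \<psi> t) = (LINT t|?N. indicator (- {\<kappa>}) t * \<psi> t + indicator {\<kappa>} t * \<psi> t)"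
      by (intro Bochner_Integration.integral_cong) (auto simp: indicator_def)
    also have "\<dots> = (LINT t|?N. indicator (- {\<kappa>}) t * \<psi> t) + (LINT t|?N. indicator {\<kappa>} t * \<psi> t)"
      using int[of "- {\<kappa>}"] int[of "{\<kappa>}"] by (intro Bochner_Integration.integral_add) auto
    also have "(LINT t|?N. indicator (- {\<kappa>}) t * \<psi> t) = of_real 1 * ?J"
    proof (rule integral_scalar_spectral_split[OF E _ uw w \<psi> bd])
      fix D assume D: "D \<in> sets borel" "D \<subseteq> - {\<kappa>}"
      have "l2_inner M (E D w) u = 0"
        using zero(2)[of D w] D pvm_sym[OF E D(1) w u] w by auto
      moreover have "c * cnj c = 1" using c by (simp add: complex_norm_square[symmetric])
      ultimately show "Re (l2_inner M (E D (\<lambda>x. u x + c * w x)) (\<lambda>x. u x + c * w x)) = 1 * Re (l2_inner M (E D w) w)"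
        using D zero(1)[of D] u w by (auto simp: pvm_inner_add_scale[OF E D(1) u w])
    qed auto
    also have "(LINT t|?N. indicator {\<kappa>} t * \<psi> t) = (LINT t|?N. indicator {\<kappa>} t *\<^sub>R \<psi> \<kappa>)"
      by (intro Bochner_Integration.integral_cong) (auto simp: indicator_def)
    also have "\<dots> = measure ?N {\<kappa>} *\<^sub>R \<psi> \<kappa>"
    proof -
      have "integrable ?N (indicator {\<kappa>} :: real \<Rightarrow> real)"
        by (rule N.integrable_const_bound[where B = 1]) auto
      then show ?thesis by (subst Bochner_Integration.integral_scaleR_left) auto
    qed
    also have "measure ?N {\<kappa>} = Re (l2_inner M (E {\<kappa>} (\<lambda>x. u x + c * w x)) (\<lambda>x. u x + c * w x))"
      using pvm_inner_real(2)[OF E _ uw, of "{\<kappa>}"]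
      by (simp add: measure_def emeasure_scalar_spectral_measure[OF E uw])
    also have "\<dots> *\<^sub>R \<psi> \<kappa> = l2_inner M (E {\<kappa>} (\<lambda>x. u x + c * w x)) (\<lambda>x. u x + c * w x) * \<psi> \<kappa>"
      using pvm_inner_real(1)[OF E _ uw, of "{\<kappa>}"] by (simp add: scaleR_conv_of_real)
    finally show ?thesis by simp
  qed
  have "spectral_form M E \<psi> u w =
      (\<Sum>j<4. \<i> ^ j * l2_inner M (E {\<kappa>} (\<lambda>x. u x + \<i> ^ j * w x)) (\<lambda>x. u x + \<i> ^ j * w x)) / 4 * \<psi> \<kappa>"
    unfolding spectral_form_def spectral_sum_split[of ?J, symmetric] by (simp add: part norm_power)
  also have "(\<Sum>j<4. \<i> ^ j * l2_inner M (E {\<kappa>} (\<lambda>x. u x + \<i> ^ j * w x)) (\<lambda>x. u x + \<i> ^ j * w x)) / 4 =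
      l2_inner M (E {\<kappa>} u) w"
    by (rule spectral_polarization[OF E _ u w]) simp
  also have "l2_inner M (E {\<kappa>} u) w = l2_inner M u w"
  proof -
    have "l2_inner M (E ({\<kappa>} \<union> - {\<kappa>}) u) w = l2_inner M (E {\<kappa>} u) w + l2_inner M (E (- {\<kappa>}) u) w"
      by (rule pvm_Un[OF E _ _ _ u w]) auto
    moreover have "l2_inner M (E UNIV u) w = l2_inner M u w"
      using pvm_UNIV[OF E u] by (intro l2_inner_cong_AE) (auto intro!: L2_measurable pvm_L2[OF E] u w)
    ultimately show ?thesis using zero(1)[of "- {\<kappa>}" w] w by (simp add: Compl_partition)
  qed
  finally show ?thesis by simp
qed

text \<open>
  Nothing is known about the resolution that the functional calculus selects except that it is a spectral
  resolution of \<open>A\<close>. The hypothesis on \<open>E0\<close> guarantees that there is one, and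
  \<open>spectral_form_eigenvector\<close> holds for all of them, so \<open>\<phi> \<kappa> u\<close> is a value
  of the functional calculus. Two values have the same inner products, hence agree almost everywhere.
\<close>

theorem functional_calculus_eigenvector:
  assumes res: "is_spectral_resolution M A E0"
    and ev: "(u, \<lambda>x. of_real \<kappa> * u x) \<in> A" and u: "u \<in> L2 M"
    and \<phi>[measurable]: "\<phi> \<in> borel_measurable borel" and bd: "\<And>t. cmod (\<phi> t) \<le> 1"
  shows "AE x in M. functional_calculus M A \<phi> u x = \<phi> \<kappa> * u x"
proof -
  define E where "E = spectral_resolution M A"
  have "is_spectral_resolution M A E"
    unfolding E_def spectral_resolution_def by (rule someI[of _ E0]) (rule res)
  then have E: "projection_valued_measure M E" and A: "A = spectral_integral M E of_real"
    by (auto simp: is_spectral_resolution_def)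
  interpret N: finite_measure "scalar_spectral_measure M E u"
    by (rule finite_scalar_spectral_measure[OF E u])
  have ev': "(u, \<lambda>x. of_real \<kappa> * u x) \<in> spectral_integral M E of_real" using ev A by simp
  have lim: "(\<lambda>n. spectral_form M E (\<lambda>t. if cmod (\<phi> t) \<le> real n then \<phi> t else 0) u w) \<longlonglongrightarrow> \<phi> \<kappa> * l2_inner M u w"
    if w: "w \<in> L2 M" for w
  proof (rule tendsto_eventually, use eventually_ge_at_top[of 1] in eventually_elim)
    fix n :: nat assume "1 \<le> n"
    then have "cmod (\<phi> t) \<le> real n" for t using order_trans[OF bd[of t], of "real n"] by simp
    then have "(\<lambda>t. if cmod (\<phi> t) \<le> real n then \<phi> t else 0) = \<phi>" by simp
    then show "spectral_form M E (\<lambda>t. if cmod (\<phi> t) \<le> real n then \<phi> t else 0) u w = \<phi> \<kappa> * l2_inner M u w"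
      using spectral_form_eigenvector[OF E u w ev' \<phi> bd] by simp
  qed
  have "(\<integral>\<^sup>+ t. ennreal ((cmod (\<phi> t))\<^sup>2) \<partial>scalar_spectral_measure M E u) \<le> (\<integral>\<^sup>+ t. 1 \<partial>scalar_spectral_measure M E u)"
    using bd by (intro nn_integral_mono) (simp add: power_le_one)
  also have "\<dots> < \<infinity>" using N.emeasure_finite[of UNIV] by (simp add: less_top[symmetric])
  finally have "(u, \<lambda>x. \<phi> \<kappa> * u x) \<in> spectral_integral M E \<phi>"
    unfolding spectral_integral_def using u lim by (auto intro: L2_scale simp: l2_inner_scale_left)
  then have "(u, functional_calculus M A \<phi> u) \<in> spectral_integral M E \<phi>"
    unfolding functional_calculus_def E_def
    by (rule someI[of "\<lambda>v. (u, v) \<in> spectral_integral M (spectral_resolution M A) \<phi>"])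
  then have v: "functional_calculus M A \<phi> u \<in> L2 M"
    and limv: "\<And>w. w \<in> L2 M \<Longrightarrow>
      (\<lambda>n. spectral_form M E (\<lambda>t. if cmod (\<phi> t) \<le> real n then \<phi> t else 0) u w)
        \<longlonglongrightarrow> l2_inner M (functional_calculus M A \<phi> u) w"
    by (auto simp: spectral_integral_def)
  let ?d = "\<lambda>x. functional_calculus M A \<phi> u x - \<phi> \<kappa> * u x"
  have d: "?d \<in> L2 M" by (intro L2_diff v L2_scale u)
  have "l2_inner M ?d ?d = 0"
    using LIMSEQ_unique[OF limv[OF d] lim[OF d]] d v u
    by (simp add: l2_inner_diff_left[OF v L2_scale[OF u] d] l2_inner_scale_left)
  from l2_inner_self_eq_0[OF d this] show ?thesis by simp
qed

section \<open>Polynomials and Dunkl operators\<close>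

text \<open>
  Complex polynomial functions, generated inductively. The rules are tailored to induction, and
  \<open>homogeneous_polynomial_iff\<close> connects them with \<open>polynomial_function\<close>.
\<close>

inductive cpoly :: "(real ^ 'n \<Rightarrow> complex) \<Rightarrow> bool" where
  cpoly_const: "cpoly (\<lambda>x. c)"
| cpoly_coord: "cpoly (\<lambda>x. of_real (x $ i))"
| cpoly_add: "cpoly f \<Longrightarrow> cpoly g \<Longrightarrow> cpoly (\<lambda>x. f x + g x)"
| cpoly_mult: "cpoly f \<Longrightarrow> cpoly g \<Longrightarrow> cpoly (\<lambda>x. f x * g x)"

lemma cpoly_sum: "(\<And>i. i \<in> I \<Longrightarrow> cpoly (f i)) \<Longrightarrow> cpoly (\<lambda>x. \<Sum>i\<in>I. f i x)"
  by (induction I rule: infinite_finite_induct) (auto intro: cpoly.intros)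

lemma cpoly_cmult: "cpoly f \<Longrightarrow> cpoly (\<lambda>x. c * f x)"
  by (intro cpoly_mult cpoly_const)

lemma cpoly_diff: "cpoly f \<Longrightarrow> cpoly g \<Longrightarrow> cpoly (\<lambda>x. f x - g x)"
  using cpoly_add[of f "\<lambda>x. - 1 * g x"] cpoly_cmult[of g "-1"] by simp

lemma cpoly_power: "cpoly f \<Longrightarrow> cpoly (\<lambda>x. f x ^ n)"
  by (induction n) (auto intro: cpoly.intros)

lemma cpoly_inner: "cpoly (\<lambda>x. of_real (\<alpha> \<bullet> x))"
  unfolding inner_vec_def of_real_sum by (auto intro!: cpoly_sum cpoly_cmult cpoly_coord)

lemma cpoly_inner': "cpoly (\<lambda>x. of_real (x \<bullet> \<alpha>))"
  using cpoly_inner[of \<alpha>] by (simp add: inner_commute)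

lemma cpoly_norm_square: "cpoly (\<lambda>x. of_real (x \<bullet> x))"
  unfolding inner_vec_def of_real_sum by (auto intro!: cpoly_sum cpoly_mult cpoly_coord)

lemma cpoly_cnj: "cpoly f \<Longrightarrow> cpoly (\<lambda>x. cnj (f x))"
  by (induction rule: cpoly.induct) (auto intro: cpoly.intros)

lemma real_polynomial_function_cpoly:
  fixes f :: "real ^ 'n \<Rightarrow> real"
  assumes "real_polynomial_function f"
  shows "cpoly (\<lambda>x. of_real (f x))"
  using assms
proof (induction rule: real_polynomial_function.induct)
  case (linear h)
  have eq: "h x = (\<Sum>i\<in>UNIV. h (axis i 1) * x $ i)" for x
  proof -
    have "h x = h (\<Sum>i\<in>UNIV. (x $ i) *\<^sub>R axis i 1)"
      using basis_expansion[of x] by (simp add: scalar_mult_eq_scaleR)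
    also have "\<dots> = (\<Sum>i\<in>UNIV. x $ i * h (axis i 1))"
      using bounded_linear.linear[OF linear] by (simp add: linear_sum linear_scale)
    finally show ?thesis by (simp add: mult.commute)
  qed
  have "(\<lambda>x. complex_of_real (h x)) = (\<lambda>x. \<Sum>i\<in>UNIV. of_real (h (axis i 1)) * of_real (x $ i))"
    by (rule ext, subst eq) simp
  then show ?case by (auto intro!: cpoly_sum cpoly_cmult cpoly_coord)
qed (auto intro: cpoly.intros)

lemma polynomial_function_cpoly:
  fixes p :: "real ^ 'n \<Rightarrow> complex"
  assumes "polynomial_function p"
  shows "cpoly p"
proof -
  have "real_polynomial_function (Re \<circ> p)" "real_polynomial_function (Im \<circ> p)"
    using assms unfolding polynomial_function_def by (auto intro: bounded_linear_Re bounded_linear_Im)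
  then have "cpoly (\<lambda>x. of_real (Re (p x)) + \<i> * of_real (Im (p x)))"
    by (intro cpoly_add cpoly_cmult) (auto dest: real_polynomial_function_cpoly)
  then show ?thesis by (simp add: complex_eq[symmetric])
qed

lemma cpoly_polynomial_function:
  assumes "cpoly p"
  shows "polynomial_function p"
proof -
  have "real_polynomial_function (\<lambda>x. Re (p x)) \<and> real_polynomial_function (\<lambda>x. Im (p x))"
    using assms
    by (induction rule: cpoly.induct)
       (auto intro: real_polynomial_function.intros(1)[OF bounded_linear_vec_nth]
         real_polynomial_function.intros(2-4) real_polynomial_function_diff)
  then show ?thesis
    unfolding polynomial_function_iff_Basis_inner
    by (auto simp: Basis_complex_def inner_complex_def real_polynomial_function_eq)
qed

lemma homogeneous_polynomial_iff:
  "homogeneous_polynomial m p \<longleftrightarrow> cpoly p \<and> (\<forall>(t::real) x. p (t *\<^sub>R x) = of_real (t ^ m) * p x)"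
  unfolding homogeneous_polynomial_def using polynomial_function_cpoly cpoly_polynomial_function by blast

lemma cpoly_has_derivative:
  assumes "cpoly f"
  shows "\<exists>f'. (\<forall>x. (f has_derivative f' x) (at x)) \<and> (\<forall>\<xi>. cpoly (\<lambda>x. f' x \<xi>))"
  using assms
proof (induction rule: cpoly.induct)
  case (cpoly_const c)
  then show ?case by (intro exI[of _ "\<lambda>x h. 0"]) (auto intro: cpoly.intros)
next
  case (cpoly_coord i)
  have "((\<lambda>x. complex_of_real (x $ i)) has_derivative (\<lambda>h. of_real (h $ i))) (at x)" for x :: "real ^ 'a"
    by (intro bounded_linear_imp_has_derivative bounded_linear_compose[OF bounded_linear_of_real bounded_linear_vec_nth])
  then show ?case by (intro exI[of _ "\<lambda>x h. of_real (h $ i)"]) (auto intro: cpoly.intros)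
next
  case (cpoly_add f g)
  then obtain f' g' where "\<And>x. (f has_derivative f' x) (at x)" "\<And>\<xi>. cpoly (\<lambda>x. f' x \<xi>)"
    "\<And>x. (g has_derivative g' x) (at x)" "\<And>\<xi>. cpoly (\<lambda>x. g' x \<xi>)" by blast
  then show ?case
    by (intro exI[of _ "\<lambda>x h. f' x h + g' x h"]) (auto intro: cpoly.intros has_derivative_add)
next
  case (cpoly_mult f g)
  then obtain f' g' where "\<And>x. (f has_derivative f' x) (at x)" "\<And>\<xi>. cpoly (\<lambda>x. f' x \<xi>)"
    "\<And>x. (g has_derivative g' x) (at x)" "\<And>\<xi>. cpoly (\<lambda>x. g' x \<xi>)" by blast
  note d = this
  show ?case
  proof (intro exI[of _ "\<lambda>x h. f x * g' x h + f' x h * g x"] conjI allI)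
    show "((\<lambda>x. f x * g x) has_derivative (\<lambda>h. f x * g' x h + f' x h * g x)) (at x)" for x
      by (intro has_derivative_mult d)
    show "cpoly (\<lambda>x. f x * g' x \<xi> + f' x \<xi> * g x)" for \<xi>
      by (intro cpoly.cpoly_add cpoly.cpoly_mult d cpoly_mult.hyps)
  qed
qed

lemma cpoly_differentiable: "cpoly f \<Longrightarrow> f differentiable (at x)"
  using cpoly_has_derivative[of f] by (auto simp: differentiable_def)

lemma cpoly_continuous: "cpoly f \<Longrightarrow> continuous_on S f"
  by (rule continuous_at_imp_continuous_on)
     (simp add: differentiable_imp_continuous_within cpoly_differentiable)

lemma cpoly_borel_measurable [measurable_dest]: "cpoly f \<Longrightarrow> f \<in> borel_measurable borel"
  by (intro borel_measurable_continuous_onI cpoly_continuous)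

lemma directional_derivative_eq:
  assumes "(f has_derivative f') (at x)"
  shows "directional_derivative \<xi> f x = f' \<xi>"
proof -
  have "((\<lambda>t. x + t *\<^sub>R \<xi>) has_derivative (\<lambda>t. t *\<^sub>R \<xi>)) (at (0::real))"
    by (auto intro!: derivative_eq_intros)
  from has_derivative_compose[OF this, of f f'] assms
  have "((\<lambda>t. f (x + t *\<^sub>R \<xi>)) has_derivative (\<lambda>t. f' (t *\<^sub>R \<xi>))) (at 0)" by simp
  moreover have "(\<lambda>t. f' (t *\<^sub>R \<xi>)) = (\<lambda>t. t *\<^sub>R f' \<xi>)"
    using has_derivative_bounded_linear[OF assms] by (simp add: bounded_linear.linear linear_scale)
  ultimately have "((\<lambda>t. f (x + t *\<^sub>R \<xi>)) has_vector_derivative f' \<xi>) (at 0)"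
    by (simp add: has_vector_derivative_def)
  then show ?thesis unfolding directional_derivative_def by (rule vector_derivative_at)
qed

lemma cpoly_directional_derivative:
  assumes "cpoly f"
  shows "cpoly (directional_derivative \<xi> f)"
proof -
  obtain f' where f': "\<And>x. (f has_derivative f' x) (at x)" "\<And>\<xi>. cpoly (\<lambda>x. f' x \<xi>)"
    using cpoly_has_derivative[OF assms] by blast
  then have "directional_derivative \<xi> f = (\<lambda>x. f' x \<xi>)"
    by (auto simp: directional_derivative_eq)
  then show ?thesis using f'(2) by simp
qed

lemma directional_derivative_const [simp]: "directional_derivative \<xi> (\<lambda>x. c) x = 0"
  by (rule directional_derivative_eq[where f' = "\<lambda>h. 0"]) simp

lemma directional_derivative_add:
  assumes "f differentiable (at x)" "g differentiable (at x)"
  shows "directional_derivative \<xi> (\<lambda>y. f y + g y) x = directional_derivative \<xi> f x + directional_derivative \<xi> g x"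
proof -
  obtain f' g' where "(f has_derivative f') (at x)" "(g has_derivative g') (at x)"
    using assms by (auto simp: differentiable_def)
  then show ?thesis
    by (simp add: directional_derivative_eq directional_derivative_eq[OF has_derivative_add])
qed

lemma directional_derivative_mult:
  assumes "f differentiable (at x)" "g differentiable (at x)"
  shows "directional_derivative \<xi> (\<lambda>y. f y * g y) x =
    f x * directional_derivative \<xi> g x + directional_derivative \<xi> f x * g x"
proof -
  obtain f' g' where "(f has_derivative f') (at x)" "(g has_derivative g') (at x)"
    using assms by (auto simp: differentiable_def)
  then show ?thesis
    by (simp add: directional_derivative_eq directional_derivative_eq[OF has_derivative_mult])
qed

lemma directional_derivative_expand:
  assumes "f differentiable (at x)"
  shows "(\<Sum>\<xi>\<in>Basis. of_real (y \<bullet> \<xi>) * directional_derivative \<xi> f x) = directional_derivative y f x"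
proof -
  obtain f' where f': "(f has_derivative f') (at x)"
    using assms by (auto simp: differentiable_def)
  then have l: "linear f'" by (rule has_derivative_linear)
  have "f' y = f' (\<Sum>\<xi>\<in>Basis. (y \<bullet> \<xi>) *\<^sub>R \<xi>)" by (simp add: euclidean_representation)
  also have "\<dots> = (\<Sum>\<xi>\<in>Basis. (y \<bullet> \<xi>) *\<^sub>R f' \<xi>)" using l by (simp add: linear_sum linear_scale)
  finally show ?thesis using f' by (simp add: directional_derivative_eq scaleR_conv_of_real)
qed

lemma linear_reflection: "linear (reflection \<alpha>)"
  by (rule linearI) (auto simp: reflection_def inner_add_right algebra_simps add_divide_distrib scaleR_add_left)

lemma reflection_perp: "\<alpha> \<bullet> x = 0 \<Longrightarrow> reflection \<alpha> x = x"
  by (simp add: reflection_def)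

lemma inner_reflection: "\<alpha> \<noteq> 0 \<Longrightarrow> \<alpha> \<bullet> reflection \<alpha> x = - (\<alpha> \<bullet> x)"
  by (simp add: reflection_def inner_diff_right power2_norm_eq_inner)

lemma inner_reflection_sym: "y \<bullet> reflection \<alpha> x = reflection \<alpha> y \<bullet> x"
  by (simp add: reflection_def inner_diff_right inner_diff_left inner_commute mult.commute)

lemma reflection_reflection [simp]: "reflection \<alpha> (reflection \<alpha> x) = x"
proof (cases "\<alpha> = 0")
  case False
  have "reflection \<alpha> (reflection \<alpha> x) = reflection \<alpha> x - (2 * (\<alpha> \<bullet> reflection \<alpha> x) / (norm \<alpha>)\<^sup>2) *\<^sub>R \<alpha>"
    by (simp add: reflection_def)
  also have "\<dots> = x" unfolding inner_reflection[OF False] by (simp add: reflection_def)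
  finally show ?thesis .
qed (simp add: reflection_def)

lemma inner_reflection_reflection [simp]: "reflection \<alpha> x \<bullet> reflection \<alpha> y = x \<bullet> y"
  by (simp add: inner_reflection_sym)

lemma norm_reflection [simp]: "norm (reflection \<alpha> x) = norm x"
  by (simp add: norm_eq_sqrt_inner)

lemma reflection_self: "\<alpha> \<noteq> 0 \<Longrightarrow> reflection \<alpha> \<alpha> = - \<alpha>"
  by (simp add: reflection_def power2_norm_eq_inner scaleR_2)

lemma cpoly_reflection:
  assumes "cpoly f"
  shows "cpoly (\<lambda>x. f (reflection \<alpha> x))"
  using assms
proof (induction rule: cpoly.induct)
  case (cpoly_coord i)
  have "(\<lambda>x. complex_of_real (reflection \<alpha> x $ i)) =
      (\<lambda>x. of_real (x $ i) - of_real (2 / (norm \<alpha>)\<^sup>2 * \<alpha> $ i) * of_real (\<alpha> \<bullet> x))"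
    by (auto simp: reflection_def)
  then show ?case
    by (simp only:) (intro cpoly_diff cpoly_cmult cpoly_inner cpoly.cpoly_coord)
qed (auto intro: cpoly.intros)

text \<open>
  Divisibility by \<open>\<alpha> \<bullet> x\<close> is inherited by products because a difference of products is
  a sum of two products, each with one difference as a factor. This makes Dunkl operators preserve polynomials.
\<close>

lemma cpoly_reflection_difference:
  assumes "cpoly f"
  shows "\<exists>q. cpoly q \<and> (\<forall>x. f x - f (reflection \<alpha> x) = of_real (\<alpha> \<bullet> x) * q x)"
  using assms
proof (induction rule: cpoly.induct)
  case (cpoly_const c)
  then show ?case by (intro exI[of _ "\<lambda>x. 0"]) (auto intro: cpoly.intros)
next
  case (cpoly_coord i)
  then show ?case
    by (intro exI[of _ "\<lambda>x. of_real (2 / (norm \<alpha>)\<^sup>2 * \<alpha> $ i)"]) (auto intro: cpoly.intros simp: reflection_def)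
next
  case (cpoly_add f g)
  then obtain p q where "cpoly p" "\<And>x. f x - f (reflection \<alpha> x) = of_real (\<alpha> \<bullet> x) * p x"
    "cpoly q" "\<And>x. g x - g (reflection \<alpha> x) = of_real (\<alpha> \<bullet> x) * q x" by blast
  then show ?case
    by (intro exI[of _ "\<lambda>x. p x + q x"]) (auto intro: cpoly.intros simp: distrib_left add_diff_add)
next
  case (cpoly_mult f g)
  then obtain p q where p: "cpoly p" "\<And>x. f x - f (reflection \<alpha> x) = of_real (\<alpha> \<bullet> x) * p x"
    and q: "cpoly q" "\<And>x. g x - g (reflection \<alpha> x) = of_real (\<alpha> \<bullet> x) * q x" by blast
  have "f x * g x - f (reflection \<alpha> x) * g (reflection \<alpha> x) =
      of_real (\<alpha> \<bullet> x) * (f x * q x + p x * g (reflection \<alpha> x))" for x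
  proof -
    have "f x * g x - f (reflection \<alpha> x) * g (reflection \<alpha> x) =
        f x * (g x - g (reflection \<alpha> x)) + (f x - f (reflection \<alpha> x)) * g (reflection \<alpha> x)"
      by (simp add: algebra_simps)
    then show ?thesis unfolding p(2) q(2) by (simp add: algebra_simps)
  qed
  moreover have "cpoly (\<lambda>x. f x * q x + p x * g (reflection \<alpha> x))"
    by (intro cpoly.cpoly_add cpoly.cpoly_mult cpoly_reflection p q cpoly_mult.hyps)
  ultimately show ?case by blast
qed

lemma reflection_quotient_mult:
  "of_real (\<alpha> \<bullet> x) * reflection_quotient \<alpha> f x = f x - f (reflection \<alpha> x)"
  by (auto simp: reflection_quotient_def reflection_perp)

text \<open>
  The quotient agrees with the polynomial from \<open>cpoly_reflection_difference\<close> also on the hyperplane: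
  there, differentiating \<open>f x - f (reflection \<alpha> x) = (\<alpha> \<bullet> x) q x\<close> in direction
  \<open>\<alpha>\<close> gives twice the derivative of \<open>f\<close> on the left and
  \<open>(norm \<alpha>)\<^sup>2 q x\<close> on the right.
\<close>

lemma cpoly_reflection_quotient:
  assumes f: "cpoly f" and \<alpha>: "\<alpha> \<noteq> 0"
  shows "cpoly (reflection_quotient \<alpha> f)"
proof -
  obtain q where q: "cpoly q" and eq: "\<And>x. f x - f (reflection \<alpha> x) = of_real (\<alpha> \<bullet> x) * q x"
    using cpoly_reflection_difference[OF f] by blast
  have "reflection_quotient \<alpha> f x = q x" for x
  proof (cases "\<alpha> \<bullet> x = 0")
    case False
    then show ?thesis by (simp add: reflection_quotient_def eq)
  next
    case True
    obtain f' where f': "\<And>x. (f has_derivative f' x) (at x)"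
      using cpoly_has_derivative[OF f] by blast
    have lin: "linear (f' x)" by (rule has_derivative_linear[OF f'])
    have "(reflection \<alpha> has_derivative reflection \<alpha>) (at x)"
      by (simp add: linear_imp_has_derivative linear_reflection)
    from has_derivative_compose[OF this, of f] f'[of "reflection \<alpha> x"]
    have "((\<lambda>y. f (reflection \<alpha> y)) has_derivative (\<lambda>h. f' x (reflection \<alpha> h))) (at x)"
      using reflection_perp[OF True] by simp
    from has_derivative_diff[OF f' this]
    have "directional_derivative \<alpha> (\<lambda>y. f y - f (reflection \<alpha> y)) x = f' x \<alpha> - f' x (reflection \<alpha> \<alpha>)"
      by (rule directional_derivative_eq)
    also have "\<dots> = 2 * f' x \<alpha>"
      using lin by (simp add: reflection_self[OF \<alpha>] linear_neg)
    finally have 1: "directional_derivative \<alpha> (\<lambda>y. of_real (\<alpha> \<bullet> y) * q y) x = 2 * directional_derivative \<alpha> f x"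
      unfolding eq using directional_derivative_eq[OF f'] by simp
    have "((\<lambda>y. complex_of_real (\<alpha> \<bullet> y)) has_derivative (\<lambda>h. of_real (\<alpha> \<bullet> h))) (at x)"
      by (intro has_derivative_of_real has_derivative_inner_right has_derivative_ident)
    then have "directional_derivative \<alpha> (\<lambda>y. of_real (\<alpha> \<bullet> y)) x = complex_of_real (\<alpha> \<bullet> \<alpha>)"
      by (rule directional_derivative_eq)
    then have "directional_derivative \<alpha> (\<lambda>y. of_real (\<alpha> \<bullet> y) * q y) x = of_real (\<alpha> \<bullet> \<alpha>) * q x"
      using True by (subst directional_derivative_mult) (auto intro: cpoly_differentiable cpoly_inner q)
    with 1 have "2 * directional_derivative \<alpha> f x = of_real ((norm \<alpha>)\<^sup>2) * q x"
      by (simp add: power2_norm_eq_inner)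
    then show ?thesis using True \<alpha> by (simp add: reflection_quotient_def field_simps)
  qed
  then have "reflection_quotient \<alpha> f = q" by auto
  then show ?thesis using q by simp
qed

lemma reflection_quotient_add:
  assumes "f differentiable (at x)" "g differentiable (at x)"
  shows "reflection_quotient \<alpha> (\<lambda>y. f y + g y) x = reflection_quotient \<alpha> f x + reflection_quotient \<alpha> g x"
  by (simp add: reflection_quotient_def directional_derivative_add[OF assms] algebra_simps add_divide_distrib diff_divide_distrib)

lemma directional_derivative_cmult:
  assumes "f differentiable (at x)"
  shows "directional_derivative \<xi> (\<lambda>y. c * f y) x = c * directional_derivative \<xi> f x"
  using directional_derivative_mult[of "\<lambda>_. c", OF _ assms] by simp

lemma reflection_quotient_cmult:
  assumes "f differentiable (at x)"
  shows "reflection_quotient \<alpha> (\<lambda>y. c * f y) x = c * reflection_quotient \<alpha> f x"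
  by (simp add: reflection_quotient_def directional_derivative_cmult[OF assms] algebra_simps diff_divide_distrib)

lemma dunkl_operator_add:
  assumes "f differentiable (at x)" "g differentiable (at x)"
  shows "dunkl_operator P k \<xi> (\<lambda>y. f y + g y) x = dunkl_operator P k \<xi> f x + dunkl_operator P k \<xi> g x"
  by (simp add: dunkl_operator_def directional_derivative_add[OF assms] reflection_quotient_add[OF assms]
      algebra_simps sum.distrib)

lemma dunkl_operator_cmult:
  assumes "f differentiable (at x)"
  shows "dunkl_operator P k \<xi> (\<lambda>y. c * f y) x = c * dunkl_operator P k \<xi> f x"
  by (simp add: dunkl_operator_def directional_derivative_cmult[OF assms] reflection_quotient_cmult[OF assms]
      algebra_simps sum_distrib_left)

text \<open>
  A Dunkl operator is not local, but it depends only on the values near the orbit of the point.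
\<close>

lemma dunkl_operator_cong:
  assumes "open U" "x \<in> U" "\<And>y. y \<in> U \<Longrightarrow> f y = g y" "\<And>\<alpha>. \<alpha> \<in> P \<Longrightarrow> reflection \<alpha> x \<in> U"
    and "g differentiable (at x)"
  shows "dunkl_operator P k \<xi> f x = dunkl_operator P k \<xi> g x"
proof -
  obtain g' where g': "(g has_derivative g') (at x)" using assms(5) by (auto simp: differentiable_def)
  then have f': "(f has_derivative g') (at x)"
    by (rule has_derivative_transform_within_open[OF _ assms(1,2)]) (use assms(3) in auto)
  have "directional_derivative \<eta> f x = directional_derivative \<eta> g x" for \<eta>
    using f' g' by (simp add: directional_derivative_eq)
  then show ?thesis
    using assms(2-4) unfolding dunkl_operator_def reflection_quotient_def
    by (intro arg_cong2[of _ _ _ _ "(+)"] sum.cong refl) auto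
qed

lemma directional_derivative_radial:
  assumes g: "(g has_real_derivative g1) (at (x \<bullet> x))"
  shows "directional_derivative \<xi> (\<lambda>y. of_real (g (y \<bullet> y))) x = of_real (2 * (x \<bullet> \<xi>) * g1)"
    and "(\<lambda>y. complex_of_real (g (y \<bullet> y))) differentiable (at x)"
proof -
  have "((\<lambda>y. y \<bullet> y) has_derivative (\<lambda>h. 2 * (x \<bullet> h))) (at x)"
    by (auto intro!: derivative_eq_intros simp: inner_commute)
  from has_derivative_compose[OF this g[unfolded has_field_derivative_def]]
  have "((\<lambda>y. g (y \<bullet> y)) has_derivative (\<lambda>h. g1 * (2 * (x \<bullet> h)))) (at x)" .
  then have d: "((\<lambda>y. complex_of_real (g (y \<bullet> y))) has_derivative (\<lambda>h. of_real (g1 * (2 * (x \<bullet> h))))) (at x)"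
    by (rule has_derivative_of_real)
  show "directional_derivative \<xi> (\<lambda>y. of_real (g (y \<bullet> y))) x = of_real (2 * (x \<bullet> \<xi>) * g1)"
    by (simp add: directional_derivative_eq[OF d] mult.commute mult.left_commute)
  show "(\<lambda>y. complex_of_real (g (y \<bullet> y))) differentiable (at x)" using d by (auto simp: differentiable_def)
qed

text \<open>
  Radial functions are invariant under reflections, so the difference part of a Dunkl operator does not see them
  and the Leibniz rule holds.
\<close>

lemma dunkl_operator_radial_mult:
  assumes g: "(g has_real_derivative g1) (at (x \<bullet> x))" and f: "f differentiable (at x)"
  shows "dunkl_operator P k \<xi> (\<lambda>y. of_real (g (y \<bullet> y)) * f y) x =
    of_real (2 * (x \<bullet> \<xi>) * g1) * f x + of_real (g (x \<bullet> x)) * dunkl_operator P k \<xi> f x"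
proof -
  note d = directional_derivative_radial[OF g]
  have dd: "directional_derivative \<eta> (\<lambda>y. of_real (g (y \<bullet> y)) * f y) x =
      of_real (2 * (x \<bullet> \<eta>) * g1) * f x + of_real (g (x \<bullet> x)) * directional_derivative \<eta> f x" for \<eta>
    by (simp only: directional_derivative_mult[OF d(2) f] d(1) add.commute)
  have "reflection_quotient \<alpha> (\<lambda>y. of_real (g (y \<bullet> y)) * f y) x = of_real (g (x \<bullet> x)) * reflection_quotient \<alpha> f x" for \<alpha>
  proof (cases "\<alpha> \<bullet> x = 0")
    case True
    then show ?thesis unfolding reflection_quotient_def dd by (simp add: inner_commute algebra_simps)
  next
    case False
    then show ?thesis unfolding reflection_quotient_def by (simp add: algebra_simps diff_divide_distrib)
  qed
  then show ?thesis
    unfolding dunkl_operator_def dd by (simp add: algebra_simps sum_distrib_left)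
qed

text \<open>
  The reflection of a coordinate is not the coordinate itself; the correction to the Leibniz rule is the sum over
  the reflected values of \<open>f\<close>. These commutators produce the dimension and \<open>\<gamma>\<close> in
  \<open>Lap_radial\<close>.
\<close>

lemma dunkl_operator_coord_mult:
  assumes f: "f differentiable (at x)"
  shows "dunkl_operator P k \<xi> (\<lambda>y. of_real (y \<bullet> \<xi>) * f y) x =
    of_real (\<xi> \<bullet> \<xi>) * f x + of_real (x \<bullet> \<xi>) * dunkl_operator P k \<xi> f x
    + (\<Sum>\<alpha>\<in>P. of_real (k \<alpha> * (2 * (\<alpha> \<bullet> \<xi>)\<^sup>2 / (norm \<alpha>)\<^sup>2)) * f (reflection \<alpha> x))"
proof -
  have d: "((\<lambda>y. complex_of_real (y \<bullet> \<xi>)) has_derivative (\<lambda>h. of_real (h \<bullet> \<xi>))) (at x)"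
    by (intro has_derivative_of_real has_derivative_inner_left has_derivative_ident)
  then have d': "(\<lambda>y. complex_of_real (y \<bullet> \<xi>)) differentiable (at x)" by (auto simp: differentiable_def)
  have dd: "directional_derivative \<eta> (\<lambda>y. of_real (y \<bullet> \<xi>) * f y) x =
      of_real (x \<bullet> \<xi>) * directional_derivative \<eta> f x + of_real (\<eta> \<bullet> \<xi>) * f x" for \<eta>
    by (simp only: directional_derivative_mult[OF d' f] directional_derivative_eq[OF d])
  have rq: "reflection_quotient \<alpha> (\<lambda>y. of_real (y \<bullet> \<xi>) * f y) x =
      of_real (x \<bullet> \<xi>) * reflection_quotient \<alpha> f x + of_real (2 * (\<alpha> \<bullet> \<xi>) / (norm \<alpha>)\<^sup>2) * f (reflection \<alpha> x)" for \<alpha>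
  proof (cases "\<alpha> \<bullet> x = 0")
    case True
    then show ?thesis
      unfolding reflection_quotient_def dd
      by (simp add: reflection_perp algebra_simps add_divide_distrib)
  next
    case False
    have e: "complex_of_real (reflection \<alpha> x \<bullet> \<xi>) =
        of_real (x \<bullet> \<xi>) - of_real (\<alpha> \<bullet> x) * of_real (2 * (\<alpha> \<bullet> \<xi>) / (norm \<alpha>)\<^sup>2)"
      by (simp add: reflection_def inner_diff_left)
    have "of_real (x \<bullet> \<xi>) * f x - of_real (reflection \<alpha> x \<bullet> \<xi>) * f (reflection \<alpha> x) =
        of_real (x \<bullet> \<xi>) * (f x - f (reflection \<alpha> x))
        + of_real (\<alpha> \<bullet> x) * (of_real (2 * (\<alpha> \<bullet> \<xi>) / (norm \<alpha>)\<^sup>2) * f (reflection \<alpha> x))"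
      unfolding e by (simp only: ring_distribs) (simp add: mult.assoc)
    then show ?thesis using False
      by (simp add: reflection_quotient_def add_divide_distrib)
  qed
  show ?thesis
    unfolding dunkl_operator_def dd rq
    by (simp add: algebra_simps sum.distrib sum_distrib_left power2_eq_square)
qed

lemma cpoly_dunkl_operator:
  assumes "cpoly f" "0 \<notin> P"
  shows "cpoly (dunkl_operator P k \<xi> f)"
proof -
  have "cpoly (\<lambda>x. \<Sum>\<alpha>\<in>P. of_real (k \<alpha> * (\<alpha> \<bullet> \<xi>)) * reflection_quotient \<alpha> f x)"
    using assms by (intro cpoly_sum cpoly_cmult cpoly_reflection_quotient) auto
  then show ?thesis unfolding dunkl_operator_def[abs_def]
    by (intro cpoly_add cpoly_directional_derivative assms(1))
qed

lemma cpoly_dunkl_laplacian: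
  assumes "cpoly f" "0 \<notin> P"
  shows "cpoly (dunkl_laplacian P k f)"
  unfolding dunkl_laplacian_def[abs_def] by (intro cpoly_sum cpoly_dunkl_operator assms)

section \<open>The Dunkl Laplacian of a radial multiple of a polynomial\<close>

lemma sum_linear_3:
  fixes c d :: "'b::comm_ring"
  shows "(\<Sum>i\<in>I. A i + c * B i + d * C i) = sum A I + c * sum B I + d * sum C I"
  by (simp add: sum.distrib sum_distrib_left)

locale dunkl_setting =
  fixes R P :: "(real ^ 'n) set" and k :: "real ^ 'n \<Rightarrow> real"
  assumes root: "root_system R"
    and pos: "positive_subsystem R P"
    and invariant: "multiplicity_function R k"
    and nonneg: "\<And>\<alpha>. \<alpha> \<in> R \<Longrightarrow> 0 \<le> k \<alpha>"
begin

abbreviation T :: "real ^ 'n \<Rightarrow> (real ^ 'n \<Rightarrow> complex) \<Rightarrow> real ^ 'n \<Rightarrow> complex" where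
  "T \<equiv> dunkl_operator P k"

abbreviation Lap :: "(real ^ 'n \<Rightarrow> complex) \<Rightarrow> real ^ 'n \<Rightarrow> complex" where
  "Lap \<equiv> dunkl_laplacian P k"

abbreviation \<gamma> :: real where
  "\<gamma> \<equiv> multiplicity_sum P k"

lemma finite_R: "finite R" and zero_notin_R: "0 \<notin> R"
  using root by (auto simp: root_system_def)

lemma P_subset: "P \<subseteq> R"
  using pos by (auto simp: positive_subsystem_def)

lemma finite_P: "finite P" and zero_notin_P: "0 \<notin> P"
  using P_subset finite_R zero_notin_R finite_subset by auto

lemma reflection_R: "\<alpha> \<in> R \<Longrightarrow> \<beta> \<in> R \<Longrightarrow> reflection \<alpha> \<beta> \<in> R"
  using root by (auto simp: root_system_def)

lemma uminus_R: "\<alpha> \<in> R \<Longrightarrow> - \<alpha> \<in> R"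
  using reflection_R[of \<alpha> \<alpha>] reflection_self[of \<alpha>] zero_notin_R by (cases "\<alpha> = 0") auto

lemma k_reflection: "\<alpha> \<in> R \<Longrightarrow> \<beta> \<in> R \<Longrightarrow> k (reflection \<alpha> \<beta>) = k \<beta>"
  using invariant coxeter_group.comp[OF coxeter_group.id, of \<alpha> R] unfolding multiplicity_function_def by fastforce

lemma k_uminus: "\<alpha> \<in> R \<Longrightarrow> k (- \<alpha>) = k \<alpha>"
  using k_reflection[of \<alpha> \<alpha>] reflection_self[of \<alpha>] zero_notin_R by (cases "\<alpha> = 0") auto

lemma sum_R:
  fixes f :: "real ^ 'n \<Rightarrow> 'b::comm_monoid_add"
  shows "(\<Sum>\<alpha>\<in>R. f \<alpha>) = (\<Sum>\<alpha>\<in>P. f \<alpha> + f (- \<alpha>))"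
proof -
  obtain \<beta> where b: "\<And>\<alpha>. \<alpha> \<in> R \<Longrightarrow> \<alpha> \<bullet> \<beta> \<noteq> 0" and P: "P = {\<alpha>\<in>R. \<alpha> \<bullet> \<beta> > 0}"
    using pos by (auto simp: positive_subsystem_def)
  have "\<alpha> \<in> uminus ` P" if "\<alpha> \<in> R" "\<alpha> \<notin> P" for \<alpha>
  proof -
    have "- \<alpha> \<in> P" using that b[of \<alpha>] uminus_R[of \<alpha>] by (auto simp: P)
    then show ?thesis by force
  qed
  then have R: "R = P \<union> uminus ` P" using P_subset uminus_R by auto
  have "P \<inter> uminus ` P = {}" by (auto simp: P)
  then have "(\<Sum>\<alpha>\<in>R. f \<alpha>) = (\<Sum>\<alpha>\<in>P. f \<alpha>) + (\<Sum>\<alpha>\<in>uminus ` P. f \<alpha>)"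
    unfolding R using finite_P by (subst sum.union_disjoint) auto
  also have "(\<Sum>\<alpha>\<in>uminus ` P. f \<alpha>) = (\<Sum>\<alpha>\<in>P. f (- \<alpha>))"
    by (subst sum.reindex) (auto simp: inj_on_def)
  finally show ?thesis by (simp add: sum.distrib)
qed

lemma gamma_R: "(\<Sum>\<alpha>\<in>R. k \<alpha>) = 2 * \<gamma>"
proof -
  have "(\<Sum>\<alpha>\<in>R. k \<alpha>) = (\<Sum>\<alpha>\<in>P. 2 * k \<alpha>)"
    unfolding sum_R using P_subset k_uminus by (intro sum.cong) auto
  then show ?thesis by (simp add: multiplicity_sum_def sum_distrib_left)
qed

lemma gamma_nonneg: "0 \<le> \<gamma>"
  unfolding multiplicity_sum_def using P_subset nonneg by (intro sum_nonneg) auto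

lemma cpoly_T: "cpoly f \<Longrightarrow> cpoly (T \<xi> f)"
  by (rule cpoly_dunkl_operator) (auto simp: zero_notin_P)

lemma cpoly_Lap: "cpoly f \<Longrightarrow> cpoly (Lap f)"
  by (rule cpoly_dunkl_laplacian) (auto simp: zero_notin_P)

lemma T_lin: "f differentiable (at x) \<Longrightarrow> g differentiable (at x) \<Longrightarrow>
    T \<xi> (\<lambda>y. c * f y + g y) x = c * T \<xi> f x + T \<xi> g x"
  by (simp add: dunkl_operator_add dunkl_operator_cmult)

lemma cpoly_T_lin:
  assumes "cpoly f" "cpoly g"
  shows "T \<xi> (\<lambda>y. c * f y + g y) = (\<lambda>x. c * T \<xi> f x + T \<xi> g x)"
  using assms by (auto simp: T_lin cpoly_differentiable)

lemma cpoly_Lap_lin: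
  assumes "cpoly f" "cpoly g"
  shows "Lap (\<lambda>y. c * f y + g y) = (\<lambda>x. c * Lap f x + Lap g x)"
  unfolding dunkl_laplacian_def
  by (simp add: cpoly_T_lin cpoly_T assms sum.distrib sum_distrib_left)

text \<open>
  The Dunkl analogue of the Euler operator.
\<close>

lemma sum_coord_T:
  assumes "f differentiable (at x)"
  shows "(\<Sum>\<xi>\<in>Basis. of_real (x \<bullet> \<xi>) * T \<xi> f x) =
    directional_derivative x f x + (\<Sum>\<alpha>\<in>P. of_real (k \<alpha>) * (f x - f (reflection \<alpha> x)))"
proof -
  have "(\<Sum>\<xi>\<in>Basis. of_real (x \<bullet> \<xi>) * (\<Sum>\<alpha>\<in>P. of_real (k \<alpha> * (\<alpha> \<bullet> \<xi>)) * reflection_quotient \<alpha> f x)) =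
      (\<Sum>\<alpha>\<in>P. \<Sum>\<xi>\<in>Basis. of_real (k \<alpha>) * (of_real ((\<alpha> \<bullet> \<xi>) * (x \<bullet> \<xi>)) * reflection_quotient \<alpha> f x))"
    by (subst sum.swap) (simp add: sum_distrib_left algebra_simps)
  also have "\<dots> = (\<Sum>\<alpha>\<in>P. of_real (k \<alpha>) * (of_real (\<Sum>\<xi>\<in>Basis. (\<alpha> \<bullet> \<xi>) * (x \<bullet> \<xi>)) * reflection_quotient \<alpha> f x))"
    by (simp add: sum_distrib_left sum_distrib_right)
  also have "\<dots> = (\<Sum>\<alpha>\<in>P. of_real (k \<alpha>) * (f x - f (reflection \<alpha> x)))"
    by (simp only: euclidean_inner[symmetric] reflection_quotient_mult)
  finally show ?thesis
    using directional_derivative_expand[OF assms, of x]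
    by (simp add: dunkl_operator_def distrib_left sum.distrib)
qed

lemma sum_T_coord:
  assumes "f differentiable (at x)"
  shows "(\<Sum>\<xi>\<in>Basis. T \<xi> (\<lambda>y. of_real (y \<bullet> \<xi>) * f y) x) =
    of_nat CARD('n) * f x + (\<Sum>\<xi>\<in>Basis. of_real (x \<bullet> \<xi>) * T \<xi> f x)
    + (\<Sum>\<alpha>\<in>P. of_real (2 * k \<alpha>) * f (reflection \<alpha> x))"
proof -
  have "(\<Sum>\<xi>\<in>Basis. \<Sum>\<alpha>\<in>P. of_real (k \<alpha> * (2 * (\<alpha> \<bullet> \<xi>)\<^sup>2 / (norm \<alpha>)\<^sup>2)) * f (reflection \<alpha> x)) =
      (\<Sum>\<alpha>\<in>P. of_real (2 * k \<alpha> / (norm \<alpha>)\<^sup>2 * (\<Sum>\<xi>\<in>Basis. (\<alpha> \<bullet> \<xi>) * (\<alpha> \<bullet> \<xi>))) * f (reflection \<alpha> x))"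
    by (subst sum.swap)
       (simp add: sum_distrib_left sum_distrib_right sum_divide_distrib power2_eq_square algebra_simps)
  also have "\<dots> = (\<Sum>\<alpha>\<in>P. of_real (2 * k \<alpha>) * f (reflection \<alpha> x))"
    unfolding euclidean_inner[symmetric] using zero_notin_P
    by (intro sum.cong) (auto simp: power2_norm_eq_inner)
  finally show ?thesis
    by (simp add: dunkl_operator_coord_mult[OF assms] sum.distrib inner_same_Basis)
qed

lemma Euler:
  assumes "homogeneous_polynomial m f"
  shows "directional_derivative x f x = of_nat m * f x"
proof -
  have "f (x + t *\<^sub>R x) = of_real ((1 + t) ^ m) * f x" for t
    using assms unfolding homogeneous_polynomial_iff by (metis scaleR_add_left scaleR_one)
  then have eq: "(\<lambda>t. f (x + t *\<^sub>R x)) = (\<lambda>t. of_real ((1 + t) ^ m) * f x)" by auto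
  have "((\<lambda>t. complex_of_real ((1 + t) ^ m)) has_vector_derivative of_real (of_nat m)) (at 0)"
    by (rule has_vector_derivative_of_real) (auto intro!: derivative_eq_intros)
  then have "((\<lambda>t. complex_of_real ((1 + t) ^ m) * f x) has_vector_derivative of_real (of_nat m) * f x) (at 0)"
    by (rule has_vector_derivative_mult_left)
  then show ?thesis unfolding directional_derivative_def eq
    by (subst vector_derivative_at) auto
qed

text \<open>
  The Leibniz rule for radial factors, applied twice. After the first application the factor
  \<open>y \<bullet> \<xi>\<close> is moved onto \<open>f\<close>, so that the second application again meets only
  a radial factor.
\<close>

lemma T_radial_twice:
  assumes S: "open S" "x \<bullet> x \<in> S"
    and g: "\<And>s. s \<in> S \<Longrightarrow> (g has_real_derivative g1 s) (at s)"
    and g1: "\<And>s. s \<in> S \<Longrightarrow> (g1 has_real_derivative g2 s) (at s)"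
    and f: "cpoly f"
  shows "T \<xi> (\<lambda>y. of_real (g (y \<bullet> y)) * f y) differentiable (at x)"
    and "T \<xi> (T \<xi> (\<lambda>y. of_real (g (y \<bullet> y)) * f y)) x =
      of_real (4 * (x \<bullet> \<xi>)\<^sup>2 * g2 (x \<bullet> x)) * f x
      + of_real (2 * g1 (x \<bullet> x)) * (T \<xi> (\<lambda>y. of_real (y \<bullet> \<xi>) * f y) x + of_real (x \<bullet> \<xi>) * T \<xi> f x)
      + of_real (g (x \<bullet> x)) * T \<xi> (T \<xi> f) x"
proof -
  let ?U = "{y :: real ^ 'n. y \<bullet> y \<in> S}"
  let ?A = "\<lambda>y. of_real (g1 (y \<bullet> y)) * (2 * (of_real (y \<bullet> \<xi>) * f y))"
  let ?B = "\<lambda>y. of_real (g (y \<bullet> y)) * T \<xi> f y"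
  have U: "open ?U"
    using open_vimage[OF S(1), of "\<lambda>y :: real ^ 'n. y \<bullet> y"]
    by (simp add: vimage_def continuous_intros)
  have xf: "cpoly (\<lambda>y. of_real (y \<bullet> \<xi>) * f y)" by (intro cpoly_mult cpoly_inner' f)
  have xf2: "cpoly (\<lambda>y. 2 * (of_real (y \<bullet> \<xi>) * f y))" by (intro cpoly_cmult xf)
  have eq: "T \<xi> (\<lambda>y. of_real (g (y \<bullet> y)) * f y) y = ?A y + ?B y" if "y \<in> ?U" for y
    using dunkl_operator_radial_mult[OF g cpoly_differentiable[OF f], of y P k \<xi>] that by simp
  have dA: "?A differentiable (at x)"
    by (rule differentiable_mult[OF directional_derivative_radial(2)[OF g1[OF S(2)]] cpoly_differentiable[OF xf2]])
  have dB: "?B differentiable (at x)"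
    by (rule differentiable_mult[OF directional_derivative_radial(2)[OF g[OF S(2)]] cpoly_differentiable[OF cpoly_T[OF f]]])
  have dAB: "(\<lambda>y. ?A y + ?B y) differentiable (at x)" by (rule differentiable_add[OF dA dB])
  then show "T \<xi> (\<lambda>y. of_real (g (y \<bullet> y)) * f y) differentiable (at x)"
    using has_derivative_transform_within_open[OF _ U, of _ _ x UNIV] eq S(2)
    unfolding differentiable_def by (metis (mono_tags, lifting) mem_Collect_eq)
  have "T \<xi> (T \<xi> (\<lambda>y. of_real (g (y \<bullet> y)) * f y)) x = T \<xi> (\<lambda>y. ?A y + ?B y) x"
    using S(2) by (intro dunkl_operator_cong[OF U _ eq _ dAB]) auto
  also have "\<dots> = T \<xi> ?A x + T \<xi> ?B x" by (rule dunkl_operator_add[OF dA dB])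
  also have "T \<xi> ?A x = of_real (2 * (x \<bullet> \<xi>) * g2 (x \<bullet> x)) * (2 * (of_real (x \<bullet> \<xi>) * f x))
      + of_real (g1 (x \<bullet> x)) * (2 * T \<xi> (\<lambda>y. of_real (y \<bullet> \<xi>) * f y) x)"
    by (simp only: dunkl_operator_radial_mult[OF g1[OF S(2)] cpoly_differentiable[OF xf2]]
        dunkl_operator_cmult[OF cpoly_differentiable[OF xf]])
  also have "T \<xi> ?B x = of_real (2 * (x \<bullet> \<xi>) * g1 (x \<bullet> x)) * T \<xi> f x + of_real (g (x \<bullet> x)) * T \<xi> (T \<xi> f) x"
    by (rule dunkl_operator_radial_mult[OF g[OF S(2)] cpoly_differentiable[OF cpoly_T[OF f]]])
  finally show "T \<xi> (T \<xi> (\<lambda>y. of_real (g (y \<bullet> y)) * f y)) x =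
      of_real (4 * (x \<bullet> \<xi>)\<^sup>2 * g2 (x \<bullet> x)) * f x
      + of_real (2 * g1 (x \<bullet> x)) * (T \<xi> (\<lambda>y. of_real (y \<bullet> \<xi>) * f y) x + of_real (x \<bullet> \<xi>) * T \<xi> f x)
      + of_real (g (x \<bullet> x)) * T \<xi> (T \<xi> f) x"
    by (simp add: power2_eq_square algebra_simps)
qed

text \<open>
  Summing \<open>T_radial_twice\<close> over the basis, the terms
  \<open>T\<^sub>\<xi> (x\<^sub>\<xi> f) + x\<^sub>\<xi> T\<^sub>\<xi> f\<close> add up to
  \<open>(N + 2 \<gamma> + 2 m) f\<close>: the reflected values from the two sums cancel, and Euler's identity
  evaluates the rest. So \<open>N + 2 \<gamma>\<close> takes the place of the dimension.
\<close>

lemma Lap_radial: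
  assumes S: "open S" "x \<bullet> x \<in> S"
    and g: "\<And>s. s \<in> S \<Longrightarrow> (g has_real_derivative g1 s) (at s)"
    and g1: "\<And>s. s \<in> S \<Longrightarrow> (g1 has_real_derivative g2 s) (at s)"
    and f: "homogeneous_polynomial m f"
  shows "Lap (\<lambda>y. of_real (g (y \<bullet> y)) * f y) x =
      of_real (4 * (x \<bullet> x) * g2 (x \<bullet> x) + (2 * CARD('n) + 4 * \<gamma> + 4 * m) * g1 (x \<bullet> x)) * f x
      + of_real (g (x \<bullet> x)) * Lap f x"
proof -
  have cf: "cpoly f" using f by (simp add: homogeneous_polynomial_iff)
  have df: "f differentiable (at x)" by (rule cpoly_differentiable[OF cf])
  have 1: "(\<Sum>\<xi>\<in>Basis. complex_of_real (4 * (x \<bullet> \<xi>)\<^sup>2 * g2 (x \<bullet> x)) * f x) = of_real (4 * (x \<bullet> x) * g2 (x \<bullet> x)) * f x"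
    unfolding euclidean_inner[of x x] by (simp add: sum_distrib_left sum_distrib_right power2_eq_square)
  have 2: "(\<Sum>\<xi>\<in>Basis. T \<xi> (\<lambda>y. of_real (y \<bullet> \<xi>) * f y) x + of_real (x \<bullet> \<xi>) * T \<xi> f x) =
      of_real (CARD('n) + 2 * \<gamma> + 2 * m) * f x"
    unfolding sum.distrib sum_T_coord[OF df] sum_coord_T[OF df] Euler[OF f]
    by (simp add: multiplicity_sum_def sum_subtractf right_diff_distrib sum_distrib_left[symmetric]
        sum_distrib_right[symmetric] algebra_simps)
  have "Lap (\<lambda>y. of_real (g (y \<bullet> y)) * f y) x = (\<Sum>\<xi>\<in>Basis.
      of_real (4 * (x \<bullet> \<xi>)\<^sup>2 * g2 (x \<bullet> x)) * f x
      + of_real (2 * g1 (x \<bullet> x)) * (T \<xi> (\<lambda>y. of_real (y \<bullet> \<xi>) * f y) x + of_real (x \<bullet> \<xi>) * T \<xi> f x)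
      + of_real (g (x \<bullet> x)) * T \<xi> (T \<xi> f) x)"
    unfolding dunkl_laplacian_def
    by (intro sum.cong refl T_radial_twice(2)[where S = S]) (use S g g1 cf in auto)
  also have "\<dots> = of_real (4 * (x \<bullet> x) * g2 (x \<bullet> x)) * f x
      + of_real (2 * g1 (x \<bullet> x)) * (of_real (CARD('n) + 2 * \<gamma> + 2 * m) * f x)
      + of_real (g (x \<bullet> x)) * Lap f x"
    unfolding sum_linear_3 1 2 dunkl_laplacian_def ..
  finally show ?thesis by (simp add: algebra_simps)
qed

end

section \<open>The Fischer decomposition\<close>

text \<open>
  Homogeneity for nonzero factors extends to the factor zero by continuity along a ray.
\<close>

lemma homogeneous_extend:
  assumes q: "cpoly q" and h: "\<And>(t::real) x. t \<noteq> 0 \<Longrightarrow> q (t *\<^sub>R x) = of_real (t ^ m) * q x"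
  shows "homogeneous_polynomial m q"
  unfolding homogeneous_polynomial_iff
proof (intro conjI allI q)
  fix t :: real and x
  show "q (t *\<^sub>R x) = of_real (t ^ m) * q x"
  proof (cases "t = 0")
    case True
    have "isCont q (0 *\<^sub>R x)" using cpoly_continuous[OF q, of UNIV] by (simp add: continuous_on_eq_continuous_at)
    then have a: "((\<lambda>s. q (s *\<^sub>R x)) \<longlongrightarrow> q (0 *\<^sub>R x)) (at 0)"
      by (intro isCont_tendsto_compose[of _ q] tendsto_intros)
    have b: "((\<lambda>s. of_real (s ^ m) * q x) \<longlongrightarrow> of_real (0 ^ m) * q x) (at (0::real))"
      by (intro tendsto_intros)
    have ev: "\<forall>\<^sub>F s in at 0. of_real (s ^ m) * q x = q (s *\<^sub>R x)"
      by (auto simp: eventually_at_filter h)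
    have "q (0 *\<^sub>R x) = of_real (0 ^ m) * q x"
      by (rule tendsto_unique[OF _ a Lim_transform_eventually[OF b ev]]) simp
    then show ?thesis using True by simp
  qed (rule h)
qed

lemma homogeneous_add:
  "homogeneous_polynomial m f \<Longrightarrow> homogeneous_polynomial m g \<Longrightarrow> homogeneous_polynomial m (\<lambda>x. f x + g x)"
  unfolding homogeneous_polynomial_iff by (auto intro: cpoly_add simp: distrib_left)

lemma homogeneous_mult:
  "homogeneous_polynomial m f \<Longrightarrow> homogeneous_polynomial n g \<Longrightarrow> homogeneous_polynomial (m + n) (\<lambda>x. f x * g x)"
  unfolding homogeneous_polynomial_iff by (auto intro: cpoly_mult simp: power_add)

lemma homogeneous_cmult:
  "homogeneous_polynomial m f \<Longrightarrow> homogeneous_polynomial m (\<lambda>x. c * f x)"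
  unfolding homogeneous_polynomial_iff by (auto intro: cpoly_cmult)

lemma homogeneous_zero: "homogeneous_polynomial m (\<lambda>x. 0)"
  unfolding homogeneous_polynomial_iff by (auto intro: cpoly_const)

lemma homogeneous_sum:
  "(\<And>i. i \<in> I \<Longrightarrow> homogeneous_polynomial m (f i)) \<Longrightarrow> homogeneous_polynomial m (\<lambda>x. \<Sum>i\<in>I. f i x)"
  by (induction I rule: infinite_finite_induct) (auto intro: homogeneous_add homogeneous_zero)

lemma homogeneous_norm_power: "homogeneous_polynomial (2 * j) (\<lambda>x. of_real ((x \<bullet> x) ^ j))"
  unfolding homogeneous_polynomial_iff of_real_power
  by (auto intro: cpoly_power cpoly_norm_square simp: power_mult_distrib power_mult power2_eq_square)

lemma homogeneous_const: "homogeneous_polynomial 0 f \<Longrightarrow> f = (\<lambda>x. f 0)"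
  unfolding homogeneous_polynomial_iff by (metis mult_1 of_real_1 power_0 scaleR_zero_left)

lemma homogeneous_directional_derivative:
  assumes f: "homogeneous_polynomial (Suc m) f" and t: "t \<noteq> 0"
  shows "directional_derivative \<xi> f (t *\<^sub>R x) = of_real (t ^ m) * directional_derivative \<xi> f x"
proof -
  have "cpoly f" using f by (simp add: homogeneous_polynomial_iff)
  then obtain f' where f': "\<And>x. (f has_derivative f' x) (at x)"
    using cpoly_has_derivative by blast
  have "((\<lambda>y. t *\<^sub>R y) has_derivative (\<lambda>h. t *\<^sub>R h)) (at x)" by (auto intro!: derivative_eq_intros)
  from has_derivative_compose[OF this f']
  have "directional_derivative \<xi> (\<lambda>y. f (t *\<^sub>R y)) x = f' (t *\<^sub>R x) (t *\<^sub>R \<xi>)" by (rule directional_derivative_eq)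
  also have "\<dots> = t *\<^sub>R f' (t *\<^sub>R x) \<xi>"
    using has_derivative_linear[OF f'] by (rule linear_scale)
  finally have "t *\<^sub>R directional_derivative \<xi> f (t *\<^sub>R x) = directional_derivative \<xi> (\<lambda>y. f (t *\<^sub>R y)) x"
    by (simp add: directional_derivative_eq[OF f'])
  also have "(\<lambda>y. f (t *\<^sub>R y)) = (\<lambda>y. of_real (t ^ Suc m) * f y)"
    using f by (auto simp: homogeneous_polynomial_iff)
  also have "directional_derivative \<xi> (\<lambda>y. of_real (t ^ Suc m) * f y) x = of_real (t ^ Suc m) * directional_derivative \<xi> f x"
    using f by (intro directional_derivative_cmult cpoly_differentiable) (simp add: homogeneous_polynomial_iff)
  finally show ?thesis using t by (simp add: scaleR_conv_of_real)
qed

lemma homogeneous_reflection_quotient: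
  assumes f: "homogeneous_polynomial (Suc m) f" and t: "t \<noteq> 0"
  shows "reflection_quotient \<alpha> f (t *\<^sub>R x) = of_real (t ^ m) * reflection_quotient \<alpha> f x"
proof -
  have scale: "f (t *\<^sub>R y) = of_real (t ^ Suc m) * f y" for y
    using f unfolding homogeneous_polynomial_iff by blast
  have "f (reflection \<alpha> (t *\<^sub>R x)) = of_real (t ^ Suc m) * f (reflection \<alpha> x)"
    unfolding linear_scale[OF linear_reflection] by (rule scale)
  with scale[of x] show ?thesis
    using t homogeneous_directional_derivative[OF assms, of \<alpha> x]
    by (auto simp: reflection_quotient_def field_simps)
qed

fun monomial :: "'n list \<Rightarrow> real ^ 'n \<Rightarrow> complex" where
  "monomial [] x = 1"
| "monomial (i # xs) x = of_real (x $ i) * monomial xs x"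

lemma monomial_append: "monomial (xs @ ys) x = monomial xs x * monomial ys x"
  by (induction xs) auto

lemma homogeneous_monomial: "homogeneous_polynomial (length xs) (monomial xs)"
proof (induction xs)
  case Nil
  have "monomial [] = (\<lambda>x :: real ^ 'a. 1)" by auto
  then show ?case by (auto simp: homogeneous_polynomial_iff intro: cpoly_const)
next
  case (Cons i xs)
  have "homogeneous_polynomial 1 (\<lambda>x :: real ^ 'a. of_real (x $ i))"
    by (auto simp: homogeneous_polynomial_iff intro: cpoly_coord)
  from homogeneous_mult[OF this Cons]
  have "homogeneous_polynomial (length (i # xs)) (\<lambda>x. of_real (x $ i) * monomial xs x)" by simp
  moreover have "monomial (i # xs) = (\<lambda>x. of_real (x $ i) * monomial xs x)" by auto
  ultimately show ?case by simp
qed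

text \<open>
  The span of the monomials. Each of them is homogeneous and can therefore be decomposed into harmonics, and the
  lists of coordinates that index them are countable.
\<close>

inductive monomial_span :: "(real ^ 'n \<Rightarrow> complex) \<Rightarrow> bool" where
  monomial: "monomial_span (\<lambda>x. c * monomial xs x)"
| add: "monomial_span f \<Longrightarrow> monomial_span g \<Longrightarrow> monomial_span (\<lambda>x. f x + g x)"

lemma monomial_span_mult:
  assumes "monomial_span f" "monomial_span g"
  shows "monomial_span (\<lambda>x. f x * g x)"
  using assms(1)
proof (induction rule: monomial_span.induct)
  case (monomial c xs)
  show ?case using assms(2)
  proof (induction rule: monomial_span.induct)
    case (monomial d ys)
    have "(\<lambda>x. c * monomial xs x * (d * monomial ys x)) = (\<lambda>x. (c * d) * monomial (xs @ ys) x)"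
      by (auto simp: monomial_append)
    then show ?case by (simp only: monomial_span.monomial)
  next
    case (add f g)
    then show ?case by (simp only: distrib_left monomial_span.add)
  qed
next
  case (add f h)
  then show ?case by (simp only: distrib_right monomial_span.add)
qed

lemma cpoly_monomial_span:
  assumes "cpoly f"
  shows "monomial_span f"
  using assms
proof (induction rule: cpoly.induct)
  case (cpoly_const c)
  show ?case using monomial_span.monomial[of c "[]"] by simp
next
  case (cpoly_coord i)
  show ?case using monomial_span.monomial[of 1 "[i]"] by simp
qed (auto intro: monomial_span.add monomial_span_mult)

context dunkl_setting
begin

lemma homogeneous_T:
  assumes f: "homogeneous_polynomial (Suc m) f"
  shows "homogeneous_polynomial m (T \<xi> f)"
proof (rule homogeneous_extend)
  show "cpoly (T \<xi> f)" using f by (intro cpoly_T) (simp add: homogeneous_polynomial_iff)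
  fix t :: real and x :: "real ^ 'n" assume "t \<noteq> 0"
  then show "T \<xi> f (t *\<^sub>R x) = of_real (t ^ m) * T \<xi> f x"
    by (simp add: dunkl_operator_def homogeneous_directional_derivative[OF f]
        homogeneous_reflection_quotient[OF f] distrib_left sum_distrib_left mult.left_commute)
qed

lemma T_const: "T \<xi> (\<lambda>x. c) = (\<lambda>x. 0)"
proof
  fix x :: "real ^ 'n"
  have "reflection_quotient \<alpha> (\<lambda>x. c) x = 0" for \<alpha> by (auto simp: reflection_quotient_def)
  then show "T \<xi> (\<lambda>x. c) x = 0" by (simp add: dunkl_operator_def)
qed

lemma Lap_zero: "Lap (\<lambda>x. 0) = (\<lambda>x. 0)"
  by (simp add: dunkl_laplacian_def[abs_def] T_const)

lemma homogeneous_Lap: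
  assumes f: "homogeneous_polynomial m f"
  shows "homogeneous_polynomial (m - 2) (Lap f)" and "m < 2 \<Longrightarrow> Lap f = (\<lambda>x. 0)"
proof -
  have zero: "Lap f = (\<lambda>x. 0)" if "m < 2"
  proof -
    have "T \<eta> (T \<xi> f) x = 0" for \<eta> \<xi> x
    proof -
      have "\<exists>c. T \<xi> f = (\<lambda>x. c)"
      proof (cases m)
        case 0
        then show ?thesis using homogeneous_const[of f] f by (metis T_const)
      next
        case (Suc n)
        then have "m = Suc 0" using that by simp
        then show ?thesis using homogeneous_const[OF homogeneous_T[of 0 f \<xi>]] f by blast
      qed
      then show ?thesis by (auto simp: T_const)
    qed
    then show ?thesis by (auto simp: dunkl_laplacian_def)
  qed
  show "m < 2 \<Longrightarrow> Lap f = (\<lambda>x. 0)" by (rule zero)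
  show "homogeneous_polynomial (m - 2) (Lap f)"
  proof (cases "m < 2")
    case True
    then show ?thesis by (simp add: zero homogeneous_zero)
  next
    case False
    then obtain n where n: "m = Suc (Suc n)" by (metis add_2_eq_Suc le_Suc_ex not_less)
    then show ?thesis unfolding dunkl_laplacian_def[abs_def]
      using f by (auto intro!: homogeneous_sum homogeneous_T)
  qed
qed

lemma homogeneous_Lap_funpow:
  assumes f: "homogeneous_polynomial m f"
  shows "homogeneous_polynomial (m - 2 * n) ((Lap ^^ n) f)"
proof (induction n)
  case (Suc n)
  have "homogeneous_polynomial (m - 2 * n - 2) ((Lap ^^ Suc n) f)"
    using homogeneous_Lap(1)[OF Suc] by simp
  then show ?case by (simp add: diff_diff_left add.commute)
qed (use f in simp)

lemma Lap_funpow_eq_0: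
  assumes f: "homogeneous_polynomial m f" and "m < 2 * n"
  shows "(Lap ^^ n) f = (\<lambda>x. 0)"
proof (cases n)
  case (Suc j)
  then have "m - 2 * j < 2" using assms by simp
  then show ?thesis using homogeneous_Lap(2)[OF homogeneous_Lap_funpow[OF f]] Suc by simp
qed (use assms in simp)

lemma cpoly_Lap_funpow: "cpoly f \<Longrightarrow> cpoly ((Lap ^^ n) f)"
  by (induction n) (auto intro: cpoly_Lap)

lemma Lap_funpow_lin:
  assumes "cpoly f" "cpoly g"
  shows "(Lap ^^ n) (\<lambda>y. c * f y + g y) = (\<lambda>x. c * (Lap ^^ n) f x + (Lap ^^ n) g x)"
  by (induction n) (simp_all add: cpoly_Lap_lin cpoly_Lap_funpow assms)

lemma Lap_funpow_zero: "(Lap ^^ n) (\<lambda>x. 0) = (\<lambda>x. 0)"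
  by (induction n) (simp_all add: Lap_zero)

lemma Lap_funpow_cmult:
  assumes "cpoly f"
  shows "(Lap ^^ n) (\<lambda>y. c * f y) = (\<lambda>x. c * (Lap ^^ n) f x)"
  using Lap_funpow_lin[OF assms cpoly_const[of 0], of n c] by (simp add: Lap_funpow_zero)

text \<open>
  An instance of \<open>Lap_radial\<close>. The factor on the right is positive, which makes the Fischer
  decomposition possible.
\<close>

lemma Lap_norm_power_harmonic:
  assumes h: "h \<in> k_harmonics P k d"
  shows "Lap (\<lambda>y. of_real ((y \<bullet> y) ^ Suc i) * h y) =
    (\<lambda>x. of_real ((real i + 1) * (4 * real i + 2 * real CARD('n) + 4 * \<gamma> + 4 * real d)) * (of_real ((x \<bullet> x) ^ i) * h x))"
proof
  fix x :: "real ^ 'n"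
  have 1: "((\<lambda>s. s ^ Suc i) has_real_derivative (i + 1) * s ^ i) (at s)" for s :: real
    using DERIV_pow[of "Suc i" s] by (simp add: add.commute)
  have 2: "((\<lambda>s. (i + 1) * s ^ i) has_real_derivative (i + 1) * (i * s ^ (i - 1))) (at s)" for s :: real
    by (auto intro!: derivative_eq_intros)
  have 3: "x \<bullet> x * (real i * (x \<bullet> x) ^ (i - 1)) = real i * (x \<bullet> x) ^ i"
    by (cases i) auto
  have "Lap (\<lambda>y. of_real ((y \<bullet> y) ^ Suc i) * h y) x =
    of_real (4 * (x \<bullet> x) * ((i + 1) * (i * (x \<bullet> x) ^ (i - 1))) + (2 * CARD('n) + 4 * \<gamma> + 4 * d) * ((i + 1) * (x \<bullet> x) ^ i)) * h x"
    using h Lap_radial[OF open_UNIV _ 1 2, of x d h] by (simp add: k_harmonics_def)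
  also have "4 * (x \<bullet> x) * ((i + 1) * (i * (x \<bullet> x) ^ (i - 1))) = 4 * (i + 1) * (x \<bullet> x * (real i * (x \<bullet> x) ^ (i - 1)))"
    by simp
  finally show "Lap (\<lambda>y. of_real ((y \<bullet> y) ^ Suc i) * h y) x =
    of_real ((real i + 1) * (4 * real i + 2 * real CARD('n) + 4 * \<gamma> + 4 * real d)) * (of_real ((x \<bullet> x) ^ i) * h x)"
    unfolding 3 by (simp add: algebra_simps)
qed

lemma Lap_funpow_norm_power_harmonic:
  assumes h: "h \<in> k_harmonics P k d"
  shows "\<exists>c. c \<noteq> 0 \<and> (Lap ^^ n) (\<lambda>y. of_real ((y \<bullet> y) ^ n) * h y) = (\<lambda>x. c * h x)"
proof (induction n)
  case 0
  then show ?case by (intro exI[of _ 1]) simp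
next
  case (Suc n)
  then obtain c where c: "c \<noteq> 0" "(Lap ^^ n) (\<lambda>y. of_real ((y \<bullet> y) ^ n) * h y) = (\<lambda>x. c * h x)" by blast
  let ?r = "(real n + 1) * (4 * real n + 2 * real CARD('n) + 4 * \<gamma> + 4 * real d)"
  have "cpoly (\<lambda>y. of_real ((y \<bullet> y) ^ n) * h y)"
    using h homogeneous_norm_power[of n] by (intro cpoly_mult) (auto simp: k_harmonics_def homogeneous_polynomial_iff)
  then have eq: "(Lap ^^ Suc n) (\<lambda>y. of_real ((y \<bullet> y) ^ Suc n) * h y) = (\<lambda>x. of_real ?r * c * h x)"
    by (simp only: funpow_Suc_right o_apply Lap_norm_power_harmonic[OF h] Lap_funpow_cmult c mult.assoc)
  have "0 < ?r" using gamma_nonneg by (intro mult_pos_pos add_nonneg_pos add_pos_nonneg) auto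
  then have "complex_of_real ?r \<noteq> 0" by (metis less_irrefl of_real_eq_0_iff)
  then have "of_real ?r * c \<noteq> 0" using c(1) by (rule no_zero_divisors)
  then show ?case using eq by blast
qed

text \<open>
  If \<open>\<Delta>\<^bsup>n + 1\<^esup> f = 0\<close> then \<open>Q = \<Delta>\<^sup>n f\<close> is harmonic,
  and \<open>\<Delta>\<^sup>n\<close> maps \<open>|x|\<^bsup>2 n\<^esup> Q\<close> to a nonzero multiple
  \<open>c Q\<close>. Subtracting \<open>|x|\<^bsup>2 n\<^esup> Q / c\<close> from \<open>f\<close> reduces
  \<open>n\<close>.
\<close>

lemma Fischer_aux:
  assumes "homogeneous_polynomial m f" "(Lap ^^ n) f = (\<lambda>x. 0)"
  shows "\<exists>h d. (\<forall>j. h j \<in> k_harmonics P k (d j)) \<and> f = (\<lambda>x. \<Sum>j<n. of_real ((x \<bullet> x) ^ j) * h j x)"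
  using assms
proof (induction n arbitrary: f)
  case 0
  have "(\<lambda>x. 0) \<in> k_harmonics P k 0"
    using homogeneous_zero Lap_zero by (auto simp: k_harmonics_def)
  then show ?case using 0 by (intro exI[of _ "\<lambda>j x. 0"] exI[of _ "\<lambda>j. 0"]) auto
next
  case (Suc n)
  define Q where "Q = (Lap ^^ n) f"
  have Qh: "Q \<in> k_harmonics P k (m - 2 * n)"
    using homogeneous_Lap_funpow[OF Suc.prems(1), of n] Suc.prems(2) by (simp add: k_harmonics_def Q_def fun_eq_iff)
  obtain c where c: "c \<noteq> 0" "(Lap ^^ n) (\<lambda>y. of_real ((y \<bullet> y) ^ n) * Q y) = (\<lambda>x. c * Q x)"
    using Lap_funpow_norm_power_harmonic[OF Qh] by blast
  have Qcp: "cpoly (\<lambda>y. of_real ((y \<bullet> y) ^ n) * Q y)"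
    using Qh homogeneous_norm_power[of n] by (intro cpoly_mult) (auto simp: k_harmonics_def homogeneous_polynomial_iff)
  have fcp: "cpoly f" using Suc.prems(1) by (simp add: homogeneous_polynomial_iff)
  show ?case
  proof (cases "2 * n \<le> m")
    case True
    define g where "g = (\<lambda>y. (- 1 / c) * (of_real ((y \<bullet> y) ^ n) * Q y) + f y)"
    have "homogeneous_polynomial (2 * n + (m - 2 * n)) (\<lambda>y. of_real ((y \<bullet> y) ^ n) * Q y)"
      using Qh by (intro homogeneous_mult homogeneous_norm_power) (simp add: k_harmonics_def)
    then have "homogeneous_polynomial m g"
      unfolding g_def using True by (intro homogeneous_add homogeneous_cmult Suc.prems(1)) simp
    moreover have "(Lap ^^ n) g = (\<lambda>x. 0)"
      unfolding g_def Lap_funpow_lin[OF Qcp fcp] c(2) using c(1) by (auto simp: Q_def)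
    ultimately obtain h d where hd: "\<And>j. h j \<in> k_harmonics P k (d j)"
        "g = (\<lambda>x. \<Sum>j<n. of_real ((x \<bullet> x) ^ j) * h j x)"
      using Suc.IH by blast
    have "Lap (\<lambda>x. (1 / c) * Q x) = (\<lambda>x. (1 / c) * Lap Q x)"
      using Qh Lap_funpow_cmult[of Q 1 "1 / c"] by (simp add: k_harmonics_def homogeneous_polynomial_iff)
    then have "(\<lambda>x. (1 / c) * Q x) \<in> k_harmonics P k (m - 2 * n)"
      using Qh unfolding k_harmonics_def mem_Collect_eq by (intro conjI homogeneous_cmult) auto
    moreover have "f = (\<lambda>x. \<Sum>j<Suc n. of_real ((x \<bullet> x) ^ j) * (h(n := \<lambda>x. (1 / c) * Q x)) j x)"
    proof
      fix x
      have "f x = g x + of_real ((x \<bullet> x) ^ n) * ((1 / c) * Q x)" by (simp add: g_def)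
      then show "f x = (\<Sum>j<Suc n. of_real ((x \<bullet> x) ^ j) * (h(n := \<lambda>x. (1 / c) * Q x)) j x)"
        by (simp add: hd(2))
    qed
    ultimately show ?thesis using hd(1)
      by (intro exI[of _ "h(n := \<lambda>x. (1 / c) * Q x)"] exI[of _ "d(n := m - 2 * n)"]) auto
  next
    case False
    then have "(Lap ^^ n) f = (\<lambda>x. 0)" using Lap_funpow_eq_0[OF Suc.prems(1)] by simp
    then obtain h d where hd: "\<And>j. h j \<in> k_harmonics P k (d j)"
        "f = (\<lambda>x. \<Sum>j<n. of_real ((x \<bullet> x) ^ j) * h j x)"
      using Suc.IH Suc.prems(1) by blast
    have "(\<lambda>x. 0) \<in> k_harmonics P k 0"
      using homogeneous_zero Lap_zero by (auto simp: k_harmonics_def)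
    then show ?thesis using hd
      by (intro exI[of _ "h(n := \<lambda>x. 0)"] exI[of _ "d(n := 0)"]) (auto simp: fun_eq_iff)
  qed
qed

theorem Fischer_decomposition:
  assumes "homogeneous_polynomial m f"
  shows "\<exists>h d. (\<forall>j. h j \<in> k_harmonics P k (d j)) \<and> f = (\<lambda>x. \<Sum>j\<le>m. of_real ((x \<bullet> x) ^ j) * h j x)"
proof -
  have "(Lap ^^ Suc m) f = (\<lambda>x. 0)" by (rule Lap_funpow_eq_0[OF assms]) simp
  from Fischer_aux[OF assms this] show ?thesis by (simp add: lessThan_Suc_atMost)
qed

end

section \<open>The oscillator on Laguerre functions\<close>

definition laguerre_poly :: "nat \<Rightarrow> real \<Rightarrow> real poly" where
  "laguerre_poly l \<nu> = (\<Sum>j\<le>l. monom ((- 1) ^ j * ((real l + \<nu>) gchoose (l - j)) / fact j) j)"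

lemma poly_laguerre_poly: "poly (laguerre_poly l \<nu>) t = laguerre l \<nu> t"
  by (simp add: laguerre_poly_def laguerre_def poly_sum poly_monom)

lemma coeff_laguerre_poly:
  "coeff (laguerre_poly l \<nu>) n = (if n \<le> l then (- 1) ^ n * ((real l + \<nu>) gchoose (l - n)) / fact n else 0)"
proof -
  have "coeff (laguerre_poly l \<nu>) n =
      (\<Sum>j\<le>l. if j = n then (- 1) ^ j * ((real l + \<nu>) gchoose (l - j)) / fact j else 0)"
    unfolding laguerre_poly_def coeff_sum coeff_monom ..
  then show ?thesis by simp
qed

text \<open>
  The Laguerre differential operator \<open>t q'' + (\<nu> + 1 - t) q'\<close>.
\<close>

definition laguerre_op :: "real \<Rightarrow> real poly \<Rightarrow> real poly" where
  "laguerre_op \<nu> q = [:0, 1:] * pderiv (pderiv q) + [:\<nu> + 1, - 1:] * pderiv q"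

lemma coeff_laguerre_op:
  "coeff (laguerre_op \<nu> q) n = (real n + 1) * (real n + 1 + \<nu>) * coeff q (Suc n) - real n * coeff q n"
  unfolding laguerre_op_def
  by (cases n) (simp_all add: coeff_pderiv mult_pCons_left algebra_simps)

lemma laguerre_op_laguerre_poly:
  "laguerre_op \<nu> (laguerre_poly l \<nu>) = smult (- real l) (laguerre_poly l \<nu>)"
proof (rule poly_eqI)
  fix n
  show "coeff (laguerre_op \<nu> (laguerre_poly l \<nu>)) n = coeff (smult (- real l) (laguerre_poly l \<nu>)) n"
  proof (cases "n < l")
    case True
    then obtain d where d: "l = n + Suc d" by (metis less_natE add_Suc_right)
    have g: "((real l + \<nu>) gchoose Suc d) * (real d + 1) = ((real l + \<nu>) gchoose d) * (real l + \<nu> - real d)"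
      using gbinomial_absorption'[of "Suc d" "real l + \<nu>"] gbinomial_mult_1[of "real l + \<nu>" d]
      by (simp add: algebra_simps)
    have "real l + \<nu> - real d = real n + 1 + \<nu>" by (simp add: d)
    with g have g': "((real l + \<nu>) gchoose d) * (real n + 1 + \<nu>) = ((real l + \<nu>) gchoose Suc d) * (real d + 1)"
      by simp
    have "coeff (laguerre_op \<nu> (laguerre_poly l \<nu>)) n =
        (real n + 1) * (real n + 1 + \<nu>) * ((- 1) ^ Suc n * ((real l + \<nu>) gchoose d) / fact (Suc n))
        - real n * ((- 1) ^ n * ((real l + \<nu>) gchoose Suc d) / fact n)"
      by (simp add: coeff_laguerre_op coeff_laguerre_poly d)
    also have "(real n + 1) * (real n + 1 + \<nu>) * ((- 1) ^ Suc n * ((real l + \<nu>) gchoose d) / fact (Suc n)) =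
        - ((- 1) ^ n * (((real l + \<nu>) gchoose d) * (real n + 1 + \<nu>)) / fact n)"
      by (simp add: field_simps del: of_nat_Suc) (simp add: algebra_simps)
    also have "- ((- 1) ^ n * (((real l + \<nu>) gchoose d) * (real n + 1 + \<nu>)) / fact n)
        - real n * ((- 1) ^ n * ((real l + \<nu>) gchoose Suc d) / fact n) =
        coeff (smult (- real l) (laguerre_poly l \<nu>)) n"
      unfolding g' by (simp add: coeff_laguerre_poly d ring_distribs diff_divide_distrib add_divide_distrib)
    finally show ?thesis .
  next
    case False
    then show ?thesis by (auto simp: coeff_laguerre_op coeff_laguerre_poly)
  qed
qed

definition profile :: "real \<Rightarrow> real poly \<Rightarrow> 'a::real_normed_vector \<Rightarrow> real" where
  "profile a q x = poly q (2 / a * norm x powr a) * exp (- (norm x powr a) / a)"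

lemma laguerre_functions_profile:
  "laguerre_functions P k a =
    {(\<lambda>x. p x * of_real (profile a (laguerre_poly l (laguerre_parameter P k a m)) x)) | p l m. p \<in> k_harmonics P k m}"
  by (simp add: laguerre_functions_def profile_def poly_laguerre_poly)

definition radial_profile :: "real \<Rightarrow> real poly \<Rightarrow> real \<Rightarrow> real" where
  "radial_profile a q s = poly q (2 / a * s powr (a / 2)) * exp (- (s powr (a / 2)) / a)"

lemma norm_powr_inner: "norm x powr a = (x \<bullet> x) powr (a / 2)"
proof -
  have "x \<bullet> x = norm x powr 2"
    by (simp add: power2_norm_eq_inner powr_numeral)
  moreover have "(norm x powr 2) powr (a / 2) = norm x powr a"
    by (subst powr_powr) simp
  ultimately show ?thesis by simp
qed

lemma profile_radial: "profile a q x = radial_profile a q (x \<bullet> x)"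
  by (simp add: profile_def radial_profile_def norm_powr_inner)

text \<open>
  The operator \<open>t d/dt\<close> conjugated with \<open>exp (- t / 2)\<close>. With
  \<open>t = 2/a s powr (a / 2)\<close> and \<open>s = |x|\<^sup>2\<close> one has
  \<open>s d/ds = (a/2) t d/dt\<close>, so derivatives of radial profiles are again radial profiles.
\<close>

definition gauge_deriv :: "real poly \<Rightarrow> real poly" where
  "gauge_deriv q = [:0, 1:] * (pderiv q - smult (1 / 2) q)"

lemma radial_profile_deriv:
  assumes a: "a > 0" and s: "s > 0"
  shows "(radial_profile a q has_real_derivative (a / 2 * radial_profile a (gauge_deriv q) s / s)) (at s)"
proof -
  have Y: "((\<lambda>s. s powr (a / 2)) has_real_derivative (a / 2 * s powr (a / 2) / s)) (at s)"
    using s by (auto intro!: derivative_eq_intros simp: powr_diff)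
  have "(radial_profile a q has_real_derivative
      poly (pderiv q) (2 / a * s powr (a / 2)) * (2 / a * (a / 2 * s powr (a / 2) / s)) * exp (- (s powr (a / 2)) / a)
      + exp (- (s powr (a / 2)) / a) * (- (a / 2 * s powr (a / 2) / s) / a) * poly q (2 / a * s powr (a / 2))) (at s)"
    unfolding radial_profile_def[abs_def]
    by (rule DERIV_mult[OF DERIV_chain2[OF poly_DERIV DERIV_cmult[OF Y]]
          DERIV_fun_exp[OF DERIV_cdivide[OF DERIV_minus[OF Y]]]])
  then show ?thesis
    by (rule DERIV_cong) (use a s in \<open>simp add: radial_profile_def gauge_deriv_def field_simps\<close>)
qed

lemma radial_profile_deriv2:
  assumes a: "a > 0" and s: "s > 0"
  shows "((\<lambda>s. a / 2 * radial_profile a (gauge_deriv q) s / s) has_real_derivative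
    (a / 2 * (a / 2 * radial_profile a (gauge_deriv (gauge_deriv q)) s - radial_profile a (gauge_deriv q) s) / s\<^sup>2)) (at s)"
  by (rule DERIV_cong, (rule derivative_intros DERIV_cmult radial_profile_deriv a s)+)
     (use s in \<open>auto simp: power2_eq_square field_simps\<close>)

context dunkl_setting
begin

text \<open>
  The regularity that makes the Dunkl Laplacian linear off the origin. At the origin the Laguerre functions need
  not be differentiable, but a point has measure zero.
\<close>

definition smooth_off_0 :: "(real ^ 'n \<Rightarrow> complex) \<Rightarrow> bool" where
  "smooth_off_0 f \<longleftrightarrow> (\<forall>x. x \<noteq> 0 \<longrightarrow> f differentiable (at x) \<and> (\<forall>\<xi>. T \<xi> f differentiable (at x)))"

lemma T_lin_off_0:
  assumes "smooth_off_0 f" "smooth_off_0 g" "x \<noteq> 0"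
  shows "T \<xi> (\<lambda>y. c * f y + g y) x = c * T \<xi> f x + T \<xi> g x"
  using assms by (intro T_lin) (auto simp: smooth_off_0_def)

lemma reflection_eq_0_iff: "reflection \<alpha> x = 0 \<longleftrightarrow> x = 0"
  using norm_reflection[of \<alpha> x] by (metis norm_eq_zero)

lemma smooth_off_0_lin:
  assumes f: "smooth_off_0 f" and g: "smooth_off_0 g"
  shows "smooth_off_0 (\<lambda>y. c * f y + g y)"
    and "x \<noteq> 0 \<Longrightarrow> Lap (\<lambda>y. c * f y + g y) x = c * Lap f x + Lap g x"
proof -
  have d: "f differentiable (at x)" "g differentiable (at x)" "T \<xi> f differentiable (at x)" "T \<xi> g differentiable (at x)"
    if "x \<noteq> 0" for x \<xi>
    using f g that by (auto simp: smooth_off_0_def)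
  have dT: "(\<lambda>x. c * T \<xi> f x + T \<xi> g x) differentiable (at x)" if "x \<noteq> 0" for x \<xi>
    by (intro differentiable_add differentiable_mult differentiable_const d that)
  have "T \<xi> (\<lambda>y. c * f y + g y) differentiable (at x)" if x: "x \<noteq> 0" for x \<xi>
  proof -
    obtain D where "((\<lambda>x. c * T \<xi> f x + T \<xi> g x) has_derivative D) (at x)"
      using dT[OF x] by (auto simp: differentiable_def)
    moreover have "open (- {0 :: real ^ 'n})" "x \<in> - {0}" using x by auto
    ultimately have "(T \<xi> (\<lambda>y. c * f y + g y) has_derivative D) (at x)"
      by (rule has_derivative_transform_within_open) (auto simp: T_lin_off_0[OF f g])
    then show ?thesis by (auto simp: differentiable_def)
  qed
  then show "smooth_off_0 (\<lambda>y. c * f y + g y)"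
    unfolding smooth_off_0_def by (intro allI impI conjI differentiable_add differentiable_mult differentiable_const d)
  assume x: "x \<noteq> 0"
  have "T \<xi> (T \<xi> (\<lambda>y. c * f y + g y)) x = c * T \<xi> (T \<xi> f) x + T \<xi> (T \<xi> g) x" for \<xi>
  proof -
    have "T \<xi> (T \<xi> (\<lambda>y. c * f y + g y)) x = T \<xi> (\<lambda>x. c * T \<xi> f x + T \<xi> g x) x"
      by (rule dunkl_operator_cong[where U = "- {0}"])
         (use x dT in \<open>auto simp: T_lin_off_0[OF f g] reflection_eq_0_iff\<close>)
    also have "\<dots> = c * T \<xi> (T \<xi> f) x + T \<xi> (T \<xi> g) x" by (intro T_lin d x)
    finally show ?thesis .
  qed
  then show "Lap (\<lambda>y. c * f y + g y) x = c * Lap f x + Lap g x"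
    by (simp add: dunkl_laplacian_def sum.distrib sum_distrib_left)
qed

lemma smooth_off_0_zero: "smooth_off_0 (\<lambda>x. 0)"
  by (simp add: smooth_off_0_def T_const)

lemma smooth_off_0_sum:
  fixes c :: "'i \<Rightarrow> complex"
  assumes "finite I" "\<And>i. i \<in> I \<Longrightarrow> smooth_off_0 (f i)"
  shows "smooth_off_0 (\<lambda>y. \<Sum>i\<in>I. c i * f i y) \<and>
    (\<forall>x. x \<noteq> 0 \<longrightarrow> Lap (\<lambda>y. \<Sum>i\<in>I. c i * f i y) x = (\<Sum>i\<in>I. c i * Lap (f i) x))"
  using assms
proof (induction I rule: finite_induct)
  case empty
  then show ?case by (simp add: smooth_off_0_zero Lap_zero)
next
  case (insert j I)
  then have "smooth_off_0 (f j)" "smooth_off_0 (\<lambda>y. \<Sum>i\<in>I. c i * f i y)" by auto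
  from smooth_off_0_lin[OF this, where c = "c j"] insert show ?case by simp
qed

lemma smooth_off_0_profile:
  assumes a: "a > 0" and p: "cpoly p"
  shows "smooth_off_0 (\<lambda>x. p x * of_real (profile a q x))"
  unfolding smooth_off_0_def
proof (intro allI impI conjI)
  fix x :: "real ^ 'n" and \<xi> assume x: "x \<noteq> 0"
  then have s: "x \<bullet> x > 0" by simp
  have eq: "(\<lambda>x. p x * of_real (profile a q x)) = (\<lambda>y. of_real (radial_profile a q (y \<bullet> y)) * p y)"
    by (auto simp: profile_radial)
  show "(\<lambda>x. p x * of_real (profile a q x)) differentiable (at x)"
    unfolding eq
    by (intro differentiable_mult directional_derivative_radial(2)[OF radial_profile_deriv[OF a s]] cpoly_differentiable p)
  show "T \<xi> (\<lambda>x. p x * of_real (profile a q x)) differentiable (at x)"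
    unfolding eq
    by (rule T_radial_twice(1)[where S = "{0<..}", OF _ _ radial_profile_deriv[OF a] radial_profile_deriv2[OF a] p])
       (use s in auto)
qed

text \<open>
  In the variable \<open>y = 2/a |x|\<^sup>a\<close> the radial part of the Laplacian from
  \<open>Lap_radial\<close> is, up to the factor \<open>a\<^sup>2 / |x|\<^sup>2\<close>, the second-order
  expression \<open>(t d/dt)\<^sup>2 + \<nu> t d/dt\<close> conjugated with \<open>exp (- y / 2)\<close>. The term
  \<open>y\<^sup>2 q / 4\<close> that the conjugation creates is cancelled by the potential
  \<open>|x|\<^sup>a\<close>.
\<close>

lemma oscillator_profile:
  assumes a: "a > 0" and p: "p \<in> k_harmonics P k m" and x: "x \<noteq> 0"
    and \<nu>: "\<nu> = laguerre_parameter P k a m"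
  shows "dunkl_oscillator P k a (\<lambda>x. p x * of_real (profile a q x)) x =
    p x * of_real (profile a (smult (2 * a) (laguerre_op \<nu> q) - smult (a * (\<nu> + 1)) q) x)"
proof -
  define s where "s = x \<bullet> x"
  have s: "s > 0" using x by (simp add: s_def)
  define y where "y = 2 / a * s powr (a / 2)"
  define E where "E = exp (- (s powr (a / 2)) / a)"
  have R: "radial_profile a r s = poly r y * E" for r
    by (simp add: radial_profile_def y_def E_def)
  have \<nu>a: "2 * real m + 2 * \<gamma> + real CARD('n) - 2 = a * \<nu>"
    using a by (simp add: \<nu> laguerre_parameter_def)
  have Lp: "Lap p x = 0" and hp: "homogeneous_polynomial m p" using p by (auto simp: k_harmonics_def)
  have "Lap (\<lambda>y. of_real (radial_profile a q (y \<bullet> y)) * p y) x =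
      of_real (4 * s * (a / 2 * (a / 2 * radial_profile a (gauge_deriv (gauge_deriv q)) s - radial_profile a (gauge_deriv q) s) / s\<^sup>2)
        + (2 * CARD('n) + 4 * \<gamma> + 4 * m) * (a / 2 * radial_profile a (gauge_deriv q) s / s)) * p x"
    using Lap_radial[where S = "{0<..}", OF _ _ radial_profile_deriv[OF a] radial_profile_deriv2[OF a] hp, of x] s
    by (simp add: Lp s_def)
  also have "4 * s * (a / 2 * (a / 2 * radial_profile a (gauge_deriv (gauge_deriv q)) s - radial_profile a (gauge_deriv q) s) / s\<^sup>2)
        + (2 * CARD('n) + 4 * \<gamma> + 4 * m) * (a / 2 * radial_profile a (gauge_deriv q) s / s)
      = a / s * (a * radial_profile a (gauge_deriv (gauge_deriv q)) s
          + (2 * real m + 2 * \<gamma> + real CARD('n) - 2) * radial_profile a (gauge_deriv q) s)"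
    using s by (simp add: field_simps power2_eq_square)
  also have "\<dots> = a\<^sup>2 / s * (poly (gauge_deriv (gauge_deriv q)) y + \<nu> * poly (gauge_deriv q) y) * E"
    unfolding \<nu>a R by (simp add: field_simps power2_eq_square)
  also have "poly (gauge_deriv (gauge_deriv q)) y + \<nu> * poly (gauge_deriv q) y =
      y * (poly (laguerre_op \<nu> q) y + y * poly q y / 4 - (\<nu> + 1) * poly q y / 2)"
    by (simp add: gauge_deriv_def laguerre_op_def pderiv_mult pderiv_diff pderiv_smult pderiv_pCons field_simps)
  finally have L: "Lap (\<lambda>y. of_real (radial_profile a q (y \<bullet> y)) * p y) x =
      of_real (a\<^sup>2 / s * (y * (poly (laguerre_op \<nu> q) y + y * poly q y / 4 - (\<nu> + 1) * poly q y / 2)) * E) * p x" .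
  have n1: "norm x powr (2 - a) * (a\<^sup>2 / s * y) = 2 * a"
  proof -
    have "norm x powr (2 - a) = s powr (1 - a / 2)"
      unfolding norm_powr_inner s_def by (simp add: diff_divide_distrib)
    also have "\<dots> = s / s powr (a / 2)" using s by (simp add: powr_diff)
    finally show ?thesis using s a by (simp add: y_def field_simps power2_eq_square)
  qed
  have n2: "norm x powr a = a / 2 * y"
    unfolding norm_powr_inner y_def s_def using a by simp
  have pr: "profile a r x = poly r y * E" for r
    using R by (simp add: profile_radial s_def)
  have eq: "(\<lambda>x. p x * of_real (profile a q x)) = (\<lambda>y. of_real (radial_profile a q (y \<bullet> y)) * p y)"
    by (auto simp: profile_radial)
  have "dunkl_oscillator P k a (\<lambda>x. p x * of_real (profile a q x)) x =
      of_real (norm x powr (2 - a) * (a\<^sup>2 / s * y) * (poly (laguerre_op \<nu> q) y + y * poly q y / 4 - (\<nu> + 1) * poly q y / 2) * E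
        - norm x powr a * (poly q y * E)) * p x"
    unfolding dunkl_oscillator_def pr unfolding eq L
    by (simp only: of_real_mult of_real_diff left_diff_distrib right_diff_distrib mult_ac)
  also have "norm x powr (2 - a) * (a\<^sup>2 / s * y) * (poly (laguerre_op \<nu> q) y + y * poly q y / 4 - (\<nu> + 1) * poly q y / 2) * E
        - norm x powr a * (poly q y * E) = (2 * a * poly (laguerre_op \<nu> q) y - a * (\<nu> + 1) * poly q y) * E"
    unfolding n1 n2 by (simp add: field_simps)
  finally show ?thesis by (simp add: pr mult.commute)
qed

lemma oscillator_laguerre:
  assumes a: "a > 0" and p: "p \<in> k_harmonics P k m" and x: "x \<noteq> 0"
  shows "dunkl_oscillator P k a (\<lambda>x. p x * of_real (profile a (laguerre_poly l (laguerre_parameter P k a m)) x)) x =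
    of_real (- (2 * a * l + a * (laguerre_parameter P k a m + 1))) *
      (p x * of_real (profile a (laguerre_poly l (laguerre_parameter P k a m)) x))"
  unfolding oscillator_profile[OF a p x refl] laguerre_op_laguerre_poly
  by (simp add: profile_def algebra_simps)

end

section \<open>Uniqueness for moments and Laplace transforms\<close>

text \<open>
  Continuous functions determine the complex measure \<open>g dM\<close> transported by \<open>X\<close>: closed
  sets are limits of continuous functions, and the closed sets are an intersection-stable generator.
\<close>

lemma integral_zero_on_borel:
  fixes g :: "'a \<Rightarrow> complex" and X :: "'a \<Rightarrow> 'b::metric_space"
  assumes int: "integrable M g" and X[measurable]: "X \<in> borel_measurable M"
    and zero: "\<And>\<phi> :: 'b \<Rightarrow> real. continuous_on UNIV \<phi> \<Longrightarrow> (\<And>x. 0 \<le> \<phi> x \<and> \<phi> x \<le> 1) \<Longrightarrow>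
      (LINT x|M. \<phi> (X x) *\<^sub>R g x) = 0"
    and B: "B \<in> sets borel"
  shows "(LINT x|M. indicator B (X x) *\<^sub>R g x) = 0"
proof -
  have [measurable]: "g \<in> borel_measurable M" using int by simp
  have one: "(LINT x|M. g x) = 0" using zero[of "\<lambda>_. 1"] by simp
  have gen: "sets borel = sigma_sets (UNIV :: 'b set) (Collect closed)"
    unfolding borel_eq_closed by (simp add: sets_measure_of)
  have intI: "integrable M (\<lambda>x. indicator A (X x) *\<^sub>R g x)" if [measurable]: "A \<in> sets borel" for A
    by (rule Bochner_Integration.integrable_bound[OF integrable_norm[OF int]]) (auto simp: indicator_def)
  have "Int_stable (Collect closed :: 'b set set)" "Collect closed \<subseteq> Pow (UNIV :: 'b set)"
    "B \<in> sigma_sets UNIV (Collect closed)"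
    using B gen by (auto simp: Int_stable_def)
  then show ?thesis
  proof (induction rule: sigma_sets_induct_disjoint)
    fix C :: "'b set" assume "C \<in> Collect closed"
    then have C: "closed C" by simp
    then have [measurable]: "C \<in> sets borel" by simp
    show "(LINT x|M. indicator C (X x) *\<^sub>R g x) = 0"
    proof (cases "C = {}")
      case False
      define \<phi> where "\<phi> n y = max 0 (1 - real n * infdist y C)" for n y
      have cont: "continuous_on UNIV (\<phi> n)" for n
        unfolding \<phi>_def by (intro continuous_intros)
      then have [measurable]: "\<phi> n \<in> borel_measurable borel" for n
        by (rule borel_measurable_continuous_onI)
      have "(\<lambda>n. LINT x|M. \<phi> n (X x) *\<^sub>R g x) \<longlonglongrightarrow> (LINT x|M. indicator C (X x) *\<^sub>R g x)"
      proof (rule integral_dominated_convergence[where w = "\<lambda>x. cmod (g x)"])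
        show "AE x in M. (\<lambda>n. \<phi> n (X x) *\<^sub>R g x) \<longlonglongrightarrow> indicator C (X x) *\<^sub>R g x"
        proof (intro AE_I2 tendsto_scaleR tendsto_const)
          fix x
          show "(\<lambda>n. \<phi> n (X x)) \<longlonglongrightarrow> indicator C (X x)"
          proof (cases "X x \<in> C")
            case True
            then show ?thesis by (simp add: \<phi>_def)
          next
            case out: False
            then have pos: "infdist (X x) C > 0"
              using C False in_closed_iff_infdist_zero[of C "X x"] infdist_nonneg[of "X x" C] by auto
            obtain N :: nat where N: "1 / infdist (X x) C < real N" using reals_Archimedean2 by blast
            have "\<forall>\<^sub>F n in sequentially. \<phi> n (X x) = 0"
              using eventually_ge_at_top[of N]
            proof eventually_elim
              case (elim n)
              then have "1 / infdist (X x) C < real n" using N by linarith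
              then have "1 < real n * infdist (X x) C" using pos by (simp add: field_simps)
              then show ?case by (simp add: \<phi>_def)
            qed
            then show ?thesis using out by (simp add: tendsto_eventually)
          qed
        qed
        have "\<bar>\<phi> n y\<bar> \<le> 1" for n y by (auto simp: \<phi>_def infdist_nonneg)
        then show "AE x in M. norm (\<phi> n (X x) *\<^sub>R g x) \<le> cmod (g x)" for n
          using mult_right_mono[of "\<bar>\<phi> n (X _)\<bar>" 1] by (intro AE_I2) (auto intro: mult_left_le_one_le)
      qed (use int C in auto)
      moreover have "(LINT x|M. \<phi> n (X x) *\<^sub>R g x) = 0" for n
        by (intro zero cont) (auto simp: \<phi>_def infdist_nonneg)
      ultimately show ?thesis by (simp add: LIMSEQ_const_iff)
    qed simp
  next
    fix A :: "'b set" assume A: "A \<in> sigma_sets UNIV (Collect closed)" "(LINT x|M. indicator A (X x) *\<^sub>R g x) = 0"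
    have "(LINT x|M. indicator (UNIV - A) (X x) *\<^sub>R g x) = (LINT x|M. g x - indicator A (X x) *\<^sub>R g x)"
      by (intro Bochner_Integration.integral_cong) (auto simp: indicator_def)
    also have "\<dots> = 0" using A gen by (subst Bochner_Integration.integral_diff) (auto simp: int intI one)
    finally show "(LINT x|M. indicator (UNIV - A) (X x) *\<^sub>R g x) = 0" .
  next
    fix A :: "nat \<Rightarrow> 'b set"
    assume disj: "disjoint_family A" and A: "range A \<subseteq> sigma_sets UNIV (Collect closed)"
      and IH: "\<And>i. (LINT x|M. indicator (A i) (X x) *\<^sub>R g x) = 0"
    have Am[measurable]: "A i \<in> sets borel" for i using A gen by auto
    have ind: "(\<Sum>i<N. indicator (A i) t) = (indicator (\<Union>i<N. A i) t :: real)" for N t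
      using disj by (subst indicator_UN_disjoint) (auto simp: disjoint_family_on_def)
    have "(\<lambda>N. LINT x|M. indicator (\<Union>i<N. A i) (X x) *\<^sub>R g x) \<longlonglongrightarrow> (LINT x|M. indicator (\<Union>i. A i) (X x) *\<^sub>R g x)"
    proof (rule integral_dominated_convergence[where w = "\<lambda>x. cmod (g x)"])
      show "AE x in M. (\<lambda>N. indicator (\<Union>i<N. A i) (X x) *\<^sub>R g x) \<longlonglongrightarrow> indicator (\<Union>i. A i) (X x) *\<^sub>R g x"
        by (intro AE_I2 tendsto_scaleR tendsto_const LIMSEQ_indicator_UN)
    qed (use int in \<open>auto simp: indicator_def\<close>)
    moreover have "(LINT x|M. indicator (\<Union>i<N. A i) (X x) *\<^sub>R g x) = 0" for N
      unfolding ind[symmetric] scaleR_sum_left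
      by (subst Bochner_Integration.integral_sum) (auto simp: intI IH)
    ultimately show "(LINT x|M. indicator (\<Union>i. A i) (X x) *\<^sub>R g x) = 0" by (simp add: LIMSEQ_const_iff)
  qed simp
qed

lemma integral_zero_compose:
  fixes g :: "'a \<Rightarrow> complex" and X :: "'a \<Rightarrow> 'b::metric_space" and \<phi> :: "'b \<Rightarrow> real"
  assumes int: "integrable M g" and X[measurable]: "X \<in> borel_measurable M"
    and zero: "\<And>B. B \<in> sets borel \<Longrightarrow> (LINT x|M. indicator B (X x) *\<^sub>R g x) = 0"
    and \<phi>[measurable]: "\<phi> \<in> borel_measurable borel" and int\<phi>: "integrable M (\<lambda>x. \<phi> (X x) *\<^sub>R g x)"
  shows "(LINT x|M. \<phi> (X x) *\<^sub>R g x) = 0"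
proof -
  have [measurable]: "g \<in> borel_measurable M" using int by simp
  obtain F where F: "\<And>i. simple_function borel (F i)" "\<And>x. (\<lambda>i. F i x) \<longlonglongrightarrow> \<phi> x"
      "\<And>i x. dist (F i x) 0 \<le> 2 * dist (\<phi> x) 0"
    using borel_measurable_implies_sequence_metric[OF \<phi>, of 0] by auto
  have [measurable]: "F i \<in> borel_measurable borel" for i using F(1) by (rule borel_measurable_simple_function)
  have intI: "integrable M (\<lambda>x. indicator A (X x) *\<^sub>R g x)" if [measurable]: "A \<in> sets borel" for A
    by (rule Bochner_Integration.integrable_bound[OF integrable_norm[OF int]]) (auto simp: indicator_def)
  have "(LINT x|M. F i (X x) *\<^sub>R g x) = 0" for i
  proof -
    have fin: "finite (range (F i))" using F(1)[of i] by (simp add: simple_function_def)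
    have Fi: "F i y = (\<Sum>v\<in>range (F i). v * indicator (F i -` {v}) y)" for y
    proof -
      have "(\<Sum>v\<in>range (F i). v * indicator (F i -` {v}) y) = (\<Sum>v\<in>{F i y}. v * indicator (F i -` {v}) y)"
        using fin by (intro sum.mono_neutral_right) auto
      then show ?thesis by simp
    qed
    have sets: "F i -` {v} \<in> sets borel" for v
      using measurable_sets[of "F i" borel borel "{v}"] by simp
    have "(LINT x|M. F i (X x) *\<^sub>R g x) = (LINT x|M. (\<Sum>v\<in>range (F i). v *\<^sub>R (indicator (F i -` {v}) (X x) *\<^sub>R g x)))"
      by (subst Fi) (simp add: scaleR_sum_left)
    also have "\<dots> = 0"
      using sets by (subst Bochner_Integration.integral_sum) (auto simp: intI zero simp del: scaleR_scaleR)
    finally show ?thesis .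
  qed
  moreover have "(\<lambda>i. LINT x|M. F i (X x) *\<^sub>R g x) \<longlonglongrightarrow> (LINT x|M. \<phi> (X x) *\<^sub>R g x)"
  proof (rule integral_dominated_convergence[where w = "\<lambda>x. 2 * norm (\<phi> (X x) *\<^sub>R g x)"])
    show "AE x in M. (\<lambda>i. F i (X x) *\<^sub>R g x) \<longlonglongrightarrow> \<phi> (X x) *\<^sub>R g x"
      by (intro AE_I2 tendsto_scaleR tendsto_const F)
    show "AE x in M. norm (F i (X x) *\<^sub>R g x) \<le> 2 * norm (\<phi> (X x) *\<^sub>R g x)" for i
      using mult_right_mono[OF F(3)] by (intro AE_I2) (auto simp: mult.assoc[symmetric])
    show "integrable M (\<lambda>x. 2 * norm (\<phi> (X x) *\<^sub>R g x))"
      using integrable_norm[OF int\<phi>] by (rule integrable_mult_right)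
  qed measurable
  ultimately show ?thesis by (simp add: LIMSEQ_const_iff)
qed

text \<open>
  On a compact set polynomials approximate continuous functions uniformly, so the transported measure vanishes on
  continuous functions, hence on all Borel functions that are integrable. Unbounded \<open>\<phi>\<close> are
  included because they serve to change weights.
\<close>

lemma integral_zero_if_moments_zero:
  fixes g :: "'a \<Rightarrow> complex" and X :: "'a \<Rightarrow> 'b::euclidean_space" and \<phi> :: "'b \<Rightarrow> real"
  assumes int: "integrable M g" and X[measurable]: "X \<in> borel_measurable M"
    and K: "compact K" "\<And>x. X x \<notin> K \<Longrightarrow> g x = 0"
    and zero: "\<And>f. real_polynomial_function f \<Longrightarrow> (LINT x|M. f (X x) *\<^sub>R g x) = 0"
    and \<phi>[measurable]: "\<phi> \<in> borel_measurable borel" and int\<phi>: "integrable M (\<lambda>x. \<phi> (X x) *\<^sub>R g x)"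
  shows "(LINT x|M. \<phi> (X x) *\<^sub>R g x) = 0"
proof (rule integral_zero_compose[OF int X _ \<phi> int\<phi>], rule integral_zero_on_borel[OF int X])
  have [measurable]: "g \<in> borel_measurable M" using int by simp
  fix \<psi> :: "'b \<Rightarrow> real" assume cont: "continuous_on UNIV \<psi>"
  have intc: "integrable M (\<lambda>x. f (X x) *\<^sub>R g x)" if f: "continuous_on UNIV f" for f :: "'b \<Rightarrow> real"
  proof -
    have "bounded (f ` K)"
      using f K(1) by (intro compact_imp_bounded compact_continuous_image) (auto intro: continuous_on_subset)
    then obtain C where C: "\<And>y. y \<in> K \<Longrightarrow> \<bar>f y\<bar> \<le> C" by (auto simp: bounded_iff)
    have [measurable]: "f \<in> borel_measurable borel" using f by (rule borel_measurable_continuous_onI)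
    show ?thesis
    proof (rule Bochner_Integration.integrable_bound)
      show "integrable M (\<lambda>x. C * norm (g x))" using int by simp
      show "AE x in M. norm (f (X x) *\<^sub>R g x) \<le> norm (C * norm (g x))"
      proof (intro AE_I2)
        fix x
        show "norm (f (X x) *\<^sub>R g x) \<le> norm (C * norm (g x))"
        proof (cases "X x \<in> K")
          case True
          have "\<bar>f (X x)\<bar> \<le> \<bar>C\<bar>" using C[OF True] by linarith
          then show ?thesis by (simp add: abs_mult mult_right_mono)
        qed (simp add: K)
      qed
    qed simp
  qed
  have bound: "norm (LINT x|M. \<psi> (X x) *\<^sub>R g x) \<le> \<epsilon> * (LINT x|M. norm (g x))" if "\<epsilon> > 0" for \<epsilon>
  proof -
    obtain f where f: "real_polynomial_function f" "\<And>y. y \<in> K \<Longrightarrow> \<bar>\<psi> y - f y\<bar> < \<epsilon>"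
      using Stone_Weierstrass_real_polynomial_function[OF K(1) continuous_on_subset[OF cont] \<open>\<epsilon> > 0\<close>] by auto
    have fc: "continuous_on UNIV f"
      using f(1) by (simp add: continuous_on_polymonial_function real_polynomial_function_eq)
    have "(LINT x|M. \<psi> (X x) *\<^sub>R g x) = (LINT x|M. \<psi> (X x) *\<^sub>R g x - f (X x) *\<^sub>R g x)"
      using intc[OF cont] intc[OF fc] zero[OF f(1)] by (subst Bochner_Integration.integral_diff) auto
    also have "norm \<dots> \<le> (LINT x|M. norm (\<psi> (X x) *\<^sub>R g x - f (X x) *\<^sub>R g x))"
      by (rule integral_norm_bound)
    also have "\<dots> \<le> (LINT x|M. \<epsilon> * norm (g x))"
    proof (rule integral_mono)
      show "integrable M (\<lambda>x. norm (\<psi> (X x) *\<^sub>R g x - f (X x) *\<^sub>R g x))" using intc[OF cont] intc[OF fc] by simp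
      show "integrable M (\<lambda>x. \<epsilon> * norm (g x))" using int by simp
      fix x
      show "norm (\<psi> (X x) *\<^sub>R g x - f (X x) *\<^sub>R g x) \<le> \<epsilon> * norm (g x)"
      proof (cases "X x \<in> K")
        case True
        then show ?thesis using f(2)[OF True]
          by (simp add: scaleR_diff_left[symmetric] mult_right_mono del: scaleR_diff_left)
      qed (simp add: K)
    qed
    finally show ?thesis by simp
  qed
  show "(LINT x|M. \<psi> (X x) *\<^sub>R g x) = 0"
  proof (rule ccontr)
    assume ne: "(LINT x|M. \<psi> (X x) *\<^sub>R g x) \<noteq> 0"
    define n where "n = norm (LINT x|M. \<psi> (X x) *\<^sub>R g x)"
    define I where "I = (LINT x|M. norm (g x))"
    have I: "0 \<le> I" and n: "0 < n" using ne by (simp_all add: I_def n_def)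
    have "0 < n / (2 * (I + 1))" using I n by simp
    from bound[OF this] have "n \<le> n / (2 * (I + 1)) * I" by (simp only: n_def I_def)
    also have "\<dots> < n"
    proof -
      have "0 + 1 \<le> I + 1" using I by (rule add_right_mono)
      then have "I < 2 * (I + 1)" by simp
      then have "n * I < n * (2 * (I + 1))" using n by (rule mult_strict_left_mono)
      then show ?thesis using I by (simp add: divide_less_eq)
    qed
    finally show False by simp
  qed
qed

text \<open>
  The substitution \<open>u = exp (- c s)\<close> maps the half-line to the unit interval and turns the values of
  the Laplace transform at the multiples of \<open>c\<close> into moments.
\<close>

lemma integral_zero_if_Laplace_zero:
  fixes g :: "'a \<Rightarrow> complex" and s :: "'a \<Rightarrow> real" and \<phi> :: "real \<Rightarrow> real"
  assumes int: "integrable M g" and s[measurable]: "s \<in> borel_measurable M" and s0: "\<And>x. 0 \<le> s x" and c: "0 < c"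
    and zero: "\<And>n. (LINT x|M. exp (- (real n * (c * s x))) *\<^sub>R g x) = 0"
    and \<phi>[measurable]: "\<phi> \<in> borel_measurable borel" and int\<phi>: "integrable M (\<lambda>x. \<phi> (s x) *\<^sub>R g x)"
  shows "(LINT x|M. \<phi> (s x) *\<^sub>R g x) = 0"
proof -
  have [measurable]: "g \<in> borel_measurable M" using int by simp
  define X where "X x = exp (- (c * s x))" for x
  have [measurable]: "X \<in> borel_measurable M" unfolding X_def by measurable
  have Xn: "X x ^ n = exp (- (real n * (c * s x)))" for x n
    unfolding X_def by (simp add: exp_of_nat_mult[symmetric])
  have inv: "- ln (X x) / c = s x" "- (ln (X x) / c) = s x" for x using c by (simp_all add: X_def)
  have "(LINT x|M. \<phi> (- ln (X x) / c) *\<^sub>R g x) = 0"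
  proof (rule integral_zero_if_moments_zero[where K = "{0..1}" and X = X and \<phi> = "\<lambda>u. \<phi> (- ln u / c)"])
    show "X x \<notin> {0..1} \<Longrightarrow> g x = 0" for x using c s0[of x] by (simp add: X_def)
    fix f :: "real \<Rightarrow> real" assume "real_polynomial_function f"
    then obtain a N where f: "f = (\<lambda>x. \<Sum>i\<le>N. a i * x ^ i)" by (auto simp: real_polynomial_function_iff_sum)
    have intn: "integrable M (\<lambda>x. exp (- (real n * (c * s x))) *\<^sub>R g x)" for n
      by (rule Bochner_Integration.integrable_bound[OF integrable_norm[OF int]])
         (use c s0 in \<open>auto intro!: mult_left_le_one_le\<close>)
    have "(LINT x|M. f (X x) *\<^sub>R g x) = (LINT x|M. (\<Sum>i\<le>N. a i *\<^sub>R (exp (- (real i * (c * s x))) *\<^sub>R g x)))"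
      by (simp add: f Xn scaleR_sum_left)
    also have "\<dots> = 0"
      by (subst Bochner_Integration.integral_sum) (auto simp: intn zero simp del: scaleR_scaleR)
    finally show "(LINT x|M. f (X x) *\<^sub>R g x) = 0" .
  qed (use int int\<phi> in \<open>auto simp: inv\<close>)
  then show ?thesis by (simp add: inv)
qed

lemma power_le_exp:
  fixes y :: real
  assumes "0 \<le> y"
  shows "y ^ j / fact j \<le> exp y"
proof -
  have "(\<Sum>i\<in>{j}. y ^ i /\<^sub>R fact i) \<le> (\<Sum>i. y ^ i /\<^sub>R fact i)"
    using assms by (intro sum_le_suminf summable_exp_generic) auto
  then show ?thesis by (simp add: exp_def divide_inverse mult.commute)
qed

lemma exp_partial_sum_le:
  fixes y :: real
  assumes "0 \<le> y"
  shows "\<bar>\<Sum>i<N. (- y) ^ i / fact i\<bar> \<le> exp y"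
proof -
  have "\<bar>\<Sum>i<N. (- y) ^ i / fact i\<bar> \<le> (\<Sum>i<N. \<bar>(- y) ^ i / fact i\<bar>)" by (rule sum_abs)
  also have "\<dots> = (\<Sum>i<N. y ^ i /\<^sub>R fact i)"
    using assms by (intro sum.cong) (auto simp: abs_mult power_abs divide_inverse mult.commute)
  also have "\<dots> \<le> (\<Sum>i. y ^ i /\<^sub>R fact i)"
    using assms by (intro sum_le_suminf summable_exp_generic) auto
  finally show ?thesis by (simp add: exp_def)
qed

text \<open>
  Vanishing moments pass to the Laplace transform through the exponential series, but the series may only be
  integrated termwise if the measure has an exponential moment. Steps of the fixed size \<open>c\<close> suffice
  for this: \<open>exp (- c s)\<close> times the measure satisfies the same hypotheses, so the step can be
  repeated.
\<close>

lemma Laplace_zero_if_moments_zero: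
  fixes g :: "'a \<Rightarrow> complex" and s :: "'a \<Rightarrow> real"
  assumes g[measurable]: "g \<in> borel_measurable M" and s[measurable]: "s \<in> borel_measurable M" and s0: "\<And>x. 0 \<le> s x" and c: "0 < c"
    and int: "integrable M (\<lambda>x. exp (2 * c * s x) *\<^sub>R g x)"
    and zero: "\<And>j. (LINT x|M. s x ^ j *\<^sub>R g x) = 0"
  shows "(LINT x|M. exp (- (real n * (c * s x))) *\<^sub>R g x) = 0"
proof -
  have bd: "s x ^ j * exp (c * s x) \<le> fact j / c ^ j * exp (2 * c * s x)" for x j
  proof -
    have "s x ^ j = fact j / c ^ j * ((c * s x) ^ j / fact j)" using c by (simp add: power_mult_distrib)
    also have "\<dots> \<le> fact j / c ^ j * exp (c * s x)"
      using c s0[of x] by (intro mult_left_mono power_le_exp) auto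
    finally have "s x ^ j * exp (c * s x) \<le> fact j / c ^ j * exp (c * s x) * exp (c * s x)"
      by (rule mult_right_mono) simp
    also have "\<dots> = fact j / c ^ j * exp (2 * c * s x)" by (simp add: exp_add[symmetric])
    finally show ?thesis .
  qed
  have intj: "integrable M (\<lambda>x. C *\<^sub>R (exp (2 * c * s x) *\<^sub>R g x))" for C
    by (rule integrable_scaleR_right) (rule int)
  have "(LINT x|M. s x ^ j *\<^sub>R (exp (- (real n * (c * s x))) *\<^sub>R g x)) = 0" for j
  proof (induction n arbitrary: j)
    case 0
    then show ?case using zero by simp
  next
    case (Suc n)
    define h where "h x = exp (- (real n * (c * s x))) *\<^sub>R g x" for x
    have [measurable]: "h \<in> borel_measurable M" unfolding h_def by measurable
    have hg: "norm (h x) \<le> norm (g x)" for x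
      using c s0[of x] by (auto simp: h_def intro!: mult_left_le_one_le)
    have dom: "norm ((s x ^ i * E) *\<^sub>R h x) \<le> norm ((fact i / c ^ i) *\<^sub>R (exp (2 * c * s x) *\<^sub>R g x))"
      if "\<bar>E\<bar> \<le> exp (c * s x)" for x E i
    proof -
      have "\<bar>s x ^ i * E\<bar> \<le> s x ^ i * exp (c * s x)"
        using that s0[of x] by (simp add: abs_mult mult_left_mono)
      also have "\<dots> \<le> fact i / c ^ i * exp (2 * c * s x)" by (rule bd)
      finally have "\<bar>s x ^ i * E\<bar> * norm (h x) \<le> fact i / c ^ i * exp (2 * c * s x) * norm (g x)"
        using hg[of x] c by (intro mult_mono) auto
      then show ?thesis using c by (simp add: abs_mult mult.assoc)
    qed
    have inti: "integrable M (\<lambda>x. s x ^ i *\<^sub>R h x)" for i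
      by (rule Bochner_Integration.integrable_bound[OF intj[of "fact i / c ^ i"]])
         (use dom[of 1] c s0 in \<open>auto intro!: AE_I2\<close>)
    have part: "(LINT x|M. (s x ^ j * (\<Sum>i<N. (- (c * s x)) ^ i / fact i)) *\<^sub>R h x) = 0" for N
    proof -
      have "(LINT x|M. (s x ^ j * (\<Sum>i<N. (- (c * s x)) ^ i / fact i)) *\<^sub>R h x)
          = (LINT x|M. (\<Sum>i<N. ((- c) ^ i / fact i) *\<^sub>R (s x ^ (j + i) *\<^sub>R h x)))"
      proof (rule Bochner_Integration.integral_cong[OF refl])
        fix x
        have "s x ^ j * (\<Sum>i<N. (- (c * s x)) ^ i / fact i) = (\<Sum>i<N. ((- c) ^ i / fact i) * s x ^ (j + i))"
          unfolding sum_distrib_left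
          by (intro sum.cong refl) (simp add: power_add power_mult_distrib[symmetric])
        then show "(s x ^ j * (\<Sum>i<N. (- (c * s x)) ^ i / fact i)) *\<^sub>R h x
            = (\<Sum>i<N. ((- c) ^ i / fact i) *\<^sub>R (s x ^ (j + i) *\<^sub>R h x))"
          by (simp add: scaleR_sum_left)
      qed
      also have "\<dots> = 0"
      proof -
        have "(LINT x|M. s x ^ i *\<^sub>R h x) = 0" for i using Suc.IH[of i] by (simp only: h_def)
        then show ?thesis
          by (subst Bochner_Integration.integral_sum) (auto simp: inti simp del: scaleR_scaleR)
      qed
      finally show ?thesis .
    qed
    have "(\<lambda>N. LINT x|M. (s x ^ j * (\<Sum>i<N. (- (c * s x)) ^ i / fact i)) *\<^sub>R h x)
        \<longlonglongrightarrow> (LINT x|M. (s x ^ j * exp (- (c * s x))) *\<^sub>R h x)"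
    proof (rule integral_dominated_convergence[where w = "\<lambda>x. norm ((fact j / c ^ j) *\<^sub>R (exp (2 * c * s x) *\<^sub>R g x))"])
      show "AE x in M. (\<lambda>N. (s x ^ j * (\<Sum>i<N. (- (c * s x)) ^ i / fact i)) *\<^sub>R h x)
          \<longlonglongrightarrow> (s x ^ j * exp (- (c * s x))) *\<^sub>R h x"
      proof (intro AE_I2 tendsto_scaleR tendsto_mult tendsto_const)
        fix x
        show "(\<lambda>N. \<Sum>i<N. (- (c * s x)) ^ i / fact i) \<longlonglongrightarrow> exp (- (c * s x))"
          using exp_converges[of "- (c * s x)"] by (simp add: sums_def divide_inverse mult.commute)
      qed
      show "AE x in M. norm ((s x ^ j * (\<Sum>i<N. (- (c * s x)) ^ i / fact i)) *\<^sub>R h x)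
          \<le> norm ((fact j / c ^ j) *\<^sub>R (exp (2 * c * s x) *\<^sub>R g x))" for N
        by (intro AE_I2 dom exp_partial_sum_le) (use c s0 in auto)
      show "integrable M (\<lambda>x. norm ((fact j / c ^ j) *\<^sub>R (exp (2 * c * s x) *\<^sub>R g x)))"
        by (intro integrable_norm intj)
    qed simp_all
    then have "(LINT x|M. (s x ^ j * exp (- (c * s x))) *\<^sub>R h x) = 0"
      by (simp add: part LIMSEQ_const_iff)
    moreover have "(s x ^ j * exp (- (c * s x))) *\<^sub>R h x = s x ^ j *\<^sub>R (exp (- (real (Suc n) * (c * s x))) *\<^sub>R g x)" for x
      by (simp add: h_def exp_add[symmetric] algebra_simps)
    ultimately show ?case by simp
  qed
  from this[of 0] show ?thesis by simp
qed

section \<open>Integrability of radial functions\<close>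

lemma powr_dyadic_bound:
  fixes u t \<beta> :: real
  assumes "t > 0" "t / 2 \<le> u" "u \<le> 2 * t"
  shows "u powr \<beta> \<le> 2 powr \<bar>\<beta>\<bar> * t powr \<beta>"
proof (cases "\<beta> \<ge> 0")
  case True
  then have "u powr \<beta> \<le> (2 * t) powr \<beta>" using assms by (intro powr_mono2) auto
  then show ?thesis using True assms by (simp add: powr_mult)
next
  case False
  then have "u powr \<beta> \<le> (t / 2) powr \<beta>" using assms by (intro powr_mono2') auto
  then show ?thesis using False assms by (simp add: powr_divide powr_minus field_simps)
qed

text \<open>
  On the shell of radius about \<open>r\<^sup>n\<close> the function is comparable to
  \<open>r\<^bsup>n \<beta>\<^esup>\<close> and the volume to \<open>r\<^bsup>n N\<^esup>\<close>, so the integral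
  is dominated by a geometric series. Radii \<open>r = 1/2\<close> and \<open>r = 2\<close> treat the singularity
  at the origin and the decay at infinity.
\<close>

lemma nn_integral_norm_powr_shells:
  fixes r \<beta> :: real
  assumes r: "r > 0" and lt: "r powr (\<beta> + real DIM('a::euclidean_space)) < 1"
    and S: "S \<in> sets borel" "\<And>x. x \<in> S \<Longrightarrow> \<exists>n::nat. r ^ n / 2 \<le> norm x \<and> norm x \<le> 2 * r ^ n"
  shows "(\<integral>\<^sup>+x. ennreal (norm x powr \<beta>) * indicator S (x::'a) \<partial>lborel) < \<infinity>"
proof -
  define N where "N = DIM('a)"
  define K where "K = 2 powr \<bar>\<beta>\<bar> * (unit_ball_vol N * 2 ^ N)"
  define q where "q = r powr (\<beta> + real N)"
  have K0: "0 \<le> K" by (simp add: K_def)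
  have q: "0 < q" "q < 1" using r lt by (simp_all add: q_def N_def)
  let ?A = "\<lambda>n::nat. {x::'a. r ^ n / 2 \<le> norm x \<and> norm x \<le> 2 * r ^ n}"
  have A[measurable]: "?A n \<in> sets borel" for n by measurable
  have shell: "(\<integral>\<^sup>+x. ennreal (norm x powr \<beta>) * indicator (?A n) x \<partial>lborel) \<le> ennreal (K * q ^ n)" for n
  proof -
    have "(\<integral>\<^sup>+x. ennreal (norm x powr \<beta>) * indicator (?A n) x \<partial>lborel)
        \<le> (\<integral>\<^sup>+x. ennreal (2 powr \<bar>\<beta>\<bar> * (r ^ n) powr \<beta>) * indicator (cball 0 (2 * r ^ n)) (x::'a) \<partial>lborel)"
      using r by (intro nn_integral_mono) (auto simp: indicator_def intro!: ennreal_leI powr_dyadic_bound)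
    also have "\<dots> = ennreal (2 powr \<bar>\<beta>\<bar> * (r ^ n) powr \<beta>) * ennreal (unit_ball_vol N * (2 * r ^ n) ^ N)"
      using r by (subst nn_integral_cmult_indicator) (auto simp: emeasure_cball N_def)
    also have "\<dots> = ennreal (2 powr \<bar>\<beta>\<bar> * (r ^ n) powr \<beta> * (unit_ball_vol N * (2 * r ^ n) ^ N))"
      using r by (subst ennreal_mult) auto
    also have "2 powr \<bar>\<beta>\<bar> * (r ^ n) powr \<beta> * (unit_ball_vol N * (2 * r ^ n) ^ N) = K * q ^ n"
    proof -
      have "(r ^ n) powr \<beta> * (r ^ n) ^ N = (r ^ n) powr (\<beta> + real N)"
        using r by (simp add: powr_add powr_realpow)
      also have "\<dots> = q ^ n"
        using r by (simp add: q_def powr_realpow[symmetric] powr_powr mult.commute)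
      finally show ?thesis by (simp add: K_def power_mult_distrib mult.assoc mult.left_commute)
    qed
    finally show ?thesis .
  qed
  have "(\<integral>\<^sup>+x. ennreal (norm x powr \<beta>) * indicator S x \<partial>lborel)
      \<le> (\<integral>\<^sup>+x. (\<Sum>n. ennreal (norm x powr \<beta>) * indicator (?A n) (x::'a)) \<partial>lborel)"
  proof (rule nn_integral_mono)
    fix x :: 'a
    show "ennreal (norm x powr \<beta>) * indicator S x \<le> (\<Sum>n. ennreal (norm x powr \<beta>) * indicator (?A n) x)"
    proof (cases "x \<in> S")
      case True
      then obtain n where n: "x \<in> ?A n" using S(2) by blast
      have "ennreal (norm x powr \<beta>) * indicator S x \<le> (\<Sum>n\<in>{n}. ennreal (norm x powr \<beta>) * indicator (?A n) x)"
        using n by (simp add: indicator_def)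
      also have "\<dots> \<le> (\<Sum>n. ennreal (norm x powr \<beta>) * indicator (?A n) x)"
        by (rule sum_le_suminf) auto
      finally show ?thesis .
    qed simp
  qed
  also have "\<dots> = (\<Sum>n. \<integral>\<^sup>+x. ennreal (norm x powr \<beta>) * indicator (?A n) (x::'a) \<partial>lborel)"
    by (rule nn_integral_suminf) measurable
  also have "\<dots> \<le> (\<Sum>n. ennreal (K * q ^ n))"
    by (intro suminf_le allI shell) auto
  also have "\<dots> = ennreal (\<Sum>n. K * q ^ n)"
    using q K0 by (intro suminf_ennreal2) (auto intro!: summable_mult summable_geometric)
  also have "\<dots> < \<infinity>" by simp
  finally show ?thesis .
qed

lemma nn_integral_norm_powr_ball:
  assumes "\<beta> + real DIM('a::euclidean_space) > 0"
  shows "(\<integral>\<^sup>+x. ennreal (norm x powr \<beta>) * indicator (cball 0 1 - {0}) (x::'a) \<partial>lborel) < \<infinity>"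
proof (rule nn_integral_norm_powr_shells[where r = "1/2"])
  show "(1/2) powr (\<beta> + real DIM('a)) < 1"
    using powr_less_mono2[OF assms, of "1/2" 1] by simp
  fix x :: 'a assume x: "x \<in> cball 0 1 - {0}"
  define y where "y = - log 2 (norm x)"
  have y: "0 \<le> y" using x by (simp add: y_def)
  have ny: "norm x = 2 powr (- y)" using x by (simp add: y_def)
  define n where "n = nat \<lfloor>y\<rfloor>"
  have n: "real n \<le> y" "y \<le> real n + 1" using y unfolding n_def by linarith+
  have p: "(1/2) ^ n = 2 powr (- real n)" by (simp add: powr_minus powr_realpow power_one_over inverse_eq_divide)
  have "(1/2) ^ n / 2 = 2 powr (- (real n + 1))" unfolding p by (simp add: powr_diff)
  also have "\<dots> \<le> norm x" unfolding ny using n by (intro powr_mono) auto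
  finally have 1: "(1/2) ^ n / 2 \<le> norm x" .
  have "norm x \<le> 2 powr (- real n)" unfolding ny using n by (intro powr_mono) auto
  then have "norm x \<le> 2 * (1/2) ^ n" unfolding p using powr_ge_zero[of 2 "- real n"] by linarith
  with 1 show "\<exists>n. (1/2) ^ n / 2 \<le> norm x \<and> norm x \<le> 2 * (1/2) ^ n" by blast
qed auto

lemma nn_integral_norm_powr_outside:
  assumes "\<beta> + real DIM('a::euclidean_space) < 0"
  shows "(\<integral>\<^sup>+x. ennreal (norm x powr \<beta>) * indicator (- cball 0 1) (x::'a) \<partial>lborel) < \<infinity>"
proof (rule nn_integral_norm_powr_shells[where r = "2"])
  show "2 powr (\<beta> + real DIM('a)) < 1"
    using powr_less_mono[OF assms, of 2] by simp
  fix x :: 'a assume x: "x \<in> - cball 0 1"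
  define y where "y = log 2 (norm x)"
  have x1: "1 < norm x" using x by simp
  then have y: "0 \<le> y" unfolding y_def by (subst zero_le_log_cancel_iff) linarith+
  have ny: "norm x = 2 powr y" unfolding y_def by (subst powr_log_cancel; use x1 in linarith)
  define n where "n = nat \<lfloor>y\<rfloor>"
  have n: "real n \<le> y" "y \<le> real n + 1" using y unfolding n_def by linarith+
  have p: "2 ^ n = 2 powr real n" by (simp add: powr_realpow)
  have "2 powr real n \<le> norm x" unfolding ny using n by (intro powr_mono) auto
  then have 1: "2 ^ n / 2 \<le> norm x" unfolding p using powr_ge_zero[of 2 "real n"] by linarith
  have "norm x \<le> 2 powr (real n + 1)" unfolding ny using n by (intro powr_mono) auto
  then have "norm x \<le> 2 * 2 ^ n" unfolding p by (simp add: powr_add)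
  with 1 show "\<exists>n. 2 ^ n / 2 \<le> norm x \<and> norm x \<le> 2 * 2 ^ n" by blast
qed auto

lemma powr_le_const_exp:
  fixes b c :: real
  assumes "0 \<le> b" "0 < c"
  shows "\<exists>K>0. \<forall>t\<ge>0. t powr b \<le> K * exp (c * t)"
proof -
  obtain n :: nat where n: "b \<le> real n" using real_arch_simple by blast
  have "t powr b \<le> (1 + fact n / c ^ n) * exp (c * t)" if t: "0 \<le> t" for t
  proof -
    have e1: "1 \<le> exp (c * t)" using assms t by simp
    have "t powr b \<le> 1 + t ^ n"
    proof (cases "t \<le> 1")
      case True
      then have "t powr b \<le> 1" using t assms(1) powr_mono2[of b t 1] by simp
      then show ?thesis using t by (simp add: add_increasing2)
    next
      case False
      then have "t powr b \<le> t powr real n" using n by (intro powr_mono) auto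
      then show ?thesis using False by (simp add: powr_realpow)
    qed
    also have "t ^ n \<le> fact n / c ^ n * exp (c * t)"
    proof -
      have "(\<Sum>i\<in>{n}. (c * t) ^ i /\<^sub>R fact i) \<le> (\<Sum>i. (c * t) ^ i /\<^sub>R fact i)"
        using assms t by (intro sum_le_suminf summable_exp_generic) auto
      then have "(c * t) ^ n / fact n \<le> exp (c * t)" by (simp add: exp_def divide_inverse mult.commute)
      then have "fact n / c ^ n * ((c * t) ^ n / fact n) \<le> fact n / c ^ n * exp (c * t)"
        using assms by (intro mult_left_mono) auto
      then show ?thesis using assms by (simp add: power_mult_distrib)
    qed
    finally show ?thesis using e1 unfolding distrib_right by linarith
  qed
  moreover have "0 < 1 + fact n / c ^ n" using assms by (simp add: add_pos_pos)
  ultimately show ?thesis by blast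
qed

lemma norm_powr_le_const_exp:
  fixes b c a :: real
  assumes "0 \<le> b" "0 < c" "0 < a"
  shows "\<exists>K>0. \<forall>x :: 'a :: real_normed_vector. norm x powr b \<le> K * exp (c * norm x powr a)"
proof -
  obtain K where K: "K > 0" "\<And>t. 0 \<le> t \<Longrightarrow> t powr (b / a) \<le> K * exp (c * t)"
    using powr_le_const_exp[of "b / a" c] assms by auto
  have "norm x powr b \<le> K * exp (c * norm x powr a)" for x :: 'a
    using K(2)[of "norm x powr a"] assms by (simp add: powr_powr)
  then show ?thesis using K(1) by blast
qed

text \<open>
  Inside the unit ball the exponential is bounded; outside, it beats every power, in particular
  \<open>|x| powr (\<delta> + N + 1)\<close>, and \<open>|x| powr (- N - 1)\<close> is integrable there.
\<close>

lemma integrable_norm_powr_exp: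
  fixes \<delta> c a :: real
  assumes d: "\<delta> + real DIM('a::euclidean_space) > 0" and c: "c > 0" and a: "a > 0"
  shows "integrable lborel (\<lambda>x::'a. norm x powr \<delta> * exp (- (c * norm x powr a)))"
proof -
  define N where "N = real DIM('a)"
  obtain K where K: "K > 0" "\<And>x::'a. norm x powr (\<delta> + N + 1) \<le> K * exp (c * norm x powr a)"
    using norm_powr_le_const_exp[of "\<delta> + N + 1" c a, where 'a = 'a] d c a unfolding N_def by auto
  have [measurable]: "cball 0 1 - {0::'a} \<in> sets borel" "- cball (0::'a) 1 \<in> sets borel" by auto
  have out: "norm x powr \<delta> * exp (- (c * norm x powr a)) \<le> K * norm x powr (- (N + 1))"
    if "x \<noteq> 0" for x :: 'a
  proof -
    have "norm x powr \<delta> = norm x powr (\<delta> + N + 1) * norm x powr (- (N + 1))"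
      by (simp add: powr_add[symmetric])
    also have "\<dots> \<le> K * exp (c * norm x powr a) * norm x powr (- (N + 1))"
      by (intro mult_right_mono K) simp
    finally have "norm x powr \<delta> * exp (- (c * norm x powr a)) \<le>
        K * exp (c * norm x powr a) * norm x powr (- (N + 1)) * exp (- (c * norm x powr a))"
      by (rule mult_right_mono) simp
    then show ?thesis by (simp add: exp_minus field_simps)
  qed
  have "(\<integral>\<^sup>+x. ennreal (norm (x::'a) powr \<delta> * exp (- (c * norm x powr a))) \<partial>lborel) \<le>
      (\<integral>\<^sup>+x. ennreal (norm (x::'a) powr \<delta>) * indicator (cball 0 1 - {0}) x
        + ennreal K * (ennreal (norm x powr (- (N + 1))) * indicator (- cball 0 1) x) \<partial>lborel)"
  proof (rule nn_integral_mono)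
    fix x :: 'a
    consider "x = 0" | "x \<noteq> 0" "norm x \<le> 1" | "norm x > 1" by linarith
    then show "ennreal (norm x powr \<delta> * exp (- (c * norm x powr a))) \<le>
      ennreal (norm x powr \<delta>) * indicator (cball 0 1 - {0}) x
        + ennreal K * (ennreal (norm x powr (- (N + 1))) * indicator (- cball 0 1) x)"
    proof cases
      case 2
      then show ?thesis using c by (auto simp: indicator_def intro!: ennreal_leI mult_right_le_one_le)
    next
      case 3
      then have "x \<noteq> 0" by auto
      from ennreal_leI[OF out[OF this]] 3 K(1) show ?thesis by (simp add: indicator_def ennreal_mult)
    qed simp
  qed
  also have "\<dots> = (\<integral>\<^sup>+x. ennreal (norm (x::'a) powr \<delta>) * indicator (cball 0 1 - {0}) x \<partial>lborel)
      + ennreal K * (\<integral>\<^sup>+x. ennreal (norm (x::'a) powr (- (N + 1))) * indicator (- cball 0 1) x \<partial>lborel)"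
    by (subst nn_integral_add) (auto simp: nn_integral_cmult)
  also have "\<dots> < \<infinity>"
    using nn_integral_norm_powr_ball[OF d] nn_integral_norm_powr_outside[where 'a = 'a, of "- (N + 1)"]
    by (simp add: N_def ennreal_mult_less_top)
  finally show ?thesis by (intro integrableI_bounded) auto
qed

section \<open>The weighted measure\<close>

lemma nn_integral_lborel_translate:
  fixes f :: "'a::euclidean_space \<Rightarrow> ennreal"
  assumes [measurable]: "f \<in> borel_measurable borel"
  shows "(\<integral>\<^sup>+x. f (c + x) \<partial>lborel) = (\<integral>\<^sup>+x. f x \<partial>lborel)"
proof -
  have "(\<integral>\<^sup>+x. f x \<partial>lborel) = (\<integral>\<^sup>+x. f x \<partial>distr lborel borel ((+) c))"
    by (simp add: lborel_distr_plus)
  also have "\<dots> = (\<integral>\<^sup>+x. f (c + x) \<partial>lborel)" by (subst nn_integral_distr) auto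
  finally show ?thesis by simp
qed

text \<open>
  Convolution with the indicator of the unit ball, which is invariant under \<open>r\<close>: the total mass of
  the convolution is \<open>\<integral>f \<cdot> vol\<close> by translation invariance and Fubini, whether
  \<open>f\<close> or \<open>f \<circ> r\<close> is used.
\<close>

lemma nn_integral_lborel_isometry:
  fixes r :: "'a::euclidean_space \<Rightarrow> 'a"
  assumes lin: "linear r" and inv: "\<And>x. r (r x) = x" and iso: "\<And>x. norm (r x) = norm x"
    and f[measurable]: "f \<in> borel_measurable borel"
  shows "(\<integral>\<^sup>+x. f (r x) \<partial>lborel) = (\<integral>\<^sup>+x. f x \<partial>lborel)"
proof -
  have [measurable]: "r \<in> borel_measurable borel"
    by (intro borel_measurable_continuous_onI linear_continuous_on linear_conv_bounded_linear[THEN iffD1] lin)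
  define g :: "'a \<Rightarrow> ennreal" where "g = indicator (ball 0 1)"
  have [measurable]: "g \<in> borel_measurable borel" unfolding g_def by (intro borel_measurable_indicator) simp
  define b where "b = (\<integral>\<^sup>+x. g x \<partial>lborel)"
  have b: "b = ennreal (unit_ball_vol DIM('a))" unfolding b_def g_def by (simp add: emeasure_ball)
  have "0 < unit_ball_vol (real DIM('a))" by simp
  then have b': "b \<noteq> 0" "b \<noteq> \<infinity>" unfolding b by (metis ennreal_eq_0_iff not_le, simp)
  have radd: "r (x + y) = r x + r y" for x y using lin by (rule linear_add)
  have "(\<integral>\<^sup>+x. f (r x) \<partial>lborel) * b = (\<integral>\<^sup>+y. (\<integral>\<^sup>+x. f (r x) * g y \<partial>lborel) \<partial>lborel)"
    unfolding b_def by (simp add: nn_integral_multc nn_integral_cmult)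
  also have "\<dots> = (\<integral>\<^sup>+y. (\<integral>\<^sup>+x. f (y + r x) * g y \<partial>lborel) \<partial>lborel)"
  proof (rule nn_integral_cong)
    fix y
    have "(\<integral>\<^sup>+x. f (r (r y + x)) * g y \<partial>lborel) = (\<integral>\<^sup>+x. f (r x) * g y \<partial>lborel)"
      by (rule nn_integral_lborel_translate) measurable
    then show "(\<integral>\<^sup>+x. f (r x) * g y \<partial>lborel) = (\<integral>\<^sup>+x. f (y + r x) * g y \<partial>lborel)"
      by (simp add: radd inv)
  qed
  also have "\<dots> = (\<integral>\<^sup>+x. (\<integral>\<^sup>+y. f (y + r x) * g y \<partial>lborel) \<partial>lborel)"
    by (rule lborel_pair.Fubini') measurable
  also have "\<dots> = (\<integral>\<^sup>+x. (\<integral>\<^sup>+y. f y * g (y - r x) \<partial>lborel) \<partial>lborel)"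
  proof (rule nn_integral_cong)
    fix x
    have "(\<integral>\<^sup>+y. f (r x + y) * g (r x + y - r x) \<partial>lborel) = (\<integral>\<^sup>+y. f y * g (y - r x) \<partial>lborel)"
      by (rule nn_integral_lborel_translate) measurable
    then show "(\<integral>\<^sup>+y. f (y + r x) * g y \<partial>lborel) = (\<integral>\<^sup>+y. f y * g (y - r x) \<partial>lborel)"
      by (simp add: add.commute)
  qed
  also have "\<dots> = (\<integral>\<^sup>+y. (\<integral>\<^sup>+x. f y * g (y - r x) \<partial>lborel) \<partial>lborel)"
    by (rule lborel_pair.Fubini') measurable
  also have "\<dots> = (\<integral>\<^sup>+y. f y * b \<partial>lborel)"
  proof (rule nn_integral_cong)
    fix y
    have "(\<integral>\<^sup>+x. f y * g (y - r (r y + x)) \<partial>lborel) = (\<integral>\<^sup>+x. f y * g (y - r x) \<partial>lborel)"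
      by (rule nn_integral_lborel_translate) measurable
    moreover have "g (y - r (r y + x)) = g x" for x
      by (simp add: radd inv g_def indicator_def iso)
    ultimately show "(\<integral>\<^sup>+x. f y * g (y - r x) \<partial>lborel) = f y * b"
      by (simp add: b_def nn_integral_cmult)
  qed
  also have "\<dots> = (\<integral>\<^sup>+y. f y \<partial>lborel) * b" by (simp add: nn_integral_multc)
  finally show ?thesis using b' by (simp add: mult.commute[of _ b] ennreal_mult_cancel_left)
qed

lemma lborel_distr_reflection: "distr lborel borel (reflection \<alpha>) = (lborel :: (real ^ 'n) measure)"
proof (rule measure_eqI)
  have [measurable]: "reflection \<alpha> \<in> borel_measurable borel"
    by (intro borel_measurable_continuous_onI linear_continuous_on linear_conv_bounded_linear[THEN iffD1] linear_reflection)
  fix A assume "A \<in> sets (distr lborel borel (reflection \<alpha>))"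
  then have [measurable]: "A \<in> sets borel" by simp
  have "emeasure (distr lborel borel (reflection \<alpha>)) A = (\<integral>\<^sup>+x. indicator A x \<partial>distr lborel borel (reflection \<alpha>))"
    by simp
  also have "\<dots> = (\<integral>\<^sup>+x. indicator A (reflection \<alpha> x) \<partial>lborel)" by (subst nn_integral_distr) auto
  also have "\<dots> = emeasure lborel A"
    by (subst nn_integral_lborel_isometry[OF linear_reflection]) auto
  finally show "emeasure (distr lborel borel (reflection \<alpha>)) A = emeasure lborel A" .
qed simp

lemma borel_measurable_reflection [measurable]: "reflection \<alpha> \<in> borel_measurable borel"
  by (intro borel_measurable_continuous_onI linear_continuous_on linear_conv_bounded_linear[THEN iffD1] linear_reflection)

lemma integral_lborel_reflection:
  fixes f :: "real ^ 'n \<Rightarrow> complex"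
  assumes [measurable]: "f \<in> borel_measurable borel"
  shows "(LINT x|lborel. f (reflection \<alpha> x)) = (LINT x|lborel. f x)"
proof -
  have "(LINT x|lborel. f x) = (LINT x|distr lborel borel (reflection \<alpha>). f x)"
    by (simp add: lborel_distr_reflection)
  also have "\<dots> = (LINT x|lborel. f (reflection \<alpha> x))" by (subst integral_distr) auto
  finally show ?thesis by simp
qed

lemma AE_off_hyperplane:
  fixes \<alpha> :: "real ^ 'n"
  assumes "\<alpha> \<noteq> 0"
  shows "AE x in lborel. \<alpha> \<bullet> x \<noteq> 0"
proof -
  have "{x. \<alpha> \<bullet> x = 0} \<in> null_sets (completion lborel)"
    using negligible_hyperplane[of \<alpha> 0] assms by (simp add: negligible_iff_null_sets)
  moreover have "{x. \<alpha> \<bullet> x = 0} \<in> sets lborel" by (simp add: closed_hyperplane)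
  ultimately have "{x. \<alpha> \<bullet> x = 0} \<in> null_sets lborel" by (simp add: null_sets_completion_iff)
  from AE_not_in[OF this] show ?thesis by simp
qed

text \<open>
  Growth slower than \<open>e\<^bsup>c |x|\<^sup>a\<^esup>\<close> for every \<open>c > 0\<close>. The class is an
  algebra that contains the polynomials, and its elements become integrable when multiplied by
  \<open>exp (- c |x|\<^sup>a)\<close> and the weight.
\<close>

definition subexp :: "real \<Rightarrow> ('a::real_normed_vector \<Rightarrow> 'b::real_normed_vector) \<Rightarrow> bool" where
  "subexp a F \<longleftrightarrow> (\<forall>c>0. \<exists>K. \<forall>x. norm (F x) \<le> K * exp (c * norm x powr a))"

lemma subexpI: "(\<And>c. c > 0 \<Longrightarrow> \<exists>K. \<forall>x. norm (F x) \<le> K * exp (c * norm x powr a)) \<Longrightarrow> subexp a F"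
  by (simp add: subexp_def)

lemma subexp_mono:
  assumes "subexp a F" "\<And>x. norm (G x) \<le> C * norm (F x)" "0 \<le> C"
  shows "subexp a G"
proof (rule subexpI)
  fix c :: real assume "c > 0"
  then obtain K where K: "\<And>x. norm (F x) \<le> K * exp (c * norm x powr a)" using assms(1) by (auto simp: subexp_def)
  have "norm (G x) \<le> (C * K) * exp (c * norm x powr a)" for x
    using order_trans[OF assms(2) mult_left_mono[OF K assms(3)]] by (simp add: mult.assoc)
  then show "\<exists>K. \<forall>x. norm (G x) \<le> K * exp (c * norm x powr a)" by blast
qed

lemma subexp_mult_bound:
  assumes F: "subexp a F" and G: "subexp a G" and H: "\<And>x. norm (H x) \<le> norm (F x) * norm (G x)"
  shows "subexp a H"
proof (rule subexpI)
  fix c :: real assume "c > 0"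
  then have c2: "c / 2 > 0" by simp
  obtain K where K: "\<And>x. norm (F x) \<le> K * exp (c / 2 * norm x powr a)" using F c2 unfolding subexp_def by blast
  obtain L where L: "\<And>x. norm (G x) \<le> L * exp (c / 2 * norm x powr a)" using G c2 unfolding subexp_def by blast
  have "norm (H x) \<le> (K * L) * exp (c * norm x powr a)" for x
  proof -
    have "norm (H x) \<le> (K * exp (c / 2 * norm x powr a)) * (L * exp (c / 2 * norm x powr a))"
      by (rule order_trans[OF H mult_mono'[OF K L]]) auto
    also have "\<dots> = (K * L) * (exp (c / 2 * norm x powr a) * exp (c / 2 * norm x powr a))" by (simp add: algebra_simps)
    also have "\<dots> = (K * L) * exp (c * norm x powr a)" by (simp add: exp_add[symmetric])
    finally show ?thesis .
  qed
  then show "\<exists>K. \<forall>x. norm (H x) \<le> K * exp (c * norm x powr a)" by blast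
qed

lemma subexp_mult:
  fixes F G :: "'a::real_normed_vector \<Rightarrow> 'b::real_normed_algebra"
  shows "subexp a F \<Longrightarrow> subexp a G \<Longrightarrow> subexp a (\<lambda>x. F x * G x)"
  by (erule (1) subexp_mult_bound) (rule norm_mult_ineq)

lemma subexp_add:
  assumes F: "subexp a F" and G: "subexp a G"
  shows "subexp a (\<lambda>x. F x + G x)"
proof (rule subexpI)
  fix c :: real assume c: "c > 0"
  obtain K where K: "\<And>x. norm (F x) \<le> K * exp (c * norm x powr a)" using F c unfolding subexp_def by blast
  obtain L where L: "\<And>x. norm (G x) \<le> L * exp (c * norm x powr a)" using G c unfolding subexp_def by blast
  have "norm (F x + G x) \<le> (K + L) * exp (c * norm x powr a)" for x
    using norm_triangle_le[OF add_mono[OF K L]] by (simp add: algebra_simps)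
  then show "\<exists>K. \<forall>x. norm (F x + G x) \<le> K * exp (c * norm x powr a)" by blast
qed

lemma subexp_const: "subexp a (\<lambda>x. c)"
proof (rule subexpI)
  fix d :: real assume "d > 0"
  then have "norm c \<le> norm c * exp (d * norm x powr a)" for x :: 'a
    using mult_left_mono[of 1 "exp (d * norm x powr a)" "norm c"] by simp
  then show "\<exists>K. \<forall>x :: 'a. norm c \<le> K * exp (d * norm x powr a)" by blast
qed

lemma subexp_norm_powr:
  assumes "0 < a" "0 \<le> b"
  shows "subexp a (\<lambda>x. norm x powr b)"
proof (rule subexpI)
  fix c :: real assume "c > 0"
  then show "\<exists>K. \<forall>x :: 'a. norm (norm x powr b) \<le> K * exp (c * norm x powr a)"
    using norm_powr_le_const_exp[of b c a] assms by auto
qed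

lemma subexp_norm: "0 < a \<Longrightarrow> subexp a (\<lambda>x. norm x)"
  using subexp_norm_powr[of a 1] by (simp add: powr_one_gt_zero_iff)

lemma subexp_bounded: "(\<And>x. norm (F x) \<le> C) \<Longrightarrow> subexp a F"
  by (rule subexp_mono[OF subexp_const[of a "1::real"], of _ C]) (auto intro: order_trans[OF norm_ge_zero])

lemma cpoly_subexp:
  assumes "0 < a" "cpoly f"
  shows "subexp a f"
  using assms(2)
proof (induction rule: cpoly.induct)
  case (cpoly_coord i)
  show ?case
    by (rule subexp_mono[OF subexp_norm[OF assms(1)], of _ 1]) (auto simp: component_le_norm_cart)
qed (auto intro: subexp_const subexp_add subexp_mult)

lemma poly_subexp:
  assumes "0 < a"
  shows "subexp a (\<lambda>x. poly q (c * norm x powr a) :: real)"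
proof (induction q)
  case (pCons b q)
  then show ?case
    by (simp only: poly_pCons) (intro subexp_add subexp_mult subexp_const subexp_norm_powr assms less_imp_le)
qed (simp add: subexp_const)

lemma subexp_prod:
  fixes F :: "'i \<Rightarrow> 'a::real_normed_vector \<Rightarrow> 'b::{real_normed_algebra_1,comm_monoid_mult}"
  assumes "\<And>i. i \<in> I \<Longrightarrow> subexp a (F i)"
  shows "subexp a (\<lambda>x. \<Prod>i\<in>I. F i x)"
  using assms by (induction I rule: infinite_finite_induct) (auto intro: subexp_const subexp_mult)

lemma subexp_of_real: "subexp a F \<Longrightarrow> subexp a (\<lambda>x. of_real (F x) :: complex)"
  by (erule subexp_mono[of _ _ _ 1]) auto

lemma subexp_cnj: "subexp a F \<Longrightarrow> subexp a (\<lambda>x. cnj (F x))"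
  by (erule subexp_mono[of _ _ _ 1]) auto

lemma dunkl_weight_scale:
  assumes t: "t > 0" and R: "finite R"
  shows "dunkl_weight R k a (t *\<^sub>R x) = t powr (a - 2 + (\<Sum>\<alpha>\<in>R. k \<alpha>)) * dunkl_weight R k a x"
proof -
  have "(\<Prod>\<alpha>\<in>R. \<bar>\<alpha> \<bullet> (t *\<^sub>R x)\<bar> powr k \<alpha>) = (\<Prod>\<alpha>\<in>R. t powr k \<alpha>) * (\<Prod>\<alpha>\<in>R. \<bar>\<alpha> \<bullet> x\<bar> powr k \<alpha>)"
    using t by (simp add: abs_mult powr_mult prod.distrib)
  also have "(\<Prod>\<alpha>\<in>R. t powr k \<alpha>) = t powr (\<Sum>\<alpha>\<in>R. k \<alpha>)" using t by (simp add: powr_sum R)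
  finally show ?thesis using t by (simp add: dunkl_weight_def powr_mult powr_add)
qed

lemma borel_measurable_dunkl_weight [measurable]: "dunkl_weight R k a \<in> borel_measurable borel"
  unfolding dunkl_weight_def[abs_def] by measurable

lemma dunkl_weight_nonneg: "0 \<le> dunkl_weight R k a x"
  by (simp add: dunkl_weight_def prod_nonneg)

lemma sets_dunkl_measure [simp, measurable_cong]: "sets (dunkl_measure R k a) = sets borel"
  by (simp add: dunkl_measure_def)

lemma space_dunkl_measure [simp]: "space (dunkl_measure R k a) = UNIV"
  by (simp add: dunkl_measure_def)

lemma AE_dunkl_measure_nonzero: "AE x in dunkl_measure R k a. x \<noteq> 0"
  unfolding dunkl_measure_def
  by (subst AE_density) (auto simp: dunkl_weight_def intro!: AE_I2)

lemma integral_dunkl_measure: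
  fixes f :: "real ^ 'n \<Rightarrow> complex"
  assumes [measurable]: "f \<in> borel_measurable borel"
  shows "(LINT x|dunkl_measure R k a. f x) = (LINT x|lborel. dunkl_weight R k a x *\<^sub>R f x)"
    and "integrable (dunkl_measure R k a) f \<longleftrightarrow> integrable lborel (\<lambda>x. dunkl_weight R k a x *\<^sub>R f x)"
  unfolding dunkl_measure_def
  by (subst integral_density; simp add: dunkl_weight_nonneg) (subst integrable_density; simp add: dunkl_weight_nonneg)

lemma dunkl_weight_bound:
  assumes "\<And>\<alpha>. \<alpha> \<in> R \<Longrightarrow> 0 \<le> k \<alpha>"
  shows "dunkl_weight R k a x \<le> (\<Prod>\<alpha>\<in>R. norm \<alpha> powr k \<alpha>) * norm x powr (a - 2 + (\<Sum>\<alpha>\<in>R. k \<alpha>))"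
proof (cases "x = 0")
  case False
  have "(\<Prod>\<alpha>\<in>R. \<bar>\<alpha> \<bullet> x\<bar> powr k \<alpha>) \<le> (\<Prod>\<alpha>\<in>R. norm \<alpha> powr k \<alpha> * norm x powr k \<alpha>)"
  proof (rule prod_mono)
    fix \<alpha> assume "\<alpha> \<in> R"
    then have "\<bar>\<alpha> \<bullet> x\<bar> powr k \<alpha> \<le> (norm \<alpha> * norm x) powr k \<alpha>"
      using assms by (intro powr_mono2 Cauchy_Schwarz_ineq2) auto
    then show "0 \<le> \<bar>\<alpha> \<bullet> x\<bar> powr k \<alpha> \<and> \<bar>\<alpha> \<bullet> x\<bar> powr k \<alpha> \<le> norm \<alpha> powr k \<alpha> * norm x powr k \<alpha>"
      by (simp add: powr_mult)
  qed
  also have "\<dots> \<le> (\<Prod>\<alpha>\<in>R. norm \<alpha> powr k \<alpha>) * norm x powr (\<Sum>\<alpha>\<in>R. k \<alpha>)"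
    using False by (cases "finite R") (simp_all add: prod.distrib powr_sum)
  finally have "dunkl_weight R k a x \<le> norm x powr (a - 2) * ((\<Prod>\<alpha>\<in>R. norm \<alpha> powr k \<alpha>) * norm x powr (\<Sum>\<alpha>\<in>R. k \<alpha>))"
    unfolding dunkl_weight_def by (intro mult_left_mono) auto
  then show ?thesis by (simp add: powr_add mult.left_commute)
qed (simp add: dunkl_weight_def)

text \<open>
  The density is at most a constant times \<open>|x|\<close> to its degree of homogeneity, so the condition on the
  degree is exactly integrability at the origin.
\<close>

lemma integrable_dunkl_measure:
  fixes F :: "real ^ 'n \<Rightarrow> complex"
  assumes k: "\<And>\<alpha>. \<alpha> \<in> R \<Longrightarrow> 0 \<le> k \<alpha>" and a: "0 < a" and pos: "a - 2 + (\<Sum>\<alpha>\<in>R. k \<alpha>) + real CARD('n) > 0"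
    and [measurable]: "F \<in> borel_measurable borel" and F: "subexp a F" and c: "0 < c"
  shows "integrable (dunkl_measure R k a) (\<lambda>x. F x * of_real (exp (- (c * norm x powr a))))"
proof -
  let ?s = "a - 2 + (\<Sum>\<alpha>\<in>R. k \<alpha>)" and ?C = "\<Prod>\<alpha>\<in>R. norm \<alpha> powr k \<alpha>"
  obtain K where K: "\<And>x. norm (F x) \<le> K * exp (c / 2 * norm x powr a)"
    using F c unfolding subexp_def by (metis half_gt_zero)
  have K0: "0 \<le> K" using order_trans[OF norm_ge_zero K[of 0]] by (simp add: zero_le_mult_iff)
  have C0: "0 \<le> ?C" by (simp add: prod_nonneg)
  have int: "integrable lborel (\<lambda>x::real^'n. (?C * K) * (norm x powr ?s * exp (- (c / 2 * norm x powr a))))"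
    using integrable_norm_powr_exp[of ?s "c / 2" a, where 'a = "real ^ 'n"] pos a c
    by (intro integrable_mult_right) simp
  have "integrable lborel (\<lambda>x. dunkl_weight R k a x *\<^sub>R (F x * of_real (exp (- (c * norm x powr a)))))"
  proof (rule Bochner_Integration.integrable_bound[OF int])
    show "AE x in lborel. norm (dunkl_weight R k a x *\<^sub>R (F x * of_real (exp (- (c * norm x powr a)))))
        \<le> norm ((?C * K) * (norm x powr ?s * exp (- (c / 2 * norm x powr a))))"
    proof (intro AE_I2)
      fix x
      have "dunkl_weight R k a x * (norm (F x) * exp (- (c * norm x powr a)))
          \<le> (?C * norm x powr ?s) * ((K * exp (c / 2 * norm x powr a)) * exp (- (c * norm x powr a)))"
        using K0 C0 by (intro mult_mono mult_right_mono K dunkl_weight_bound k mult_nonneg_nonneg dunkl_weight_nonneg) auto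
      also have "exp (c / 2 * norm x powr a) * exp (- (c * norm x powr a)) = exp (- (c / 2 * norm x powr a))"
        by (simp add: exp_add[symmetric])
      then have "(?C * norm x powr ?s) * ((K * exp (c / 2 * norm x powr a)) * exp (- (c * norm x powr a)))
          = (?C * K) * (norm x powr ?s * exp (- (c / 2 * norm x powr a)))"
        by (simp add: mult.assoc mult.left_commute)
      finally show "norm (dunkl_weight R k a x *\<^sub>R (F x * of_real (exp (- (c * norm x powr a)))))
          \<le> norm ((?C * K) * (norm x powr ?s * exp (- (c / 2 * norm x powr a))))"
        using K0 C0 by (simp add: norm_mult abs_mult dunkl_weight_nonneg prod_nonneg)
    qed
  qed measurable
  then show ?thesis by (subst integral_dunkl_measure(2)) auto
qed

section \<open>Integration by parts\<close>

lemma integrable_gaussian: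
  fixes F :: "real ^ 'n \<Rightarrow> 'b::{banach, second_countable_topology, real_normed_algebra_1}"
  assumes [measurable]: "F \<in> borel_measurable borel" and F: "subexp 2 F" and c: "0 < c"
  shows "integrable lborel (\<lambda>x. exp (- (c * (x \<bullet> x))) *\<^sub>R F x)"
proof -
  obtain K where K: "\<And>x. norm (F x) \<le> K * exp (c / 2 * norm x powr 2)"
    using F c unfolding subexp_def by (metis half_gt_zero)
  have n2: "norm x powr 2 = x \<bullet> x" for x :: "real ^ 'n"
    by (simp add: power2_norm_eq_inner powr_numeral)
  have "integrable lborel (\<lambda>x::real^'n. norm x powr 0 * exp (- (c / 2 * norm x powr 2)))"
    using c by (intro integrable_norm_powr_exp) auto
  then have int: "integrable lborel (\<lambda>x::real^'n. K * (norm x powr 0 * exp (- (c / 2 * norm x powr 2))))"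
    by (rule integrable_mult_right)
  show ?thesis
  proof (rule Bochner_Integration.integrable_bound[OF int])
    show "AE x in lborel. norm (exp (- (c * (x \<bullet> x))) *\<^sub>R F x) \<le> norm (K * (norm x powr 0 * exp (- (c / 2 * norm x powr 2))))"
      using AE_lborel_singleton[of "0 :: real ^ 'n"]
    proof eventually_elim
      fix x :: "real ^ 'n" assume x: "x \<noteq> 0"
      have "exp (- (c * (x \<bullet> x))) * norm (F x) \<le> exp (- (c * (x \<bullet> x))) * (K * exp (c / 2 * (x \<bullet> x)))"
        using K[of x] by (intro mult_left_mono) (auto simp: n2)
      also have "\<dots> = K * exp (- (c / 2 * (x \<bullet> x)))"
        by (simp add: exp_add[symmetric] mult.left_commute)
      finally show "norm (exp (- (c * (x \<bullet> x))) *\<^sub>R F x) \<le> norm (K * (norm x powr 0 * exp (- (c / 2 * norm x powr 2))))"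
        using x by (simp add: n2 abs_mult order_trans[OF _ mult_right_mono[OF abs_ge_self]])
    qed
  qed measurable
qed

text \<open>
  The integral of a difference quotient vanishes by translation invariance. The Gaussian bound on the derivative
  dominates the difference quotients of step at most \<open>1\<close>, because
  \<open>|x|\<^sup>2 \<le> 2 |x + s \<xi>|\<^sup>2 + 2\<close> for \<open>|s| \<le> 1\<close>.
\<close>

lemma integral_derivative_zero:
  fixes H H' :: "real ^ 'n \<Rightarrow> complex"
  assumes deriv: "\<And>x. ((\<lambda>t. H (x + t *\<^sub>R \<xi>)) has_vector_derivative H' x) (at 0)"
    and [measurable]: "H \<in> borel_measurable borel" "H' \<in> borel_measurable borel"
    and int: "integrable lborel H"
    and bound: "\<And>x. norm (H' x) \<le> K * exp (- (c * (x \<bullet> x)))" and c: "0 < c" and \<xi>: "norm \<xi> = 1"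
  shows "(LINT x|lborel. H' x) = 0"
proof -
  define h where "h n = inverse (real (Suc n))" for n
  have h: "0 < h n" "h n \<le> 1" for n by (auto simp: h_def inverse_le_1_iff)
  have h0: "h \<longlonglongrightarrow> 0" unfolding h_def[abs_def] by (rule LIMSEQ_inverse_real_of_nat)
  have K0: "0 \<le> K" using order_trans[OF norm_ge_zero bound[of 0]] by simp
  have deriv': "((\<lambda>t. H (x + t *\<^sub>R \<xi>)) has_vector_derivative H' (x + s *\<^sub>R \<xi>)) (at s within S)" for x s S
  proof -
    have "((\<lambda>t. H ((x + s *\<^sub>R \<xi>) + t *\<^sub>R \<xi>)) has_vector_derivative H' (x + s *\<^sub>R \<xi>)) (at (s - s))"
      using deriv[of "x + s *\<^sub>R \<xi>"] by simp
    moreover have "((\<lambda>t. t - s) has_vector_derivative 1 - 0) (at s)"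
      by (intro has_vector_derivative_diff has_vector_derivative_id has_vector_derivative_const)
    ultimately have "((\<lambda>t. H ((x + s *\<^sub>R \<xi>) + (t - s) *\<^sub>R \<xi>)) has_vector_derivative H' (x + s *\<^sub>R \<xi>)) (at s)"
      using vector_diff_chain_at[of "\<lambda>t. t - s" 1 s "\<lambda>t. H ((x + s *\<^sub>R \<xi>) + t *\<^sub>R \<xi>)" "H' (x + s *\<^sub>R \<xi>)"]
      by (simp add: o_def)
    then show ?thesis by (simp add: algebra_simps has_vector_derivative_at_within)
  qed
  define D where "D n x = (1 / h n) *\<^sub>R (H (x + h n *\<^sub>R \<xi>) - H x)" for n x
  have tr: "(LINT x|lborel. H (x + v)) = (LINT x|lborel. H x)" "integrable lborel (\<lambda>x. H (x + v))" for v
  proof -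
    have "(LINT x|lborel. H x) = (LINT x|distr lborel borel ((+) v). H x)" by (simp add: lborel_distr_plus)
    also have "\<dots> = (LINT x|lborel. H (v + x))" by (subst integral_distr) auto
    finally show "(LINT x|lborel. H (x + v)) = (LINT x|lborel. H x)" by (simp add: add.commute)
    have "integrable (distr lborel borel ((+) v)) H" using int by (simp add: lborel_distr_plus)
    then show "integrable lborel (\<lambda>x. H (x + v))" by (subst (asm) integrable_distr_eq) (auto simp: add.commute)
  qed
  have Dint: "(LINT x|lborel. D n x) = 0" for n
    unfolding D_def using tr int by (subst integral_scaleR_right) (auto simp: Bochner_Integration.integral_diff)
  have Dbound: "norm (D n x) \<le> K * exp c * exp (- (c / 2 * (x \<bullet> x)))" for n x
  proof -
    have "norm (H (x + h n *\<^sub>R \<xi>) - H (x + 0 *\<^sub>R \<xi>)) \<le> (K * exp c * exp (- (c / 2 * (x \<bullet> x)))) * norm (h n - 0)"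
    proof (rule differentiable_bound[where S = "{0..1}" and f = "\<lambda>t. H (x + t *\<^sub>R \<xi>)" and f' = "\<lambda>s t. t *\<^sub>R H' (x + s *\<^sub>R \<xi>)"])
      show "convex {0..1::real}" by simp
      fix s :: real assume s: "s \<in> {0..1}"
      show "((\<lambda>t. H (x + t *\<^sub>R \<xi>)) has_derivative (\<lambda>t. t *\<^sub>R H' (x + s *\<^sub>R \<xi>))) (at s within {0..1})"
        using deriv' by (simp add: has_vector_derivative_def)
      have "norm x \<le> norm (x + s *\<^sub>R \<xi>) + 1"
        using norm_triangle_ineq4[of "x + s *\<^sub>R \<xi>" "s *\<^sub>R \<xi>"] s \<xi> by simp
      then have "(norm x)\<^sup>2 \<le> (norm (x + s *\<^sub>R \<xi>) + 1)\<^sup>2" by (intro power_mono) auto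
      also have "\<dots> \<le> 2 * (norm (x + s *\<^sub>R \<xi>))\<^sup>2 + 2"
        using sum_squares_bound[of "norm (x + s *\<^sub>R \<xi>)" 1] by (simp add: power2_sum)
      finally have q: "x \<bullet> x \<le> 2 * ((x + s *\<^sub>R \<xi>) \<bullet> (x + s *\<^sub>R \<xi>)) + 2" by (simp add: power2_norm_eq_inner)
      have "c / 2 * (x \<bullet> x) \<le> c / 2 * (2 * ((x + s *\<^sub>R \<xi>) \<bullet> (x + s *\<^sub>R \<xi>)) + 2)"
        using q c by (intro mult_left_mono) auto
      then have "- (c * ((x + s *\<^sub>R \<xi>) \<bullet> (x + s *\<^sub>R \<xi>))) \<le> c + - (c / 2 * (x \<bullet> x))"
        by (simp add: algebra_simps)
      then have "exp (- (c * ((x + s *\<^sub>R \<xi>) \<bullet> (x + s *\<^sub>R \<xi>)))) \<le> exp c * exp (- (c / 2 * (x \<bullet> x)))"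
        unfolding exp_add[symmetric] by simp
      then have "norm (H' (x + s *\<^sub>R \<xi>)) \<le> K * exp c * exp (- (c / 2 * (x \<bullet> x)))"
        using order_trans[OF bound mult_left_mono[OF _ K0]] by (simp add: mult.assoc)
      then show "onorm (\<lambda>t. t *\<^sub>R H' (x + s *\<^sub>R \<xi>)) \<le> K * exp c * exp (- (c / 2 * (x \<bullet> x)))"
        by (intro onorm_le) (simp add: mult.commute mult_left_mono)
    qed (use h[of n] in auto)
    then have "norm (H (x + h n *\<^sub>R \<xi>) - H x) \<le> (K * exp c * exp (- (c / 2 * (x \<bullet> x)))) * h n"
      using h[of n] by simp
    then show ?thesis
      unfolding D_def norm_scaleR using h[of n] by (simp add: pos_divide_le_eq)
  qed
  have "(\<lambda>n. LINT x|lborel. D n x) \<longlonglongrightarrow> (LINT x|lborel. H' x)"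
  proof (rule integral_dominated_convergence[where w = "\<lambda>x. K * exp c * exp (- (c / 2 * (x \<bullet> x)))"])
    show "AE x in lborel. (\<lambda>n. D n x) \<longlonglongrightarrow> H' x"
    proof (intro AE_I2)
      fix x
      have "((\<lambda>t. (1 / norm (t - 0)) *\<^sub>R (H (x + t *\<^sub>R \<xi>) - (H (x + 0 *\<^sub>R \<xi>) + (t - 0) *\<^sub>R H' x))) \<longlongrightarrow> 0) (at 0)"
        using deriv[of x] unfolding has_vector_derivative_def has_derivative_at2 by blast
      moreover have "filterlim h (at 0) sequentially"
        using h h0 by (auto simp: filterlim_at less_imp_neq[symmetric] intro!: always_eventually)
      ultimately have "(\<lambda>n. (1 / norm (h n - 0)) *\<^sub>R (H (x + h n *\<^sub>R \<xi>) - (H (x + 0 *\<^sub>R \<xi>) + (h n - 0) *\<^sub>R H' x))) \<longlonglongrightarrow> 0"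
        by (rule filterlim_compose)
      moreover have "(1 / norm (h n - 0)) *\<^sub>R (H (x + h n *\<^sub>R \<xi>) - (H (x + 0 *\<^sub>R \<xi>) + (h n - 0) *\<^sub>R H' x)) = D n x - H' x" for n
        using h[of n] by (simp add: D_def scaleR_diff_right scaleR_add_right)
      ultimately show "(\<lambda>n. D n x) \<longlonglongrightarrow> H' x" by (simp add: LIM_zero_iff)
    qed
    have "integrable lborel (\<lambda>x::real^'n. exp (- (c / 2 * (x \<bullet> x))) *\<^sub>R (1::real))"
      using c by (intro integrable_gaussian subexp_const) auto
    then show "integrable lborel (\<lambda>x::real^'n. K * exp c * exp (- (c / 2 * (x \<bullet> x))))" by simp
  qed (use Dbound in \<open>auto simp: D_def\<close>)
  then show ?thesis by (simp add: Dint LIMSEQ_const_iff)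
qed

lemma has_vector_derivative_along_line:
  assumes "(f has_derivative f') (at x)"
  shows "((\<lambda>t. f (x + t *\<^sub>R \<xi>)) has_vector_derivative f' \<xi>) (at 0)"
proof -
  have "((\<lambda>t. x + t *\<^sub>R \<xi>) has_derivative (\<lambda>t. t *\<^sub>R \<xi>)) (at (0::real))"
    by (auto intro!: derivative_eq_intros)
  from has_derivative_compose[OF this, of f f'] assms
  have "((\<lambda>t. f (x + t *\<^sub>R \<xi>)) has_derivative (\<lambda>t. f' (t *\<^sub>R \<xi>))) (at 0)" by simp
  moreover have "(\<lambda>t. f' (t *\<^sub>R \<xi>)) = (\<lambda>t. t *\<^sub>R f' \<xi>)"
    using has_derivative_bounded_linear[OF assms] by (simp add: bounded_linear.linear linear_scale)
  ultimately show ?thesis by (simp add: has_vector_derivative_def)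
qed

context dunkl_setting
begin

lemma sum_R_reflection:
  assumes "\<beta> \<in> R"
  shows "(\<Sum>\<alpha>\<in>R. f (reflection \<beta> \<alpha>)) = (\<Sum>\<alpha>\<in>R. f \<alpha>)"
  by (rule sum.reindex_bij_witness[of _ "reflection \<beta>" "reflection \<beta>"]) (auto intro: reflection_R assms)

lemma prod_R_reflection:
  assumes "\<beta> \<in> R"
  shows "(\<Prod>\<alpha>\<in>R. f (reflection \<beta> \<alpha>)) = (\<Prod>\<alpha>\<in>R. f \<alpha>)"
  by (rule prod.reindex_bij_witness[of _ "reflection \<beta>" "reflection \<beta>"]) (auto intro: reflection_R assms)

text \<open>
  A regularization of the weight for \<open>a = 2\<close>, obtained by replacing each
  \<open>|\<alpha> \<bullet> x|\<^sup>2\<close> by \<open>(\<alpha> \<bullet> x)\<^sup>2 + \<epsilon>\<close>. For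
  small multiplicities the weight itself is not differentiable on the reflecting hyperplanes and its gradient is
  unbounded there. The regularization, for which integration by parts is straightforward, is smooth, invariant
  under the reflections and increasing in \<open>\<epsilon>\<close>.
\<close>

definition smooth_weight :: "real \<Rightarrow> real ^ 'n \<Rightarrow> real" where
  "smooth_weight \<epsilon> x = exp (\<Sum>\<alpha>\<in>R. k \<alpha> / 2 * ln ((\<alpha> \<bullet> x)\<^sup>2 + \<epsilon>))"

lemma smooth_weight_pos: "0 < smooth_weight \<epsilon> x"
  by (simp add: smooth_weight_def)

lemma borel_measurable_smooth_weight [measurable]: "smooth_weight \<epsilon> \<in> borel_measurable borel"
  unfolding smooth_weight_def[abs_def] by measurable

lemma smooth_weight_reflection:
  assumes "\<beta> \<in> R"
  shows "smooth_weight \<epsilon> (reflection \<beta> x) = smooth_weight \<epsilon> x"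
proof -
  have "(\<Sum>\<alpha>\<in>R. k \<alpha> / 2 * ln ((\<alpha> \<bullet> reflection \<beta> x)\<^sup>2 + \<epsilon>)) =
      (\<Sum>\<alpha>\<in>R. k (reflection \<beta> \<alpha>) / 2 * ln ((reflection \<beta> \<alpha> \<bullet> x)\<^sup>2 + \<epsilon>))"
    using assms by (intro sum.cong refl) (simp add: inner_reflection_sym k_reflection)
  also have "\<dots> = (\<Sum>\<alpha>\<in>R. k \<alpha> / 2 * ln ((\<alpha> \<bullet> x)\<^sup>2 + \<epsilon>))"
    by (rule sum_R_reflection[OF assms, of "\<lambda>\<alpha>. k \<alpha> / 2 * ln ((\<alpha> \<bullet> x)\<^sup>2 + \<epsilon>)"])
  finally show ?thesis by (simp add: smooth_weight_def)
qed

lemma dunkl_weight_reflection: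
  assumes "\<beta> \<in> R"
  shows "dunkl_weight R k a (reflection \<beta> x) = dunkl_weight R k a x"
proof -
  have "(\<Prod>\<alpha>\<in>R. \<bar>\<alpha> \<bullet> reflection \<beta> x\<bar> powr k \<alpha>) = (\<Prod>\<alpha>\<in>R. \<bar>reflection \<beta> \<alpha> \<bullet> x\<bar> powr k (reflection \<beta> \<alpha>))"
    using assms by (intro prod.cong refl) (simp add: inner_reflection_sym k_reflection)
  also have "\<dots> = (\<Prod>\<alpha>\<in>R. \<bar>\<alpha> \<bullet> x\<bar> powr k \<alpha>)"
    by (rule prod_R_reflection[OF assms, of "\<lambda>\<alpha>. \<bar>\<alpha> \<bullet> x\<bar> powr k \<alpha>"])
  finally show ?thesis by (simp add: dunkl_weight_def)
qed

lemma smooth_weight_has_derivative: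
  assumes \<epsilon>: "0 < \<epsilon>"
  shows "(smooth_weight \<epsilon> has_derivative
    (\<lambda>h. smooth_weight \<epsilon> x * (\<Sum>\<alpha>\<in>R. k \<alpha> * (\<alpha> \<bullet> x) * (\<alpha> \<bullet> h) / ((\<alpha> \<bullet> x)\<^sup>2 + \<epsilon>)))) (at x)"
proof -
  have "((\<lambda>x. k \<alpha> / 2 * ln ((\<alpha> \<bullet> x)\<^sup>2 + \<epsilon>)) has_derivative
      (\<lambda>h. k \<alpha> * (\<alpha> \<bullet> x) * (\<alpha> \<bullet> h) / ((\<alpha> \<bullet> x)\<^sup>2 + \<epsilon>))) (at x)" for \<alpha>
  proof -
    have pos: "0 < (\<alpha> \<bullet> x)\<^sup>2 + \<epsilon>" using \<epsilon> by (simp add: add_nonneg_pos)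
    have "((\<lambda>x. (\<alpha> \<bullet> x)\<^sup>2 + \<epsilon>) has_derivative (\<lambda>h. 2 * (\<alpha> \<bullet> x) * (\<alpha> \<bullet> h))) (at x)"
      by (auto intro!: derivative_eq_intros)
    note D = has_derivative_mult_right[OF has_derivative_ln[OF pos this], of "k \<alpha> / 2"]
    show ?thesis
      by (rule has_derivative_eq_rhs[OF D]) (simp add: fun_eq_iff inverse_eq_divide)
  qed
  then have "((\<lambda>x. \<Sum>\<alpha>\<in>R. k \<alpha> / 2 * ln ((\<alpha> \<bullet> x)\<^sup>2 + \<epsilon>)) has_derivative
      (\<lambda>h. \<Sum>\<alpha>\<in>R. k \<alpha> * (\<alpha> \<bullet> x) * (\<alpha> \<bullet> h) / ((\<alpha> \<bullet> x)\<^sup>2 + \<epsilon>))) (at x)"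
    by (rule has_derivative_sum)
  from has_derivative_exp[OF this] show ?thesis
    unfolding smooth_weight_def[abs_def] by (simp add: mult.commute)
qed

lemma smooth_weight_mono:
  assumes "0 < \<epsilon>" "\<epsilon> \<le> \<delta>"
  shows "smooth_weight \<epsilon> x \<le> smooth_weight \<delta> x"
proof -
  have pos: "0 < (\<alpha> \<bullet> x)\<^sup>2 + \<epsilon>" for \<alpha> using assms by (simp add: add_nonneg_pos)
  have "k \<alpha> / 2 * ln ((\<alpha> \<bullet> x)\<^sup>2 + \<epsilon>) \<le> k \<alpha> / 2 * ln ((\<alpha> \<bullet> x)\<^sup>2 + \<delta>)" if "\<alpha> \<in> R" for \<alpha>
    using pos[of \<alpha>] assms nonneg[OF that] by (intro mult_left_mono ln_mono) auto
  then show ?thesis unfolding smooth_weight_def exp_le_cancel_iff by (rule sum_mono)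
qed

lemma subexp_smooth_weight_1: "subexp 2 (smooth_weight 1)"
proof -
  have pos: "0 < (\<alpha> \<bullet> x)\<^sup>2 + 1" for \<alpha> x :: "real ^ 'n" by (simp add: add_nonneg_pos)
  have "subexp 2 (\<lambda>x. ((\<alpha> \<bullet> x)\<^sup>2 + 1) powr (k \<alpha> / 2))" if \<alpha>: "\<alpha> \<in> R" for \<alpha>
  proof (rule subexpI)
    fix c :: real assume c: "c > 0"
    have q: "0 < (norm \<alpha>)\<^sup>2 + 1" by (simp add: add_nonneg_pos)
    define c' where "c' = c / ((norm \<alpha>)\<^sup>2 + 1)"
    have c': "c' > 0" using c q by (simp add: c'_def)
    obtain K where K: "K > 0" "\<And>t. 0 \<le> t \<Longrightarrow> t powr (k \<alpha> / 2) \<le> K * exp (c' * t)"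
      using powr_le_const_exp[of "k \<alpha> / 2" c'] nonneg[OF \<alpha>] c' by auto
    have "((\<alpha> \<bullet> x)\<^sup>2 + 1) powr (k \<alpha> / 2) \<le> (K * exp c') * exp (c * norm x powr 2)" for x
    proof -
      have "(\<alpha> \<bullet> x)\<^sup>2 \<le> (norm \<alpha>)\<^sup>2 * (norm x)\<^sup>2"
        using Cauchy_Schwarz_ineq2[of \<alpha> x] by (metis abs_le_square_iff abs_mult abs_norm_cancel power_mult_distrib)
      also have "\<dots> \<le> ((norm \<alpha>)\<^sup>2 + 1) * (norm x)\<^sup>2" by (intro mult_right_mono) auto
      finally have "c' * ((\<alpha> \<bullet> x)\<^sup>2 + 1) \<le> c' * (((norm \<alpha>)\<^sup>2 + 1) * (norm x)\<^sup>2 + 1)"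
        using c' by (intro mult_left_mono) auto
      also have "\<dots> = c' + c * (norm x)\<^sup>2" using q by (simp add: c'_def distrib_left)
      finally have "exp (c' * ((\<alpha> \<bullet> x)\<^sup>2 + 1)) \<le> exp c' * exp (c * (norm x)\<^sup>2)"
        by (simp add: exp_add[symmetric])
      then have "K * exp (c' * ((\<alpha> \<bullet> x)\<^sup>2 + 1)) \<le> K * (exp c' * exp (c * (norm x)\<^sup>2))"
        using K(1) by (intro mult_left_mono) auto
      then show ?thesis
        using K(2)[of "(\<alpha> \<bullet> x)\<^sup>2 + 1"] pos[of \<alpha> x] by (simp add: powr_numeral)
    qed
    then show "\<exists>K. \<forall>x. norm (((\<alpha> \<bullet> x)\<^sup>2 + 1) powr (k \<alpha> / 2)) \<le> K * exp (c * norm x powr 2)"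
      by auto
  qed
  then have "subexp 2 (\<lambda>x. \<Prod>\<alpha>\<in>R. ((\<alpha> \<bullet> x)\<^sup>2 + 1) powr (k \<alpha> / 2))"
    by (rule subexp_prod)
  moreover have "smooth_weight 1 = (\<lambda>x. \<Prod>\<alpha>\<in>R. ((\<alpha> \<bullet> x)\<^sup>2 + 1) powr (k \<alpha> / 2))"
    using pos finite_R by (auto simp: smooth_weight_def fun_eq_iff exp_sum powr_def less_imp_neq[symmetric])
  ultimately show ?thesis by simp
qed

lemma subexp_smooth_weight:
  assumes "0 < \<epsilon>" "\<epsilon> \<le> 1"
  shows "subexp 2 (smooth_weight \<epsilon>)"
  using smooth_weight_mono[OF assms] smooth_weight_pos
  by (intro subexp_mono[OF subexp_smooth_weight_1, of _ 1]) (auto simp: less_imp_le abs_of_pos)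

lemma AE_generic: "AE x in lborel. x \<noteq> (0 :: real ^ 'n) \<and> (\<forall>\<alpha>\<in>R. \<alpha> \<bullet> x \<noteq> 0)"
proof -
  have "AE x in lborel. \<forall>\<alpha>\<in>R. \<alpha> \<bullet> x \<noteq> 0"
    using zero_notin_R by (subst AE_finite_all[OF finite_R]) (auto intro!: AE_off_hyperplane)
  with AE_lborel_singleton[of "0 :: real ^ 'n"] show ?thesis by eventually_elim auto
qed

lemma smooth_weight_tendsto:
  assumes x: "x \<noteq> 0" and gen: "\<And>\<alpha>. \<alpha> \<in> R \<Longrightarrow> \<alpha> \<bullet> x \<noteq> 0" and h: "h \<longlonglongrightarrow> 0"
  shows "(\<lambda>n. smooth_weight (h n) x) \<longlonglongrightarrow> dunkl_weight R k 2 x"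
proof -
  have "(\<lambda>n. smooth_weight (h n) x) \<longlonglongrightarrow> exp (\<Sum>\<alpha>\<in>R. k \<alpha> / 2 * ln ((\<alpha> \<bullet> x)\<^sup>2 + 0))"
    unfolding smooth_weight_def
    by (intro tendsto_intros h) (use gen in auto)
  also have "exp (\<Sum>\<alpha>\<in>R. k \<alpha> / 2 * ln ((\<alpha> \<bullet> x)\<^sup>2 + 0)) = (\<Prod>\<alpha>\<in>R. \<bar>\<alpha> \<bullet> x\<bar> powr k \<alpha>)"
  proof -
    have "exp (k \<alpha> / 2 * ln ((\<alpha> \<bullet> x)\<^sup>2 + 0)) = \<bar>\<alpha> \<bullet> x\<bar> powr k \<alpha>" if "\<alpha> \<in> R" for \<alpha>
    proof -
      have "ln ((\<alpha> \<bullet> x)\<^sup>2) = 2 * ln \<bar>\<alpha> \<bullet> x\<bar>"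
        using gen[OF that] by (metis ln_realpow power2_abs zero_less_abs_iff of_nat_numeral)
      then show ?thesis using gen[OF that] by (simp add: powr_def)
    qed
    then show ?thesis using finite_R by (simp add: exp_sum)
  qed
  also have "\<dots> = dunkl_weight R k 2 x" using x by (simp add: dunkl_weight_def)
  finally show ?thesis .
qed

lemma integrable_smooth_gaussian:
  assumes F[measurable]: "F \<in> borel_measurable borel" and sF: "subexp 2 F" and c: "0 < c" and \<epsilon>: "0 < \<epsilon>" "\<epsilon> \<le> 1"
  shows "integrable lborel (\<lambda>x. (exp (- (c * (x \<bullet> x))) * smooth_weight \<epsilon> x) *\<^sub>R (F x :: complex))"
proof -
  have "integrable lborel (\<lambda>x. exp (- (c * (x \<bullet> x))) *\<^sub>R (of_real (smooth_weight \<epsilon> x) * F x))"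
    by (intro integrable_gaussian c subexp_mult sF subexp_of_real subexp_smooth_weight \<epsilon>) measurable
  then show ?thesis by (simp add: scaleR_conv_of_real mult.assoc)
qed

lemma singular_factor_bound:
  assumes "0 < \<epsilon>"
  shows "\<bar>(\<alpha> \<bullet> x) / ((\<alpha> \<bullet> x)\<^sup>2 + \<epsilon>)\<bar> \<le> norm \<alpha> / \<epsilon> * norm x"
proof -
  have "\<epsilon> \<le> (\<alpha> \<bullet> x)\<^sup>2 + \<epsilon>" by simp
  then have "\<bar>\<alpha> \<bullet> x\<bar> / ((\<alpha> \<bullet> x)\<^sup>2 + \<epsilon>) \<le> (norm \<alpha> * norm x) / \<epsilon>"
    using assms by (intro frac_le Cauchy_Schwarz_ineq2) auto
  then show ?thesis using assms by (simp add: abs_divide add_nonneg_pos abs_of_pos)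
qed

lemma subexp_singular_factor:
  assumes "0 < \<epsilon>"
  shows "subexp 2 (\<lambda>x. complex_of_real ((\<alpha> \<bullet> x) / ((\<alpha> \<bullet> x)\<^sup>2 + \<epsilon>)))"
  using singular_factor_bound[OF assms, of \<alpha>] assms
  by (intro subexp_mono[OF subexp_norm[of 2], of _ "norm \<alpha> / \<epsilon>"]) (auto simp: norm_divide norm_mult simp flip: of_real_divide of_real_add of_real_power)

lemma integral_parts_smooth:
  assumes f: "cpoly f" and \<xi>: "\<xi> \<in> Basis" and c: "0 < c" and \<epsilon>: "0 < \<epsilon>" "\<epsilon> \<le> 1"
  shows "(LINT x|lborel. (exp (- (c * (x \<bullet> x))) * smooth_weight \<epsilon> x) *\<^sub>R
    (directional_derivative \<xi> f x - of_real (2 * c * (x \<bullet> \<xi>)) * f x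
      + f x * (\<Sum>\<alpha>\<in>R. of_real (k \<alpha> * (\<alpha> \<bullet> \<xi>)) * of_real ((\<alpha> \<bullet> x) / ((\<alpha> \<bullet> x)\<^sup>2 + \<epsilon>))))) = 0"
    (is "(LINT x|lborel. _ *\<^sub>R ?B x) = 0")
proof -
  have [measurable]: "f \<in> borel_measurable borel" "directional_derivative \<xi> f \<in> borel_measurable borel"
    using f cpoly_directional_derivative[OF f] by (auto intro: cpoly_borel_measurable)
  have sB: "subexp 2 ?B"
  proof -
    have "subexp 2 (\<lambda>x. directional_derivative \<xi> f x - of_real (2 * c) * (of_real (x \<bullet> \<xi>) * f x))"
      by (intro cpoly_subexp cpoly_diff cpoly_cmult cpoly_mult cpoly_inner' cpoly_directional_derivative f) simp
    moreover have "subexp 2 (\<lambda>x. f x * (\<Sum>\<alpha>\<in>R. of_real (k \<alpha> * (\<alpha> \<bullet> \<xi>)) * of_real ((\<alpha> \<bullet> x) / ((\<alpha> \<bullet> x)\<^sup>2 + \<epsilon>))))"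
    proof (rule subexp_mult)
      show "subexp 2 f" by (rule cpoly_subexp[OF _ f]) simp
      show "subexp 2 (\<lambda>x. \<Sum>\<alpha>\<in>R. complex_of_real (k \<alpha> * (\<alpha> \<bullet> \<xi>)) * of_real ((\<alpha> \<bullet> x) / ((\<alpha> \<bullet> x)\<^sup>2 + \<epsilon>)))"
        using finite_R by (induction R rule: finite_induct)
          (auto intro!: subexp_const subexp_add subexp_mult subexp_singular_factor \<epsilon> simp del: of_real_divide of_real_mult)
    qed
    ultimately show ?thesis using subexp_add by (simp add: mult.assoc)
  qed
  have sWB: "subexp 2 (\<lambda>x. of_real (smooth_weight \<epsilon> x) * ?B x)"
    by (intro subexp_mult sB subexp_of_real subexp_smooth_weight \<epsilon>)
  have "c / 2 > 0" using c by simp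
  from sWB[unfolded subexp_def, rule_format, OF this]
  obtain K where K': "\<forall>x. norm (of_real (smooth_weight \<epsilon> x) * ?B x) \<le> K * exp (c / 2 * norm x powr 2)" ..
  note K = K'[rule_format]
  show ?thesis
  proof (rule integral_derivative_zero[where c = "c / 2" and K = K and \<xi> = \<xi>
        and H = "\<lambda>x. (exp (- (c * (x \<bullet> x))) * smooth_weight \<epsilon> x) *\<^sub>R f x"])
    let ?G = "\<lambda>x. exp (- (c * (x \<bullet> x))) * smooth_weight \<epsilon> x"
    show "((\<lambda>t. ?G (x + t *\<^sub>R \<xi>) *\<^sub>R f (x + t *\<^sub>R \<xi>)) has_vector_derivative ?G x *\<^sub>R ?B x) (at 0)" for x
    proof -
      obtain f' where f': "(f has_derivative f') (at x)"
        using cpoly_differentiable[OF f, of x] by (auto simp: differentiable_def)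
      have "((\<lambda>x. exp (- (c * (x \<bullet> x)))) has_derivative (\<lambda>h. exp (- (c * (x \<bullet> x))) * (- (2 * c * (x \<bullet> h))))) (at x)"
        by (auto intro!: derivative_eq_intros simp: inner_commute algebra_simps)
      from has_derivative_scaleR[OF has_derivative_mult[OF this smooth_weight_has_derivative[OF \<epsilon>(1)]] f']
      have D: "((\<lambda>x. ?G x *\<^sub>R f x) has_derivative (\<lambda>h. ?G x *\<^sub>R f' h
          + (exp (- (c * (x \<bullet> x))) * (smooth_weight \<epsilon> x * (\<Sum>\<alpha>\<in>R. k \<alpha> * (\<alpha> \<bullet> x) * (\<alpha> \<bullet> h) / ((\<alpha> \<bullet> x)\<^sup>2 + \<epsilon>)))
            + exp (- (c * (x \<bullet> x))) * (- (2 * c * (x \<bullet> h))) * smooth_weight \<epsilon> x) *\<^sub>R f x)) (at x)" .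
      have s: "(\<Sum>\<alpha>\<in>R. k \<alpha> * (\<alpha> \<bullet> x) * (\<alpha> \<bullet> \<xi>) / ((\<alpha> \<bullet> x)\<^sup>2 + \<epsilon>)) =
          (\<Sum>\<alpha>\<in>R. k \<alpha> * (\<alpha> \<bullet> \<xi>) * ((\<alpha> \<bullet> x) / ((\<alpha> \<bullet> x)\<^sup>2 + \<epsilon>)))"
        by (simp add: mult.commute mult.left_commute)
      have s2: "(\<Sum>\<alpha>\<in>R. complex_of_real (k \<alpha> * (\<alpha> \<bullet> \<xi>)) * of_real ((\<alpha> \<bullet> x) / ((\<alpha> \<bullet> x)\<^sup>2 + \<epsilon>))) =
          of_real (\<Sum>\<alpha>\<in>R. k \<alpha> * (\<alpha> \<bullet> \<xi>) * ((\<alpha> \<bullet> x) / ((\<alpha> \<bullet> x)\<^sup>2 + \<epsilon>)))"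
        by (simp only: of_real_sum of_real_mult)
      have "?G x *\<^sub>R ?B x = ?G x *\<^sub>R f' \<xi>
          + (exp (- (c * (x \<bullet> x))) * (smooth_weight \<epsilon> x * (\<Sum>\<alpha>\<in>R. k \<alpha> * (\<alpha> \<bullet> x) * (\<alpha> \<bullet> \<xi>) / ((\<alpha> \<bullet> x)\<^sup>2 + \<epsilon>)))
            + exp (- (c * (x \<bullet> x))) * (- (2 * c * (x \<bullet> \<xi>))) * smooth_weight \<epsilon> x) *\<^sub>R f x"
        unfolding s s2 directional_derivative_eq[OF f']
        by (simp add: scaleR_conv_of_real algebra_simps)
      then show ?thesis
        by (simp only: has_vector_derivative_along_line[OF D])
    qed
    show "integrable lborel (\<lambda>x. ?G x *\<^sub>R f x)"
      by (intro integrable_smooth_gaussian cpoly_subexp f c \<epsilon>) auto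
    show "norm (?G x *\<^sub>R ?B x) \<le> K * exp (- (c / 2 * (x \<bullet> x)))" for x
    proof -
      have "norm (?G x *\<^sub>R ?B x) = exp (- (c * (x \<bullet> x))) * norm (of_real (smooth_weight \<epsilon> x) * ?B x)"
        using smooth_weight_pos[of \<epsilon> x] by (simp add: norm_mult abs_mult abs_of_pos)
      also have "\<dots> \<le> exp (- (c * (x \<bullet> x))) * (K * exp (c / 2 * (x \<bullet> x)))"
        using K[of x] by (intro mult_left_mono) (auto simp: powr_numeral power2_norm_eq_inner)
      also have "\<dots> = K * exp (- (c / 2 * (x \<bullet> x)))" by (simp add: exp_add[symmetric] mult.left_commute)
      finally show ?thesis .
    qed
  qed (use c \<xi> in \<open>auto intro!: measurable_If\<close>)
qed

end

section \<open>Orthogonality of harmonics of different degree\<close>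

lemma half_ratio_bound:
  fixes y \<epsilon> :: real
  assumes "0 \<le> y" "0 < \<epsilon>"
  shows "\<bar>y / (y + \<epsilon>) / 2\<bar> \<le> 1"
proof -
  have "0 \<le> y / (y + \<epsilon>)" "y / (y + \<epsilon>) \<le> 1" using assms by simp_all
  moreover have "\<bar>z / 2\<bar> \<le> 1" if "0 \<le> z" "z \<le> 1" for z :: real using that by simp
  ultimately show ?thesis by blast
qed

lemma subexp_sum:
  "(\<And>i. i \<in> I \<Longrightarrow> subexp a (F i)) \<Longrightarrow> subexp a (\<lambda>x. \<Sum>i\<in>I. F i x)"
  by (induction I rule: infinite_finite_induct) (auto intro: subexp_const subexp_add)

lemma integral_add_sum:
  fixes h :: "'a \<Rightarrow> complex"
  assumes "integrable M h" "\<And>i. i \<in> I \<Longrightarrow> integrable M (g i)"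
  shows "(LINT x|M. h x + (\<Sum>i\<in>I. d i * g i x)) = (LINT x|M. h x) + (\<Sum>i\<in>I. d i * (LINT x|M. g i x))"
  using assms by simp

lemma reflection_uminus: "reflection (- \<alpha>) = reflection \<alpha>"
  by (auto simp: reflection_def fun_eq_iff)

lemma directional_derivative_uminus:
  assumes "f differentiable (at x)"
  shows "directional_derivative (- \<xi>) f x = - directional_derivative \<xi> f x"
proof -
  obtain f' where f': "(f has_derivative f') (at x)" using assms by (auto simp: differentiable_def)
  then show ?thesis
    using linear_neg[OF has_derivative_linear[OF f']] by (simp add: directional_derivative_eq)
qed

lemma reflection_quotient_uminus:
  assumes "cpoly f"
  shows "reflection_quotient (- \<alpha>) f x = - reflection_quotient \<alpha> f x"
  using directional_derivative_uminus[OF cpoly_differentiable[OF assms]]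
  by (simp add: reflection_quotient_def reflection_uminus)

lemma reflection_quotient_reflection:
  assumes "\<alpha> \<noteq> 0"
  shows "reflection_quotient \<alpha> f (reflection \<alpha> x) = reflection_quotient \<alpha> f x"
proof (cases "\<alpha> \<bullet> x = 0")
  case False
  then show ?thesis
    using assms by (simp add: reflection_quotient_def inner_reflection divide_simps)
qed (simp add: reflection_perp)

text \<open>
  The Leibniz rule for the difference quotients, with its correction term written symmetrically in the two
  factors. Under the reflection the correction changes sign and so integrates to zero.
\<close>

lemma reflection_quotient_product:
  assumes "cpoly p" "cpoly q"
  shows "reflection_quotient \<alpha> (\<lambda>x. p x * q x) x =
    reflection_quotient \<alpha> p x * q x + p x * reflection_quotient \<alpha> q x
      - of_real (\<alpha> \<bullet> x) * (reflection_quotient \<alpha> p x * reflection_quotient \<alpha> q x)"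
proof (cases "\<alpha> \<bullet> x = 0")
  case True
  then show ?thesis
    using directional_derivative_mult[OF cpoly_differentiable[OF assms(1)] cpoly_differentiable[OF assms(2)], of \<alpha> x]
    by (simp add: reflection_quotient_def algebra_simps)
next
  case False
  then have ne: "complex_of_real (\<alpha> \<bullet> x) \<noteq> 0" by simp
  have 1: "of_real (\<alpha> \<bullet> x) * reflection_quotient \<alpha> (\<lambda>x. p x * q x) x =
      p x * q x - p (reflection \<alpha> x) * q (reflection \<alpha> x)"
    by (rule reflection_quotient_mult)
  have "of_real (\<alpha> \<bullet> x) * (reflection_quotient \<alpha> p x * q x + p x * reflection_quotient \<alpha> q x
      - of_real (\<alpha> \<bullet> x) * (reflection_quotient \<alpha> p x * reflection_quotient \<alpha> q x)) =
      (of_real (\<alpha> \<bullet> x) * reflection_quotient \<alpha> p x) * q x + p x * (of_real (\<alpha> \<bullet> x) * reflection_quotient \<alpha> q x)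
      - (of_real (\<alpha> \<bullet> x) * reflection_quotient \<alpha> p x) * (of_real (\<alpha> \<bullet> x) * reflection_quotient \<alpha> q x)"
    by (simp add: algebra_simps)
  also have "\<dots> = p x * q x - p (reflection \<alpha> x) * q (reflection \<alpha> x)"
    unfolding reflection_quotient_mult by (simp add: algebra_simps)
  finally show ?thesis by (rule iffD1[OF mult_left_cancel[OF ne], OF trans[OF 1 sym]])
qed

context dunkl_setting
begin

text \<open>
  The factor \<open>(\<alpha> \<bullet> x) / ((\<alpha> \<bullet> x)\<^sup>2 + \<epsilon>)\<close> is odd under
  the reflection while the weight is even, so \<open>f\<close> may be replaced by half of
  \<open>f x - f (reflection \<alpha> x)\<close>. This difference contains the factor
  \<open>\<alpha> \<bullet> x\<close>, and what remains is bounded uniformly in \<open>\<epsilon>\<close>.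
\<close>

lemma integral_singular_part:
  assumes f: "cpoly f" and \<alpha>: "\<alpha> \<in> R" and c: "0 < c" and \<epsilon>: "0 < \<epsilon>" "\<epsilon> \<le> 1"
  shows "(LINT x|lborel. (exp (- (c * (x \<bullet> x))) * smooth_weight \<epsilon> x) *\<^sub>R
      (f x * of_real ((\<alpha> \<bullet> x) / ((\<alpha> \<bullet> x)\<^sup>2 + \<epsilon>)))) =
    (LINT x|lborel. (exp (- (c * (x \<bullet> x))) * smooth_weight \<epsilon> x) *\<^sub>R
      (of_real ((\<alpha> \<bullet> x)\<^sup>2 / ((\<alpha> \<bullet> x)\<^sup>2 + \<epsilon>) / 2) * reflection_quotient \<alpha> f x))"
    (is "?I = ?J")
    and "integrable lborel (\<lambda>x. (exp (- (c * (x \<bullet> x))) * smooth_weight \<epsilon> x) *\<^sub>R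
      (f x * of_real ((\<alpha> \<bullet> x) / ((\<alpha> \<bullet> x)\<^sup>2 + \<epsilon>))))"
proof -
  define A where "A x = exp (- (c * (x \<bullet> x))) * smooth_weight \<epsilon> x" for x :: "real ^ 'n"
  define S where "S x = (\<alpha> \<bullet> x) / ((\<alpha> \<bullet> x)\<^sup>2 + \<epsilon>)" for x :: "real ^ 'n"
  have [measurable]: "A \<in> borel_measurable borel" "S \<in> borel_measurable borel"
    unfolding A_def[abs_def] S_def[abs_def] by measurable
  have \<alpha>0: "\<alpha> \<noteq> 0" using \<alpha> zero_notin_R by auto
  have Ar: "A (reflection \<alpha> x) = A x" for x by (simp add: A_def smooth_weight_reflection[OF \<alpha>])
  have Sr: "S (reflection \<alpha> x) = - S x" for x by (simp add: S_def inner_reflection[OF \<alpha>0])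
  have int: "integrable lborel (\<lambda>x. A x *\<^sub>R (g x * of_real (S x)))" if g: "cpoly g" for g
  proof -
    have [measurable]: "g \<in> borel_measurable borel" using g by (rule cpoly_borel_measurable)
    have "subexp 2 (\<lambda>x. g x * of_real (S x))"
      unfolding S_def by (intro subexp_mult subexp_singular_factor cpoly_subexp g \<epsilon>) simp
    then show ?thesis unfolding A_def by (intro integrable_smooth_gaussian c \<epsilon>) measurable
  qed
  have [measurable]: "f \<in> borel_measurable borel" using f by (rule cpoly_borel_measurable)
  show "integrable lborel (\<lambda>x. (exp (- (c * (x \<bullet> x))) * smooth_weight \<epsilon> x) *\<^sub>R (f x * of_real ((\<alpha> \<bullet> x) / ((\<alpha> \<bullet> x)\<^sup>2 + \<epsilon>))))"
    using int[OF f] by (simp only: A_def S_def)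
  have "(LINT x|lborel. A x *\<^sub>R (f x * of_real (S x))) =
      (LINT x|lborel. A (reflection \<alpha> x) *\<^sub>R (f (reflection \<alpha> x) * of_real (S (reflection \<alpha> x))))"
    by (rule integral_lborel_reflection[symmetric]) measurable
  also have "\<dots> = - (LINT x|lborel. A x *\<^sub>R (f (reflection \<alpha> x) * of_real (S x)))"
    by (simp add: Ar Sr)
  finally have "2 * (LINT x|lborel. A x *\<^sub>R (f x * of_real (S x))) =
      (LINT x|lborel. A x *\<^sub>R (f x * of_real (S x))) - (LINT x|lborel. A x *\<^sub>R (f (reflection \<alpha> x) * of_real (S x)))"
    by simp
  also have "\<dots> = (LINT x|lborel. A x *\<^sub>R (f x * of_real (S x)) - A x *\<^sub>R (f (reflection \<alpha> x) * of_real (S x)))"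
    by (rule Bochner_Integration.integral_diff[symmetric]) (intro int f cpoly_reflection)+
  also have "\<dots> = (LINT x|lborel. 2 * (A x *\<^sub>R (of_real ((\<alpha> \<bullet> x)\<^sup>2 / ((\<alpha> \<bullet> x)\<^sup>2 + \<epsilon>) / 2) * reflection_quotient \<alpha> f x)))"
  proof (rule Bochner_Integration.integral_cong[OF refl])
    fix x
    have "A x *\<^sub>R (f x * of_real (S x)) - A x *\<^sub>R (f (reflection \<alpha> x) * of_real (S x)) =
        A x *\<^sub>R (of_real (S x) * (f x - f (reflection \<alpha> x)))"
      by (simp add: scaleR_conv_of_real algebra_simps)
    also have "\<dots> = A x *\<^sub>R (of_real (S x * (\<alpha> \<bullet> x)) * reflection_quotient \<alpha> f x)"
      by (simp only: reflection_quotient_mult[symmetric] of_real_mult mult.assoc)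
    also have "S x * (\<alpha> \<bullet> x) = 2 * ((\<alpha> \<bullet> x)\<^sup>2 / ((\<alpha> \<bullet> x)\<^sup>2 + \<epsilon>) / 2)"
    proof -
      have "2 * (y / 2) = y" for y :: real by simp
      then show ?thesis by (simp only: S_def power2_eq_square times_divide_eq_left)
    qed
    finally show "A x *\<^sub>R (f x * of_real (S x)) - A x *\<^sub>R (f (reflection \<alpha> x) * of_real (S x)) =
        2 * (A x *\<^sub>R (of_real ((\<alpha> \<bullet> x)\<^sup>2 / ((\<alpha> \<bullet> x)\<^sup>2 + \<epsilon>) / 2) * reflection_quotient \<alpha> f x))"
      by (simp only: of_real_mult mult_scaleR_right mult.assoc of_real_numeral)
  qed
  also have "\<dots> = 2 * (LINT x|lborel. A x *\<^sub>R (of_real ((\<alpha> \<bullet> x)\<^sup>2 / ((\<alpha> \<bullet> x)\<^sup>2 + \<epsilon>) / 2) * reflection_quotient \<alpha> f x))"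
    by (rule integral_mult_right_zero)
  finally have "(LINT x|lborel. A x *\<^sub>R (f x * of_real (S x))) =
      (LINT x|lborel. A x *\<^sub>R (of_real ((\<alpha> \<bullet> x)\<^sup>2 / ((\<alpha> \<bullet> x)\<^sup>2 + \<epsilon>) / 2) * reflection_quotient \<alpha> f x))"
    by (rule iffD1[OF mult_left_cancel, rotated]) (rule zero_neq_numeral[symmetric])
  then show "?I = ?J" unfolding A_def S_def .
qed

lemma integral_T_smooth:
  assumes f: "cpoly f" and \<xi>: "\<xi> \<in> Basis" and c: "0 < c" and \<epsilon>: "0 < \<epsilon>" "\<epsilon> \<le> 1"
  shows "(LINT x|lborel. (exp (- (c * (x \<bullet> x))) * smooth_weight \<epsilon> x) *\<^sub>R
    (directional_derivative \<xi> f x - of_real (2 * c * (x \<bullet> \<xi>)) * f x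
      + (\<Sum>\<alpha>\<in>R. of_real (k \<alpha> * (\<alpha> \<bullet> \<xi>)) * (of_real ((\<alpha> \<bullet> x)\<^sup>2 / ((\<alpha> \<bullet> x)\<^sup>2 + \<epsilon>) / 2) * reflection_quotient \<alpha> f x)))) = 0"
proof -
  define A where "A x = exp (- (c * (x \<bullet> x))) * smooth_weight \<epsilon> x" for x :: "real ^ 'n"
  define S where "S \<alpha> x = complex_of_real ((\<alpha> \<bullet> x) / ((\<alpha> \<bullet> x)\<^sup>2 + \<epsilon>))" for \<alpha> x :: "real ^ 'n"
  define Q where "Q \<alpha> x = complex_of_real ((\<alpha> \<bullet> x)\<^sup>2 / ((\<alpha> \<bullet> x)\<^sup>2 + \<epsilon>) / 2) * reflection_quotient \<alpha> f x" for \<alpha> x :: "real ^ 'n"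
  define B where "B x = directional_derivative \<xi> f x - of_real (2 * c * (x \<bullet> \<xi>)) * f x" for x
  have cB: "cpoly B"
  proof -
    have "cpoly (\<lambda>x. directional_derivative \<xi> f x - of_real (2 * c) * (of_real (x \<bullet> \<xi>) * f x))"
      by (intro cpoly_diff cpoly_cmult cpoly_mult cpoly_inner' cpoly_directional_derivative f)
    then show ?thesis unfolding B_def[abs_def] by (simp add: mult.assoc)
  qed
  have intB: "integrable lborel (\<lambda>x. A x *\<^sub>R B x)"
    unfolding A_def using cB
    by (intro integrable_smooth_gaussian cpoly_subexp cpoly_borel_measurable c \<epsilon>) auto
  have S: "(LINT x|lborel. A x *\<^sub>R (f x * S \<alpha> x)) = (LINT x|lborel. A x *\<^sub>R Q \<alpha> x)"
    "integrable lborel (\<lambda>x. A x *\<^sub>R (f x * S \<alpha> x))" if "\<alpha> \<in> R" for \<alpha>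
    using integral_singular_part[OF f that c \<epsilon>] unfolding A_def S_def Q_def by auto
  have intQ: "integrable lborel (\<lambda>x. A x *\<^sub>R Q \<alpha> x)" if "\<alpha> \<in> R" for \<alpha>
  proof -
    have rq: "cpoly (reflection_quotient \<alpha> f)" using that zero_notin_R by (intro cpoly_reflection_quotient f) auto
    have [measurable]: "reflection_quotient \<alpha> f \<in> borel_measurable borel" using rq by (rule cpoly_borel_measurable)
    have "norm (complex_of_real ((\<alpha> \<bullet> x)\<^sup>2 / ((\<alpha> \<bullet> x)\<^sup>2 + \<epsilon>) / 2)) \<le> 1" for x
      unfolding norm_of_real by (rule half_ratio_bound) (use \<epsilon> in auto)
    then have "subexp 2 (Q \<alpha>)"
      unfolding Q_def[abs_def] by (intro subexp_mult cpoly_subexp rq subexp_bounded[where C = 1]) auto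
    then show ?thesis
      unfolding A_def by (intro integrable_smooth_gaussian c \<epsilon>) (auto simp: Q_def[abs_def])
  qed
  have "(LINT x|lborel. A x *\<^sub>R (B x + (\<Sum>\<alpha>\<in>R. of_real (k \<alpha> * (\<alpha> \<bullet> \<xi>)) * Q \<alpha> x))) =
      (LINT x|lborel. A x *\<^sub>R B x + (\<Sum>\<alpha>\<in>R. of_real (k \<alpha> * (\<alpha> \<bullet> \<xi>)) * (A x *\<^sub>R Q \<alpha> x)))"
    by (simp only: scaleR_add_right scaleR_sum_right mult_scaleR_right)
  also have "\<dots> = (LINT x|lborel. A x *\<^sub>R B x) + (\<Sum>\<alpha>\<in>R. of_real (k \<alpha> * (\<alpha> \<bullet> \<xi>)) * (LINT x|lborel. A x *\<^sub>R Q \<alpha> x))"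
    by (rule integral_add_sum[OF intB intQ])
  also have "\<dots> = (LINT x|lborel. A x *\<^sub>R B x) + (\<Sum>\<alpha>\<in>R. of_real (k \<alpha> * (\<alpha> \<bullet> \<xi>)) * (LINT x|lborel. A x *\<^sub>R (f x * S \<alpha> x)))"
    by (simp add: S(1))
  also have "\<dots> = (LINT x|lborel. A x *\<^sub>R B x + (\<Sum>\<alpha>\<in>R. of_real (k \<alpha> * (\<alpha> \<bullet> \<xi>)) * (A x *\<^sub>R (f x * S \<alpha> x))))"
    by (rule integral_add_sum[OF intB S(2), symmetric])
  also have "\<dots> = (LINT x|lborel. A x *\<^sub>R (B x + f x * (\<Sum>\<alpha>\<in>R. of_real (k \<alpha> * (\<alpha> \<bullet> \<xi>)) * S \<alpha> x)))"
    by (simp only: scaleR_add_right scaleR_sum_right mult_scaleR_right sum_distrib_left mult.left_commute)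
  also have "\<dots> = 0"
    using integral_parts_smooth[OF f \<xi> c \<epsilon>] unfolding A_def B_def S_def .
  finally show ?thesis unfolding A_def B_def Q_def .
qed

lemma T_as_sum_R:
  assumes "cpoly f"
  shows "T \<xi> f x = directional_derivative \<xi> f x + (\<Sum>\<alpha>\<in>R. of_real (k \<alpha> * (\<alpha> \<bullet> \<xi>)) * (of_real (1 / 2) * reflection_quotient \<alpha> f x))"
proof -
  have "(\<Sum>\<alpha>\<in>R. of_real (k \<alpha> * (\<alpha> \<bullet> \<xi>)) * (of_real (1 / 2) * reflection_quotient \<alpha> f x)) =
      (\<Sum>\<alpha>\<in>P. of_real (k \<alpha> * (\<alpha> \<bullet> \<xi>)) * reflection_quotient \<alpha> f x)"
    unfolding sum_R using P_subset
    by (intro sum.cong refl) (auto simp: reflection_quotient_uminus[OF assms] k_uminus subset_eq)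
  then show ?thesis by (simp add: dunkl_operator_def)
qed

definition Gauss :: "real \<Rightarrow> (real ^ 'n \<Rightarrow> complex) \<Rightarrow> complex" where
  "Gauss c F = (LINT x|dunkl_measure R k 2. F x * of_real (exp (- (c * norm x powr 2))))"

lemma Gauss_integrable:
  assumes "cpoly F" "0 < c"
  shows "integrable (dunkl_measure R k 2) (\<lambda>x. F x * of_real (exp (- (c * norm x powr 2))))"
  using assms gamma_nonneg
  by (intro integrable_dunkl_measure cpoly_subexp cpoly_borel_measurable nonneg) (auto simp: gamma_R add_nonneg_pos)

lemma Gauss_add: "cpoly F \<Longrightarrow> cpoly G \<Longrightarrow> 0 < c \<Longrightarrow> Gauss c (\<lambda>x. F x + G x) = Gauss c F + Gauss c G"
  unfolding Gauss_def distrib_right by (intro Bochner_Integration.integral_add Gauss_integrable)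

lemma Gauss_diff: "cpoly F \<Longrightarrow> cpoly G \<Longrightarrow> 0 < c \<Longrightarrow> Gauss c (\<lambda>x. F x - G x) = Gauss c F - Gauss c G"
  unfolding Gauss_def left_diff_distrib by (intro Bochner_Integration.integral_diff Gauss_integrable)

lemma Gauss_cmult: "Gauss c (\<lambda>x. d * F x) = d * Gauss c F"
  unfolding Gauss_def by (simp add: mult.assoc)

lemma Gauss_sum:
  assumes "\<And>i. i \<in> I \<Longrightarrow> cpoly (F i)" "0 < c"
  shows "Gauss c (\<lambda>x. \<Sum>i\<in>I. F i x) = (\<Sum>i\<in>I. Gauss c (F i))"
  unfolding Gauss_def sum_distrib_right by (intro Bochner_Integration.integral_sum Gauss_integrable assms)

lemma Gauss_reflection:
  assumes "\<beta> \<in> R" "cpoly F"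
  shows "Gauss c (\<lambda>x. F (reflection \<beta> x)) = Gauss c F"
proof -
  have [measurable]: "F \<in> borel_measurable borel" using assms(2) by (rule cpoly_borel_measurable)
  have "(LINT x|lborel. dunkl_weight R k 2 x *\<^sub>R (F x * of_real (exp (- (c * norm x powr 2))))) =
      (LINT x|lborel. dunkl_weight R k 2 (reflection \<beta> x) *\<^sub>R (F (reflection \<beta> x) * of_real (exp (- (c * norm (reflection \<beta> x) powr 2)))))"
    by (rule integral_lborel_reflection[symmetric]) measurable
  then show ?thesis
    unfolding Gauss_def by (simp add: integral_dunkl_measure(1) dunkl_weight_reflection[OF assms(1)])
qed

text \<open>
  The Dunkl operators are skew on constants up to the derivative of the Gaussian. For the regularized weight this
  is \<open>integral_T_smooth\<close>, whose singular terms are tamed by \<open>integral_singular_part\<close>; as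
  \<open>\<epsilon>\<close> tends to zero, they converge off the hyperplanes to the difference part of the Dunkl
  operator, and the weight for \<open>\<epsilon> = 1\<close> dominates.
\<close>

lemma Gauss_T:
  assumes f: "cpoly f" and \<xi>: "\<xi> \<in> Basis" and c: "0 < c"
  shows "Gauss c (T \<xi> f) = of_real (2 * c) * Gauss c (\<lambda>x. of_real (x \<bullet> \<xi>) * f x)"
proof -
  define h where "h n = inverse (real (Suc n))" for n
  have h: "0 < h n" "h n \<le> 1" for n by (auto simp: h_def inverse_le_1_iff)
  have h0: "h \<longlonglongrightarrow> 0" unfolding h_def[abs_def] by (rule LIMSEQ_inverse_real_of_nat)
  define B where "B x = directional_derivative \<xi> f x - of_real (2 * c * (x \<bullet> \<xi>)) * f x" for x
  define Q where "Q \<alpha> = reflection_quotient \<alpha> f" for \<alpha>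
  define q where "q \<epsilon> \<alpha> x = (\<alpha> \<bullet> x)\<^sup>2 / ((\<alpha> \<bullet> x)\<^sup>2 + \<epsilon>) / 2" for \<epsilon> and \<alpha> x :: "real ^ 'n"
  define F where "F \<epsilon> x = B x + (\<Sum>\<alpha>\<in>R. of_real (k \<alpha> * (\<alpha> \<bullet> \<xi>)) * (of_real (q \<epsilon> \<alpha> x) * Q \<alpha> x))" for \<epsilon> x
  define F0 where "F0 x = T \<xi> f x - of_real (2 * c * (x \<bullet> \<xi>)) * f x" for x
  have F0: "F0 x = B x + (\<Sum>\<alpha>\<in>R. of_real (k \<alpha> * (\<alpha> \<bullet> \<xi>)) * (of_real (1 / 2) * Q \<alpha> x))" for x
    by (simp add: F0_def B_def Q_def T_as_sum_R[OF f])
  have cB: "cpoly B"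
  proof -
    have "cpoly (\<lambda>x. directional_derivative \<xi> f x - of_real (2 * c) * (of_real (x \<bullet> \<xi>) * f x))"
      by (intro cpoly_diff cpoly_cmult cpoly_mult cpoly_inner' cpoly_directional_derivative f)
    then show ?thesis unfolding B_def[abs_def] by (simp add: mult.assoc)
  qed
  have cQ: "cpoly (Q \<alpha>)" if "\<alpha> \<in> R" for \<alpha>
    unfolding Q_def using that zero_notin_R by (intro cpoly_reflection_quotient f) auto
  define D where "D x = cmod (B x) + (\<Sum>\<alpha>\<in>R. \<bar>k \<alpha> * (\<alpha> \<bullet> \<xi>)\<bar> * cmod (Q \<alpha> x))" for x
  have [measurable]: "B \<in> borel_measurable borel" "\<And>\<alpha>. \<alpha> \<in> R \<Longrightarrow> Q \<alpha> \<in> borel_measurable borel"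
    using cB cQ by (auto intro: cpoly_borel_measurable)
  have Dm: "D \<in> borel_measurable borel" unfolding D_def[abs_def] by measurable
  have Fm: "F \<epsilon> \<in> borel_measurable borel" for \<epsilon> unfolding F_def[abs_def] q_def[abs_def] by measurable
  have F0m: "F0 \<in> borel_measurable borel" unfolding F0 by measurable
  have sD: "subexp 2 D"
  proof -
    have n: "subexp 2 (\<lambda>x. cmod (g x))" if "cpoly g" for g
      by (rule subexp_mono[OF cpoly_subexp[OF _ that], of 2 _ 1]) auto
    have "subexp 2 (\<lambda>x. \<Sum>\<alpha>\<in>R. \<bar>k \<alpha> * (\<alpha> \<bullet> \<xi>)\<bar> * cmod (Q \<alpha> x))"
      by (intro subexp_sum subexp_mult subexp_const n cQ)
    then show ?thesis unfolding D_def[abs_def] by (intro subexp_add n cB)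
  qed
  have q1: "\<bar>q (h n) \<alpha> x\<bar> \<le> 1" for n \<alpha> x
    unfolding q_def by (rule half_ratio_bound) (use h[of n] in auto)
  have FD: "cmod (F (h n) x) \<le> D x" for n x
  proof -
    have "cmod (\<Sum>\<alpha>\<in>R. of_real (k \<alpha> * (\<alpha> \<bullet> \<xi>)) * (of_real (q (h n) \<alpha> x) * Q \<alpha> x)) \<le>
        (\<Sum>\<alpha>\<in>R. \<bar>k \<alpha> * (\<alpha> \<bullet> \<xi>)\<bar> * cmod (Q \<alpha> x))"
    proof (rule sum_norm_le)
      fix \<alpha>
      have "\<bar>q (h n) \<alpha> x\<bar> * cmod (Q \<alpha> x) \<le> 1 * cmod (Q \<alpha> x)" by (rule mult_right_mono[OF q1]) simp
      then show "cmod (of_real (k \<alpha> * (\<alpha> \<bullet> \<xi>)) * (of_real (q (h n) \<alpha> x) * Q \<alpha> x)) \<le> \<bar>k \<alpha> * (\<alpha> \<bullet> \<xi>)\<bar> * cmod (Q \<alpha> x)"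
        unfolding norm_mult norm_of_real by (intro mult_left_mono) auto
    qed
    then show ?thesis unfolding F_def D_def by (intro norm_triangle_le add_left_mono)
  qed
  have "(\<lambda>n. LINT x|lborel. (exp (- (c * (x \<bullet> x))) * smooth_weight (h n) x) *\<^sub>R F (h n) x) \<longlonglongrightarrow>
      (LINT x|lborel. (exp (- (c * (x \<bullet> x))) * dunkl_weight R k 2 x) *\<^sub>R F0 x)"
  proof (rule integral_dominated_convergence[where w = "\<lambda>x. norm ((exp (- (c * (x \<bullet> x))) * smooth_weight 1 x) *\<^sub>R complex_of_real (D x))"])
    show "AE x in lborel. (\<lambda>n. (exp (- (c * (x \<bullet> x))) * smooth_weight (h n) x) *\<^sub>R F (h n) x) \<longlonglongrightarrow>
      (exp (- (c * (x \<bullet> x))) * dunkl_weight R k 2 x) *\<^sub>R F0 x"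
      using AE_generic
    proof eventually_elim
      fix x :: "real ^ 'n" assume x: "x \<noteq> 0 \<and> (\<forall>\<alpha>\<in>R. \<alpha> \<bullet> x \<noteq> 0)"
      have "(\<lambda>n. q (h n) \<alpha> x) \<longlonglongrightarrow> 1 / 2" if "\<alpha> \<in> R" for \<alpha>
      proof -
        have ne: "(\<alpha> \<bullet> x)\<^sup>2 \<noteq> 0" using x that by simp
        have "(\<lambda>n. q (h n) \<alpha> x) \<longlonglongrightarrow> (\<alpha> \<bullet> x)\<^sup>2 / ((\<alpha> \<bullet> x)\<^sup>2 + 0) / 2"
          unfolding q_def by (intro tendsto_intros h0) (use ne in auto)
        then show ?thesis using ne by simp
      qed
      then have "(\<lambda>n. F (h n) x) \<longlonglongrightarrow> F0 x"
        unfolding F_def F0 by (intro tendsto_intros)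
      then show "(\<lambda>n. (exp (- (c * (x \<bullet> x))) * smooth_weight (h n) x) *\<^sub>R F (h n) x) \<longlonglongrightarrow>
          (exp (- (c * (x \<bullet> x))) * dunkl_weight R k 2 x) *\<^sub>R F0 x"
        using x by (intro tendsto_intros smooth_weight_tendsto h0) auto
    qed
    show "AE x in lborel. norm ((exp (- (c * (x \<bullet> x))) * smooth_weight (h n) x) *\<^sub>R F (h n) x)
        \<le> norm ((exp (- (c * (x \<bullet> x))) * smooth_weight 1 x) *\<^sub>R complex_of_real (D x))" for n
    proof (intro AE_I2)
      fix x :: "real ^ 'n"
      have "exp (- (c * (x \<bullet> x))) * smooth_weight (h n) x * cmod (F (h n) x) \<le> exp (- (c * (x \<bullet> x))) * smooth_weight 1 x * \<bar>D x\<bar>"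
        using FD[of n x] smooth_weight_pos[of "h n" x] smooth_weight_pos[of 1 x]
        by (intro mult_mono smooth_weight_mono h mult_nonneg_nonneg) (auto simp: less_imp_le)
      then show "norm ((exp (- (c * (x \<bullet> x))) * smooth_weight (h n) x) *\<^sub>R F (h n) x)
        \<le> norm ((exp (- (c * (x \<bullet> x))) * smooth_weight 1 x) *\<^sub>R complex_of_real (D x))"
        by (simp add: abs_mult abs_of_pos smooth_weight_pos)
    qed
    show "integrable lborel (\<lambda>x. norm ((exp (- (c * (x \<bullet> x))) * smooth_weight 1 x) *\<^sub>R complex_of_real (D x)))"
      using Dm by (intro integrable_norm integrable_smooth_gaussian subexp_of_real sD c) auto
  qed (use Fm F0m in measurable)
  moreover have "(LINT x|lborel. (exp (- (c * (x \<bullet> x))) * smooth_weight (h n) x) *\<^sub>R F (h n) x) = 0" for n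
    using integral_T_smooth[OF f \<xi> c h] unfolding F_def B_def Q_def q_def .
  ultimately have "(LINT x|lborel. (exp (- (c * (x \<bullet> x))) * dunkl_weight R k 2 x) *\<^sub>R F0 x) = 0"
    by (simp add: LIMSEQ_const_iff)
  moreover have "Gauss c F0 = (LINT x|lborel. (exp (- (c * (x \<bullet> x))) * dunkl_weight R k 2 x) *\<^sub>R F0 x)"
    unfolding Gauss_def using F0m
    by (subst integral_dunkl_measure(1)) (auto simp: scaleR_conv_of_real powr_numeral power2_norm_eq_inner mult_ac intro!: Bochner_Integration.integral_cong)
  moreover have "Gauss c F0 = Gauss c (T \<xi> f) - of_real (2 * c) * Gauss c (\<lambda>x. of_real (x \<bullet> \<xi>) * f x)"
  proof -
    have "F0 = (\<lambda>x. T \<xi> f x - of_real (2 * c) * (of_real (x \<bullet> \<xi>) * f x))"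
      by (simp add: F0_def fun_eq_iff)
    moreover have "Gauss c \<dots> = Gauss c (T \<xi> f) - Gauss c (\<lambda>x. of_real (2 * c) * (of_real (x \<bullet> \<xi>) * f x))"
      by (intro Gauss_diff cpoly_T cpoly_cmult cpoly_mult cpoly_inner' f c)
    ultimately show ?thesis by (simp only: Gauss_cmult)
  qed
  ultimately show ?thesis by simp
qed

lemma Gauss_skew:
  assumes p: "cpoly p" and q: "cpoly q" and \<xi>: "\<xi> \<in> Basis" and c: "0 < c"
  shows "Gauss c (\<lambda>x. T \<xi> p x * q x) + Gauss c (\<lambda>x. p x * T \<xi> q x) =
    of_real (2 * c) * Gauss c (\<lambda>x. of_real (x \<bullet> \<xi>) * (p x * q x))"
proof -
  let ?D = "\<lambda>\<alpha> x. of_real (\<alpha> \<bullet> x) * (reflection_quotient \<alpha> p x * reflection_quotient \<alpha> q x)"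
  have cD: "cpoly (?D \<alpha>)" if "\<alpha> \<in> P" for \<alpha>
    using that zero_notin_P by (intro cpoly_mult cpoly_inner cpoly_reflection_quotient p q) auto
  have T: "T \<xi> (\<lambda>x. p x * q x) = (\<lambda>x. (T \<xi> p x * q x + p x * T \<xi> q x) - (\<Sum>\<alpha>\<in>P. of_real (k \<alpha> * (\<alpha> \<bullet> \<xi>)) * ?D \<alpha> x))"
    unfolding dunkl_operator_def reflection_quotient_product[OF p q]
      directional_derivative_mult[OF cpoly_differentiable[OF p] cpoly_differentiable[OF q]]
    by (simp add: fun_eq_iff algebra_simps sum.distrib sum_subtractf sum_distrib_left sum_distrib_right)
  have D0: "Gauss c (?D \<alpha>) = 0" if "\<alpha> \<in> P" for \<alpha>
  proof -
    have \<alpha>: "\<alpha> \<in> R" "\<alpha> \<noteq> 0" using that P_subset zero_notin_P by auto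
    have "Gauss c (?D \<alpha>) = Gauss c (\<lambda>x. ?D \<alpha> (reflection \<alpha> x))"
      by (rule Gauss_reflection[OF \<alpha>(1) cD[OF that], symmetric])
    also have "\<dots> = Gauss c (\<lambda>x. (- 1) * ?D \<alpha> x)"
      using \<alpha>(2) by (simp add: inner_reflection reflection_quotient_reflection)
    also have "\<dots> = - Gauss c (?D \<alpha>)" by (subst Gauss_cmult) simp
    finally show ?thesis by simp
  qed
  have "Gauss c (T \<xi> (\<lambda>x. p x * q x)) = Gauss c (\<lambda>x. T \<xi> p x * q x) + Gauss c (\<lambda>x. p x * T \<xi> q x)
      - (\<Sum>\<alpha>\<in>P. of_real (k \<alpha> * (\<alpha> \<bullet> \<xi>)) * Gauss c (?D \<alpha>))"
    unfolding T
    by (subst Gauss_diff Gauss_add Gauss_sum | intro cpoly_add cpoly_mult cpoly_sum cpoly_cmult cpoly_T p q c cD cpoly_diff | assumption)+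
       (simp add: Gauss_cmult)
  also have "\<dots> = Gauss c (\<lambda>x. T \<xi> p x * q x) + Gauss c (\<lambda>x. p x * T \<xi> q x)" by (simp add: D0)
  finally show ?thesis using Gauss_T[OF cpoly_mult[OF p q] \<xi> c] by simp
qed

text \<open>
  For the bilinear pairing \<open>\<langle>f, g\<rangle> = Gauss c (f g)\<close> consider
  \<open>S = \<Sum>\<^sub>\<xi> \<langle>T\<^sub>\<xi> p, T\<^sub>\<xi> q\<rangle>\<close>. Moving the operators
  from \<open>q\<close> to the harmonic \<open>p\<close> leaves only the terms from the Gaussian,
  \<open>2 c \<Sum>\<^sub>\<xi> \<langle>x\<^sub>\<xi> T\<^sub>\<xi> p, q\<rangle>\<close>, which by the Euler
  identity is \<open>2 c (m \<langle>p, q\<rangle> + \<langle>K p, q\<rangle>)\<close> with a reflection term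
  \<open>K\<close> that is symmetric. Exchanging the roles of \<open>p\<close> and \<open>q\<close> gives the same
  with \<open>n\<close> instead of \<open>m\<close>.
\<close>

lemma Gauss_harmonic_orthogonal:
  assumes p: "p \<in> k_harmonics P k m" and q: "q \<in> k_harmonics P k n" and mn: "m \<noteq> n" and c: "0 < c"
  shows "Gauss c (\<lambda>x. p x * q x) = 0"
proof -
  define K where "K f x = (\<Sum>\<alpha>\<in>P. of_real (k \<alpha>) * (f x - f (reflection \<alpha> x)))" for f :: "real ^ 'n \<Rightarrow> complex" and x
  define S where "S p q = (\<Sum>\<xi>\<in>Basis. Gauss c (\<lambda>x. T \<xi> p x * T \<xi> q x))" for p q
  have main: "S p q = of_real (2 * c) * (of_nat m * Gauss c (\<lambda>x. p x * q x) + Gauss c (\<lambda>x. K p x * q x))"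
    if p: "p \<in> k_harmonics P k m" and q: "cpoly q" for p q m
  proof -
    have hp: "homogeneous_polynomial m p" and cp: "cpoly p" and Lp: "\<And>x. Lap p x = 0"
      using p by (auto simp: k_harmonics_def homogeneous_polynomial_iff)
    have "(\<Sum>\<xi>\<in>Basis. Gauss c (\<lambda>x. T \<xi> (T \<xi> p) x * q x) + Gauss c (\<lambda>x. T \<xi> p x * T \<xi> q x)) =
        (\<Sum>\<xi>\<in>Basis. of_real (2 * c) * Gauss c (\<lambda>x. of_real (x \<bullet> \<xi>) * (T \<xi> p x * q x)))"
      by (intro sum.cong refl Gauss_skew cpoly_T cp q c)
    moreover have "(\<Sum>\<xi>\<in>Basis. Gauss c (\<lambda>x. T \<xi> (T \<xi> p) x * q x)) = 0"
    proof -
      have "(\<Sum>\<xi>\<in>Basis. Gauss c (\<lambda>x. T \<xi> (T \<xi> p) x * q x)) = Gauss c (\<lambda>x. \<Sum>\<xi>\<in>Basis. T \<xi> (T \<xi> p) x * q x)"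
        by (rule Gauss_sum[symmetric]) (intro cpoly_mult cpoly_T cp q c)+
      also have "(\<lambda>x. \<Sum>\<xi>\<in>Basis. T \<xi> (T \<xi> p) x * q x) = (\<lambda>x. 0)"
        using Lp by (simp add: sum_distrib_right[symmetric] dunkl_laplacian_def)
      finally show ?thesis by (simp add: Gauss_def)
    qed
    moreover have "(\<Sum>\<xi>\<in>Basis. Gauss c (\<lambda>x. of_real (x \<bullet> \<xi>) * (T \<xi> p x * q x))) =
        of_nat m * Gauss c (\<lambda>x. p x * q x) + Gauss c (\<lambda>x. K p x * q x)"
    proof -
      have cK: "cpoly (K p)" unfolding K_def
        by (intro cpoly_sum cpoly_cmult cpoly_diff cpoly_reflection cp)
      have "(\<Sum>\<xi>\<in>Basis. Gauss c (\<lambda>x. of_real (x \<bullet> \<xi>) * (T \<xi> p x * q x))) =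
          Gauss c (\<lambda>x. \<Sum>\<xi>\<in>Basis. of_real (x \<bullet> \<xi>) * (T \<xi> p x * q x))"
        by (rule Gauss_sum[symmetric]) (intro cpoly_mult cpoly_inner' cpoly_T cp q c)+
      also have "(\<lambda>x. \<Sum>\<xi>\<in>Basis. of_real (x \<bullet> \<xi>) * (T \<xi> p x * q x)) = (\<lambda>x. of_nat m * (p x * q x) + K p x * q x)"
        using sum_coord_T[OF cpoly_differentiable[OF cp]] Euler[OF hp]
        by (simp add: mult.assoc[symmetric] sum_distrib_right[symmetric] K_def distrib_right fun_eq_iff)
      also have "Gauss c \<dots> = of_nat m * Gauss c (\<lambda>x. p x * q x) + Gauss c (\<lambda>x. K p x * q x)"
        by (subst Gauss_add) (auto intro!: cpoly_cmult cpoly_mult cp q cK c simp: Gauss_cmult)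
      finally show ?thesis .
    qed
    ultimately show ?thesis by (simp add: S_def sum.distrib sum_distrib_left[symmetric])
  qed
  have cp: "cpoly p" and cq: "cpoly q" using p q by (auto simp: k_harmonics_def homogeneous_polynomial_iff)
  have sym: "Gauss c (\<lambda>x. K p x * q x) = Gauss c (\<lambda>x. K q x * p x)"
  proof -
    have expand: "Gauss c (\<lambda>x. K f x * g x) = (\<Sum>\<alpha>\<in>P. of_real (k \<alpha>) * (Gauss c (\<lambda>x. f x * g x) - Gauss c (\<lambda>x. f (reflection \<alpha> x) * g x)))"
      if f: "cpoly f" and g: "cpoly g" for f g
    proof -
      have "(\<lambda>x. K f x * g x) = (\<lambda>x. \<Sum>\<alpha>\<in>P. of_real (k \<alpha>) * (f x * g x - f (reflection \<alpha> x) * g x))"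
        by (simp add: K_def sum_distrib_right left_diff_distrib mult.assoc fun_eq_iff)
      moreover have "Gauss c \<dots> = (\<Sum>\<alpha>\<in>P. Gauss c (\<lambda>x. of_real (k \<alpha>) * (f x * g x - f (reflection \<alpha> x) * g x)))"
        by (intro Gauss_sum cpoly_cmult cpoly_diff cpoly_mult cpoly_reflection f g c)
      ultimately show ?thesis
        by (simp add: Gauss_cmult Gauss_diff cpoly_mult cpoly_reflection f g c)
    qed
    have "Gauss c (\<lambda>x. p (reflection \<alpha> x) * q x) = Gauss c (\<lambda>x. q (reflection \<alpha> x) * p x)" if "\<alpha> \<in> P" for \<alpha>
    proof -
      have "\<alpha> \<in> R" using that P_subset by auto
      from Gauss_reflection[OF this cpoly_mult[OF cpoly_reflection[OF cp, of \<alpha>] cq], of c]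
      show ?thesis by (simp add: mult.commute)
    qed
    moreover have "Gauss c (\<lambda>x. p x * q x) = Gauss c (\<lambda>x. q x * p x)" by (simp add: mult.commute)
    ultimately show ?thesis
      unfolding expand[OF cp cq] expand[OF cq cp] by (intro sum.cong refl) simp
  qed
  have "S p q = S q p" by (simp add: S_def mult.commute)
  then have "of_nat m * Gauss c (\<lambda>x. p x * q x) = of_nat n * Gauss c (\<lambda>x. q x * p x)"
    using c by (simp add: main[OF p cq] main[OF q cp] sym)
  then have "(of_nat m - of_nat n) * Gauss c (\<lambda>x. p x * q x) = 0"
    by (simp add: mult.commute[of "q _"] algebra_simps)
  then show ?thesis using mn by simp
qed

end

section \<open>Laguerre functions in the weighted Hilbert space\<close>

lemma poly_monom_induct:
  assumes "\<And>c n. Q (monom c n)" "\<And>p q. Q p \<Longrightarrow> Q q \<Longrightarrow> Q (p + q)"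
  shows "Q (p :: real poly)"
proof -
  have "Q (\<Sum>i\<in>I. monom (coeff p i) i)" if "finite I" for I
    using that by (induction I rule: finite_induct) (use assms(1)[of 0 0] in \<open>auto intro: assms\<close>)
  from this[of "{..degree p}"] show ?thesis by (simp add: poly_as_sum_of_monoms)
qed

text \<open>
  The recursion of the moments is integration by parts for the density \<open>t powr \<nu> exp (- t)\<close>, and
  makes the Laguerre operator symmetric; its eigenvectors to different eigenvalues are then orthogonal.
\<close>

lemma laguerre_moment_functional:
  fixes \<Lambda> :: "real poly \<Rightarrow> complex"
  assumes add: "\<And>A B. \<Lambda> (A + B) = \<Lambda> A + \<Lambda> B" and smult: "\<And>c A. \<Lambda> (smult c A) = of_real c * \<Lambda> A"
    and rec: "\<And>j. \<Lambda> (monom 1 (Suc j)) = of_real (real j + \<nu> + 1) * \<Lambda> (monom 1 j)"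
    and l: "l \<noteq> l'"
  shows "\<Lambda> (laguerre_poly l \<nu> * laguerre_poly l' \<nu>) = 0"
proof -
  have parts: "\<Lambda> ([:0, 1:] * pderiv Q) = \<Lambda> ([:- (\<nu> + 1), 1:] * Q)" for Q
  proof (induction Q rule: poly_monom_induct)
    case (1 c n)
    have m: "monom c n = smult c (monom 1 n)" for n by (simp add: smult_monom)
    have "[:0, 1:] * pderiv (monom c n) = smult (c * real n) (monom 1 n)"
      by (rule poly_eqI) (auto simp: coeff_pderiv coeff_pCons split: nat.split)
    moreover have "[:- (\<nu> + 1), 1:] * monom c n = smult c (smult (- (\<nu> + 1)) (monom 1 n) + monom 1 (Suc n))"
      by (simp add: mult_pCons_left m smult_add_right monom_Suc)
    ultimately show ?case
      by (simp only: add smult rec) (simp add: algebra_simps)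
  next
    case (2 p q)
    then show ?case by (simp only: pderiv_add distrib_left add)
  qed
  have neg: "\<Lambda> (- A) = - \<Lambda> A" for A using smult[of "-1" A] by simp
  have op: "\<Lambda> (A * laguerre_op \<nu> B) = - \<Lambda> ([:0, 1:] * (pderiv A * pderiv B))" for A B
  proof -
    have e: "[:\<nu> + 1, - 1:] = - [:- (\<nu> + 1), 1:]" by simp
    have "A * laguerre_op \<nu> B = [:0, 1:] * (A * pderiv (pderiv B)) + - ([:- (\<nu> + 1), 1:] * (A * pderiv B))"
      unfolding laguerre_op_def e
      by (simp only: distrib_left minus_mult_left[symmetric] minus_mult_right[symmetric] mult.left_commute)
    then have "\<Lambda> (A * laguerre_op \<nu> B) = \<Lambda> ([:0, 1:] * (A * pderiv (pderiv B))) - \<Lambda> ([:0, 1:] * pderiv (A * pderiv B))"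
      by (simp only: add neg parts[symmetric]) simp
    also have "[:0, 1:] * pderiv (A * pderiv B) = [:0, 1:] * (A * pderiv (pderiv B)) + [:0, 1:] * (pderiv A * pderiv B)"
      by (simp add: pderiv_mult algebra_simps)
    finally show ?thesis by (simp only: add) simp
  qed
  let ?A = "laguerre_poly l \<nu>" and ?B = "laguerre_poly l' \<nu>"
  have "\<Lambda> (?A * laguerre_op \<nu> ?B) = \<Lambda> (?B * laguerre_op \<nu> ?A)"
    unfolding op by (simp add: mult.commute)
  then have "of_real (- real l') * \<Lambda> (?A * ?B) = of_real (- real l) * \<Lambda> (?A * ?B)"
    by (simp only: laguerre_op_laguerre_poly mult_smult_right smult mult.commute[of ?B ?A])
  then have "\<Lambda> (?A * ?B) = 0 \<or> complex_of_real (- real l') = of_real (- real l)"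
    by (simp only: mult_cancel_right)
  then show "\<Lambda> (?A * ?B) = 0" using l by auto
qed

text \<open>
  The second condition says that the degree of homogeneity of the weight exceeds \<open>-N\<close>, that is, that
  the weight is locally integrable at the origin.
\<close>

locale dunkl_oscillator_setting = dunkl_setting R P k
  for R P :: "(real ^ 'n) set" and k +
  fixes a :: real
  assumes a_pos: "0 < a" and index_pos: "0 < a - 2 + 2 * \<gamma> + real CARD('n)"
begin

abbreviation M :: "(real ^ 'n) measure" where
  "M \<equiv> dunkl_measure R k a"

abbreviation \<nu> :: "nat \<Rightarrow> real" where
  "\<nu> \<equiv> laguerre_parameter P k a"

abbreviation rad :: "real ^ 'n \<Rightarrow> real" where
  "rad x \<equiv> 2 / a * norm x powr a"

lemma integrable_M:
  fixes F :: "real ^ 'n \<Rightarrow> complex"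
  assumes "F \<in> borel_measurable borel" "subexp a F" "0 < c"
  shows "integrable M (\<lambda>x. F x * of_real (exp (- (c * norm x powr a))))"
  using assms index_pos by (intro integrable_dunkl_measure nonneg a_pos) (auto simp: gamma_R)

lemma L2_subexp:
  assumes F[measurable]: "F \<in> borel_measurable borel" and sF: "subexp a F" and c: "0 < c"
  shows "(\<lambda>x. F x * of_real (exp (- (c * norm x powr a)))) \<in> L2 M"
proof -
  have "integrable M (\<lambda>x. (F x * cnj (F x)) * of_real (exp (- (2 * c * norm x powr a))))"
    using c by (intro integrable_M subexp_mult subexp_cnj sF) (auto intro: measurable_compose[OF F borel_measurable_cnj])
  moreover have "(F x * cnj (F x)) * of_real (exp (- (2 * c * norm x powr a))) =
      complex_of_real ((cmod (F x * of_real (exp (- (c * norm x powr a)))))\<^sup>2)" for x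
  proof -
    have "exp (- (2 * c * norm x powr a)) = (exp (- (c * norm x powr a)))\<^sup>2"
      by (simp add: power2_eq_square exp_add[symmetric])
    then show ?thesis
      by (simp add: norm_mult power_mult_distrib complex_norm_square[symmetric])
  qed
  ultimately have "integrable M (\<lambda>x. complex_of_real ((cmod (F x * of_real (exp (- (c * norm x powr a)))))\<^sup>2))"
    by simp
  then have "integrable M (\<lambda>x. (cmod (F x * of_real (exp (- (c * norm x powr a)))))\<^sup>2)"
    by (simp only: complex_of_real_integrable_eq)
  then show ?thesis by (simp add: L2_def)
qed

lemma L2_profile:
  assumes p: "cpoly p"
  shows "(\<lambda>x. p x * of_real (profile a q x)) \<in> L2 M"
proof -
  have [measurable]: "p \<in> borel_measurable borel" using p by (rule cpoly_borel_measurable)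
  have [measurable]: "poly q \<in> borel_measurable borel"
    by (intro borel_measurable_continuous_onI continuous_on_poly continuous_on_id)
  have "(\<lambda>x. (p x * of_real (poly q (rad x))) * of_real (exp (- (1 / a * norm x powr a)))) \<in> L2 M"
    using a_pos by (intro L2_subexp subexp_mult subexp_of_real poly_subexp cpoly_subexp p) auto
  then show ?thesis by (simp add: profile_def mult.assoc)
qed

lemma integral_M_eq_D2:
  fixes F :: "real ^ 'n \<Rightarrow> complex"
  assumes [measurable]: "F \<in> borel_measurable borel"
  shows "(LINT x|M. F x) = (LINT x|dunkl_measure R k 2. norm x powr (a - 2) *\<^sub>R F x)"
    and "integrable M F \<longleftrightarrow> integrable (dunkl_measure R k 2) (\<lambda>x. norm x powr (a - 2) *\<^sub>R F x)"
proof -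
  have w: "dunkl_weight R k a x *\<^sub>R F x = dunkl_weight R k 2 x *\<^sub>R (norm x powr (a - 2) *\<^sub>R F x)" for x
    by (cases "x = 0") (simp_all add: dunkl_weight_def mult.commute)
  show "(LINT x|M. F x) = (LINT x|dunkl_measure R k 2. norm x powr (a - 2) *\<^sub>R F x)"
    by (simp add: integral_dunkl_measure(1) w del: scaleR_scaleR)
  show "integrable M F \<longleftrightarrow> integrable (dunkl_measure R k 2) (\<lambda>x. norm x powr (a - 2) *\<^sub>R F x)"
    by (simp add: integral_dunkl_measure(2) w del: scaleR_scaleR)
qed

text \<open>
  \<open>Gauss_harmonic_orthogonal\<close> at the points \<open>c = j + 1\<close> says that the Laplace transform
  in \<open>|x|\<^sup>2\<close> of \<open>p q\<close> times a Gaussian vanishes at the natural numbers. Hence the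
  integral against every radial function vanishes, and the change from the weight for \<open>a = 2\<close> to the
  given one is absorbed in that function.
\<close>

lemma harmonic_radial_orthogonal:
  assumes p: "p \<in> k_harmonics P k m" and q: "q \<in> k_harmonics P k n" and mn: "m \<noteq> n"
    and h[measurable]: "h \<in> borel_measurable borel" and int: "integrable M (\<lambda>x. h (norm x) *\<^sub>R (p x * q x))"
  shows "(LINT x|M. h (norm x) *\<^sub>R (p x * q x)) = 0"
proof -
  have cp: "cpoly p" "cpoly q" using p q by (auto simp: k_harmonics_def homogeneous_polynomial_iff)
  have [measurable]: "p \<in> borel_measurable borel" "q \<in> borel_measurable borel"
    using cp by (auto intro: cpoly_borel_measurable)
  define G where "G x = p x * q x * of_real (exp (- (1 * norm x powr 2)))" for x
  (* The factor exp s removes the Gaussian with c = 1 that makes G integrable. *)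
  define \<phi> where "\<phi> s = sqrt s powr (a - 2) * h (sqrt s) * exp s" for s
  have [measurable]: "\<phi> \<in> borel_measurable borel" unfolding \<phi>_def by measurable
  have eq: "norm x powr (a - 2) *\<^sub>R (h (norm x) *\<^sub>R (p x * q x)) = \<phi> (norm x powr 2) *\<^sub>R G x" for x
  proof -
    have "sqrt (norm x powr 2) = norm x" by (simp add: powr_numeral)
    then show ?thesis
      unfolding \<phi>_def G_def by (simp add: scaleR_conv_of_real mult_ac exp_minus)
  qed
  have "(LINT x|dunkl_measure R k 2. \<phi> (norm x powr 2) *\<^sub>R G x) = 0"
  proof (rule integral_zero_if_Laplace_zero[where c = 1 and g = G and s = "\<lambda>x. norm x powr 2" and \<phi> = \<phi>])
    show "integrable (dunkl_measure R k 2) G"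
      unfolding G_def by (intro Gauss_integrable cpoly_mult cp) simp
    show "(LINT x|dunkl_measure R k 2. exp (- (real j * (1 * norm x powr 2))) *\<^sub>R G x) = 0" for j
    proof -
      have "exp (- (real j * (1 * norm x powr 2))) *\<^sub>R G x = p x * q x * of_real (exp (- ((real j + 1) * norm x powr 2)))" for x
      proof -
        have "exp (- ((real j + 1) * norm x powr 2)) = exp (- (real j * (1 * norm x powr 2))) * exp (- (1 * norm x powr 2))"
          by (simp add: exp_add[symmetric] algebra_simps)
        then show ?thesis by (simp add: G_def scaleR_conv_of_real mult_ac)
      qed
      then show ?thesis
        using Gauss_harmonic_orthogonal[OF p q mn, of "real j + 1"] by (simp add: Gauss_def)
    qed
    show "integrable (dunkl_measure R k 2) (\<lambda>x. \<phi> (norm x powr 2) *\<^sub>R G x)"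
      using int by (subst (asm) integral_M_eq_D2(2)) (simp_all only: eq, measurable)
  qed auto
  then show ?thesis by (subst integral_M_eq_D2(1)) (simp_all only: eq, measurable)
qed

lemma integral_M_scale:
  fixes F :: "real ^ 'n \<Rightarrow> complex"
  assumes [measurable]: "F \<in> borel_measurable borel" and t: "0 < t"
  shows "(LINT x|M. F x) = of_real (t powr (a - 2 + 2 * \<gamma> + real CARD('n))) * (LINT x|M. F (t *\<^sub>R x))"
proof -
  have "(LINT x|lborel. dunkl_weight R k a x *\<^sub>R F x) =
      (LINT x|density (distr lborel borel (\<lambda>x. 0 + t *\<^sub>R x)) (\<lambda>_. ennreal (\<bar>t\<bar> ^ DIM(real ^ 'n))). dunkl_weight R k a x *\<^sub>R F x)"
    using lborel_affine[of t "0 :: real ^ 'n"] t by simp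
  also have "\<dots> = (LINT x|lborel. t ^ CARD('n) *\<^sub>R (dunkl_weight R k a (t *\<^sub>R x) *\<^sub>R F (t *\<^sub>R x)))"
    using t by (subst integral_density) (auto simp: integral_distr)
  also have "\<dots> = (LINT x|lborel. t powr (a - 2 + 2 * \<gamma> + real CARD('n)) *\<^sub>R (dunkl_weight R k a x *\<^sub>R F (t *\<^sub>R x)))"
    using t by (simp add: dunkl_weight_scale[OF t finite_R] gamma_R powr_add powr_realpow mult_ac)
  also have "\<dots> = of_real (t powr (a - 2 + 2 * \<gamma> + real CARD('n))) * (LINT x|lborel. dunkl_weight R k a x *\<^sub>R F (t *\<^sub>R x))"
    by (subst integral_scaleR_right) (simp_all add: scaleR_conv_of_real)
  finally show ?thesis by (simp add: integral_dunkl_measure(1))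
qed

text \<open>
  Put \<open>I\<^sub>j(c) = \<integral> p q t\<^sup>j exp (- c t)\<close> with \<open>t = rad x\<close>. Scaling
  \<open>x\<close> by \<open>c powr (1 / a)\<close> and using homogeneity,
  \<open>I\<^sub>j(c) = c powr (- (j + \<nu> + 1)) I\<^sub>j(1)\<close>, while differentiation under the integral
  gives \<open>- I\<^sub>j\<^sub>+\<^sub>1(1)\<close> for the derivative at \<open>c = 1\<close>. Comparing the
  two is the recursion.
\<close>

lemma Gamma_moment_recursion:
  assumes p: "homogeneous_polynomial m p" and q: "homogeneous_polynomial m q"
  shows "(LINT x|M. p x * q x * of_real (rad x ^ Suc j * exp (- rad x))) =
    of_real (real j + \<nu> m + 1) * (LINT x|M. p x * q x * of_real (rad x ^ j * exp (- rad x)))"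
proof -
  have cp: "cpoly p" "cpoly q" using p q by (auto simp: homogeneous_polynomial_iff)
  have [measurable]: "p \<in> borel_measurable borel" "q \<in> borel_measurable borel"
    using cp by (auto intro: cpoly_borel_measurable)
  define I where "I j c = (LINT x|M. p x * q x * of_real (rad x ^ j * exp (- (c * rad x))))" for j c
  have int: "integrable M (\<lambda>x. p x * q x * of_real (rad x ^ j * exp (- (c * rad x))))" if "0 < c" for c j
  proof -
    have "subexp a (\<lambda>x. poly (monom 1 j) (rad x))" by (rule poly_subexp[OF a_pos])
    then have "subexp a (\<lambda>x. complex_of_real (rad x ^ j))"
      by (intro subexp_of_real) (simp add: poly_monom)
    from subexp_mult[OF cpoly_subexp[OF a_pos cpoly_mult[OF cp]] this]
    have "integrable M (\<lambda>x. (p x * q x * of_real (rad x ^ j)) * of_real (exp (- (c * (2 / a) * norm x powr a))))"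
      using that a_pos by (intro integrable_M) auto
    then show ?thesis by (simp add: mult.assoc)
  qed
  have scale: "I j c = of_real (c powr (- (real j + \<nu> m + 1))) * I j 1" if c: "0 < c" for c
  proof -
    define t where "t = c powr (1 / a)"
    have t: "0 < t" using c by (simp add: t_def)
    have ta: "t powr a = c" using c a_pos by (simp add: t_def powr_powr)
    have rad_t: "rad (t *\<^sub>R x) = c * rad x" for x using t by (simp add: powr_mult ta)
    have pt: "p (t *\<^sub>R x) * q (t *\<^sub>R x) = of_real (t ^ (2 * m)) * (p x * q x)" for x
    proof -
      have "complex_of_real (t ^ (2 * m)) = of_real (t ^ m) * of_real (t ^ m)"
        by (simp add: power_add[symmetric] mult_2)
      moreover have "p (t *\<^sub>R x) = of_real (t ^ m) * p x" "q (t *\<^sub>R x) = of_real (t ^ m) * q x"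
        using p q unfolding homogeneous_polynomial_iff by blast+
      ultimately show ?thesis by (simp only: mult_ac)
    qed
    have "I j 1 = of_real (t powr (a - 2 + 2 * \<gamma> + real CARD('n))) *
        (LINT x|M. p (t *\<^sub>R x) * q (t *\<^sub>R x) * of_real (rad (t *\<^sub>R x) ^ j * exp (- (1 * rad (t *\<^sub>R x)))))"
      unfolding I_def by (rule integral_M_scale[OF _ t]) measurable
    also have "(LINT x|M. p (t *\<^sub>R x) * q (t *\<^sub>R x) * of_real (rad (t *\<^sub>R x) ^ j * exp (- (1 * rad (t *\<^sub>R x))))) =
        (LINT x|M. of_real (t ^ (2 * m) * c ^ j) * (p x * q x * of_real (rad x ^ j * exp (- (c * rad x)))))"
      unfolding pt rad_t power_mult_distrib mult_1 of_real_mult by (simp only: mult_ac)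
    also have "\<dots> = of_real (t ^ (2 * m) * c ^ j) * I j c"
      unfolding I_def by (rule integral_mult_right_zero)
    finally have "I j 1 = of_real (t powr (a - 2 + 2 * \<gamma> + real CARD('n)) * (t ^ (2 * m) * c ^ j)) * I j c"
      by simp
    also have "t powr (a - 2 + 2 * \<gamma> + real CARD('n)) * (t ^ (2 * m) * c ^ j) = c powr (real j + \<nu> m + 1)"
    proof -
      have "t powr (a - 2 + 2 * \<gamma> + real CARD('n)) * t ^ (2 * m) = t powr (a - 2 + 2 * \<gamma> + real CARD('n) + real (2 * m))"
        using t by (simp add: powr_add powr_realpow del: of_nat_mult)
      also have "a - 2 + 2 * \<gamma> + real CARD('n) + real (2 * m) = a * (\<nu> m + 1)"
        using a_pos by (simp add: laguerre_parameter_def field_simps)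
      also have "t powr (a * (\<nu> m + 1)) = c powr (\<nu> m + 1)"
        unfolding ta[symmetric] powr_powr ..
      finally show ?thesis using c by (simp add: powr_add powr_realpow mult_ac)
    qed
    finally have "I j 1 = of_real (c powr (real j + \<nu> m + 1)) * I j c" .
    moreover have "c powr (- (real j + \<nu> m + 1)) * c powr (real j + \<nu> m + 1) = 1"
      using c by (simp add: powr_add[symmetric])
    ultimately show ?thesis
      by (metis mult.assoc mult_1 of_real_1 of_real_mult)
  qed
  define h where "h n = inverse (real (Suc n))" for n
  have h: "0 < h n" for n by (simp add: h_def)
  have h0: "h \<longlonglongrightarrow> 0" unfolding h_def[abs_def] by (rule LIMSEQ_inverse_real_of_nat)
  have hat: "filterlim h (at 0) sequentially"
    using h h0 by (auto simp: filterlim_at less_imp_neq[symmetric] intro!: always_eventually)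
  let ?s = "- (real j + \<nu> m + 1)"
  have lim1: "(\<lambda>n. (I j (1 + h n) - I j 1) / of_real (h n)) \<longlonglongrightarrow> of_real ?s * I j 1"
  proof -
    have "((\<lambda>c. c powr ?s) has_real_derivative ?s * 1 powr (?s - 1)) (at 1)"
      by (rule has_real_derivative_powr) simp
    then have "((\<lambda>h. ((1 + h) powr ?s - 1 powr ?s) / h) \<longlongrightarrow> ?s * 1 powr (?s - 1)) (at 0)"
      by (simp only: DERIV_def)
    from filterlim_compose[OF this hat]
    have "(\<lambda>n. ((1 + h n) powr ?s - 1) / h n) \<longlonglongrightarrow> ?s" by simp
    then have "(\<lambda>n. of_real (((1 + h n) powr ?s - 1) / h n) * I j 1) \<longlonglongrightarrow> of_real ?s * I j 1"
      by (intro tendsto_mult tendsto_of_real tendsto_const)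
    moreover have "of_real (((1 + h n) powr ?s - 1) / h n) * I j 1 = (I j (1 + h n) - I j 1) / of_real (h n)" for n
      using scale[of "1 + h n"] h[of n] by (simp add: left_diff_distrib add_pos_pos)
    ultimately show ?thesis by (simp only:)
  qed
  have lim2: "(\<lambda>n. (I j (1 + h n) - I j 1) / of_real (h n)) \<longlonglongrightarrow> - I (Suc j) 1"
  proof -
    have D: "(I j (1 + h n) - I j 1) / of_real (h n) =
        (LINT x|M. p x * q x * of_real (rad x ^ j * exp (- rad x) * ((exp (- (h n * rad x)) - 1) / h n)))" for n
    proof -
      have "I j (1 + h n) - I j 1 = (LINT x|M. p x * q x * of_real (rad x ^ j * exp (- ((1 + h n) * rad x)))
          - p x * q x * of_real (rad x ^ j * exp (- (1 * rad x))))"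
        unfolding I_def using h[of n] by (intro Bochner_Integration.integral_diff[symmetric] int) auto
      also have "\<dots> = (LINT x|M. of_real (h n) * (p x * q x * of_real (rad x ^ j * exp (- rad x) * ((exp (- (h n * rad x)) - 1) / h n))))"
      proof (rule Bochner_Integration.integral_cong[OF refl])
        fix x
        have "- ((1 + h n) * y) = - y + - (h n * y)" for y by (simp add: algebra_simps)
        then have e: "exp (- ((1 + h n) * rad x)) = exp (- rad x) * exp (- (h n * rad x))"
          by (simp only: exp_add)
        have "h n * (rad x ^ j * exp (- rad x) * ((exp (- (h n * rad x)) - 1) / h n))
            = rad x ^ j * exp (- ((1 + h n) * rad x)) - rad x ^ j * exp (- (1 * rad x))"
        proof -
          have gen: "d * (A * B * ((E - 1) / d)) = A * (B * E) - A * B" if "d \<noteq> 0" for d A B E :: real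
            using that by (simp add: field_simps)
          have "h n \<noteq> 0" using h[of n] by simp
          then show ?thesis unfolding e mult_1 by (rule gen)
        qed
        then show "p x * q x * of_real (rad x ^ j * exp (- ((1 + h n) * rad x))) - p x * q x * of_real (rad x ^ j * exp (- (1 * rad x)))
            = of_real (h n) * (p x * q x * of_real (rad x ^ j * exp (- rad x) * ((exp (- (h n * rad x)) - 1) / h n)))"
          by (metis (no_types) mult.left_commute of_real_diff of_real_mult right_diff_distrib)
      qed
      also have "\<dots> = of_real (h n) * (LINT x|M. p x * q x * of_real (rad x ^ j * exp (- rad x) * ((exp (- (h n * rad x)) - 1) / h n)))"
        by (rule integral_mult_right_zero)
      finally show ?thesis using h[of n] by simp
    qed
    have rad0: "0 \<le> rad x" for x using a_pos by simp
    have "(\<lambda>n. LINT x|M. p x * q x * of_real (rad x ^ j * exp (- rad x) * ((exp (- (h n * rad x)) - 1) / h n)))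
        \<longlonglongrightarrow> (LINT x|M. p x * q x * of_real (rad x ^ j * exp (- rad x) * (- rad x)))"
    proof (rule integral_dominated_convergence[where w = "\<lambda>x. norm (p x * q x * of_real (rad x ^ Suc j * exp (- (1 * rad x))))"])
      show "AE x in M. (\<lambda>n. p x * q x * of_real (rad x ^ j * exp (- rad x) * ((exp (- (h n * rad x)) - 1) / h n)))
          \<longlonglongrightarrow> p x * q x * of_real (rad x ^ j * exp (- rad x) * (- rad x))"
      proof (intro AE_I2 tendsto_mult tendsto_of_real tendsto_const)
        fix x
        have "((\<lambda>t. exp (- (t * y))) has_real_derivative - y) (at 0)" for y :: real
          by (auto intro!: derivative_eq_intros)
        then have "((\<lambda>t. exp (- (t * rad x))) has_real_derivative - rad x) (at 0)" .
        then have "((\<lambda>h. (exp (- ((0 + h) * rad x)) - exp (- (0 * rad x))) / h) \<longlongrightarrow> - rad x) (at 0)"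
          by (simp only: DERIV_def)
        from filterlim_compose[OF this hat]
        show "(\<lambda>n. (exp (- (h n * rad x)) - 1) / h n) \<longlonglongrightarrow> - rad x" by simp
      qed
      show "AE x in M. norm (p x * q x * of_real (rad x ^ j * exp (- rad x) * ((exp (- (h n * rad x)) - 1) / h n)))
          \<le> norm (p x * q x * of_real (rad x ^ Suc j * exp (- (1 * rad x))))" for n
      proof (intro AE_I2)
        fix x
        define y where "y = rad x"
        have y0: "0 \<le> y" unfolding y_def by (rule rad0)
        have hy: "0 \<le> h n * y" by (rule mult_nonneg_nonneg[OF less_imp_le[OF h] y0])
        have "1 - h n * y \<le> exp (- (h n * y))" using exp_ge_add_one_self[of "- (h n * y)"] by simp
        moreover have "exp (- (h n * y)) \<le> 1" using hy by simp
        ultimately have "\<bar>exp (- (h n * y)) - 1\<bar> \<le> h n * y" using hy by (simp add: abs_le_iff)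
        then have "\<bar>(exp (- (h n * y)) - 1) / h n\<bar> \<le> y"
          using h[of n] by (simp add: abs_divide pos_divide_le_eq mult.commute)
        then have "norm (p x * q x) * (y ^ j * exp (- y) * \<bar>(exp (- (h n * y)) - 1) / h n\<bar>)
            \<le> norm (p x * q x) * (y ^ j * exp (- y) * y)"
          using y0 by (intro mult_left_mono mult_nonneg_nonneg) auto
        moreover have "norm (p x * q x * of_real (y ^ j * exp (- y) * ((exp (- (h n * y)) - 1) / h n))) =
            norm (p x * q x) * (y ^ j * exp (- y) * \<bar>(exp (- (h n * y)) - 1) / h n\<bar>)"
          unfolding norm_mult norm_of_real abs_mult using y0 by (simp add: power_abs)
        moreover have "norm (p x * q x * of_real (y ^ Suc j * exp (- (1 * y)))) = norm (p x * q x) * (y ^ j * exp (- y) * y)"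
          unfolding norm_mult norm_of_real abs_mult using y0 by (simp add: power_abs)
        ultimately show "norm (p x * q x * of_real (rad x ^ j * exp (- rad x) * ((exp (- (h n * rad x)) - 1) / h n)))
          \<le> norm (p x * q x * of_real (rad x ^ Suc j * exp (- (1 * rad x))))"
          unfolding y_def by (simp only:)
      qed
      show "integrable M (\<lambda>x. norm (p x * q x * of_real (rad x ^ Suc j * exp (- (1 * rad x)))))"
        by (intro integrable_norm int) simp
    qed measurable
    also have "(LINT x|M. p x * q x * of_real (rad x ^ j * exp (- rad x) * (- rad x))) =
        (LINT x|M. - (p x * q x * of_real (rad x ^ Suc j * exp (- (1 * rad x)))))"
      by (intro Bochner_Integration.integral_cong refl) (simp add: mult_ac)
    also have "\<dots> = - I (Suc j) 1" unfolding I_def by (rule integral_minus)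
    finally show ?thesis unfolding D .
  qed
  have "of_real ?s * I j 1 = - I (Suc j) 1" by (rule LIMSEQ_unique[OF lim1 lim2])
  then have "I (Suc j) 1 = - (of_real ?s * I j 1)" by (simp only: minus_minus)
  then have "I (Suc j) 1 = of_real (real j + \<nu> m + 1) * I j 1"
    by (simp only: of_real_minus mult_minus_left minus_minus)
  then show ?thesis by (simp only: I_def mult_1)
qed

end

section \<open>Orthogonality and totality of the Laguerre functions\<close>

lemma directional_derivative_cnj:
  assumes "f differentiable (at x)"
  shows "directional_derivative \<xi> (\<lambda>y. cnj (f y)) x = cnj (directional_derivative \<xi> f x)"
proof -
  obtain f' where f': "(f has_derivative f') (at x)" using assms by (auto simp: differentiable_def)
  from bounded_linear.has_derivative[OF bounded_linear_cnj this]
  have D: "((\<lambda>y. cnj (f y)) has_derivative (\<lambda>h. cnj (f' h))) (at x)" .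
  show ?thesis unfolding directional_derivative_eq[OF D] directional_derivative_eq[OF f'] ..
qed

lemma reflection_quotient_cnj:
  assumes "f differentiable (at x)"
  shows "reflection_quotient \<alpha> (\<lambda>y. cnj (f y)) x = cnj (reflection_quotient \<alpha> f x)"
  by (simp add: reflection_quotient_def directional_derivative_cnj[OF assms])

context dunkl_setting
begin

lemma T_cnj:
  assumes "cpoly f"
  shows "T \<xi> (\<lambda>y. cnj (f y)) = (\<lambda>x. cnj (T \<xi> f x))"
  by (simp add: dunkl_operator_def fun_eq_iff directional_derivative_cnj reflection_quotient_cnj cpoly_differentiable assms)

lemma k_harmonics_cnj:
  assumes "p \<in> k_harmonics P k m"
  shows "(\<lambda>x. cnj (p x)) \<in> k_harmonics P k m"
proof -
  have cp: "cpoly p" and hp: "homogeneous_polynomial m p" and L: "\<And>x. Lap p x = 0"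
    using assms by (auto simp: k_harmonics_def homogeneous_polynomial_iff)
  have "Lap (\<lambda>x. cnj (p x)) x = cnj (Lap p x)" for x
    by (simp add: dunkl_laplacian_def T_cnj cp cpoly_T)
  moreover have "homogeneous_polynomial m (\<lambda>x. cnj (p x))"
    using hp by (auto simp: homogeneous_polynomial_iff intro: cpoly_cnj)
  ultimately show ?thesis using L by (simp add: k_harmonics_def)
qed

end

context dunkl_oscillator_setting
begin

lemma borel_measurable_poly [measurable]: "poly (q :: real poly) \<in> borel_measurable borel"
  by (intro borel_measurable_continuous_onI continuous_on_poly continuous_on_id)

lemma profile_mult: "profile a A x * profile a B x = poly (A * B) (rad x) * exp (- rad x)"
  by (simp add: profile_def exp_add[symmetric] algebra_simps)

definition laguerre_function :: "(real ^ 'n \<Rightarrow> complex) \<Rightarrow> nat \<Rightarrow> nat \<Rightarrow> real ^ 'n \<Rightarrow> complex" where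
  "laguerre_function p m l x = p x * of_real (profile a (laguerre_poly l (\<nu> m)) x)"

lemma laguerre_function_L2: "p \<in> k_harmonics P k m \<Longrightarrow> laguerre_function p m l \<in> L2 M"
  unfolding laguerre_function_def[abs_def]
  by (rule L2_profile) (simp add: k_harmonics_def homogeneous_polynomial_iff)

text \<open>
  For different degrees this is \<open>harmonic_radial_orthogonal\<close>. For equal degrees the integrals of
  \<open>p\<close> times the conjugate of \<open>q\<close> against polynomials in \<open>rad\<close> form a
  functional to which \<open>laguerre_moment_functional\<close> applies. Conjugation turns the second factor into
  another harmonic.
\<close>

theorem laguerre_function_orthogonal:
  assumes p: "p \<in> k_harmonics P k m" and q: "q \<in> k_harmonics P k n" and ne: "(l, m) \<noteq> (l', n)"
  shows "l2_inner M (laguerre_function p m l) (laguerre_function q n l') = 0"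
proof -
  define q' where "q' x = cnj (q x)" for x
  have q': "q' \<in> k_harmonics P k n" unfolding q'_def[abs_def] by (rule k_harmonics_cnj[OF q])
  have cp: "cpoly p" "cpoly q'" and hp: "homogeneous_polynomial m p" and hq: "homogeneous_polynomial n q'"
    using p q' by (auto simp: k_harmonics_def homogeneous_polynomial_iff)
  let ?Q = "laguerre_poly l (\<nu> m) * laguerre_poly l' (\<nu> n)"
  have [measurable]: "p \<in> borel_measurable borel" "q' \<in> borel_measurable borel"
    using cp by (auto intro: cpoly_borel_measurable)
  have int: "integrable M (\<lambda>x. p x * q' x * of_real (poly Q (rad x) * exp (- rad x)))" for Q
  proof -
    have "integrable M (\<lambda>x. (p x * q' x * of_real (poly Q (rad x))) * of_real (exp (- (2 / a * norm x powr a))))"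
      using a_pos by (intro integrable_M subexp_mult[OF cpoly_subexp[OF a_pos cpoly_mult[OF cp]]] subexp_of_real poly_subexp a_pos) auto
    then show ?thesis by (simp add: mult.assoc)
  qed
  have "l2_inner M (laguerre_function p m l) (laguerre_function q n l') =
      (LINT x|M. p x * q' x * of_real (poly ?Q (rad x) * exp (- rad x)))"
    unfolding l2_inner_def laguerre_function_def q'_def profile_mult[symmetric]
    by (intro Bochner_Integration.integral_cong refl) (simp add: mult_ac)
  also have "\<dots> = 0"
  proof (cases "m = n")
    case False
    have "(LINT x|M. (poly ?Q (2 / a * norm x powr a) * exp (- (2 / a * norm x powr a))) *\<^sub>R (p x * q' x)) = 0"
      by (rule harmonic_radial_orthogonal[OF p q' False, where h = "\<lambda>r. poly ?Q (2 / a * r powr a) * exp (- (2 / a * r powr a))"])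
         (use int[of ?Q] in \<open>simp_all add: scaleR_conv_of_real mult_ac del: poly_mult\<close>)
    then show ?thesis by (simp add: scaleR_conv_of_real mult_ac del: poly_mult)
  next
    case True
    then have ll: "l \<noteq> l'" using ne by simp
    define \<Lambda> where "\<Lambda> Q = (LINT x|M. p x * q' x * of_real (poly Q (rad x) * exp (- rad x)))" for Q
    have "\<Lambda> (laguerre_poly l (\<nu> m) * laguerre_poly l' (\<nu> m)) = 0"
    proof (rule laguerre_moment_functional[OF _ _ _ ll])
      show "\<Lambda> (A + B) = \<Lambda> A + \<Lambda> B" for A B
        unfolding \<Lambda>_def poly_add distrib_right of_real_add distrib_left
        by (intro Bochner_Integration.integral_add int)
      show "\<Lambda> (smult c A) = of_real c * \<Lambda> A" for c A
      proof -
        have "\<Lambda> (smult c A) = (LINT x|M. of_real c * (p x * q' x * of_real (poly A (rad x) * exp (- rad x))))"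
          unfolding \<Lambda>_def by (intro Bochner_Integration.integral_cong refl) (simp add: mult_ac)
        then show ?thesis unfolding \<Lambda>_def by simp
      qed
      show "\<Lambda> (monom 1 (Suc j)) = of_real (real j + \<nu> m + 1) * \<Lambda> (monom 1 j)" for j
        using Gamma_moment_recursion[OF hp hq[folded True], of j] by (simp only: \<Lambda>_def poly_monom mult_1)
    qed
    then show ?thesis using True by (simp only: \<Lambda>_def)
  qed
  finally show ?thesis .
qed

text \<open>
  Laguerre polynomials of order at most \<open>j\<close> span the polynomials of degree at most \<open>j\<close>,
  because the leading coefficients do not vanish.
\<close>

lemma laguerre_moments_zero:
  assumes f: "f \<in> L2 M" and p: "p \<in> k_harmonics P k m"
    and zero: "\<And>l. l2_inner M f (laguerre_function p m l) = 0"
  shows "(LINT x|M. rad x ^ j *\<^sub>R (f x * cnj (p x) * of_real (exp (- (rad x / 2))))) = 0"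
proof (induction j rule: less_induct)
  case (less j)
  have cp: "cpoly p" using p by (simp add: k_harmonics_def homogeneous_polynomial_iff)
  define I where "I q = l2_inner M f (\<lambda>x. p x * of_real (profile a q x))" for q
  have L2: "(\<lambda>x. p x * of_real (profile a q x)) \<in> L2 M" for q by (rule L2_profile[OF cp])
  have I_add: "I (A + B) = I A + I B" for A B
  proof -
    have "(\<lambda>x. p x * complex_of_real (profile a (A + B) x)) = (\<lambda>x. p x * of_real (profile a A x) + p x * of_real (profile a B x))"
      by (simp add: profile_def algebra_simps)
    then show ?thesis unfolding I_def by (simp only: l2_inner_add_right[OF L2 L2 f])
  qed
  have I_smult: "I (smult c A) = of_real c * I A" for c A
  proof -
    have "(\<lambda>x. p x * complex_of_real (profile a (smult c A) x)) = (\<lambda>x. of_real c * (p x * of_real (profile a A x)))"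
      by (simp add: profile_def algebra_simps)
    then show ?thesis unfolding I_def by (simp only: l2_inner_scale_right complex_cnj_complex_of_real)
  qed
  have I0: "I 0 = 0" using I_smult[of 0 0] by simp
  have I_sum: "I (\<Sum>i\<in>S. g i) = (\<Sum>i\<in>S. I (g i))" for S :: "nat set" and g
    by (induction S rule: infinite_finite_induct) (auto simp: I0 I_add)
  have I_monom: "I (monom 1 i) = (LINT x|M. rad x ^ i *\<^sub>R (f x * cnj (p x) * of_real (exp (- (rad x / 2)))))" for i
    unfolding I_def l2_inner_def
    by (intro Bochner_Integration.integral_cong refl) (simp add: profile_def poly_monom scaleR_conv_of_real mult_ac)
  define c where "c = coeff (laguerre_poly j (\<nu> m))"
  have "c j \<noteq> 0" by (simp add: c_def coeff_laguerre_poly)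
  have "laguerre_poly j (\<nu> m) = (\<Sum>i\<le>j. smult (c i) (monom 1 i))"
  proof -
    have "c i = (- 1) ^ i * ((real j + \<nu> m) gchoose (j - i)) / fact i" if "i \<le> j" for i
      using that by (simp add: c_def coeff_laguerre_poly)
    then show ?thesis
      unfolding laguerre_poly_def by (intro sum.cong refl) (simp add: smult_monom)
  qed
  then have "I (laguerre_poly j (\<nu> m)) = (\<Sum>i\<le>j. of_real (c i) * I (monom 1 i))"
    by (simp add: I_sum I_smult)
  also have "\<dots> = (\<Sum>i\<in>{j}. of_real (c i) * I (monom 1 i))"
    by (rule sum.mono_neutral_right) (use less in \<open>auto simp: I_monom\<close>)
  finally have "I (laguerre_poly j (\<nu> m)) = of_real (c j) * I (monom 1 j)" by simp
  moreover have "I (laguerre_poly j (\<nu> m)) = 0"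
    using zero[of j] by (simp add: I_def laguerre_function_def[abs_def])
  ultimately have "I (monom 1 j) = 0" using \<open>c j \<noteq> 0\<close> by simp
  then show ?case by (simp only: I_monom)
qed

text \<open>
  The radial moments of \<open>f\<close> against \<open>p\<close> vanish, and the weight
  \<open>exp (- t / 2)\<close>, half of which secures integrability, leaves room for an exponential moment. So all
  integrals against functions of the radius vanish; one of these is the indicator of the ball times a power of
  \<open>|x|\<^sup>2\<close>, with the weight removed.
\<close>

lemma ball_integral_harmonic_zero:
  assumes f: "f \<in> L2 M" and p: "p \<in> k_harmonics P k m"
    and zero: "\<And>l. l2_inner M f (laguerre_function p m l) = 0"
  shows "(LINT x|M. indicator (cball 0 \<rho>) x *\<^sub>R (f x * (of_real ((x \<bullet> x) ^ j) * cnj (p x)))) = 0"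
proof (cases "\<rho> \<ge> 0")
  case False
  then show ?thesis by simp
next
  case \<rho>: True
  have cp: "cpoly p" using p by (simp add: k_harmonics_def homogeneous_polynomial_iff)
  have [measurable]: "f \<in> borel_measurable borel" "p \<in> borel_measurable borel"
    using L2_measurable[OF f] cpoly_borel_measurable[OF cp] by auto
  define g where "g x = f x * cnj (p x) * of_real (exp (- (rad x / 2)))" for x
  have [measurable]: "g \<in> borel_measurable borel" unfolding g_def by measurable
  have rad0: "0 \<le> rad x" for x using a_pos by simp
  have L2g: "integrable M (\<lambda>x. f x * (cnj (p x) * of_real (exp (- (c * norm x powr a)))))" if "0 < c" for c
    using that by (intro L2_mult_integrable f L2_subexp subexp_cnj cpoly_subexp cp a_pos) measurable
  (* Half of the decay of g is spent on the exponential moment, the other half on integrability. *)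
  have gint: "integrable M (\<lambda>x. exp (2 * (1 / 8) * rad x) *\<^sub>R g x)"
  proof -
    have "exp (2 * (1 / 8) * rad x) *\<^sub>R g x = f x * (cnj (p x) * of_real (exp (- (1 / (2 * a) * norm x powr a))))" for x
    proof -
      have "exp (2 * (1 / 8) * rad x) * exp (- (rad x / 2)) = exp (- (1 / (2 * a) * norm x powr a))"
        using a_pos by (simp add: exp_add[symmetric] field_simps)
      then show ?thesis unfolding g_def scaleR_conv_of_real by (metis (no_types, opaque_lifting) mult.assoc mult.commute of_real_mult)
    qed
    then show ?thesis using L2g[of "1 / (2 * a)"] a_pos by simp
  qed
  have gint0: "integrable M g"
  proof -
    have "g = (\<lambda>x. f x * (cnj (p x) * of_real (exp (- (1 / a * norm x powr a)))))"
      by (simp add: g_def fun_eq_iff mult.assoc)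
    then show ?thesis using L2g[of "1 / a"] a_pos by simp
  qed
  define root where "root s = (a / 2 * s) powr (1 / a)" for s
  have root_rad: "root (rad x) = norm x" for x
    using a_pos by (simp add: root_def powr_powr)
  define \<phi> where "\<phi> s = (if root s \<le> \<rho> then (root s ^ 2) ^ j * exp (s / 2) else 0)" for s
  have [measurable]: "\<phi> \<in> borel_measurable borel" unfolding \<phi>_def root_def by measurable
  have eq: "\<phi> (rad x) *\<^sub>R g x = indicator (cball 0 \<rho>) x *\<^sub>R (f x * (of_real ((x \<bullet> x) ^ j) * cnj (p x)))" for x
  proof (cases "norm x \<le> \<rho>")
    case True
    have "\<phi> (rad x) = (x \<bullet> x) ^ j * exp (rad x / 2)"
      unfolding \<phi>_def root_rad using True by (simp add: power2_norm_eq_inner)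
    moreover have "complex_of_real (exp (rad x / 2)) * of_real (exp (- (rad x / 2))) = 1"
      by (simp add: exp_minus)
    ultimately show ?thesis
      using True by (simp add: g_def scaleR_conv_of_real mult_ac del: of_real_power)
  next
    case False
    then show ?thesis unfolding \<phi>_def root_rad by simp
  qed
  have "(LINT x|M. \<phi> (rad x) *\<^sub>R g x) = 0"
  proof (rule integral_zero_if_Laplace_zero[where c = "1 / 8" and s = rad and g = g and \<phi> = \<phi>])
    show "(LINT x|M. exp (- (real n * (1 / 8 * rad x))) *\<^sub>R g x) = 0" for n
      using laguerre_moments_zero[OF f p zero]
      by (intro Laplace_zero_if_moments_zero[OF _ _ rad0 _ gint]) (auto simp: g_def)
    show "integrable M (\<lambda>x. \<phi> (rad x) *\<^sub>R g x)"
    proof (rule Bochner_Integration.integrable_bound)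
      let ?C = "(\<rho> ^ 2) ^ j * exp (1 / a * \<rho> powr a)"
      show "integrable M (\<lambda>x. ?C *\<^sub>R g x)" by (rule integrable_scaleR_right) (rule gint0)
      show "AE x in M. norm (\<phi> (rad x) *\<^sub>R g x) \<le> norm (?C *\<^sub>R g x)"
      proof (intro AE_I2)
        fix x :: "real ^ 'n"
        have "\<bar>\<phi> (rad x)\<bar> \<le> ?C"
        proof (cases "norm x \<le> \<rho>")
          case True
          have "norm x powr a \<le> \<rho> powr a" using True a_pos by (intro powr_mono2) auto
          then have "exp (rad x / 2) \<le> exp (1 / a * \<rho> powr a)" using a_pos by (simp add: divide_right_mono)
          moreover have "(norm x ^ 2) ^ j \<le> (\<rho> ^ 2) ^ j" using True by (intro power_mono) auto
          ultimately have "(norm x ^ 2) ^ j * exp (rad x / 2) \<le> ?C" using \<rho> by (intro mult_mono) auto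
          then show ?thesis unfolding \<phi>_def root_rad using True by simp
        next
          case False
          then show ?thesis unfolding \<phi>_def root_rad using \<rho> by simp
        qed
        then have "\<bar>\<phi> (rad x)\<bar> * norm (g x) \<le> \<bar>?C\<bar> * norm (g x)"
          by (intro mult_right_mono order_trans[OF _ abs_ge_self]) auto
        then show "norm (\<phi> (rad x) *\<^sub>R g x) \<le> norm (?C *\<^sub>R g x)" by simp
      qed
    qed measurable
  qed (use gint0 rad0 in auto)
  then show ?thesis by (simp only: eq)
qed

text \<open>
  The coefficient functions \<open>h\<close> and \<open>d\<close> are a Fischer decomposition of each monomial.
  They are kept as data because a countable subfamily of the Laguerre functions is all that is to be tested. On
  every ball \<open>f\<close> is orthogonal to all polynomials, hence to its own real and imaginary part.
\<close>

theorem laguerre_functions_total: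
  assumes f: "f \<in> L2 M"
    and h: "\<And>xs j. h xs j \<in> k_harmonics P k (d xs j)"
    and mono: "\<And>xs. monomial xs = (\<lambda>x. \<Sum>j\<le>length xs. of_real ((x \<bullet> x) ^ j) * h xs j x)"
    and zero: "\<And>xs j l. l2_inner M f (laguerre_function (h xs j) (d xs j) l) = 0"
  shows "AE x in M. f x = 0"
proof -
  have [measurable]: "f \<in> borel_measurable borel" using L2_measurable[OF f] by simp
  have "AE x in M. x \<in> cball 0 \<rho> \<longrightarrow> f x = 0" for \<rho>
  proof -
    (* Outside the ball g vanishes, so the moments of g on a compact set decide. *)
    define g where "g x = indicator (cball 0 \<rho>) x *\<^sub>R f x" for x
    have [measurable]: "cball (0 :: real ^ 'n) \<rho> \<in> sets borel" by simp
    have gm[measurable]: "g \<in> borel_measurable borel" unfolding g_def by measurable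
    have intF: "integrable M (\<lambda>x. indicator (cball 0 \<rho>) x *\<^sub>R (f x * F x))" if F: "cpoly F" for F
    proof -
      have [measurable]: "F \<in> borel_measurable borel" using F by (rule cpoly_borel_measurable)
      define C where "C = exp (1 / a * \<rho> powr a)"
      have "integrable M (\<lambda>x. f x * (F x * of_real (exp (- (1 / a * norm x powr a)))))"
        using a_pos by (intro L2_mult_integrable f L2_subexp cpoly_subexp F) auto
      then have "integrable M (\<lambda>x. C *\<^sub>R (f x * (F x * of_real (exp (- (1 / a * norm x powr a))))))"
        by (intro integrable_scaleR_right)
      then show ?thesis
      proof (rule Bochner_Integration.integrable_bound)
        show "AE x in M. norm (indicator (cball 0 \<rho>) x *\<^sub>R (f x * F x)) \<le>
            norm (C *\<^sub>R (f x * (F x * of_real (exp (- (1 / a * norm x powr a))))))"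
        proof (intro AE_I2)
          fix x :: "real ^ 'n"
          have "indicator (cball 0 \<rho>) x \<le> C * exp (- (1 / a * norm x powr a))"
          proof (cases "norm x \<le> \<rho>")
            case True
            have "norm x powr a \<le> \<rho> powr a" using True a_pos by (intro powr_mono2) auto
            then have "0 \<le> 1 / a * \<rho> powr a + - (1 / a * norm x powr a)" using a_pos by (simp add: divide_right_mono)
            then show ?thesis using True unfolding C_def exp_add[symmetric] by simp
          qed (simp add: C_def)
          then have "indicator (cball 0 \<rho>) x * (norm (f x) * norm (F x)) \<le>
              C * exp (- (1 / a * norm x powr a)) * (norm (f x) * norm (F x))"
            by (intro mult_right_mono) auto
          then show "norm (indicator (cball 0 \<rho>) x *\<^sub>R (f x * F x)) \<le>
            norm (C *\<^sub>R (f x * (F x * of_real (exp (- (1 / a * norm x powr a))))))"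
            by (simp add: norm_mult C_def mult_ac)
        qed
      qed measurable
    qed
    have mono0: "(LINT x|M. indicator (cball 0 \<rho>) x *\<^sub>R (f x * monomial xs x)) = 0" for xs
    proof -
      have "monomial xs x = cnj (monomial xs x)" for x :: "real ^ 'n" by (induction xs) auto
      then have m: "monomial xs x = (\<Sum>j\<le>length xs. of_real ((x \<bullet> x) ^ j) * cnj (h xs j x))" for x
        using mono[of xs] by (metis (no_types, lifting) cnj_sum complex_cnj_complex_of_real complex_cnj_mult sum.cong)
      have "(LINT x|M. indicator (cball 0 \<rho>) x *\<^sub>R (f x * monomial xs x)) =
          (LINT x|M. (\<Sum>j\<le>length xs. indicator (cball 0 \<rho>) x *\<^sub>R (f x * (of_real ((x \<bullet> x) ^ j) * cnj (h xs j x)))))"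
        unfolding m sum_distrib_left scaleR_sum_right ..
      also have "\<dots> = (\<Sum>j\<le>length xs. (LINT x|M. indicator (cball 0 \<rho>) x *\<^sub>R (f x * (of_real ((x \<bullet> x) ^ j) * cnj (h xs j x)))))"
        using homogeneous_norm_power h
        by (intro Bochner_Integration.integral_sum intF cpoly_mult cpoly_cnj) (auto simp: homogeneous_polynomial_iff k_harmonics_def)
      also have "\<dots> = 0" by (simp only: ball_integral_harmonic_zero[OF f h zero] sum.neutral_const)
      finally show ?thesis .
    qed
    have span0: "(LINT x|M. indicator (cball 0 \<rho>) x *\<^sub>R (f x * F x)) = 0 \<and> cpoly F" if "monomial_span F" for F
      using that
    proof (induction rule: monomial_span.induct)
      case (monomial c xs)
      have "(LINT x|M. indicator (cball 0 \<rho>) x *\<^sub>R (f x * (c * monomial xs x))) =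
          (LINT x|M. c * (indicator (cball 0 \<rho>) x *\<^sub>R (f x * monomial xs x)))"
        by (intro Bochner_Integration.integral_cong refl) (simp add: scaleR_conv_of_real mult_ac)
      also have "\<dots> = c * (LINT x|M. indicator (cball 0 \<rho>) x *\<^sub>R (f x * monomial xs x))"
        by (rule integral_mult_right_zero)
      also have "\<dots> = 0" by (simp only: mono0 mult_zero_right)
      finally have "(LINT x|M. indicator (cball 0 \<rho>) x *\<^sub>R (f x * (c * monomial xs x))) = 0" .
      moreover have "cpoly (monomial xs :: real ^ 'n \<Rightarrow> complex)"
        using homogeneous_monomial[of xs] by (simp add: homogeneous_polynomial_iff)
      ultimately show ?case by (intro conjI cpoly_cmult)
    next
      case (add F G)
      have "(LINT x|M. indicator (cball 0 \<rho>) x *\<^sub>R (f x * (F x + G x))) =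
          (LINT x|M. indicator (cball 0 \<rho>) x *\<^sub>R (f x * F x)) + (LINT x|M. indicator (cball 0 \<rho>) x *\<^sub>R (f x * G x))"
        unfolding distrib_left scaleR_add_right using add.IH
        by (intro Bochner_Integration.integral_add intF) auto
      then show ?case using add.IH by (auto intro: cpoly_add)
    qed
    have gint: "integrable M g" using intF[OF cpoly_const[of 1]] by (simp add: g_def[abs_def])
    have gf2: "integrable M (\<lambda>x. (cmod (f x))\<^sup>2)" by (rule L2_integrable_norm_square[OF f])
    have part: "(LINT x|M. r x *\<^sub>R g x) = 0 \<and> integrable M (\<lambda>x. r x *\<^sub>R g x)"
      if [measurable]: "r \<in> borel_measurable borel" and r: "\<And>x. \<bar>r x\<bar> \<le> cmod (f x)" for r :: "real ^ 'n \<Rightarrow> real"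
    proof -
      have int: "integrable M (\<lambda>x. r x *\<^sub>R g x)"
      proof (rule Bochner_Integration.integrable_bound[OF gf2])
        show "AE x in M. norm (r x *\<^sub>R g x) \<le> norm ((cmod (f x))\<^sup>2)"
          using mult_right_mono[OF r norm_ge_zero] by (intro AE_I2) (auto simp: g_def indicator_def power2_eq_square)
      qed measurable
      have "(LINT x|M. r x *\<^sub>R g x) = 0"
      proof (rule integral_zero_if_moments_zero[where X = "\<lambda>x. x" and K = "cball 0 \<rho>" and \<phi> = r, OF gint])
        show "compact (cball (0 :: real ^ 'n) \<rho>)" by simp
        show "x \<notin> cball 0 \<rho> \<Longrightarrow> g x = 0" for x by (simp add: g_def)
        fix F :: "real ^ 'n \<Rightarrow> real" assume "real_polynomial_function F"
        then have "cpoly (\<lambda>x. complex_of_real (F x))" by (rule real_polynomial_function_cpoly)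
        from span0[OF cpoly_monomial_span[OF this]]
        show "(LINT x|M. F x *\<^sub>R g x) = 0"
          by (simp add: g_def scaleR_conv_of_real mult_ac)
      qed (use int in auto)
      then show ?thesis using int by simp
    qed
    have Re: "(LINT x|M. Re (f x) *\<^sub>R g x) = 0 \<and> integrable M (\<lambda>x. Re (f x) *\<^sub>R g x)"
      by (rule part) (auto intro: abs_Re_le_cmod)
    have Im: "(LINT x|M. Im (f x) *\<^sub>R g x) = 0 \<and> integrable M (\<lambda>x. Im (f x) *\<^sub>R g x)"
      by (rule part) (auto intro: abs_Im_le_cmod)
    (* Tested with the conjugate of f itself, the vanishing integral is the norm of g. *)
    have "(LINT x|M. Re (f x) *\<^sub>R g x - \<i> * (Im (f x) *\<^sub>R g x)) =
        (LINT x|M. Re (f x) *\<^sub>R g x) - (LINT x|M. \<i> * (Im (f x) *\<^sub>R g x))"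
      using Re Im by (intro Bochner_Integration.integral_diff integrable_mult_right) blast+
    also have "\<dots> = 0"
      by (simp only: Re[THEN conjunct1] integral_mult_right_zero Im[THEN conjunct1] mult_zero_right diff_zero)
    finally have "(LINT x|M. Re (f x) *\<^sub>R g x - \<i> * (Im (f x) *\<^sub>R g x)) = 0" .
    moreover have "Re (f x) *\<^sub>R g x - \<i> * (Im (f x) *\<^sub>R g x) = of_real ((cmod (g x))\<^sup>2)" for x
    proof -
      have "Re (f x) *\<^sub>R g x - \<i> * (Im (f x) *\<^sub>R g x) = cnj (f x) * g x"
        by (simp add: complex_eq_iff)
      also have "\<dots> = of_real ((cmod (g x))\<^sup>2)"
        unfolding complex_norm_square by (simp add: g_def indicator_def mult.commute)
      finally show ?thesis .
    qed
    ultimately have "complex_of_real (LINT x|M. (cmod (g x))\<^sup>2) = 0"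
      by (simp only: integral_complex_of_real)
    then have "(LINT x|M. (cmod (g x))\<^sup>2) = 0" by simp
    moreover have "integrable M (\<lambda>x. (cmod (g x))\<^sup>2)"
      by (rule Bochner_Integration.integrable_bound[OF gf2]) (auto simp: g_def indicator_def)
    ultimately have "AE x in M. (cmod (g x))\<^sup>2 = 0"
      by (subst (asm) integral_nonneg_eq_0_iff_AE) auto
    then show ?thesis by eventually_elim (auto simp: g_def indicator_def)
  qed
  then have "AE x in M. \<forall>n::nat. x \<in> cball 0 (real n) \<longrightarrow> f x = 0"
    unfolding AE_all_countable by blast
  then show ?thesis
  proof eventually_elim
    fix x :: "real ^ 'n" assume "\<forall>n::nat. x \<in> cball 0 (real n) \<longrightarrow> f x = 0"
    moreover obtain n :: nat where "norm x \<le> real n" using real_arch_simple by blast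
    ultimately show "f x = 0" by (metis mem_cball_0)
  qed
qed

end

section \<open>Gram-Schmidt orthonormalization\<close>

lemma complex_span_zero: "(\<lambda>x. 0) \<in> complex_span S"
  unfolding complex_span_def by (intro CollectI exI[of _ "0::nat"]) simp

lemma complex_span_step:
  assumes g: "g \<in> S" and "F \<in> complex_span S"
  shows "(\<lambda>x. c * g x + F x) \<in> complex_span S"
proof -
  obtain n :: nat and d h where F: "F = (\<lambda>x. \<Sum>i<n. d i * h i x)" and h: "\<forall>i<n. h i \<in> S"
    using assms(2) by (auto simp: complex_span_def)
  have "(\<lambda>x. c * g x + F x) = (\<lambda>x. \<Sum>i<Suc n. (d(n := c)) i * (h(n := g)) i x)"
    by (simp add: F fun_eq_iff add.commute)
  moreover have "\<forall>i<Suc n. (h(n := g)) i \<in> S" using h g by (auto simp: less_Suc_eq)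
  ultimately show ?thesis unfolding complex_span_def by blast
qed

lemma complex_span_induct [consumes 1, case_names zero step]:
  assumes "F \<in> complex_span S"
    and zero: "Q (\<lambda>x. 0)"
    and step: "\<And>c g G. g \<in> S \<Longrightarrow> G \<in> complex_span S \<Longrightarrow> Q G \<Longrightarrow> Q (\<lambda>x. c * g x + G x)"
  shows "Q F"
proof -
  have "(\<lambda>x. \<Sum>i<n. c i * g i x) \<in> complex_span S \<and> Q (\<lambda>x. \<Sum>i<n. c i * g i x)"
    if "\<forall>i<n. g i \<in> S" for n :: nat and c g
    using that
  proof (induction n)
    case 0 show ?case using complex_span_zero zero by simp
  next
    case (Suc n)
    then have IH: "(\<lambda>x. \<Sum>i<n. c i * g i x) \<in> complex_span S" "Q (\<lambda>x. \<Sum>i<n. c i * g i x)" and "g n \<in> S" by auto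
    then show ?case
      using step[of "g n" "\<lambda>x. \<Sum>i<n. c i * g i x" "c n"] complex_span_step[of "g n" S "\<lambda>x. \<Sum>i<n. c i * g i x" "c n"]
      by (simp add: add.commute)
  qed
  then show ?thesis using assms(1) by (auto simp: complex_span_def)
qed

lemma complex_span_lin:
  assumes "F \<in> complex_span S" and G: "G \<in> complex_span S"
  shows "(\<lambda>x. c * F x + G x) \<in> complex_span S"
  using assms(1)
proof (induction F rule: complex_span_induct)
  case zero then show ?case using G by simp
next
  case (step d g F)
  from complex_span_step[OF step(1) step(3), of "c * d"] show ?case
    by (simp add: algebra_simps)
qed

lemma complex_span_base: "g \<in> S \<Longrightarrow> g \<in> complex_span S"
  using complex_span_step[OF _ complex_span_zero, of g S 1] by simp

lemma complex_span_scale: "F \<in> complex_span S \<Longrightarrow> (\<lambda>x. c * F x) \<in> complex_span S"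
  using complex_span_lin[OF _ complex_span_zero, of F S c] by simp

lemma complex_span_sum:
  "(\<And>i. i \<in> I \<Longrightarrow> F i \<in> complex_span S) \<Longrightarrow> (\<lambda>x. \<Sum>i\<in>I. c i * F i x) \<in> complex_span S"
  by (induction I rule: infinite_finite_induct) (auto simp: complex_span_zero complex_span_lin)

lemma complex_span_mono: "S \<subseteq> S' \<Longrightarrow> complex_span S \<subseteq> complex_span S'"
  by (auto simp: complex_span_def) blast

lemma complex_span_L2:
  assumes "F \<in> complex_span S" "S \<subseteq> L2 M"
  shows "F \<in> L2 M"
  using assms(1) by (induction F rule: complex_span_induct) (use assms(2) in \<open>auto intro!: L2_zero L2_add L2_scale\<close>)

lemma complex_span_orthogonal:
  assumes "F \<in> complex_span S" "S \<subseteq> L2 M" "u \<in> L2 M" and orth: "\<And>g. g \<in> S \<Longrightarrow> l2_inner M u g = 0"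
  shows "l2_inner M u F = 0"
  using assms(1)
proof (induction F rule: complex_span_induct)
  case zero then show ?case by (simp add: l2_inner_def)
next
  case (step c g G)
  have "g \<in> L2 M" "G \<in> L2 M" using step assms(2) by (auto intro: complex_span_L2[OF _ assms(2)])
  then show ?case
    using assms(3) step by (simp add: l2_inner_add_right L2_scale l2_inner_scale_right orth)
qed

text \<open>
  A null vector is sent to zero, since \<open>1 / 0 = 0\<close>.
\<close>

definition normalize_L2 :: "'a measure \<Rightarrow> ('a \<Rightarrow> complex) \<Rightarrow> 'a \<Rightarrow> complex" where
  "normalize_L2 M v x = of_real (1 / sqrt (Re (l2_inner M v v))) * v x"

lemma normalize_L2_norm:
  "l2_inner M (normalize_L2 M v) (normalize_L2 M v) = 0 \<or> l2_inner M (normalize_L2 M v) (normalize_L2 M v) = 1"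
proof -
  define s where "s = (LINT x|M. (cmod (v x))\<^sup>2)"
  have s: "s \<ge> 0" unfolding s_def by simp
  have "l2_inner M (normalize_L2 M v) (normalize_L2 M v) = of_real (1 / sqrt s) * (of_real (1 / sqrt s) * of_real s)"
    unfolding normalize_L2_def[abs_def] l2_inner_scale_left l2_inner_scale_right
    by (simp add: l2_inner_self s_def)
  also have "\<dots> = of_real (1 / sqrt s * (1 / sqrt s * s))" by (simp only: of_real_mult)
  also have "1 / sqrt s * (1 / sqrt s * s) = (if s = 0 then 0 else 1)" using s by auto
  finally show ?thesis by auto
qed

lemma normalize_L2_recover:
  assumes v: "v \<in> L2 M" and u: "u \<in> L2 M" and "l2_inner M u (normalize_L2 M v) = 0"
  shows "l2_inner M u v = 0"
proof (cases "l2_inner M v v = 0")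
  case True
  then have "AE x in M. v x = 0" by (rule l2_inner_self_eq_0[OF v])
  then have "l2_inner M u v = l2_inner M u (\<lambda>x. 0)"
    using u v by (intro l2_inner_cong_AE) (auto intro: L2_measurable)
  then show ?thesis by (simp add: l2_inner_def)
next
  case False
  then have "Re (l2_inner M v v) \<noteq> 0" by (simp add: l2_inner_self)
  then show ?thesis using assms(3) unfolding normalize_L2_def[abs_def] l2_inner_scale_right by simp
qed

fun gram_schmidt :: "'a measure \<Rightarrow> (nat \<Rightarrow> 'a \<Rightarrow> complex) \<Rightarrow> nat \<Rightarrow> 'a \<Rightarrow> complex" where
  "gram_schmidt M f n =
     normalize_L2 M (\<lambda>x. f n x - (\<Sum>i<n. l2_inner M (f n) (gram_schmidt M f i) * gram_schmidt M f i x))"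

declare gram_schmidt.simps [simp del]

context
  fixes M :: "'a measure" and f :: "nat \<Rightarrow> 'a \<Rightarrow> complex"
  assumes f_L2: "\<And>n. f n \<in> L2 M"
begin

abbreviation (input) "gs \<equiv> gram_schmidt M f"
abbreviation (input) "res n \<equiv> (\<lambda>x. f n x - (\<Sum>i<n. l2_inner M (f n) (gs i) * gs i x))"

lemma gram_schmidt_L2: "gs n \<in> L2 M"
proof (induction n rule: less_induct)
  case (less n)
  then show ?case
    unfolding gram_schmidt.simps[of M f n] normalize_L2_def[abs_def]
    by (intro L2_scale L2_diff f_L2 L2_sum) auto
qed

lemma gram_schmidt_norm: "l2_inner M (gs n) (gs n) = 0 \<or> l2_inner M (gs n) (gs n) = 1"
  unfolding gram_schmidt.simps[of M f n] by (rule normalize_L2_norm)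

lemma gram_schmidt_projection:
  assumes u: "u \<in> L2 M"
  shows "l2_inner M u (gs n) * l2_inner M (gs n) (gs n) = l2_inner M u (gs n)"
proof (cases "l2_inner M (gs n) (gs n) = 0")
  case True
  then have "AE x in M. gs n x = 0" by (rule l2_inner_self_eq_0[OF gram_schmidt_L2])
  then have "l2_inner M u (gs n) = l2_inner M u (\<lambda>x. 0)"
    using u gram_schmidt_L2[of n] by (intro l2_inner_cong_AE) (auto intro: L2_measurable)
  then show ?thesis by (simp add: l2_inner_def)
qed (use gram_schmidt_norm[of n] in auto)

lemma residual_L2: "res n \<in> L2 M"
  by (intro L2_diff f_L2 L2_sum L2_scale gram_schmidt_L2)

lemma gram_schmidt_orthogonal_less: "i < n \<Longrightarrow> l2_inner M (gs n) (gs i) = 0"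
proof (induction n arbitrary: i rule: less_induct)
  case (less n)
  have off: "l2_inner M (gs j) (gs i) = 0" if "j < n" "j \<noteq> i" for j
  proof (cases "i < j")
    case True then show ?thesis using less.IH that by blast
  next
    case False
    then have "l2_inner M (gs i) (gs j) = 0" using less that by auto
    then show ?thesis by (subst l2_inner_commute) simp
  qed
  have "l2_inner M (res n) (gs i) =
      l2_inner M (f n) (gs i) - (\<Sum>j<n. l2_inner M (f n) (gs j) * l2_inner M (gs j) (gs i))"
    by (simp add: l2_inner_diff_left l2_inner_sum_left l2_inner_scale_left f_L2 L2_sum L2_scale gram_schmidt_L2)
  also have "(\<Sum>j<n. l2_inner M (f n) (gs j) * l2_inner M (gs j) (gs i)) =
      (\<Sum>j<n. if j = i then l2_inner M (f n) (gs i) else 0)"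
    by (intro sum.cong refl) (auto simp: off gram_schmidt_projection[OF f_L2])
  finally have "l2_inner M (res n) (gs i) = 0" using less.prems by simp
  then show ?case
    unfolding gram_schmidt.simps[of M f n] normalize_L2_def[abs_def] l2_inner_scale_left by simp
qed

lemma gram_schmidt_orthogonal: "i \<noteq> j \<Longrightarrow> l2_inner M (gs i) (gs j) = 0"
proof (cases "i < j")
  case True
  then have "l2_inner M (gs j) (gs i) = 0" by (rule gram_schmidt_orthogonal_less)
  then show ?thesis by (subst l2_inner_commute) simp
qed (auto intro: gram_schmidt_orthogonal_less)

lemma gram_schmidt_complete:
  assumes u: "u \<in> L2 M" and zero: "\<And>n. l2_inner M u (gs n) = 0"
  shows "l2_inner M u (f n) = 0"
proof -
  have "l2_inner M u (res n) = 0"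
    using zero[of n] unfolding gram_schmidt.simps[of M f n]
    by (rule normalize_L2_recover[OF residual_L2 u])
  moreover have "l2_inner M u (\<lambda>x. \<Sum>i<n. l2_inner M (f n) (gs i) * gs i x) = 0"
    by (rule complex_span_orthogonal[OF complex_span_sum[OF complex_span_base[of _ "range gs"]]])
       (auto simp: gram_schmidt_L2 u zero)
  ultimately show ?thesis
    using u by (simp add: l2_inner_diff_right f_L2 L2_sum L2_scale gram_schmidt_L2)
qed

text \<open>
  If the given vectors fall into mutually orthogonal blocks, the coefficients that link different blocks vanish,
  and the process does not leave a block. For eigenspaces this keeps eigenvectors eigenvectors.
\<close>

lemma gram_schmidt_in_block:
  fixes ev :: "nat \<Rightarrow> 'b"
  assumes orth: "\<And>i j. ev i \<noteq> ev j \<Longrightarrow> l2_inner M (f i) (f j) = 0"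
  shows "gs n \<in> complex_span {f i | i. ev i = ev n}"
proof (induction n rule: less_induct)
  case (less n)
  let ?S = "{f i | i. ev i = ev n}"
  have "(\<lambda>x. l2_inner M (f n) (gs i) * gs i x) \<in> complex_span ?S" if "i < n" for i
  proof (cases "ev i = ev n")
    case True
    then show ?thesis using less[OF that] by (simp add: complex_span_scale)
  next
    case False
    have "l2_inner M (f n) (gs i) = 0"
      by (rule complex_span_orthogonal[OF less[OF that]]) (use False in \<open>auto intro: f_L2 orth\<close>)
    then show ?thesis by (simp add: complex_span_zero)
  qed
  then have "(\<lambda>x. \<Sum>i<n. 1 * (l2_inner M (f n) (gs i) * gs i x)) \<in> complex_span ?S"
    by (intro complex_span_sum) auto
  then have "(\<lambda>x. - 1 * (\<Sum>i<n. l2_inner M (f n) (gs i) * gs i x) + f n x) \<in> complex_span ?S"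
    using complex_span_base[of "f n" ?S] by (intro complex_span_lin) auto
  then have "res n \<in> complex_span ?S" by (simp add: algebra_simps)
  then show ?case
    unfolding gram_schmidt.simps[of M f n] normalize_L2_def[abs_def] by (rule complex_span_scale)
qed

end

section \<open>The spectral resolution of the oscillator\<close>

context dunkl_oscillator_setting
begin

definition eigenvalue :: "nat \<Rightarrow> nat \<Rightarrow> real" where
  "eigenvalue m l = - (2 * a * l + a * (\<nu> m + 1))"

text \<open>
  Grouped by eigenvalue because different pairs of \<open>m\<close> and \<open>l\<close> can share one.
\<close>

definition eigenfunctions :: "real \<Rightarrow> (real ^ 'n \<Rightarrow> complex) set" where
  "eigenfunctions \<kappa> = {laguerre_function p m l | p m l. p \<in> k_harmonics P k m \<and> eigenvalue m l = \<kappa>}"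

lemma laguerre_functions_eq: "laguerre_functions P k a = (\<Union>\<kappa>. eigenfunctions \<kappa>)"
  by (auto simp: laguerre_functions_profile eigenfunctions_def laguerre_function_def[abs_def])

lemma eigenfunctions_L2: "eigenfunctions \<kappa> \<subseteq> L2 M"
  by (auto simp: eigenfunctions_def laguerre_function_L2)

lemma eigenfunctions_orthogonal:
  assumes "f \<in> eigenfunctions \<kappa>" "g \<in> eigenfunctions \<kappa>'" "\<kappa> \<noteq> \<kappa>'"
  shows "l2_inner M f g = 0"
proof -
  obtain p m l q n l' where "f = laguerre_function p m l" "p \<in> k_harmonics P k m" "eigenvalue m l = \<kappa>"
      and "g = laguerre_function q n l'" "q \<in> k_harmonics P k n" "eigenvalue n l' = \<kappa>'"
    using assms(1,2) by (auto simp: eigenfunctions_def)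
  then show ?thesis using assms(3) laguerre_function_orthogonal[of p m q n l l'] by auto
qed

lemma eigenfunctions_oscillator:
  assumes "f \<in> eigenfunctions \<kappa>"
  shows "smooth_off_0 f" and "x \<noteq> 0 \<Longrightarrow> dunkl_oscillator P k a f x = of_real \<kappa> * f x"
proof -
  obtain p m l where f: "f = laguerre_function p m l" and p: "p \<in> k_harmonics P k m" and \<kappa>: "eigenvalue m l = \<kappa>"
    using assms by (auto simp: eigenfunctions_def)
  show "smooth_off_0 f" unfolding f laguerre_function_def[abs_def]
    using p by (intro smooth_off_0_profile a_pos) (simp add: k_harmonics_def homogeneous_polynomial_iff)
  show "dunkl_oscillator P k a f x = of_real \<kappa> * f x" if "x \<noteq> 0"
    unfolding f \<kappa>[symmetric] eigenvalue_def laguerre_function_def[abs_def]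
    by (rule oscillator_laguerre[OF a_pos p that])
qed

lemma oscillator_lin:
  assumes "smooth_off_0 f" "smooth_off_0 g" "x \<noteq> 0"
  shows "dunkl_oscillator P k a (\<lambda>y. c * f y + g y) x = c * dunkl_oscillator P k a f x + dunkl_oscillator P k a g x"
  by (simp only: dunkl_oscillator_def smooth_off_0_lin(2)[OF assms]) (simp add: algebra_simps)

lemma eigenspan_oscillator:
  assumes "F \<in> complex_span (eigenfunctions \<kappa>)"
  shows "smooth_off_0 F \<and> (\<forall>x. x \<noteq> 0 \<longrightarrow> dunkl_oscillator P k a F x = of_real \<kappa> * F x)"
  using assms
proof (induction F rule: complex_span_induct)
  case zero
  then show ?case by (simp add: smooth_off_0_zero dunkl_oscillator_def Lap_zero)
next
  case (step c g G)
  note g = eigenfunctions_oscillator[OF step(1)]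
  show ?case
    using step(3) g by (auto simp: oscillator_lin smooth_off_0_lin(1) distrib_left mult.left_commute)
qed

lemma oscillator_sum:
  fixes c :: "'i \<Rightarrow> complex"
  assumes "finite I" "\<And>i. i \<in> I \<Longrightarrow> smooth_off_0 (f i)"
  shows "smooth_off_0 (\<lambda>y. \<Sum>i\<in>I. c i * f i y) \<and>
    (\<forall>x. x \<noteq> 0 \<longrightarrow> dunkl_oscillator P k a (\<lambda>y. \<Sum>i\<in>I. c i * f i y) x = (\<Sum>i\<in>I. c i * dunkl_oscillator P k a (f i) x))"
  using smooth_off_0_sum[OF assms, where c = c]
  by (simp add: dunkl_oscillator_def sum_distrib_left right_diff_distrib sum_subtractf mult_ac)

text \<open>
  The symmetry of the oscillator, tested against an eigenvector. The value \<open>G\<close> is a combination of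
  the generators of \<open>F\<close>, each multiplied by its eigenvalue; those with an eigenvalue other than
  \<open>\<kappa>\<close> are orthogonal to \<open>e\<close>.
\<close>

lemma oscillator_symmetric_on_eigenspan:
  assumes F: "F \<in> complex_span (laguerre_functions P k a)" and e: "e \<in> complex_span (eigenfunctions \<kappa>)"
  shows "smooth_off_0 F \<and> (\<exists>G\<in>L2 M. (\<forall>x. x \<noteq> 0 \<longrightarrow> dunkl_oscillator P k a F x = G x) \<and>
      l2_inner M G e = of_real \<kappa> * l2_inner M F e)"
  using F
proof (induction F rule: complex_span_induct)
  case zero
  then show ?case
    by (auto simp: smooth_off_0_zero dunkl_oscillator_def Lap_zero l2_inner_zero_left intro!: bexI[of _ "\<lambda>x. 0"] L2_zero)
next
  case (step c g F)
  obtain \<kappa>' where g: "g \<in> eigenfunctions \<kappa>'" using step(1) by (auto simp: laguerre_functions_eq)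
  obtain G where G: "G \<in> L2 M" "\<forall>x. x \<noteq> 0 \<longrightarrow> dunkl_oscillator P k a F x = G x"
      "l2_inner M G e = of_real \<kappa> * l2_inner M F e" and sF: "smooth_off_0 F"
    using step(3) by blast
  have gL: "g \<in> L2 M" using eigenfunctions_L2 g by blast
  have eL: "e \<in> L2 M" by (rule complex_span_L2[OF e eigenfunctions_L2])
  have FL: "F \<in> L2 M"
    by (rule complex_span_L2[OF step(2)]) (use eigenfunctions_L2 in \<open>auto simp: laguerre_functions_eq\<close>)
  have ge: "of_real \<kappa>' * l2_inner M g e = of_real \<kappa> * l2_inner M g e"
  proof (cases "\<kappa> = \<kappa>'")
    case False
    then have "l2_inner M g e = 0"
      by (intro complex_span_orthogonal[OF e eigenfunctions_L2 gL] eigenfunctions_orthogonal[OF g]) auto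
    then show ?thesis by simp
  qed simp
  let ?G = "\<lambda>x. (c * of_real \<kappa>') * g x + G x"
  have "?G \<in> L2 M" by (intro L2_add L2_scale gL G)
  moreover have "\<forall>x. x \<noteq> 0 \<longrightarrow> dunkl_oscillator P k a (\<lambda>y. c * g y + F y) x = ?G x"
    using G(2) eigenfunctions_oscillator[OF g] sF by (simp add: oscillator_lin)
  moreover have "l2_inner M ?G e = of_real \<kappa> * l2_inner M (\<lambda>x. c * g x + F x) e"
  proof -
    have "l2_inner M ?G e = c * (of_real \<kappa>' * l2_inner M g e) + l2_inner M G e"
      by (subst l2_inner_add_left[OF L2_scale[OF gL] G(1) eL]) (simp only: l2_inner_scale_left mult.assoc)
    also have "\<dots> = of_real \<kappa> * (c * l2_inner M g e + l2_inner M F e)"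
      unfolding ge G(3) by (simp add: distrib_left mult.left_commute)
    also have "c * l2_inner M g e + l2_inner M F e = l2_inner M (\<lambda>x. c * g x + F x) e"
      by (subst l2_inner_add_left[OF L2_scale[OF gL] FL eL]) (simp only: l2_inner_scale_left)
    finally show ?thesis .
  qed
  moreover have "smooth_off_0 (\<lambda>x. c * g x + F x)"
    by (rule smooth_off_0_lin(1)[OF eigenfunctions_oscillator(1)[OF g] sF])
  ultimately show ?case by (intro conjI bexI[of _ ?G])
qed

lemma oscillator_graph_coordinates:
  assumes "(f, g) \<in> dunkl_oscillator_graph R P k a" and e: "e \<in> complex_span (eigenfunctions \<kappa>)"
  shows "f \<in> L2 M" and "g \<in> L2 M" and "l2_inner M g e = of_real \<kappa> * l2_inner M f e"
proof -
  have f: "f \<in> complex_span (laguerre_functions P k a)" and g: "g \<in> L2 M"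
    and eq: "AE x in M. g x = dunkl_oscillator P k a f x"
    using assms(1) by (auto simp: dunkl_oscillator_graph_def)
  show "f \<in> L2 M"
    by (rule complex_span_L2[OF f]) (use eigenfunctions_L2 in \<open>auto simp: laguerre_functions_eq\<close>)
  show "g \<in> L2 M" by (rule g)
  obtain G where G: "G \<in> L2 M" "\<forall>x. x \<noteq> 0 \<longrightarrow> dunkl_oscillator P k a f x = G x"
      "l2_inner M G e = of_real \<kappa> * l2_inner M f e"
    using oscillator_symmetric_on_eigenspan[OF f e] by blast
  have "AE x in M. g x = G x" using eq AE_dunkl_measure_nonzero by eventually_elim (use G(2) in auto)
  moreover have "e \<in> L2 M" by (rule complex_span_L2[OF e eigenfunctions_L2])
  ultimately have "l2_inner M g e = l2_inner M G e"
    using g G(1) by (intro l2_inner_cong_AE) (auto intro: L2_measurable)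
  then show "l2_inner M g e = of_real \<kappa> * l2_inner M f e" using G(3) by simp
qed

lemma eigenspan_sum_in_graph:
  fixes ev :: "'i \<Rightarrow> real"
  assumes "finite I" and e: "\<And>i. i \<in> I \<Longrightarrow> e i \<in> complex_span (eigenfunctions (ev i))"
  shows "(\<lambda>x. \<Sum>i\<in>I. c i * e i x, \<lambda>x. \<Sum>i\<in>I. (of_real (ev i) * c i) * e i x) \<in> dunkl_oscillator_graph R P k a"
proof -
  have "(\<lambda>x. \<Sum>i\<in>I. c i * e i x) \<in> complex_span (laguerre_functions P k a)"
    using e complex_span_mono[of "eigenfunctions _" "laguerre_functions P k a"]
    by (intro complex_span_sum) (auto simp: laguerre_functions_eq)
  moreover have "(\<lambda>x. \<Sum>i\<in>I. (of_real (ev i) * c i) * e i x) \<in> L2 M"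
    using e by (intro L2_sum L2_scale complex_span_L2[OF _ eigenfunctions_L2])
  moreover have "AE x in M. (\<Sum>i\<in>I. (of_real (ev i) * c i) * e i x) = dunkl_oscillator P k a (\<lambda>x. \<Sum>i\<in>I. c i * e i x) x"
    using AE_dunkl_measure_nonzero
  proof eventually_elim
    fix x :: "real ^ 'n" assume x: "x \<noteq> 0"
    have "dunkl_oscillator P k a (\<lambda>x. \<Sum>i\<in>I. c i * e i x) x = (\<Sum>i\<in>I. c i * dunkl_oscillator P k a (e i) x)"
      using oscillator_sum[OF assms(1), of e c] eigenspan_oscillator[OF e] x by simp
    also have "\<dots> = (\<Sum>i\<in>I. (of_real (ev i) * c i) * e i x)"
      using eigenspan_oscillator[OF e] x by (intro sum.cong refl) simp
    finally show "(\<Sum>i\<in>I. (of_real (ev i) * c i) * e i x) = dunkl_oscillator P k a (\<lambda>x. \<Sum>i\<in>I. c i * e i x) x" ..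
  qed
  ultimately show ?thesis by (simp add: dunkl_oscillator_graph_def)
qed

text \<open>
  The harmonics in a Fischer decomposition of the monomials, combined with all Laguerre orders, form a countable
  total family of eigenfunctions. Gram-Schmidt makes it a basis that diagonalizes the oscillator.
\<close>

theorem oscillator_spectral_resolution_exists:
  "\<exists>E. is_spectral_resolution M (operator_closure M (dunkl_oscillator_graph R P k a)) E"
proof -
  have "\<exists>p. (\<forall>j. fst p j \<in> k_harmonics P k (snd p j)) \<and>
      monomial xs = (\<lambda>x :: real ^ 'n. \<Sum>j\<le>length xs. of_real ((x \<bullet> x) ^ j) * fst p j x)" for xs
  proof -
    obtain h d where *: "(\<forall>j. h j \<in> k_harmonics P k (d j)) \<and>
        monomial xs = (\<lambda>x :: real ^ 'n. \<Sum>j\<le>length xs. of_real ((x \<bullet> x) ^ j) * h j x)"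
      using Fischer_decomposition[OF homogeneous_monomial[of xs]] by (elim exE)
    show ?thesis by (rule exI[of _ "(h, d)"], simp only: fst_conv snd_conv, rule *)
  qed
  then have "\<exists>p. \<forall>xs. (\<forall>j. fst (p xs) j \<in> k_harmonics P k (snd (p xs) j)) \<and>
      monomial xs = (\<lambda>x :: real ^ 'n. \<Sum>j\<le>length xs. of_real ((x \<bullet> x) ^ j) * fst (p xs) j x)"
    by (intro choice allI)
  then obtain p where p: "\<forall>xs. (\<forall>j. fst (p xs) j \<in> k_harmonics P k (snd (p xs) j)) \<and>
      monomial xs = (\<lambda>x :: real ^ 'n. \<Sum>j\<le>length xs. of_real ((x \<bullet> x) ^ j) * fst (p xs) j x)" ..
  (* One decomposition is fixed for each monomial, so that the resulting family is countable. *)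
  define h d where "h xs = fst (p xs)" and "d xs = snd (p xs)" for xs
  have h: "h xs j \<in> k_harmonics P k (d xs j)" for xs j
    unfolding h_def d_def by (rule p[THEN spec, THEN conjunct1, THEN spec])
  have mono: "monomial xs = (\<lambda>x :: real ^ 'n. \<Sum>j\<le>length xs. of_real ((x \<bullet> x) ^ j) * h xs j x)" for xs
    unfolding h_def by (rule p[THEN spec, THEN conjunct2])
  define F where "F = (\<lambda>(xs, j, l). laguerre_function (h xs j) (d xs j) l)"
  define \<Lambda> where "\<Lambda> = (\<lambda>(xs, j, l). eigenvalue (d xs j) l)"
  define f where "f n = F (from_nat n)" for n
  define ev where "ev n = \<Lambda> (from_nat n)" for n
  have fe: "f n \<in> eigenfunctions (ev n)" for n
  proof -
    obtain xs j l where "from_nat n = (xs :: 'n list, j :: nat, l :: nat)" by (cases "from_nat n :: 'n list \<times> nat \<times> nat")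
    then show ?thesis using h[of xs j] by (simp add: f_def ev_def F_def \<Lambda>_def eigenfunctions_def) blast
  qed
  have fL: "f n \<in> L2 M" for n using fe eigenfunctions_L2 by blast
  define e where "e = gram_schmidt M f"
  have ee: "e n \<in> complex_span (eigenfunctions (ev n))" for n
  proof -
    have "e n \<in> complex_span {f i | i. ev i = ev n}"
      unfolding e_def by (rule gram_schmidt_in_block[OF fL]) (rule eigenfunctions_orthogonal[OF fe fe])
    moreover have "{f i | i. ev i = ev n} \<subseteq> eigenfunctions (ev n)"
    proof safe
      fix i assume "ev i = ev n" then show "f i \<in> eigenfunctions (ev n)" using fe[of i] by simp
    qed
    ultimately show ?thesis using complex_span_mono by blast
  qed
  interpret L2_basis M e
  proof
    show "e i \<in> L2 M" for i unfolding e_def by (rule gram_schmidt_L2[OF fL])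
    show "i \<noteq> j \<Longrightarrow> l2_inner M (e i) (e j) = 0" for i j unfolding e_def by (rule gram_schmidt_orthogonal[OF fL])
    show "l2_inner M (e i) (e i) = 0 \<or> l2_inner M (e i) (e i) = 1" for i
      unfolding e_def by (rule gram_schmidt_norm[OF fL])
    fix u assume u: "u \<in> L2 M" "\<And>i. l2_inner M u (e i) = 0"
    have "l2_inner M u (f n) = 0" for n
      by (rule gram_schmidt_complete[OF fL u(1)]) (use u(2) in \<open>simp add: e_def\<close>)
    then have "l2_inner M u (F (from_nat n)) = 0" for n by (simp add: f_def)
    then have "l2_inner M u (F t) = 0" for t by (metis from_nat_to_nat)
    then have "l2_inner M u (laguerre_function (h xs j) (d xs j) l) = 0" for xs j l
      by (auto simp: F_def split: prod.splits)
    then show "AE x in M. u x = 0" by (rule laguerre_functions_total[OF u(1) h mono])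
  qed
  have "is_spectral_resolution M (operator_closure M (dunkl_oscillator_graph R P k a)) (specproj ev)"
  proof (rule diagonal_spectral_resolution)
    show "u \<in> L2 M \<and> v \<in> L2 M \<and> (\<forall>i. coord v i = of_real (ev i) * coord u i)"
      if "(u, v) \<in> dunkl_oscillator_graph R P k a" for u v
      using oscillator_graph_coordinates[OF that ee] by (simp add: coord_def)
    show "(comb c {..<n}, comb (\<lambda>i. of_real (ev i) * c i) {..<n}) \<in> dunkl_oscillator_graph R P k a" for c n
      using eigenspan_sum_in_graph[of "{..<n}" e ev c] ee by (simp add: comb_def[abs_def])
  qed
  then show ?thesis by blast
qed

lemma graph_subset_closure:
  assumes "(u, v) \<in> A" "u \<in> L2 N" "v \<in> L2 N"
  shows "(u, v) \<in> operator_closure N A"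
  using assms unfolding operator_closure_def
  by (auto simp: l2_tendsto_def intro!: exI[of _ "\<lambda>_. (u, v)"])

text \<open>
  A Laguerre function lies in the domain of the oscillator, so its eigenvalue equation holds in the closure.
\<close>

theorem functional_calculus_laguerre_function:
  assumes p: "p \<in> k_harmonics P k m" and [measurable]: "\<phi> \<in> borel_measurable borel" and bd: "\<And>t. cmod (\<phi> t) \<le> 1"
  shows "AE x in M. functional_calculus M (operator_closure M (dunkl_oscillator_graph R P k a)) \<phi> (laguerre_function p m l) x
      = \<phi> (eigenvalue m l) * laguerre_function p m l x"
proof -
  let ?u = "laguerre_function p m l"
  have u: "?u \<in> L2 M" by (rule laguerre_function_L2[OF p])
  have "?u \<in> complex_span (eigenfunctions (eigenvalue m l))"
    using p by (intro complex_span_base) (auto simp: eigenfunctions_def)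
  from eigenspan_sum_in_graph[of "{()}" "\<lambda>_. ?u" "\<lambda>_. eigenvalue m l" "\<lambda>_. 1", OF _ this]
  have "(?u, \<lambda>x. of_real (eigenvalue m l) * ?u x) \<in> dunkl_oscillator_graph R P k a" by simp
  then have "(?u, \<lambda>x. of_real (eigenvalue m l) * ?u x) \<in> operator_closure M (dunkl_oscillator_graph R P k a)"
    by (rule graph_subset_closure[OF _ u L2_scale[OF u]])
  moreover obtain E where "is_spectral_resolution M (operator_closure M (dunkl_oscillator_graph R P k a)) E"
    using oscillator_spectral_resolution_exists by blast
  ultimately show ?thesis by (intro functional_calculus_eigenvector[OF _ _ u] bd) auto
qed

lemma laguerre_function_0: "laguerre_function p m 0 = (\<lambda>x. of_real (exp (- (norm x powr a) / a)) * p x)"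
  by (simp add: laguerre_function_def[abs_def] profile_def poly_laguerre_poly laguerre_def mult.commute)

end

theorem corollary5p20:
  fixes R P :: "(real ^ 'n) set"
    and k :: "real ^ 'n \<Rightarrow> real"
    and a :: real
    and m :: nat
    and p :: "real ^ 'n \<Rightarrow> complex"
  assumes "root_system R"
    and "positive_subsystem R P"
    and "multiplicity_function R k"
    and "\<forall>\<alpha>\<in>R. k \<alpha> \<ge> 0"
    and "a > 0"
    and "2 * multiplicity_sum P k + real CARD('n) > max 1 (2 - a)"
    and "homogeneous_polynomial m p"
    and "\<forall>x. dunkl_laplacian P k p x = 0"
  shows "AE \<xi> in dunkl_measure R k a.
           generalized_fourier R P k a (\<lambda>x. of_real (exp (- (norm x powr a) / a)) * p x) \<xi>
           = exp (- \<i> * of_real (pi / a * real m)) * of_real (exp (- (norm \<xi> powr a) / a)) * p \<xi>"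
proof -
  interpret dunkl_oscillator_setting R P k a
    by unfold_locales (use assms in auto)
  have p: "p \<in> k_harmonics P k m" using assms by (simp add: k_harmonics_def)
  let ?\<phi> = "\<lambda>t :: real. exp (\<i> * complex_of_real (pi / (2 * a) * t))"
  let ?c = "exp (\<i> * complex_of_real (pi / 2 * ((2 * multiplicity_sum P k + real CARD('n) + a - 2) / a)))"
  have AE: "AE x in M. functional_calculus M (operator_closure M (dunkl_oscillator_graph R P k a)) ?\<phi> (laguerre_function p m 0) x
      = ?\<phi> (eigenvalue m 0) * laguerre_function p m 0 x"
    by (rule functional_calculus_laguerre_function[OF p]) simp_all
  have phase: "?c * ?\<phi> (eigenvalue m 0) = exp (- \<i> * of_real (pi / a * real m))"
  proof -
    have ev: "eigenvalue m 0 = - (2 * real m + 2 * multiplicity_sum P k + real CARD('n) - 2 + a)"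
      using a_pos by (simp add: eigenvalue_def laguerre_parameter_def field_simps)
    have "pi / 2 * ((2 * multiplicity_sum P k + real CARD('n) + a - 2) / a) + pi / (2 * a) * eigenvalue m 0 = - (pi / a * real m)"
      unfolding ev using a_pos by (simp add: field_simps)
    then have "\<i> * complex_of_real (pi / 2 * ((2 * multiplicity_sum P k + real CARD('n) + a - 2) / a)) +
        \<i> * complex_of_real (pi / (2 * a) * eigenvalue m 0) = \<i> * complex_of_real (- (pi / a * real m))"
      by (simp only: distrib_left[symmetric] of_real_add[symmetric])
    then show ?thesis by (simp only: exp_add[symmetric]) simp
  qed
  show ?thesis
    using AE unfolding generalized_fourier_def laguerre_function_0
    by eventually_elim (simp only: mult.assoc[symmetric] phase)
qed

end
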